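(* Let $m$ be some $w$-moderate weight function on $\mathcal G$, let $0<p<q\le\infty$ and define $\alpha=1/p-1/q>0$. Let $(x_i)_{i\in I}$ be some well-spread set in $\mathcal G$ and $g\in\mathbb D(L_m(p,\infty))\subset\mathbb D(L^q_m)$ such that $\{\pi(x_i)g\}_{i\in I}$ forms an atomic decomposition simultaneously of $\mathcal C(L_m(p,\infty))$ and of $\mathcal C(L^q_m)$. Then there is a constant $C>0$ such that for all $f\in\mathcal C(L_m(p,\infty))$ and all $n\in\mathbb N$, $n\ge1$, $$\sigma_n(f,\mathcal C(L^q_m))\le C\,\|f|\mathcal C(L_m(p,\infty))\|\,n^{-\alpha}.$$
   Context: **Best $n$-term approximation.** $\sigma_n(f,\mathcal C(Y))=\inf\|f-\sum_{i\in N}\lambda_i\pi(x_i)g\,|\,\mathcal C(Y)\|$, the infimum taken over all $N\subset I$ with $\#N\le n$ and all coefficients $\lambda_i$. **Lorentz spaces.** For measurable $F$ on $\mathcal G$ let $\lambda_F(s)=|\{x:|F(x)|>s\}|$ (Haar measure) and $F^*(t)=\inf\{s:\lambda_F(s)\le t\}$. For $0<p<\infty$, $L(p,\infty)$ consists of all $F$ with $\|F\|^*_{p,\infty}=\sup_{t>0}t^{1/p}F^*(t)<\infty$, and $L_m(p,\infty)=\{F: Fm\in L(p,\infty)\}$ with $\|F|L_m(p,\infty)\|=\|Fm\|^*_{p,\infty}$. $L^q_m=\{F:Fm\in L^q\}$ with $\|F|L^q_m\|=\|Fm\|_{L^q}$. A weight $w$ is a positive continuous function; it is submultiplicative if $w(xy)\le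 w(x)w(y)$, and $m$ is $w$-moderate (with $w$ submultiplicative) if $m(xyz)\le w(x)m(y)w(z)$ for all $x,y,z\in\mathcal G$. **Group and amalgam spaces.** $\mathcal G$ is a locally compact group with identity $e$, left Haar measure and Haar modulus $\Delta$. $L_xF(y)=F(x^{-1}y)$, $R_xF(y)=F(yx)$, $F^\vee(x)=F(x^{-1})$; for a Radon measure $\mu$, $(A_x\mu)(k)=\mu(R_xk)$. A quasi-norm is an $s$-norm ($0<s\le1$) if $\|f+g\|^s\le\|f\|^s+\|g\|^s$; every quasi-Banach space is equipped with an equivalent $s$-norm for some $0<s\le1$. Below, $Y$ denotes a solid quasi-Banach space of measurable functions on $\mathcal G$ ($F\in Y$, $|G|\le|F|$ a.e. imply $G\in Y$, $\|G|Y\|\le\|F|Y\|$) containing the characteristic functions of compact sets and with $s$-norm, such that $W(L^\infty,Y)$ is left and right translation invariant; here $Y=L_m(p,\infty)$ or $Y=L^q_m$. For $B=L^\infty(\mathcal G)$ or $M(\mathcal G)$ (complex Radon measures) and a relatively compact neighborhood $Q$ of $e$, $W(B,Y)=\{F\in B_{loc}:K(F,Q,B)\in Y\}$, $K(F,Q,B)(x)=\|\chi_{xQ}F|B\|$, $\|F|W(B,Y)\|=\|K(F,Q,B)|Y\|$ (independent of $Q$). $Z^\vee=\{F^\vee:F\in Z\}$ with $\|F|Z^\vee\|=\|F^\vee|Z\|$. $\|T\|_{B\to B}$ is the operator quasi-norm. **Discrete sets.** $(x_i)_{i\in I}\subset\mathcal G$ is well-spread if for every compact $K$, $\sup_j\#\{i:x_iK\cap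 x_jK\ne\emptyset\}<\infty$, and $\mathcal G=\bigcup_ix_iV$ for some relatively compact neighborhood $V$ of $e$. $Y_d=\{(\lambda_i):\sum_i|\lambda_i|\chi_{x_iQ}\in Y\}$ with $\|(\lambda_i)|Y_d\|=\|\sum_i|\lambda_i|\chi_{x_iQ}|Y\|$. **Coorbit spaces.** $\pi$ is an irreducible unitary representation of $\mathcal G$ on a Hilbert space $\mathcal H$, $V_gf(x)=\langle f,\pi(x)g\rangle$. Put (all operator norms on the indicated amalgam space) $w_Y(x)=\max\{\|R_x|W(L^\infty,Y)\|,\Delta(x^{-1})\|R_{x^{-1}}|W(L^\infty,Y)\|\}$, $v_Y(x)=\max\{1,\|L_{x^{-1}}|W(L^\infty,Y)\|\}$, $\tilde w_Y(x)=\max\{w_Y(x),\|A_x|W(M,Y)\|\}$. $\mathbb A_v=\{g\in\mathcal H:V_gg\in L^1_v\}$ (assumed non-trivial for $v=v_Y$), $\mathbb B(Y)=\mathbb A_{v_Y}\cap\{g\in\mathcal H:V_gg\in L^2\cap W(L^\infty,L^s_{w_Y})\}$ (assumed non-trivial), $$\mathbb D(Y)=\mathbb A_{v_Y}\cap\{g\in\mathcal H:V_gg\in W(L^\infty,L^s_{\tilde w_Y})\cap W(L^\infty,W(L^\infty,L^s_{w_Y})^\vee)^\vee\}.$$ With fixed $g\in\mathbb A_v\setminus\{0\}$, $v=v_Y$: $\mathcal H^1_v=\{f\in\mathcal H:V_gf\in L^1_v\}$ with norm $\|V_gf\|_{L^1_v}$ (independent of $g$), $(\mathcal H^1_v)^\urcorner$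 is its anti-dual, $V_gf(x)=\langle f,\pi(x)g\rangle$ for $f\in(\mathcal H^1_v)^\urcorner$, and $\mathcal C(Y)=\{f\in(\mathcal H^1_v)^\urcorner:V_gf\in W(L^\infty,Y)\}$, $\|f|\mathcal C(Y)\|=\|V_gf|W(L^\infty,Y)\|$ for a $g\in\mathbb B(Y)\setminus\{0\}$ (independent of $g$ up to equivalence). **Atomic decomposition.** $\{\pi(x_i)g\}_{i\in I}$ forms an atomic decomposition of $\mathcal C(Y)$ if there are bounded linear functionals $\lambda_i$ on $(\mathcal H^1_v)^\urcorner$ such that (a) $f=\sum_i\lambda_i(f)\pi(x_i)g$ for all $f\in\mathcal C(Y)$, with weak-$*$ convergence in $(\mathcal H^1_v)^\urcorner$ and convergence in $\mathcal C(Y)$ if the finite sequences are dense in $Y_d$; (b) $f\in(\mathcal H^1_v)^\urcorner$ lies in $\mathcal C(Y)$ iff $(\lambda_i(f))_i\in Y_d$, and $\|(\lambda_i(f))_i|Y_d\|$ is an equivalent quasi-norm on $\mathcal C(Y)$. *)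

theory Defs
  imports "HOL-Analysis.Analysis" "HOL-Probability.Essential_Supremum"
begin

text \<open>
  The locally compact group is written additively: \<^class>\<open>topological_group_add\<close> is the library's class
  of (not necessarily commutative) topological groups. Thus \<open>x + y\<close>, \<open>- x\<close>, \<open>0\<close> stand for
  \<open>xy\<close>, \<open>x\<^sup>-\<^sup>1\<close>, \<open>e\<close>, and \<open>(+) x ` Q\<close> is the left translate \<open>xQ\<close>.
\<close>

section \<open>Complex Hilbert spaces\<close>

text \<open>The inner product is linear in the first and antilinear in the second argument.\<close>

class complex_hilbert_space = banach +
  fixes scaleC :: "complex \<Rightarrow> 'a \<Rightarrow> 'a" (infixr "*\<^sub>C" 75)
    and cinner :: "'a \<Rightarrow> 'a \<Rightarrow> complex"
  assumes scaleC_of_real: "complex_of_real r *\<^sub>C x = r *\<^sub>R x"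
    and scaleC_scaleC: "a *\<^sub>C (b *\<^sub>C x) = (a * b) *\<^sub>C x"
    and scaleC_add_left: "(a + b) *\<^sub>C x = a *\<^sub>C x + b *\<^sub>C x"
    and scaleC_add_right: "a *\<^sub>C (x + y) = a *\<^sub>C x + a *\<^sub>C y"
    and cinner_add_left: "cinner (x + y) z = cinner x z + cinner y z"
    and cinner_scaleC_left: "cinner (a *\<^sub>C x) y = a * cinner x y"
    and cinner_commute: "cinner x y = cnj (cinner y x)"
    and cinner_self: "cinner x x = complex_of_real ((norm x)\<^sup>2)"


section \<open>Haar measure, modulus, translations\<close>

text \<open>A left Haar measure is a nonzero left invariant Radon measure on the Borel sets.\<close>

definition left_haar_measure :: "'g::{topological_group_add,t2_space} measure \<Rightarrow> bool" where
  "left_haar_measure \<mu> \<longleftrightarrow>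
     sets \<mu> = sets borel \<and>
     emeasure \<mu> UNIV \<noteq> 0 \<and>
     (\<forall>K. compact K \<longrightarrow> emeasure \<mu> K < top) \<and>
     (\<forall>A\<in>sets borel. emeasure \<mu> A = (INF U\<in>{U. open U \<and> A \<subseteq> U}. emeasure \<mu> U)) \<and>
     (\<forall>U. open U \<longrightarrow> emeasure \<mu> U = (SUP K\<in>{K. compact K \<and> K \<subseteq> U}. emeasure \<mu> K)) \<and>
     (\<forall>x. \<forall>A\<in>sets borel. emeasure \<mu> ((+) x ` A) = emeasure \<mu> A)"

text \<open>Convention for the modulus: \<open>|Ax| = \<Delta>(x) |A|\<close>, equivalently
  \<open>\<integral> F(x\<^sup>-\<^sup>1) \<Delta>(x\<^sup>-\<^sup>1) dx = \<integral> F(x) dx\<close>.\<close>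

definition haar_modulus :: "'g::{topological_group_add,t2_space} measure \<Rightarrow> 'g \<Rightarrow> real" where
  "haar_modulus \<mu> x =
     (THE c. 0 < c \<and> (\<forall>A\<in>sets borel. emeasure \<mu> ((\<lambda>y. y + x) ` A) = ennreal c * emeasure \<mu> A))"

definition left_translate :: "'g::group_add \<Rightarrow> ('g \<Rightarrow> 'b) \<Rightarrow> 'g \<Rightarrow> 'b" where
  "left_translate x F = (\<lambda>y. F (- x + y))"

definition right_translate :: "'g::group_add \<Rightarrow> ('g \<Rightarrow> 'b) \<Rightarrow> 'g \<Rightarrow> 'b" where
  "right_translate x F = (\<lambda>y. F (y + x))"

definition measure_translate ::
  "'g::group_add \<Rightarrow> (('g \<Rightarrow> complex) \<Rightarrow> complex) \<Rightarrow> ('g \<Rightarrow> complex) \<Rightarrow> complex" where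
  "measure_translate x \<nu> = (\<lambda>k. \<nu> (right_translate x k))"

definition rel_compact_nbhd :: "'g::{topological_group_add,t2_space} set \<Rightarrow> bool" where
  "rel_compact_nbhd Q \<longleftrightarrow> 0 \<in> interior Q \<and> compact (closure Q)"


section \<open>Weights\<close>

definition weight :: "('g::topological_space \<Rightarrow> real) \<Rightarrow> bool" where
  "weight w \<longleftrightarrow> continuous_on UNIV w \<and> (\<forall>x. 0 < w x)"

definition submultiplicative :: "('g::group_add \<Rightarrow> real) \<Rightarrow> bool" where
  "submultiplicative w \<longleftrightarrow> (\<forall>x y. w (x + y) \<le> w x * w y)"

definition moderate :: "('g::group_add \<Rightarrow> real) \<Rightarrow> ('g \<Rightarrow> real) \<Rightarrow> bool" where
  "moderate w m \<longleftrightarrow> (\<forall>x y z. m (x + y + z) \<le> w x * m y * w z)"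


section \<open>Solid quasi-normed function spaces\<close>

text \<open>
  A solid space \<open>Y\<close> of measurable functions is represented by the functional assigning to a function
  \<open>G \<ge> 0\<close> its extended quasi-norm, which is \<open>top\<close> when \<open>G\<close> is not measurable. A complex function \<open>F\<close>
  lies in \<open>Y\<close> iff it is measurable and the functional is finite at \<open>|F|\<close>.
\<close>

type_synonym 'g solid = "('g \<Rightarrow> ennreal) \<Rightarrow> ennreal"

definition abs_fun :: "('g \<Rightarrow> complex) \<Rightarrow> 'g \<Rightarrow> ennreal" where
  "abs_fun F = (\<lambda>x. ennreal (cmod (F x)))"

definition qnorm :: "'g measure \<Rightarrow> 'g solid \<Rightarrow> ('g \<Rightarrow> complex) \<Rightarrow> ennreal" where
  "qnorm \<mu> Y F = (if F \<in> borel_measurable \<mu> then Y (abs_fun F) else top)"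

definition fspace :: "'g measure \<Rightarrow> 'g solid \<Rightarrow> ('g \<Rightarrow> complex) set" where
  "fspace \<mu> Y = {F. qnorm \<mu> Y F < top}"

text \<open>Powers with exponent \<open>r > 0\<close>.\<close>

definition ennreal_powr :: "ennreal \<Rightarrow> real \<Rightarrow> ennreal" where
  "ennreal_powr a r = (if a = top then top else ennreal (enn2real a powr r))"

definition lebesgue_space :: "'g measure \<Rightarrow> ennreal \<Rightarrow> 'g solid" where
  "lebesgue_space \<mu> q G =
     (if G \<notin> borel_measurable \<mu> then top
      else if q = top then esssup \<mu> G
      else ennreal_powr (\<integral>\<^sup>+ x. ennreal_powr (G x) (enn2real q) \<partial>\<mu>) (1 / enn2real q))"

definition distribution_fun :: "'g measure \<Rightarrow> ('g \<Rightarrow> ennreal) \<Rightarrow> ennreal \<Rightarrow> ennreal" where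
  "distribution_fun \<mu> G s = emeasure \<mu> {x \<in> space \<mu>. s < G x}"

definition rearrangement :: "'g measure \<Rightarrow> ('g \<Rightarrow> ennreal) \<Rightarrow> real \<Rightarrow> ennreal" where
  "rearrangement \<mu> G t = Inf {s. distribution_fun \<mu> G s \<le> ennreal t}"

definition weak_lebesgue_space :: "'g measure \<Rightarrow> real \<Rightarrow> 'g solid" where
  "weak_lebesgue_space \<mu> p G =
     (if G \<notin> borel_measurable \<mu> then top
      else (SUP t\<in>{0<..}. ennreal (t powr (1 / p)) * rearrangement \<mu> G t))"

definition weighted :: "('g \<Rightarrow> ennreal) \<Rightarrow> 'g solid \<Rightarrow> 'g solid" where
  "weighted m Y G = Y (\<lambda>x. G x * m x)"

definition weighted_lebesgue :: "'g measure \<Rightarrow> ennreal \<Rightarrow> ('g \<Rightarrow> real) \<Rightarrow> 'g solid" where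
  "weighted_lebesgue \<mu> q m = weighted (\<lambda>x. ennreal (m x)) (lebesgue_space \<mu> q)"

definition weighted_lorentz :: "'g measure \<Rightarrow> real \<Rightarrow> ('g \<Rightarrow> real) \<Rightarrow> 'g solid" where
  "weighted_lorentz \<mu> p m = weighted (\<lambda>x. ennreal (m x)) (weak_lebesgue_space \<mu> p)"

definition involuted :: "'g::group_add solid \<Rightarrow> 'g solid" where
  "involuted Y G = Y (\<lambda>x. G (- x))"

text \<open>\<open>Y\<close> carries an equivalent quasi-norm \<open>N\<close> that is an \<open>s\<close>-norm.\<close>

definition has_equivalent_s_norm :: "'g measure \<Rightarrow> 'g solid \<Rightarrow> real \<Rightarrow> bool" where
  "has_equivalent_s_norm \<mu> Y s \<longleftrightarrow> 0 < s \<and> s \<le> 1 \<and>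
     (\<exists>N :: ('g \<Rightarrow> complex) \<Rightarrow> real. \<exists>a>0. \<exists>b>0.
        (\<forall>F\<in>fspace \<mu> Y. 0 \<le> N F \<and>
           ennreal a * qnorm \<mu> Y F \<le> ennreal (N F) \<and> ennreal (N F) \<le> ennreal b * qnorm \<mu> Y F) \<and>
        (\<forall>F\<in>fspace \<mu> Y. \<forall>c. N (\<lambda>x. c * F x) = cmod c * N F) \<and>
        (\<forall>F\<in>fspace \<mu> Y. \<forall>G\<in>fspace \<mu> Y. N (\<lambda>x. F x + G x) powr s \<le> N F powr s + N G powr s))"


section \<open>Amalgam spaces\<close>

definition control_fun ::
  "'g::{topological_group_add,t2_space} measure \<Rightarrow> 'g set \<Rightarrow> ('g \<Rightarrow> ennreal) \<Rightarrow> 'g \<Rightarrow> ennreal" where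
  "control_fun \<mu> Q G x = esssup \<mu> (\<lambda>y. indicator ((+) x ` Q) y * G y)"

text \<open>\<open>W(L\<^sup>\<infinity>, Y)\<close>\<close>

definition amalgam ::
  "'g::{topological_group_add,t2_space} measure \<Rightarrow> 'g set \<Rightarrow> 'g solid \<Rightarrow> 'g solid" where
  "amalgam \<mu> Q Y G =
     (if G \<in> borel_measurable \<mu> \<and> (\<forall>K. compact K \<longrightarrow> esssup \<mu> (\<lambda>y. indicator K y * G y) < top)
      then Y (control_fun \<mu> Q G) else top)"

text \<open>
  Complex Radon measures are the linear functionals on \<open>C\<^sub>c\<close> that are bounded on the functions
  supported in any fixed compact set; their values outside \<open>C\<^sub>c\<close> are irrelevant.
\<close>

definition Cc_fun :: "('g::topological_space \<Rightarrow> complex) set" where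
  "Cc_fun = {k. continuous_on UNIV k \<and> compact (closure {x. k x \<noteq> 0})}"

definition radon_functional :: "(('g::topological_space \<Rightarrow> complex) \<Rightarrow> complex) \<Rightarrow> bool" where
  "radon_functional \<nu> \<longleftrightarrow>
     (\<forall>k\<in>Cc_fun. \<forall>l\<in>Cc_fun. \<nu> (\<lambda>x. k x + l x) = \<nu> k + \<nu> l) \<and>
     (\<forall>k\<in>Cc_fun. \<forall>c. \<nu> (\<lambda>x. c * k x) = c * \<nu> k) \<and>
     (\<forall>K. compact K \<longrightarrow> (\<exists>C. \<forall>k\<in>Cc_fun. \<forall>B.
        closure {x. k x \<noteq> 0} \<subseteq> K \<longrightarrow> (\<forall>x. cmod (k x) \<le> B) \<longrightarrow> cmod (\<nu> k) \<le> C * B))"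

text \<open>\<open>|\<nu>|(E)\<close> for Borel \<open>E\<close>, i.e. the total variation norm of \<open>\<chi>\<^sub>E \<nu>\<close>, through outer regularity.\<close>

definition radon_variation ::
  "(('g::topological_space \<Rightarrow> complex) \<Rightarrow> complex) \<Rightarrow> 'g set \<Rightarrow> ennreal" where
  "radon_variation \<nu> E =
     (INF U\<in>{U. open U \<and> E \<subseteq> U}.
        SUP k\<in>{k\<in>Cc_fun. (\<forall>x. cmod (k x) \<le> 1) \<and> closure {x. k x \<noteq> 0} \<subseteq> U}. ennreal (cmod (\<nu> k)))"

text \<open>The quasi-norm of \<open>W(M, Y)\<close>; the value \<open>top\<close> means non-membership.\<close>

definition measure_amalgam_norm ::
  "'g::{topological_group_add,t2_space} set \<Rightarrow> 'g solid \<Rightarrow> (('g \<Rightarrow> complex) \<Rightarrow> complex) \<Rightarrow> ennreal" where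
  "measure_amalgam_norm Q Y \<nu> =
     (if radon_functional \<nu> then Y (\<lambda>x. radon_variation \<nu> ((+) x ` Q)) else top)"

text \<open>Operator quasi-norm of \<open>T\<close> on the space \<open>{f. N f < top}\<close>.\<close>

definition operator_norm :: "('f \<Rightarrow> ennreal) \<Rightarrow> ('f \<Rightarrow> 'f) \<Rightarrow> ennreal" where
  "operator_norm N T = (SUP f\<in>{f. N f \<le> 1}. N (T f))"


section \<open>The weights attached to \<open>Y\<close>\<close>

definition right_norm ::
  "'g::{topological_group_add,t2_space} measure \<Rightarrow> 'g set \<Rightarrow> 'g solid \<Rightarrow> 'g \<Rightarrow> ennreal" where
  "right_norm \<mu> Q Y x = operator_norm (qnorm \<mu> (amalgam \<mu> Q Y)) (right_translate x)"

definition w_weight ::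
  "'g::{topological_group_add,t2_space} measure \<Rightarrow> 'g set \<Rightarrow> 'g solid \<Rightarrow> 'g \<Rightarrow> ennreal" where
  "w_weight \<mu> Q Y x =
     max (right_norm \<mu> Q Y x) (ennreal (haar_modulus \<mu> (- x)) * right_norm \<mu> Q Y (- x))"

definition v_weight ::
  "'g::{topological_group_add,t2_space} measure \<Rightarrow> 'g set \<Rightarrow> 'g solid \<Rightarrow> 'g \<Rightarrow> ennreal" where
  "v_weight \<mu> Q Y x = max 1 (operator_norm (qnorm \<mu> (amalgam \<mu> Q Y)) (left_translate (- x)))"

definition w_tilde_weight ::
  "'g::{topological_group_add,t2_space} measure \<Rightarrow> 'g set \<Rightarrow> 'g solid \<Rightarrow> 'g \<Rightarrow> ennreal" where
  "w_tilde_weight \<mu> Q Y x =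
     max (w_weight \<mu> Q Y x) (operator_norm (measure_amalgam_norm Q Y) (measure_translate x))"


section \<open>Representations and analyzing vectors\<close>

definition unitary_representation ::
  "('g::{topological_group_add,t2_space} \<Rightarrow> 'h::complex_hilbert_space \<Rightarrow> 'h) \<Rightarrow> bool" where
  "unitary_representation \<pi> \<longleftrightarrow>
     (\<forall>x f f'. \<pi> x (f + f') = \<pi> x f + \<pi> x f') \<and>
     (\<forall>x c f. \<pi> x (c *\<^sub>C f) = c *\<^sub>C \<pi> x f) \<and>
     (\<forall>x f f'. cinner (\<pi> x f) (\<pi> x f') = cinner f f') \<and>
     (\<forall>x. surj (\<pi> x)) \<and>
     (\<forall>x y. \<pi> (x + y) = \<pi> x \<circ> \<pi> y) \<and>
     (\<forall>f. continuous_on UNIV (\<lambda>x. \<pi> x f))"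

definition irreducible_representation ::
  "('g \<Rightarrow> 'h::complex_hilbert_space \<Rightarrow> 'h) \<Rightarrow> bool" where
  "irreducible_representation \<pi> \<longleftrightarrow>
     (\<exists>f::'h. f \<noteq> 0) \<and>
     (\<forall>S. closed S \<longrightarrow> 0 \<in> S \<longrightarrow> (\<forall>f\<in>S. \<forall>f'\<in>S. f + f' \<in> S) \<longrightarrow> (\<forall>c. \<forall>f\<in>S. c *\<^sub>C f \<in> S) \<longrightarrow>
        (\<forall>x. \<forall>f\<in>S. \<pi> x f \<in> S) \<longrightarrow> S = {0} \<or> S = UNIV)"

definition voice :: "('g \<Rightarrow> 'h \<Rightarrow> 'h) \<Rightarrow> 'h::complex_hilbert_space \<Rightarrow> 'h \<Rightarrow> 'g \<Rightarrow> complex" where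
  "voice \<pi> g f x = cinner f (\<pi> x g)"

definition A_set ::
  "'g measure \<Rightarrow> ('g \<Rightarrow> 'h \<Rightarrow> 'h) \<Rightarrow> ('g \<Rightarrow> ennreal) \<Rightarrow> 'h::complex_hilbert_space set" where
  "A_set \<mu> \<pi> v = {g. voice \<pi> g g \<in> fspace \<mu> (weighted v (lebesgue_space \<mu> 1))}"

text \<open>In \<open>B_set\<close> and \<open>D_set\<close>, \<open>s\<close> is the exponent for which \<open>Y\<close> is \<open>s\<close>-normed.\<close>

definition B_set ::
  "'g::{topological_group_add,t2_space} measure \<Rightarrow> 'g set \<Rightarrow> ('g \<Rightarrow> 'h \<Rightarrow> 'h) \<Rightarrow> real \<Rightarrow> 'g solid
     \<Rightarrow> 'h::complex_hilbert_space set" where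
  "B_set \<mu> Q \<pi> s Y = A_set \<mu> \<pi> (v_weight \<mu> Q Y) \<inter>
     {g. voice \<pi> g g \<in> fspace \<mu> (lebesgue_space \<mu> 2) \<inter>
           fspace \<mu> (amalgam \<mu> Q (weighted (w_weight \<mu> Q Y) (lebesgue_space \<mu> (ennreal s))))}"

definition D_set ::
  "'g::{topological_group_add,t2_space} measure \<Rightarrow> 'g set \<Rightarrow> ('g \<Rightarrow> 'h \<Rightarrow> 'h) \<Rightarrow> real \<Rightarrow> 'g solid
     \<Rightarrow> 'h::complex_hilbert_space set" where
  "D_set \<mu> Q \<pi> s Y = A_set \<mu> \<pi> (v_weight \<mu> Q Y) \<inter>
     {g. voice \<pi> g g \<in>
           fspace \<mu> (amalgam \<mu> Q (weighted (w_tilde_weight \<mu> Q Y) (lebesgue_space \<mu> (ennreal s)))) \<inter>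
           fspace \<mu> (involuted (amalgam \<mu> Q (involuted
             (amalgam \<mu> Q (weighted (w_weight \<mu> Q Y) (lebesgue_space \<mu> (ennreal s)))))))}"


section \<open>Coorbit spaces\<close>

text \<open>\<open>H1_norm \<mu> \<pi> v k\<close> is the norm of \<open>\<H>\<^sup>1\<^sub>v\<close> computed with the window \<open>k\<close>.\<close>

definition H1_norm ::
  "'g measure \<Rightarrow> ('g \<Rightarrow> 'h \<Rightarrow> 'h) \<Rightarrow> ('g \<Rightarrow> ennreal) \<Rightarrow> 'h \<Rightarrow> 'h::complex_hilbert_space \<Rightarrow> ennreal" where
  "H1_norm \<mu> \<pi> v k f = qnorm \<mu> (weighted v (lebesgue_space \<mu> 1)) (voice \<pi> k f)"

definition H1 ::
  "'g measure \<Rightarrow> ('g \<Rightarrow> 'h \<Rightarrow> 'h) \<Rightarrow> ('g \<Rightarrow> ennreal) \<Rightarrow> 'h \<Rightarrow> 'h::complex_hilbert_space set" where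
  "H1 \<mu> \<pi> v k = {f. H1_norm \<mu> \<pi> v k f < top}"

text \<open>
  Elements of the anti-dual are functions on the whole Hilbert space that vanish outside \<open>\<H>\<^sup>1\<^sub>v\<close>, so
  that equal functionals are equal as functions and the anti-dual is closed under pointwise
  operations. In particular the anti-duals for two weights with the same \<open>\<H>\<^sup>1\<^sub>v\<close> and equivalent norms
  are literally the same set. This is the case for \<open>v_weight\<close> of \<open>L\<^sub>m(p,\<infinity>)\<close> and of \<open>L\<^sup>q\<^sub>m\<close> when \<open>m\<close> is
  moderate, since both are equivalent to \<open>x \<mapsto> max 1 (SUP y. m (- x + y) / m y)\<close>.
\<close>

definition antidual ::
  "'g measure \<Rightarrow> ('g \<Rightarrow> 'h \<Rightarrow> 'h) \<Rightarrow> ('g \<Rightarrow> ennreal) \<Rightarrow> 'h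
     \<Rightarrow> ('h::complex_hilbert_space \<Rightarrow> complex) set" where
  "antidual \<mu> \<pi> v k = {\<phi>.
     (\<forall>h\<in>H1 \<mu> \<pi> v k. \<forall>h'\<in>H1 \<mu> \<pi> v k. \<phi> (h + h') = \<phi> h + \<phi> h') \<and>
     (\<forall>h\<in>H1 \<mu> \<pi> v k. \<forall>c. \<phi> (c *\<^sub>C h) = cnj c * \<phi> h) \<and>
     (\<exists>C\<ge>0. \<forall>h\<in>H1 \<mu> \<pi> v k. ennreal (cmod (\<phi> h)) \<le> ennreal C * H1_norm \<mu> \<pi> v k h) \<and>
     (\<forall>h. h \<notin> H1 \<mu> \<pi> v k \<longrightarrow> \<phi> h = 0)}"

definition antidual_norm ::
  "'g measure \<Rightarrow> ('g \<Rightarrow> 'h \<Rightarrow> 'h) \<Rightarrow> ('g \<Rightarrow> ennreal) \<Rightarrow> 'h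
     \<Rightarrow> ('h::complex_hilbert_space \<Rightarrow> complex) \<Rightarrow> ennreal" where
  "antidual_norm \<mu> \<pi> v k \<phi> = (SUP h\<in>{h. H1_norm \<mu> \<pi> v k h \<le> 1}. ennreal (cmod (\<phi> h)))"

text \<open>The embedding of the Hilbert space into the anti-dual.\<close>

definition hilbert_embed ::
  "'g measure \<Rightarrow> ('g \<Rightarrow> 'h \<Rightarrow> 'h) \<Rightarrow> ('g \<Rightarrow> ennreal) \<Rightarrow> 'h
     \<Rightarrow> 'h::complex_hilbert_space \<Rightarrow> 'h \<Rightarrow> complex" where
  "hilbert_embed \<mu> \<pi> v k f = (\<lambda>h. if h \<in> H1 \<mu> \<pi> v k then cinner f h else 0)"

definition voice_ext :: "('g \<Rightarrow> 'h \<Rightarrow> 'h) \<Rightarrow> 'h \<Rightarrow> ('h \<Rightarrow> complex) \<Rightarrow> 'g \<Rightarrow> complex" where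
  "voice_ext \<pi> g \<phi> x = \<phi> (\<pi> x g)"

text \<open>
  The quasi-norm of \<open>\<C>(Y)\<close>, equal to \<open>top\<close> off \<open>\<C>(Y)\<close>. The window \<open>k \<in> \<A>\<^sub>v\<close> defines \<open>\<H>\<^sup>1\<^sub>v\<close>, the window
  \<open>u \<in> \<B>(Y)\<close> defines the quasi-norm.
\<close>

definition coorbit_norm ::
  "'g::{topological_group_add,t2_space} measure \<Rightarrow> 'g set \<Rightarrow> ('g \<Rightarrow> 'h \<Rightarrow> 'h) \<Rightarrow> 'h \<Rightarrow> 'h
     \<Rightarrow> 'g solid \<Rightarrow> ('h::complex_hilbert_space \<Rightarrow> complex) \<Rightarrow> ennreal" where
  "coorbit_norm \<mu> Q \<pi> k u Y \<phi> =
     (if \<phi> \<in> antidual \<mu> \<pi> (v_weight \<mu> Q Y) k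
      then qnorm \<mu> (amalgam \<mu> Q Y) (voice_ext \<pi> u \<phi>) else top)"

definition coorbit_space ::
  "'g::{topological_group_add,t2_space} measure \<Rightarrow> 'g set \<Rightarrow> ('g \<Rightarrow> 'h \<Rightarrow> 'h) \<Rightarrow> 'h \<Rightarrow> 'h
     \<Rightarrow> 'g solid \<Rightarrow> ('h::complex_hilbert_space \<Rightarrow> complex) set" where
  "coorbit_space \<mu> Q \<pi> k u Y = {\<phi>. coorbit_norm \<mu> Q \<pi> k u Y \<phi> < top}"


section \<open>Discrete sets and atomic decompositions\<close>

definition well_spread :: "('i \<Rightarrow> 'g::{topological_group_add,t2_space}) \<Rightarrow> bool" where
  "well_spread x \<longleftrightarrow>
     (\<forall>K. compact K \<longrightarrow> (\<exists>b. \<forall>j. finite {i. (+) (x i) ` K \<inter> (+) (x j) ` K \<noteq> {}} \<and>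
        card {i. (+) (x i) ` K \<inter> (+) (x j) ` K \<noteq> {}} \<le> b)) \<and>
     (\<exists>V. rel_compact_nbhd V \<and> (\<Union>i. (+) (x i) ` V) = UNIV)"

definition seq_norm ::
  "'g::group_add set \<Rightarrow> 'g solid \<Rightarrow> ('i \<Rightarrow> 'g) \<Rightarrow> ('i \<Rightarrow> complex) \<Rightarrow> ennreal" where
  "seq_norm Q Y x c = Y (\<lambda>y. \<Sum>\<^sub>\<infinity>i. ennreal (cmod (c i)) * indicator ((+) (x i) ` Q) y)"

definition finite_seqs_dense :: "'g::group_add set \<Rightarrow> 'g solid \<Rightarrow> ('i \<Rightarrow> 'g) \<Rightarrow> bool" where
  "finite_seqs_dense Q Y x \<longleftrightarrow>
     (\<forall>c. seq_norm Q Y x c < top \<longrightarrow>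
        (\<forall>\<epsilon>>0. \<exists>d. finite {i. d i \<noteq> 0} \<and> seq_norm Q Y x (\<lambda>i. c i - d i) < ennreal \<epsilon>))"

definition bounded_linear_functional ::
  "'g measure \<Rightarrow> ('g \<Rightarrow> 'h \<Rightarrow> 'h) \<Rightarrow> ('g \<Rightarrow> ennreal) \<Rightarrow> 'h
     \<Rightarrow> (('h::complex_hilbert_space \<Rightarrow> complex) \<Rightarrow> complex) \<Rightarrow> bool" where
  "bounded_linear_functional \<mu> \<pi> v k \<Lambda> \<longleftrightarrow>
     (\<forall>\<phi>\<in>antidual \<mu> \<pi> v k. \<forall>\<psi>\<in>antidual \<mu> \<pi> v k. \<Lambda> (\<lambda>h. \<phi> h + \<psi> h) = \<Lambda> \<phi> + \<Lambda> \<psi>) \<and>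
     (\<forall>\<phi>\<in>antidual \<mu> \<pi> v k. \<forall>c. \<Lambda> (\<lambda>h. c * \<phi> h) = c * \<Lambda> \<phi>) \<and>
     (\<exists>C\<ge>0. \<forall>\<phi>\<in>antidual \<mu> \<pi> v k. ennreal (cmod (\<Lambda> \<phi>)) \<le> ennreal C * antidual_norm \<mu> \<pi> v k \<phi>)"

text \<open>
  Since the index set carries no order, convergence of the series is convergence along the net of
  finite partial sums. Weak-* convergence is pointwise convergence on \<open>\<H>\<^sup>1\<^sub>v\<close>.
\<close>

definition atomic_decomposition ::
  "'g::{topological_group_add,t2_space} measure \<Rightarrow> 'g set \<Rightarrow> ('g \<Rightarrow> 'h \<Rightarrow> 'h) \<Rightarrow> 'h \<Rightarrow> 'h
     \<Rightarrow> 'g solid \<Rightarrow> ('i \<Rightarrow> 'g) \<Rightarrow> 'h::complex_hilbert_space \<Rightarrow> bool" where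
  "atomic_decomposition \<mu> Q \<pi> k u Y x g \<longleftrightarrow>
     (\<exists>\<Lambda> :: 'i \<Rightarrow> ('h \<Rightarrow> complex) \<Rightarrow> complex.
        (\<forall>i. bounded_linear_functional \<mu> \<pi> (v_weight \<mu> Q Y) k (\<Lambda> i)) \<and>
        (\<forall>f\<in>coorbit_space \<mu> Q \<pi> k u Y.
           (\<forall>h\<in>H1 \<mu> \<pi> (v_weight \<mu> Q Y) k.
              ((\<lambda>i. \<Lambda> i f * hilbert_embed \<mu> \<pi> (v_weight \<mu> Q Y) k (\<pi> (x i) g) h) has_sum f h) UNIV) \<and>
           (finite_seqs_dense Q Y x \<longrightarrow>
              ((\<lambda>N. coorbit_norm \<mu> Q \<pi> k u Y
                   (\<lambda>h. f h - (\<Sum>i\<in>N. \<Lambda> i f * hilbert_embed \<mu> \<pi> (v_weight \<mu> Q Y) k (\<pi> (x i) g) h)))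
                \<longlongrightarrow> 0) (finite_subsets_at_top UNIV))) \<and>
        (\<forall>f\<in>antidual \<mu> \<pi> (v_weight \<mu> Q Y) k.
           f \<in> coorbit_space \<mu> Q \<pi> k u Y \<longleftrightarrow> seq_norm Q Y x (\<lambda>i. \<Lambda> i f) < top) \<and>
        (\<exists>a>0. \<exists>b>0. \<forall>f\<in>coorbit_space \<mu> Q \<pi> k u Y.
           ennreal a * coorbit_norm \<mu> Q \<pi> k u Y f \<le> seq_norm Q Y x (\<lambda>i. \<Lambda> i f) \<and>
           seq_norm Q Y x (\<lambda>i. \<Lambda> i f) \<le> ennreal b * coorbit_norm \<mu> Q \<pi> k u Y f))"

definition best_approx_error ::
  "'g::{topological_group_add,t2_space} measure \<Rightarrow> 'g set \<Rightarrow> ('g \<Rightarrow> 'h \<Rightarrow> 'h) \<Rightarrow> 'h \<Rightarrow> 'h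
     \<Rightarrow> 'g solid \<Rightarrow> ('i \<Rightarrow> 'g) \<Rightarrow> 'h::complex_hilbert_space \<Rightarrow> nat \<Rightarrow> ('h \<Rightarrow> complex) \<Rightarrow> ennreal" where
  "best_approx_error \<mu> Q \<pi> k u Y x g n f =
     (INF (N, c)\<in>{N :: 'i set. finite N \<and> card N \<le> n} \<times> (UNIV :: ('i \<Rightarrow> complex) set).
        coorbit_norm \<mu> Q \<pi> k u Y
          (\<lambda>h. f h - (\<Sum>i\<in>N. c i * hilbert_embed \<mu> \<pi> (v_weight \<mu> Q Y) k (\<pi> (x i) g) h)))"

end

theory Submission
  imports Defs
begin

text \<open>
  Let \<open>\<lambda>\<^sub>i\<close> be the coefficients of \<open>f\<close>. That their weighted sequence norm is finite is a weak-type bound for the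
  numbers \<open>|\<lambda>\<^sub>i| m (x i)\<close>. Keep the at most \<open>n\<close> terms for which this number exceeds a threshold of order
  \<open>n powr (-1/p)\<close>; by summing over dyadic layers, the remaining coefficients have a weighted \<open>\<ell>\<^sup>q\<close>-norm of order
  \<open>n powr (-\<alpha>)\<close>. The tail is small because synthesis is bounded from the weighted \<open>\<ell>\<^sup>q\<close>-space to \<open>\<C>(L\<^sup>q\<^sub>m)\<close>: by the
  orthogonality relations the voice transform of an atom is dominated by a convolution of \<open>|V\<^sub>g g|\<close> and \<open>|V\<^sub>u u|\<close>,
  and each of these two functions is dominated by a sum of translated indicator functions whose coefficients
  are \<open>s\<close>-summable against the norms of the right translations. Both weights \<open>v_weight\<close> are equivalent to
  \<open>x \<mapsto> max 1 (SUP y. m (- x + y) / m y)\<close>, so that the two spaces have the same anti-dual.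
\<close>

section \<open>Hilbert spaces\<close>

text \<open>Integrals are therefore taken of lower semicontinuous functions: voice transforms are
  continuous, control functions turn out to be lower semicontinuous, and for such integrands inner
  regularity on open sets suffices.

  The orthogonality relations enter in a weak form: an invariant bounded form of an irreducible
  representation is a multiple of the inner product, and a suitable right shift of one window makes
  the multiple nonzero. Formal degree operators never appear.

  Exponents \<open>q < 1\<close> are allowed, which rules out duality and Young's inequality. What
  remains is the \<open>s\<close>-triangle inequality, left invariance and bounds for right
  translations; hence both windows are discretized before they are convolved.

  The rate is a matter of exponents: below a threshold \<tau> of order \<open>n powr (-1/p)\<close>
  the counting bound leaves an \<ell>^q-norm of order \<open>\<tau> powr (1 - p/q)\<close>, and
  (1/p)(1 - p/q) = \<alpha>.\<close>

lemma cinner_add_right: "cinner x (y + z) = cinner x y + cinner x z"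
  by (metis cinner_commute cinner_add_left complex_cnj_add)

lemma cinner_scaleC_right: "cinner x (a *\<^sub>C y) = cnj a * cinner x y"
  by (metis cinner_commute cinner_scaleC_left complex_cnj_mult)

lemma cinner_scaleR_left: "cinner (r *\<^sub>R x) y = complex_of_real r * cinner x y"
  by (metis cinner_scaleC_left scaleC_of_real)

lemma cinner_scaleR_right: "cinner x (r *\<^sub>R y) = complex_of_real r * cinner x y"
  by (metis cinner_scaleC_right scaleC_of_real complex_cnj_complex_of_real)

lemma cinner_minus_left: "cinner (- x) y = - cinner x y"
  using cinner_scaleR_left[of "-1" x y] by simp

lemma cinner_minus_right: "cinner x (- y) = - cinner x y"
  using cinner_scaleR_right[of x "-1" y] by simp

lemma cinner_diff_left: "cinner (x - y) z = cinner x z - cinner y z"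
  using cinner_add_left[of x "-y" z] by (simp add: cinner_minus_left)

lemma cinner_diff_right: "cinner x (y - z) = cinner x y - cinner x z"
  using cinner_add_right[of x y "-z"] by (simp add: cinner_minus_right)

lemma cinner_zero_left [simp]: "cinner 0 y = 0"
  using cinner_scaleR_left[of 0 0 y] by simp

lemma cinner_zero_right [simp]: "cinner x 0 = 0"
  using cinner_scaleR_right[of x 0 0] by simp

lemma norm_scaleC: "norm (a *\<^sub>C x) = cmod a * norm x"
proof -
  have "complex_of_real ((norm (a *\<^sub>C x))\<^sup>2) = complex_of_real ((cmod a * norm x)\<^sup>2)"
    unfolding cinner_self[symmetric] cinner_scaleC_left cinner_scaleC_right
    by (simp add: cinner_self power_mult_distrib complex_norm_square mult_ac flip: complex_norm_square)
  then have "(norm (a *\<^sub>C x))\<^sup>2 = (cmod a * norm x)\<^sup>2"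
    using of_real_eq_iff by blast
  then show ?thesis by (simp add: power2_eq_iff_nonneg)
qed

lemma norm_add_square: "(norm (x + y))\<^sup>2 = (norm x)\<^sup>2 + (norm y)\<^sup>2 + 2 * Re (cinner x y)"
proof -
  have "complex_of_real ((norm (x + y))\<^sup>2)
      = complex_of_real ((norm x)\<^sup>2) + complex_of_real ((norm y)\<^sup>2) + (cinner x y + cnj (cinner x y))"
    unfolding cinner_self[symmetric] cinner_add_left cinner_add_right
    using cinner_commute[of y x] by simp
  then have "Re (complex_of_real ((norm (x + y))\<^sup>2)) = Re (complex_of_real ((norm x)\<^sup>2)
     + complex_of_real ((norm y)\<^sup>2) + (cinner x y + cnj (cinner x y)))" by simp
  then show ?thesis by simp
qed

lemma norm_diff_square: "(norm (x - y))\<^sup>2 = (norm x)\<^sup>2 + (norm y)\<^sup>2 - 2 * Re (cinner x y)"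
  using norm_add_square[of x "-y"] by (simp add: cinner_minus_right)

lemma cmod_cinner_le: "cmod (cinner x y) \<le> norm x * norm y"
proof (cases "y = 0")
  case False
  \<comment> \<open>The coefficient of the orthogonal projection of \<open>x\<close> onto
    \<open>y\<close>; the squared norm of the remainder gives the inequality.\<close>
  define a where "a = cinner x y / complex_of_real ((norm y)\<^sup>2)"
  have ny: "(norm y)\<^sup>2 > 0" using False by simp
  have "0 \<le> (norm (x - a *\<^sub>C y))\<^sup>2" by simp
  also have "\<dots> = (norm x)\<^sup>2 + (cmod a)\<^sup>2 * (norm y)\<^sup>2 - 2 * Re (cnj a * cinner x y)"
    by (simp add: norm_diff_square norm_scaleC cinner_scaleC_right power_mult_distrib)
  also have "cnj a * cinner x y = complex_of_real ((cmod (cinner x y))\<^sup>2 / (norm y)\<^sup>2)"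
    by (simp add: a_def complex_norm_square mult.commute flip: complex_norm_square)
  also have "(cmod a)\<^sup>2 * (norm y)\<^sup>2 = (cmod (cinner x y))\<^sup>2 / (norm y)\<^sup>2"
    using ny by (simp add: a_def norm_divide power_divide norm_power power2_eq_square norm_mult)
  finally have "(cmod (cinner x y))\<^sup>2 \<le> (norm x)\<^sup>2 * (norm y)\<^sup>2"
    using ny by (simp add: field_simps)
  then show ?thesis by (metis norm_ge_zero power_mult_distrib power2_le_imp_le mult_nonneg_nonneg)
qed simp

lemma parallelogram: "(norm (x + y :: 'h::complex_hilbert_space))\<^sup>2 + (norm (x - y))\<^sup>2 = 2 * (norm x)\<^sup>2 + 2 * (norm y)\<^sup>2"
  unfolding norm_add_square norm_diff_square by simp

lemma bounded_linear_cinner_left: "bounded_linear (\<lambda>x::'h::complex_hilbert_space. cinner x y)"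
  by (rule bounded_linear_intro[where K="norm y"])
    (auto simp: cinner_add_left cinner_scaleR_left scaleR_conv_of_real cmod_cinner_le)

lemma bounded_linear_cinner_right: "bounded_linear (\<lambda>y::'h::complex_hilbert_space. cinner x y)"
  by (rule bounded_linear_intro[where K="norm x"])
    (use cmod_cinner_le[of x] in \<open>auto simp: cinner_add_right cinner_scaleR_right scaleR_conv_of_real mult.commute\<close>)

lemmas continuous_on_cinner_left [continuous_intros] =
  bounded_linear.continuous_on[OF bounded_linear_cinner_left]
lemmas continuous_on_cinner_right [continuous_intros] =
  bounded_linear.continuous_on[OF bounded_linear_cinner_right]

text \<open>The representing vector minimizes \<open>\<parallel>x\<parallel>\<^sup>2 - 2 Re (\<ell> x)\<close>; minimizing sequences are Cauchy by the
  parallelogram law.\<close>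

lemma riesz_representation:
  fixes l :: "'h::complex_hilbert_space \<Rightarrow> complex"
  assumes add: "\<And>x y. l (x + y) = l x + l y" and scale: "\<And>a x. l (a *\<^sub>C x) = a * l x"
    and bound: "\<And>x. cmod (l x) \<le> C * norm x"
  shows "\<exists>t. \<forall>x. l x = cinner x t"
proof -
  define J where "J x = (norm x)\<^sup>2 - 2 * Re (l x)" for x
  have scaleR: "l (r *\<^sub>R x) = complex_of_real r * l x" for r x
    by (metis scale scaleC_of_real)
  have C0: "Re (l x) \<le> C * norm x" for x
    using bound[of x] complex_Re_le_cmod[of "l x"] by linarith
  \<comment> \<open>Completing the square in the norm of \<open>x\<close>.\<close>
  have Jlow: "J x \<ge> - C\<^sup>2" for x
  proof -
    have "0 \<le> (norm x - C)\<^sup>2" by simp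
    then show ?thesis using C0[of x] by (simp add: J_def power2_eq_square algebra_simps)
  qed
  define j where "j = Inf (range J)"
  have bdd: "bdd_below (range J)" using Jlow by (intro bdd_belowI[of _ "- C\<^sup>2"]) auto
  have jle: "j \<le> J x" for x unfolding j_def using bdd by (simp add: cInf_lower)
  have "\<exists>x. J x < j + inverse (real (Suc n))" for n
  proof -
    have "Inf (range J) < j + inverse (real (Suc n))" unfolding j_def by simp
    then show ?thesis using cInf_lessD[of "range J"] by blast
  qed
  then obtain X where X: "\<And>n. J (X n) < j + inverse (real (Suc n))" by metis
  have blin: "bounded_linear l"
    by (rule bounded_linear_intro[where K=C])
      (use bound in \<open>auto simp: add scaleR scaleR_conv_of_real mult.commute\<close>)
  \<comment> \<open>Since \<open>l\<close> is additive, its contributions at \<open>x\<close>,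
    \<open>y\<close> and their midpoint cancel in the parallelogram law, so nearly minimal values of
    \<open>J\<close> force small distances.\<close>
  have diff: "(norm (x - y))\<^sup>2 = 2 * J x + 2 * J y - 4 * J ((1/2) *\<^sub>R (x + y))" for x y
  proof -
    have "(norm ((1/2) *\<^sub>R (x + y)))\<^sup>2 = (norm (x + y))\<^sup>2 / 4"
      by (simp add: power_divide)
    moreover have "Re (l ((1/2) *\<^sub>R (x + y))) = (Re (l x) + Re (l y)) / 2"
      unfolding scaleR add by simp
    ultimately show ?thesis using parallelogram[of x y] unfolding J_def by argo
  qed
  have "Cauchy X"
  proof (rule metric_CauchyI)
    fix e :: real assume e: "e > 0"
    then obtain M where M: "inverse (real (Suc M)) < e\<^sup>2 / 4"
      using reals_Archimedean[of "e\<^sup>2 / 4"] by auto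
    show "\<exists>M. \<forall>m\<ge>M. \<forall>n\<ge>M. dist (X m) (X n) < e"
    proof (intro exI allI impI)
      fix m n assume mn: "m \<ge> M" "n \<ge> M"
      have i: "inverse (real (Suc m)) \<le> inverse (real (Suc M))" "inverse (real (Suc n)) \<le> inverse (real (Suc M))"
        using mn by auto
      have "(norm (X m - X n))\<^sup>2 < e\<^sup>2"
        unfolding diff using X[of m] X[of n] i M jle[of "(1/2) *\<^sub>R (X m + X n)"] by linarith
      then show "dist (X m) (X n) < e" using e by (simp add: dist_norm power2_less_imp_less)
    qed
  qed
  then obtain t where t: "X \<longlonglongrightarrow> t" using Cauchy_convergent convergent_def by blast
  have "(\<lambda>n. J (X n)) \<longlonglongrightarrow> J t"
    unfolding J_def by (intro tendsto_intros t bounded_linear.tendsto[OF blin])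
  moreover have "(\<lambda>n. j + inverse (real (Suc n))) \<longlonglongrightarrow> j + 0"
    by (intro tendsto_intros LIMSEQ_inverse_real_of_nat)
  ultimately have "J t \<le> j + 0"
    by (rule LIMSEQ_le) (use X less_imp_le in blast)
  then have Jt: "J t \<le> J x" for x using jle[of x] by simp
  have Re: "Re (l x) = Re (cinner x t)" for x
  proof (rule ccontr)
    define d where "d = Re (l x) - Re (cinner x t)"
    assume "\<not> ?thesis"
    then have d: "d \<noteq> 0" and x0: "x \<noteq> 0" using bound[of 0] by (auto simp: d_def)
    \<comment> \<open>The step length minimizing the quadratic polynomial that \<open>J\<close>
      becomes along the line through \<open>t\<close> in direction \<open>x\<close>.\<close>
    define s where "s = d / (norm x)\<^sup>2"
    have "J (t + s *\<^sub>R x) = J t + s\<^sup>2 * (norm x)\<^sup>2 - 2 * s * d"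
      unfolding J_def norm_add_square add scaleR d_def cinner_scaleR_right
      using cinner_commute[of x t] by (simp add: power_mult_distrib algebra_simps)
    also have "\<dots> = J t - d\<^sup>2 / (norm x)\<^sup>2"
      using x0 by (simp add: s_def power_divide power2_eq_square)
    also have "\<dots> < J t" using d x0 by simp
    finally show False using Jt[of "t + s *\<^sub>R x"] by simp
  qed
  have "l x = cinner x t" for x
  proof (rule complex_eqI)
    show "Re (l x) = Re (cinner x t)" by (rule Re)
    \<comment> \<open>Multiplication by \<open>\<i>\<close> turns imaginary parts into real parts,
      up to sign.\<close>
    show "Im (l x) = Im (cinner x t)"
      using Re[of "\<i> *\<^sub>C x"] by (simp add: scale cinner_scaleC_left)
  qed
  then show ?thesis by blast
qed

section \<open>Schur's lemma for invariant forms\<close>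

definition bounded_form :: "('h::complex_hilbert_space \<Rightarrow> 'h \<Rightarrow> complex) \<Rightarrow> bool" where
  "bounded_form B \<longleftrightarrow> (\<forall>x y z. B (x + y) z = B x z + B y z) \<and> (\<forall>x y z. B x (y + z) = B x y + B x z) \<and>
     (\<forall>a x y. B (a *\<^sub>C x) y = a * B x y) \<and> (\<forall>a x y. B x (a *\<^sub>C y) = cnj a * B x y) \<and>
     (\<exists>C\<ge>0. \<forall>x y. cmod (B x y) \<le> C * norm x * norm y)"

text \<open>Complex polarization: the diagonal at \<open>x + y\<close> makes \<open>B\<close>
  antisymmetric, and the diagonal at \<open>x\<close> plus \<open>\<i>\<close> times
  \<open>y\<close> makes it symmetric. Complex scalars are essential, since real antisymmetric forms
  have zero diagonal.\<close>

lemma bounded_form_diag_zero: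
  assumes B: "bounded_form B" and z: "\<And>x. B x x = 0"
  shows "B x y = 0"
proof -
  have a: "B (x + y) z = B x z + B y z" "B x (y + z) = B x y + B x z" "B (c *\<^sub>C x) y = c * B x y"
    "B x (c *\<^sub>C y) = cnj c * B x y" for x y z c using B unfolding bounded_form_def by auto
  have 1: "B x y + B y x = 0"
  proof -
    have "B (x + y) (x + y) = B x x + B y x + (B x y + B y y)" by (simp only: a(1,2))
    then show ?thesis by (simp add: z add.commute)
  qed
  have "B x (\<i> *\<^sub>C y) + B (\<i> *\<^sub>C y) x = 0"
  proof -
    let ?y = "\<i> *\<^sub>C y"
    have "B (x + ?y) (x + ?y) = B x x + B ?y x + (B x ?y + B ?y ?y)" by (simp only: a(1,2))
    then show ?thesis by (simp only: z) (simp add: add.commute)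
  qed
  then have "- \<i> * B x y + \<i> * B y x = 0" by (simp add: a)
  then have "\<i> * (B y x - B x y) = 0" by (simp add: algebra_simps)
  then have "B y x = B x y" by simp
  then show ?thesis using 1 by simp
qed

lemma bounded_form_scaled_cinner: "bounded_form (\<lambda>x y. c * cinner x y)"
  unfolding bounded_form_def
proof (intro conjI allI exI[of _ "cmod c"])
  fix x y :: 'a
  show "cmod (c * cinner x y) \<le> cmod c * norm x * norm y"
    using mult_left_mono[OF cmod_cinner_le[of x y] norm_ge_zero[of c]] by (simp add: norm_mult mult.assoc)
qed (auto simp: cinner_add_left cinner_add_right cinner_scaleC_left cinner_scaleC_right algebra_simps)

lemma bounded_form_comb:
  assumes "bounded_form B" "bounded_form D"
  shows "bounded_form (\<lambda>x y. a * B x y + b * D x y)"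
proof -
  obtain C1 C2 where C: "\<And>x y. cmod (B x y) \<le> C1 * norm x * norm y" "\<And>x y. cmod (D x y) \<le> C2 * norm x * norm y"
    "C1 \<ge> 0" "C2 \<ge> 0"
    using assms unfolding bounded_form_def by metis
  have "cmod (a * B x y + b * D x y) \<le> (cmod a * C1 + cmod b * C2) * norm x * norm y" for x y
  proof -
    have "cmod (a * B x y + b * D x y) \<le> cmod a * cmod (B x y) + cmod b * cmod (D x y)"
      by (metis norm_triangle_ineq norm_mult)
    also have "\<dots> \<le> cmod a * (C1 * norm x * norm y) + cmod b * (C2 * norm x * norm y)"
      by (intro add_mono mult_left_mono C) auto
    finally show ?thesis by (simp add: algebra_simps)
  qed
  moreover have "cmod a * C1 + cmod b * C2 \<ge> 0" using C by simp
  ultimately show ?thesis using assms unfolding bounded_form_def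
    by (intro conjI exI[of _ "cmod a * C1 + cmod b * C2"]) (auto simp: algebra_simps)
qed

lemma bounded_form_cnj:
  assumes "bounded_form B" shows "bounded_form (\<lambda>x y. cnj (B y x))"
proof -
  obtain C where "C \<ge> 0" "\<And>x y. cmod (B x y) \<le> C * norm x * norm y"
    using assms unfolding bounded_form_def by metis
  then have "\<exists>C\<ge>0. \<forall>x y. cmod (cnj (B y x)) \<le> C * norm x * norm y"
    by (metis complex_mod_cnj mult.assoc mult.commute)
  then show ?thesis using assms unfolding bounded_form_def by auto
qed

lemma bounded_form_operator:
  fixes B :: "'h::complex_hilbert_space \<Rightarrow> 'h \<Rightarrow> complex"
  assumes B: "bounded_form B"
  obtains T :: "'h \<Rightarrow>\<^sub>L 'h" where "\<And>x y. B x y = cinner (T x) y" "\<And>a x. T (a *\<^sub>C x) = a *\<^sub>C T x"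
proof -
  obtain C where C: "C \<ge> 0" "\<And>x y. cmod (B x y) \<le> C * norm x * norm y"
    using B unfolding bounded_form_def by metis
  have a: "B (x + y) z = B x z + B y z" "B x (y + z) = B x y + B x z" "B (c *\<^sub>C x) y = c * B x y"
    "B x (c *\<^sub>C y) = cnj c * B x y" for x y z c using B unfolding bounded_form_def by auto
  have "\<exists>t. \<forall>y. cnj (B x y) = cinner y t" for x
    by (rule riesz_representation[where C="C * norm x"]) (use C in \<open>auto simp: a\<close>)
  then obtain t where t: "\<And>x y. cnj (B x y) = cinner y (t x)" by metis
  have Bt: "B x y = cinner (t x) y" for x y
    by (metis t cinner_commute complex_cnj_cnj)
  have eqI: "u = v" if "\<And>y. cinner u y = cinner v y" for u v :: 'h
    using that[of "u - v"] cinner_self[of "u - v"] by (simp add: cinner_diff_left)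
  have add: "t (x + y) = t x + t y" for x y
    by (rule eqI) (simp add: cinner_add_left a flip: Bt)
  have scale: "t (c *\<^sub>C x) = c *\<^sub>C t x" for c x
    by (rule eqI) (simp add: cinner_scaleC_left a flip: Bt)
  have "norm (t x) \<le> norm x * C" for x
  proof -
    have "norm (t x) * norm (t x) = cmod (B x (t x))"
      by (simp add: Bt cinner_self power2_eq_square norm_mult)
    also have "\<dots> \<le> (norm x * C) * norm (t x)" using C(2)[of x "t x"] by (simp add: mult_ac)
    finally show ?thesis using C(1) by (cases "t x = 0") auto
  qed
  then have "bounded_linear t"
    by (intro bounded_linear_intro[where K=C]) (auto simp: add scale simp flip: scaleC_of_real)
  then have "blinfun_apply (Blinfun t) = t" by (simp add: bounded_linear_Blinfun_apply)
  then show ?thesis using that[of "Blinfun t"] Bt scale by simp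
qed

section \<open>The modulus of a self-adjoint contraction\<close>

lemmas blinfun_compose_simps =
  bounded_bilinear.add_left[OF bounded_bilinear_blinfun_compose] bounded_bilinear.add_right[OF bounded_bilinear_blinfun_compose]
  bounded_bilinear.diff_left[OF bounded_bilinear_blinfun_compose] bounded_bilinear.diff_right[OF bounded_bilinear_blinfun_compose]
  bounded_bilinear.scaleR_left[OF bounded_bilinear_blinfun_compose] bounded_bilinear.scaleR_right[OF bounded_bilinear_blinfun_compose]

lemma blinfun_compose_assoc: "(a o\<^sub>L b) o\<^sub>L c = a o\<^sub>L (b o\<^sub>L c)"
  by (rule blinfun_eqI) simp

text \<open>A fixed point \<open>Y\<close> satisfies 2 Y = C + Y^2, that is, (1 - Y)^2 = 1 - C. The
  limit thus yields a square root of 1 - C without spectral theory.\<close>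

fun sqrt_iter :: "('h::real_normed_vector \<Rightarrow>\<^sub>L 'h) \<Rightarrow> nat \<Rightarrow> 'h \<Rightarrow>\<^sub>L 'h" where
  "sqrt_iter C 0 = 0"
| "sqrt_iter C (Suc n) = (1/2) *\<^sub>R (C + (sqrt_iter C n o\<^sub>L sqrt_iter C n))"

text \<open>The iteration for the scalar \<open>C = 1\<close>. Its increments dominate the norms of
  the increments of \<open>sqrt_iter\<close> for every contraction, so convergence of this bounded
  increasing sequence settles convergence of the operators.\<close>

fun sqrt_iter_real :: "nat \<Rightarrow> real" where
  "sqrt_iter_real 0 = 0"
| "sqrt_iter_real (Suc n) = (1 + sqrt_iter_real n * sqrt_iter_real n) / 2"

lemma sqrt_iter_real_bounds: "0 \<le> sqrt_iter_real n \<and> sqrt_iter_real n \<le> 1"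
proof (induction n)
  case (Suc n)
  then have "sqrt_iter_real n * sqrt_iter_real n \<le> 1 * 1" by (intro mult_mono) auto
  then show ?case using Suc by simp
qed simp

lemma sqrt_iter_real_incseq: "sqrt_iter_real n \<le> sqrt_iter_real (Suc n)"
proof -
  have "0 \<le> (sqrt_iter_real n - 1)\<^sup>2" by simp
  then show ?thesis by (simp add: power2_eq_square algebra_simps)
qed

lemma Cauchy_sqrt_iter_real: "Cauchy sqrt_iter_real"
proof (intro convergent_Cauchy Bseq_monoseq_convergent)
  show "Bseq sqrt_iter_real" by (rule BseqI'[of _ 1]) (use sqrt_iter_real_bounds in auto)
  show "monoseq sqrt_iter_real"
    unfolding monoseq_Suc using sqrt_iter_real_incseq by blast
qed

lemma norm_sqrt_iter:
  assumes "norm C \<le> 1" shows "norm (sqrt_iter C n) \<le> sqrt_iter_real n"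
proof (induction n)
  case (Suc n)
  have "norm (C + (sqrt_iter C n o\<^sub>L sqrt_iter C n)) \<le> 1 + sqrt_iter_real n * sqrt_iter_real n"
    by (rule order_trans[OF norm_triangle_ineq], intro add_mono assms order_trans[OF norm_blinfun_compose]
         mult_mono Suc) (use sqrt_iter_real_bounds in auto)
  then show ?case unfolding sqrt_iter.simps sqrt_iter_real.simps by simp
qed simp

lemma norm_sqrt_iter_step:
  assumes "norm C \<le> 1"
  shows "norm (sqrt_iter C (Suc n) - sqrt_iter C n) \<le> sqrt_iter_real (Suc n) - sqrt_iter_real n"
proof (induction n)
  case 0 then show ?case using assms by simp
next
  case (Suc n)
  let ?a = "sqrt_iter C (Suc n)" and ?b = "sqrt_iter C n"
  let ?r = "sqrt_iter_real (Suc n)" and ?s = "sqrt_iter_real n"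
  \<comment> \<open>The noncommutative factorization a^2 - b^2 = a (a - b) + (a - b) b, whose scalar
    version is the increment of the majorant.\<close>
  have e: "sqrt_iter C (Suc (Suc n)) - sqrt_iter C (Suc n)
     = (1/2) *\<^sub>R ((?a o\<^sub>L (?a - ?b)) + ((?a - ?b) o\<^sub>L ?b))"
    unfolding sqrt_iter.simps(2)[of C "Suc n"] sqrt_iter.simps(2)[of C n, symmetric]
    by (subst (3) sqrt_iter.simps(2)) (simp add: blinfun_compose_simps scaleR_diff_right scaleR_add_right del: sqrt_iter.simps)
  have n: "norm ?a \<le> ?r" "norm ?b \<le> ?s" by (rule norm_sqrt_iter[OF assms])+
  have "norm ((?a o\<^sub>L (?a - ?b)) + ((?a - ?b) o\<^sub>L ?b)) \<le> ?r * (?r - ?s) + (?r - ?s) * ?s"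
    by (intro order_trans[OF norm_triangle_ineq] add_mono order_trans[OF norm_blinfun_compose] mult_mono Suc.IH n)
      (use sqrt_iter_real_bounds[of n] sqrt_iter_real_bounds[of "Suc n"] sqrt_iter_real_incseq[of n] in \<open>auto simp del: sqrt_iter_real.simps sqrt_iter.simps\<close>)
  also have "\<dots> = 2 * (sqrt_iter_real (Suc (Suc n)) - ?r)"
    unfolding sqrt_iter_real.simps(2)[of "Suc n"]
    by (subst (6) sqrt_iter_real.simps(2)) (simp add: field_simps del: sqrt_iter_real.simps)
  finally show ?case unfolding e by (simp del: sqrt_iter.simps sqrt_iter_real.simps)
qed

lemma norm_sqrt_iter_diff:
  assumes "norm C \<le> 1" "m \<le> n"
  shows "norm (sqrt_iter C n - sqrt_iter C m) \<le> sqrt_iter_real n - sqrt_iter_real m"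
  using assms(2)
proof (induction n rule: dec_induct)
  case (step n)
  have "norm (sqrt_iter C (Suc n) - sqrt_iter C m)
     \<le> norm (sqrt_iter C (Suc n) - sqrt_iter C n) + norm (sqrt_iter C n - sqrt_iter C m)"
    using norm_triangle_ineq[of "sqrt_iter C (Suc n) - sqrt_iter C n" "sqrt_iter C n - sqrt_iter C m"]
    by (simp del: sqrt_iter.simps)
  then show ?case using norm_sqrt_iter_step[OF assms(1), of n] step.IH by (simp del: sqrt_iter.simps sqrt_iter_real.simps)
qed simp

lemma sqrt_iter_commute:
  assumes "D o\<^sub>L C = C o\<^sub>L D" shows "D o\<^sub>L sqrt_iter C n = sqrt_iter C n o\<^sub>L D"
proof (induction n)
  case (Suc n)
  have "D o\<^sub>L (sqrt_iter C n o\<^sub>L sqrt_iter C n) = (sqrt_iter C n o\<^sub>L sqrt_iter C n) o\<^sub>L D"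
    by (metis Suc blinfun_compose_assoc)
  then show ?case
    by (simp add: blinfun_compose_simps assms)
qed simp

text \<open>The modulus of a self-adjoint contraction \<open>R\<close> is \<open>1 - Y\<close>, where \<open>Y\<close> is the limit of the
  iteration \<open>Y \<mapsto> (1 - R\<^sup>2 + Y\<^sup>2) / 2\<close>.\<close>

lemma operator_modulus:
  fixes R :: "'h::complex_hilbert_space \<Rightarrow>\<^sub>L 'h"
  assumes sa: "\<And>x y. cinner (R x) y = cinner x (R y)" and nR: "norm R \<le> 1"
  obtains P :: "'h \<Rightarrow>\<^sub>L 'h" where "P o\<^sub>L P = R o\<^sub>L R"
    "\<And>D. D o\<^sub>L R = R o\<^sub>L D \<Longrightarrow> D o\<^sub>L P = P o\<^sub>L D" "\<And>h. Re (cinner (P h) h) \<ge> 0"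
proof -
  define I where "I = (id_blinfun :: 'h \<Rightarrow>\<^sub>L 'h)"
  have I: "I o\<^sub>L X = X" "X o\<^sub>L I = X" "I h = h" for X :: "'h \<Rightarrow>\<^sub>L 'h" and h
    by (auto simp: I_def blinfun_eqI)
  define C where "C = I - (R o\<^sub>L R)"
  have nRh: "norm (R h) \<le> norm h" for h
    by (rule order_trans[OF norm_blinfun]) (use nR mult_right_mono[OF nR norm_ge_zero[of h]] in auto)
  \<comment> \<open>Self-adjointness turns the cross term into twice the squared norm of
    \<open>R h\<close>, which outweighs the squared norm of \<open>R (R h)\<close>.\<close>
  have "norm (C h) \<le> norm h" for h
  proof -
    have "(norm (C h))\<^sup>2 = (norm h)\<^sup>2 + (norm (R (R h)))\<^sup>2 - 2 * Re (cinner h (R (R h)))"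
      by (simp add: C_def I blinfun.diff_left norm_diff_square)
    also have "cinner h (R (R h)) = complex_of_real ((norm (R h))\<^sup>2)"
      by (simp add: sa[symmetric] cinner_self)
    also have "(norm (R (R h)))\<^sup>2 \<le> (norm (R h))\<^sup>2" using nRh by (simp add: power_mono)
    finally have "(norm (C h))\<^sup>2 \<le> (norm h)\<^sup>2 - (norm (R h))\<^sup>2" by simp
    also have "\<dots> \<le> (norm h)\<^sup>2" by simp
    finally have "(norm (C h))\<^sup>2 \<le> (norm h)\<^sup>2" .
    then show ?thesis by (rule power2_le_imp_le) simp
  qed
  then have nC: "norm C \<le> 1" by (intro norm_blinfun_bound) auto
  have "Cauchy (sqrt_iter C)"
  proof (rule metric_CauchyI)
    fix e :: real assume "e > 0"
    then obtain M where M: "\<And>m n. m \<ge> M \<Longrightarrow> n \<ge> M \<Longrightarrow> dist (sqrt_iter_real m) (sqrt_iter_real n) < e"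
      using Cauchy_sqrt_iter_real unfolding Cauchy_def by metis
    have "dist (sqrt_iter C m) (sqrt_iter C n) < e" if "m \<ge> M" "n \<ge> M" for m n
    proof (cases "m \<le> n")
      case True
      then show ?thesis using norm_sqrt_iter_diff[OF nC True] M[OF that(2) that(1)]
        by (simp add: dist_norm norm_minus_commute)
    next
      case False
      then show ?thesis using norm_sqrt_iter_diff[OF nC, of n m] M[OF that]
        by (simp add: dist_norm norm_minus_commute)
    qed
    then show "\<exists>M. \<forall>m\<ge>M. \<forall>n\<ge>M. dist (sqrt_iter C m) (sqrt_iter C n) < e" by blast
  qed
  then obtain Y where Y: "sqrt_iter C \<longlonglongrightarrow> Y" using Cauchy_convergent convergent_def by blast
  have "(\<lambda>n. sqrt_iter C (Suc n)) \<longlonglongrightarrow> (1/2) *\<^sub>R (C + (Y o\<^sub>L Y))"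
    unfolding sqrt_iter.simps
    by (intro tendsto_intros Y bounded_bilinear.tendsto[OF bounded_bilinear_blinfun_compose])
  moreover have "(\<lambda>n. sqrt_iter C (Suc n)) \<longlonglongrightarrow> Y" using Y LIMSEQ_Suc by blast
  ultimately have "Y = (1/2) *\<^sub>R (C + (Y o\<^sub>L Y))" by (rule LIMSEQ_unique[rotated])
  then have Yeq: "Y + Y = C + (Y o\<^sub>L Y)"
    by (metis scaleR_2 scaleR_scaleR divide_self_if mult_1 scaleR_one times_divide_eq_right zero_neq_numeral mult.right_neutral)
  define P where "P = I - Y"
  have "P o\<^sub>L P = I - (Y + Y) + (Y o\<^sub>L Y)"
    by (simp add: P_def blinfun_compose_simps I)
  then have 1: "P o\<^sub>L P = R o\<^sub>L R" unfolding Yeq C_def by simp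
  have 2: "D o\<^sub>L P = P o\<^sub>L D" if D: "D o\<^sub>L R = R o\<^sub>L D" for D
  proof -
    have "D o\<^sub>L C = C o\<^sub>L D"
      unfolding C_def blinfun_compose_simps I
      by (metis D blinfun_compose_assoc)
    then have "(\<lambda>n. D o\<^sub>L sqrt_iter C n) = (\<lambda>n. sqrt_iter C n o\<^sub>L D)" using sqrt_iter_commute by blast
    moreover have "(\<lambda>n. D o\<^sub>L sqrt_iter C n) \<longlonglongrightarrow> (D o\<^sub>L Y)" "(\<lambda>n. sqrt_iter C n o\<^sub>L D) \<longlonglongrightarrow> (Y o\<^sub>L D)"
      by (intro tendsto_intros Y bounded_bilinear.tendsto[OF bounded_bilinear_blinfun_compose])+
    ultimately have "D o\<^sub>L Y = Y o\<^sub>L D" using LIMSEQ_unique by metis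
    then show ?thesis unfolding P_def blinfun_compose_simps I by simp
  qed
  have "norm (sqrt_iter C n) \<le> 1" for n
    using norm_sqrt_iter[OF nC, of n] sqrt_iter_real_bounds[of n] by linarith
  then have nY: "norm Y \<le> 1" using Lim_norm_ubound[OF _ Y] by (simp add: always_eventually)
  \<comment> \<open>Positivity of \<open>P = I - Y\<close> only requires that the limit
    \<open>Y\<close> is a contraction.\<close>
  have 3: "Re (cinner (P h) h) \<ge> 0" for h
  proof -
    have "Re (cinner (Y h) h) \<le> norm (Y h) * norm h"
      using cmod_cinner_le complex_Re_le_cmod order_trans by blast
    also have "norm (Y h) \<le> norm h"
      by (rule order_trans[OF norm_blinfun]) (use mult_right_mono[OF nY norm_ge_zero[of h]] in auto)
    finally show ?thesis by (simp add: P_def I blinfun.diff_left cinner_diff_left cinner_self power2_eq_square mult_right_mono)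
  qed
  show ?thesis using that[of P] 1 2 3 by blast
qed

text \<open>Let \<open>T\<close> be the self-adjoint operator of \<open>B\<close>. For every real
  \<open>l\<close>, the quadratic form of \<open>T - l\<close> has a constant sign: for a scaled
  copy \<open>R\<close> of \<open>T - l\<close> with modulus \<open>P\<close>, the kernel of
  \<open>P + R\<close> is closed and invariant, hence trivial or everything. Letting
  \<open>l\<close> vary leaves a single possible value for the Rayleigh quotient of
  \<open>T\<close>.\<close>

lemma schur_hermitian:
  fixes B :: "'h::complex_hilbert_space \<Rightarrow> 'h \<Rightarrow> complex" and \<pi> :: "'g::{topological_group_add,t2_space} \<Rightarrow> 'h \<Rightarrow> 'h"
  assumes pi: "unitary_representation \<pi>" "irreducible_representation \<pi>"
    and B: "bounded_form B" and herm: "\<And>x y. B y x = cnj (B x y)"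
    and inv: "\<And>z x y. B (\<pi> z x) (\<pi> z y) = B x y"
  shows "\<exists>c::real. \<forall>x y. B x y = complex_of_real c * cinner x y"
proof -
  obtain T :: "'h \<Rightarrow>\<^sub>L 'h" where T: "\<And>x y. B x y = cinner (T x) y" and TC: "\<And>a x. T (a *\<^sub>C x) = a *\<^sub>C T x"
    using bounded_form_operator[OF B] by metis
  have pia: "\<pi> z (f + f') = \<pi> z f + \<pi> z f'" "\<pi> z (c *\<^sub>C f) = c *\<^sub>C \<pi> z f"
     "cinner (\<pi> z f) (\<pi> z f') = cinner f f'" "surj (\<pi> z)" for z f f' c
    using pi(1) unfolding unitary_representation_def by auto
  have pin: "norm (\<pi> z f) = norm f" for z f
    using pia(3)[of z f f] by (simp add: cinner_self power2_eq_iff_nonneg flip: of_real_power)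
  have pib: "bounded_linear (\<pi> z)" for z
    by (intro bounded_linear_intro[where K=1]) (auto simp: pia pin simp flip: scaleC_of_real)
  define p where "p z = Blinfun (\<pi> z)" for z
  have p: "blinfun_apply (p z) = \<pi> z" for z by (simp add: p_def bounded_linear_Blinfun_apply pib)
  have eqI: "u = v" if "\<And>y. cinner u y = cinner v y" for u v :: 'h
    using that[of "u - v"] cinner_self[of "u - v"] by (simp add: cinner_diff_left)
  have sa: "cinner (T x) y = cinner x (T y)" for x y
    using herm[of x y] cinner_commute[of x "T y"] by (simp add: T)
  have Tpi: "T (\<pi> z x) = \<pi> z (T x)" for z x
  proof (rule eqI)
    fix y obtain y' where "y = \<pi> z y'" using pia(4)[of z] by blast
    then show "cinner (T (\<pi> z x)) y = cinner (\<pi> z (T x)) y" using inv[of z x y'] by (simp add: pia T)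
  qed
  define q where "q h = Re (cinner (T h) h)" for h
  have key: "(\<forall>h. q h \<ge> l * (norm h)\<^sup>2) \<or> (\<forall>h. q h \<le> l * (norm h)\<^sup>2)" for l :: real
  proof -
    define S where "S = T - l *\<^sub>R id_blinfun"
    \<comment> \<open>Positive scaling makes \<open>R\<close> a contraction, as
      \<open>operator_modulus\<close> requires, and preserves signs.\<close>
    define b where "b = 1 / (1 + norm S)"
    have b: "b > 0" "b * norm S \<le> 1" by (auto simp: b_def add_pos_nonneg field_simps)
    define R where "R = b *\<^sub>R S"
    have nR: "norm R \<le> 1" using b by (simp add: R_def)
    have Rh: "R h = b *\<^sub>R (T h - l *\<^sub>R h)" for h
      by (simp add: R_def S_def blinfun.scaleR_left blinfun.diff_left)
    have Rsa: "cinner (R x) y = cinner x (R y)" for x y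
      by (simp add: Rh cinner_scaleR_left cinner_scaleR_right cinner_diff_left cinner_diff_right sa)
    obtain P :: "'h \<Rightarrow>\<^sub>L 'h" where P: "P o\<^sub>L P = R o\<^sub>L R"
      "\<And>D. D o\<^sub>L R = R o\<^sub>L D \<Longrightarrow> D o\<^sub>L P = P o\<^sub>L D" "\<And>h. Re (cinner (P h) h) \<ge> 0"
      using operator_modulus[OF Rsa nR] by metis
    have blS: "bounded_linear (\<lambda>x::'h. a *\<^sub>C x)" for a
      by (intro bounded_linear_intro[where K="cmod a"])
        (auto simp: scaleC_add_right norm_scaleC scaleC_scaleC mult.commute simp flip: scaleC_of_real)
    have CR: "a *\<^sub>C (r *\<^sub>R x) = r *\<^sub>R (a *\<^sub>C x)" for a r and x :: 'h
      by (simp add: scaleC_scaleC mult.commute flip: scaleC_of_real)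
    have PC: "P (a *\<^sub>C x) = a *\<^sub>C P x" for a x
    proof -
      have "Blinfun (\<lambda>x. a *\<^sub>C x) o\<^sub>L R = R o\<^sub>L Blinfun (\<lambda>x. a *\<^sub>C x)"
        by (rule blinfun_eqI) (simp add: bounded_linear_Blinfun_apply blS Rh TC CR
           linear_diff[OF bounded_linear.linear[OF blS]] blinfun.scaleR_right scaleC_scaleC mult.commute)
      from P(2)[OF this] have "blinfun_apply (Blinfun (\<lambda>x. a *\<^sub>C x) o\<^sub>L P) x = blinfun_apply (P o\<^sub>L Blinfun (\<lambda>x. a *\<^sub>C x)) x" by simp
      then show ?thesis by (simp add: bounded_linear_Blinfun_apply blS)
    qed
    have Ppi: "P (\<pi> z x) = \<pi> z (P x)" for z x
    proof -
      have "p z o\<^sub>L R = R o\<^sub>L p z"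
        by (rule blinfun_eqI) (simp add: p Rh Tpi linear_simps[OF pib])
      from P(2)[OF this] have "blinfun_apply (p z o\<^sub>L P) x = blinfun_apply (P o\<^sub>L p z) x" by simp
      then show ?thesis by (simp add: p)
    qed
    have PR: "P o\<^sub>L R = R o\<^sub>L P" using P(2)[of R] by simp
    define K where "K = {h. P h + R h = 0}"
    have "closed K" unfolding K_def by (intro closed_Collect_eq continuous_intros)
    moreover have "\<forall>f\<in>K. \<forall>f'\<in>K. f + f' \<in> K"
      unfolding K_def by (simp add: blinfun.add_right) (metis (no_types, lifting) add.assoc add.commute add.right_neutral)
    moreover have RC: "R (a *\<^sub>C h) = a *\<^sub>C R h" for a h
      by (simp add: Rh TC CR linear_diff[OF bounded_linear.linear[OF blS]])
    have s0: "a *\<^sub>C (0::'h) = 0" for a using linear_0[OF bounded_linear.linear[OF blS]] by simp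
    have "\<forall>c. \<forall>f\<in>K. c *\<^sub>C f \<in> K" unfolding K_def
      by (auto simp: PC RC s0 simp flip: scaleC_add_right)
    moreover have "\<forall>x. \<forall>f\<in>K. \<pi> x f \<in> K"
    proof (intro allI ballI)
      fix x f assume "f \<in> K"
      then have "P f + R f = 0" by (simp add: K_def)
      moreover have "R (\<pi> x f) = \<pi> x (R f)" by (simp add: Rh Tpi linear_simps[OF pib])
      ultimately have "P (\<pi> x f) + R (\<pi> x f) = \<pi> x 0" by (simp add: Ppi flip: pia)
      then show "\<pi> x f \<in> K" by (simp add: K_def linear_simps[OF pib])
    qed
    moreover have "0 \<in> K" by (simp add: K_def)
    ultimately have "K = {0} \<or> K = UNIV" using pi(2) unfolding irreducible_representation_def by blast
    then show ?thesis
    proof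
      assume K: "K = {0}"
      \<comment> \<open>\<open>P\<close> and \<open>R\<close> commute and have equal squares, so (P
        + R)(P - R) = 0 and the range of \<open>P - R\<close> lies in \<open>K\<close>.\<close>
      have "P h = R h" for h
      proof -
        have "(P o\<^sub>L P) h = (R o\<^sub>L R) h" "(P o\<^sub>L R) h = (R o\<^sub>L P) h" using P(1) PR by simp_all
        then have "P (P h - R h) + R (P h - R h) = 0" by (simp add: blinfun.diff_right)
        then have "P h - R h \<in> K" by (simp add: K_def)
        then show ?thesis using K by simp
      qed
      then have "b * (q h - l * (norm h)\<^sup>2) \<ge> 0" for h
        using P(3)[of h] by (simp add: Rh cinner_scaleR_left cinner_diff_left q_def cinner_self)
      then have "q h \<ge> l * (norm h)\<^sup>2" for h using b(1) by (simp add: zero_le_mult_iff)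
      then show ?thesis by blast
    next
      assume K: "K = UNIV"
      then have Ph: "P h = - R h" for h unfolding K_def using eq_neg_iff_add_eq_0 by blast
      then have "b * (q h - l * (norm h)\<^sup>2) \<le> 0" for h
        using P(3)[of h] by (simp add: Rh Ph cinner_minus_left cinner_scaleR_left cinner_diff_left q_def cinner_self)
      then have "q h \<le> l * (norm h)\<^sup>2" for h using b(1) by (simp add: mult_le_0_iff)
      then show ?thesis by blast
    qed
  qed
  obtain h0 :: 'h where h0: "h0 \<noteq> 0" using pi(2) unfolding irreducible_representation_def by blast
  \<comment> \<open>The Rayleigh quotient at one vector decides the alternative \<open>key\<close>
    for every \<open>l\<close> other than \<open>c\<close>: below \<open>c\<close> the upper bound
    fails at \<open>h0\<close>, above \<open>c\<close> the lower bound does.\<close>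
  define c where "c = q h0 / (norm h0)\<^sup>2"
  have qc: "q h0 = c * (norm h0)\<^sup>2" using h0 by (simp add: c_def)
  have "q h = c * (norm h)\<^sup>2" for h
  proof (cases "h = 0")
    case False
    have lower: "q h \<ge> l * (norm h)\<^sup>2" if "l < c" for l
    proof -
      have "\<not> q h0 \<le> l * (norm h0)\<^sup>2" using that h0 by (simp add: qc)
      then show ?thesis using key[of l] by blast
    qed
    have upper: "q h \<le> l * (norm h)\<^sup>2" if "c < l" for l
    proof -
      have "\<not> q h0 \<ge> l * (norm h0)\<^sup>2" using that h0 by (simp add: qc)
      then show ?thesis using key[of l] by blast
    qed
    have n: "(norm h)\<^sup>2 > 0" using False by simp
    have "q h / (norm h)\<^sup>2 \<ge> c"
      by (rule dense_le) (use lower n in \<open>auto simp: field_simps\<close>)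
    moreover have "q h / (norm h)\<^sup>2 \<le> c"
      by (rule dense_ge) (use upper n in \<open>auto simp: field_simps\<close>)
    ultimately show ?thesis using n by (simp add: field_simps)
  qed (simp add: q_def)
  moreover have "cinner (T h) h = complex_of_real (q h)" for h
    using cinner_commute[of h "T h"] sa[of h h] by (simp add: q_def complex_eq_iff)
  ultimately have d: "B h h = complex_of_real c * cinner h h" for h
    by (simp add: T cinner_self)
  have "bounded_form (\<lambda>x y. 1 * B x y + (-1) * (complex_of_real c * cinner x y))"
    by (rule bounded_form_comb[OF B bounded_form_scaled_cinner])
  from bounded_form_diag_zero[OF this] have "B x y = complex_of_real c * cinner x y" for x y
    by (simp add: d)
  then show ?thesis by blast
qed

text \<open>The two hermitian forms built from \<open>B\<close> and its adjoint are scalar by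
  \<open>schur_hermitian\<close>, and \<open>B\<close> is recovered from them like a complex number
  from its real and imaginary parts.\<close>

lemma schur_form:
  fixes B :: "'h::complex_hilbert_space \<Rightarrow> 'h \<Rightarrow> complex" and \<pi> :: "'g::{topological_group_add,t2_space} \<Rightarrow> 'h \<Rightarrow> 'h"
  assumes pi: "unitary_representation \<pi>" "irreducible_representation \<pi>"
    and B: "bounded_form B" and inv: "\<And>z x y. B (\<pi> z x) (\<pi> z y) = B x y"
  shows "\<exists>c. \<forall>x y. B x y = c * cinner x y"
proof -
  have 1: "\<exists>c::real. \<forall>x y. 1 * B x y + 1 * cnj (B y x) = complex_of_real c * cinner x y"
    by (rule schur_hermitian[OF pi bounded_form_comb[OF B bounded_form_cnj[OF B]]])
      (auto simp: inv)
  have 2: "\<exists>c::real. \<forall>x y. \<i> * B x y + (- \<i>) * cnj (B y x) = complex_of_real c * cinner x y"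
    by (rule schur_hermitian[OF pi bounded_form_comb[OF B bounded_form_cnj[OF B]]])
      (auto simp: inv)
  obtain a b :: real where ab: "\<And>x y. B x y + cnj (B y x) = complex_of_real a * cinner x y"
     "\<And>x y. \<i> * B x y + (- \<i>) * cnj (B y x) = complex_of_real b * cinner x y"
    using 1 2 by auto
  have "B x y = ((complex_of_real a - \<i> * complex_of_real b) / 2) * cinner x y" for x y
  proof -
    have "B x y - cnj (B y x) = - \<i> * (complex_of_real b * cinner x y)"
      unfolding ab(2)[symmetric] by (simp add: algebra_simps)
    moreover have "2 * B x y = (B x y + cnj (B y x)) + (B x y - cnj (B y x))" by simp
    ultimately have "2 * B x y = complex_of_real a * cinner x y - \<i> * (complex_of_real b * cinner x y)"
      unfolding ab(1) by simp
    then show ?thesis by (simp add: field_simps)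
  qed
  then show ?thesis by blast
qed

section \<open>Lower semicontinuous functions\<close>

text \<open>Open superlevel sets give access to inner regularity and to positivity of the measure.
  The class is also closed under sums, products, suprema and integration over one variable, so it
  contains every integrand built below.\<close>

definition lsc :: "('a::topological_space \<Rightarrow> ennreal) \<Rightarrow> bool" where
  "lsc F \<longleftrightarrow> (\<forall>a. open {x. a < F x})"

lemma lscD: "lsc F \<Longrightarrow> open {x. a < F x}"
  unfolding lsc_def by blast

lemma lsc_iff_eventually: "lsc F \<longleftrightarrow> (\<forall>x. \<forall>a<F x. eventually (\<lambda>y. a < F y) (nhds x))"
proof
  assume "lsc F"
  then show "\<forall>x. \<forall>a<F x. eventually (\<lambda>y. a < F y) (nhds x)"
    unfolding eventually_nhds lsc_def by (metis mem_Collect_eq)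
next
  assume R: "\<forall>x. \<forall>a<F x. eventually (\<lambda>y. a < F y) (nhds x)"
  show "lsc F" unfolding lsc_def
  proof
    fix a show "open {x. a < F x}"
      unfolding open_subopen[of "{x. a < F x}"] using R unfolding eventually_nhds subset_eq mem_Collect_eq by blast
  qed
qed

lemma lsc_measurable: "lsc F \<Longrightarrow> F \<in> borel_measurable borel"
  by (rule borel_measurableI_greater) (auto dest: lscD intro: borel_open)

lemma lsc_compose:
  assumes "lsc F" "continuous_on UNIV h" shows "lsc (\<lambda>x. F (h x))"
  unfolding lsc_def
proof
  fix a
  have "open (h -` {x. a < F x})" by (rule open_vimage[OF lscD[OF assms(1)] assms(2)])
  then show "open {x. a < F (h x)}" by (simp add: vimage_def)
qed

lemma lsc_continuous:
  assumes "continuous_on UNIV F" shows "lsc F"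
  unfolding lsc_def by (intro allI open_Collect_less continuous_intros assms)

lemma lsc_ennreal_continuous:
  assumes "continuous_on UNIV f" shows "lsc (\<lambda>x. ennreal (f x))"
  by (rule lsc_continuous) (intro continuous_on_ennreal assms)

lemma lsc_const [simp]: "lsc (\<lambda>x. c)"
  unfolding lsc_def by (auto simp: Collect_const)

lemma lsc_indicator: assumes "open U" shows "lsc (indicator U)"
  unfolding lsc_def
proof
  fix a :: ennreal
  have "{x. a < indicator U x} = (if a < 1 then (if a < 0 then UNIV else U) else {})"
    by (auto simp: indicator_def)
  then show "open {x. a < indicator U x}" using assms by simp
qed

lemma lsc_SUP:
  assumes "\<And>i. i \<in> I \<Longrightarrow> lsc (F i)" shows "lsc (\<lambda>x. SUP i\<in>I. F i x)"
  unfolding lsc_def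
proof
  fix a
  have "{x. a < (SUP i\<in>I. F i x)} = (\<Union>i\<in>I. {x. a < F i x})" by (auto simp: less_SUP_iff)
  moreover have "open (\<Union>i\<in>I. {x. a < F i x})" by (intro open_UN ballI lscD assms)
  ultimately show "open {x. a < (SUP i\<in>I. F i x)}" by simp
qed

lemma ennreal_eq_SUP_lessThan: "u = (SUP b\<in>{..<u}. b)" for u :: ennreal
proof (rule antisym)
  show "u \<le> (SUP b\<in>{..<u}. b)"
    by (rule dense_le) (auto intro: SUP_upper)
qed (auto intro: SUP_least)

text \<open>Both summands must be positive because nothing lies strictly below zero; in
  \<open>ennreal_less_mult_split\<close> positivity follows from the strict inequality
  itself.\<close>

lemma ennreal_less_add_split:
  fixes a u v :: ennreal
  assumes "a < u + v" "0 < u" "0 < v" obtains b c where "b < u" "c < v" "a < b + c"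
proof -
  have "a < (SUP b\<in>{..<u}. b + v)"
    using assms(1,2) ennreal_SUP_add_left[of "{..<u}" "\<lambda>b. b" v] by (force simp flip: ennreal_eq_SUP_lessThan)
  then obtain b where b: "b < u" "a < b + v" by (auto simp: less_SUP_iff)
  have "a < (SUP c\<in>{..<v}. b + c)"
    using b(2) assms(3) ennreal_SUP_add_right[of "{..<v}" b "\<lambda>b. b"] by (force simp flip: ennreal_eq_SUP_lessThan)
  then obtain c where "c < v" "a < b + c" by (auto simp: less_SUP_iff)
  with b that show ?thesis by blast
qed

lemma ennreal_less_mult_split:
  fixes a u v :: ennreal
  assumes "a < u * v" obtains b c where "b < u" "c < v" "a < b * c"
proof -
  have "a < (SUP b\<in>{..<u}. b * v)"
    using assms SUP_mult_right_ennreal[of "\<lambda>b. b" "{..<u}" v] by (simp flip: ennreal_eq_SUP_lessThan)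
  then obtain b where b: "b < u" "a < b * v" by (auto simp: less_SUP_iff)
  have "a < (SUP c\<in>{..<v}. b * c)"
    using b(2) SUP_mult_left_ennreal[of b "\<lambda>b. b" "{..<v}"] by (simp flip: ennreal_eq_SUP_lessThan)
  then obtain c where "c < v" "a < b * c" by (auto simp: less_SUP_iff)
  with b that show ?thesis by blast
qed

lemma lsc_add: assumes "lsc F" "lsc G" shows "lsc (\<lambda>x. F x + G x)"
  unfolding lsc_iff_eventually
proof (intro allI impI)
  fix x a assume a: "a < F x + G x"
  have F: "eventually (\<lambda>y. b < F y) (nhds x)" if "b < F x" for b
    using assms(1) that unfolding lsc_iff_eventually by blast
  have G: "eventually (\<lambda>y. b < G y) (nhds x)" if "b < G x" for b
    using assms(2) that unfolding lsc_iff_eventually by blast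
  show "eventually (\<lambda>y. a < F y + G y) (nhds x)"
  proof (cases "F x = 0 \<or> G x = 0")
    case True
    then have "a < F x \<or> a < G x" using a by auto
    then show ?thesis
      by (auto dest!: F G elim!: eventually_mono intro: less_le_trans simp: add_increasing add_increasing2)
  next
    case False
    then obtain b c where bc: "b < F x" "c < G x" "a < b + c"
      using ennreal_less_add_split[OF a] by (metis not_gr_zero)
    from F[OF bc(1)] G[OF bc(2)] show ?thesis
      by eventually_elim (use bc(3) in \<open>meson add_mono less_imp_le less_le_trans\<close>)
  qed
qed

lemma lsc_mult: assumes "lsc F" "lsc G" shows "lsc (\<lambda>x. F x * G x)"
  unfolding lsc_iff_eventually
proof (intro allI impI)
  fix x a assume a: "a < F x * G x"
  have F: "eventually (\<lambda>y. b < F y) (nhds x)" if "b < F x" for b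
    using assms(1) that unfolding lsc_iff_eventually by blast
  have G: "eventually (\<lambda>y. b < G y) (nhds x)" if "b < G x" for b
    using assms(2) that unfolding lsc_iff_eventually by blast
  obtain b c where bc: "b < F x" "c < G x" "a < b * c"
    using ennreal_less_mult_split[OF a] by metis
  from F[OF bc(1)] G[OF bc(2)] show "eventually (\<lambda>y. a < F y * G y) (nhds x)"
    by eventually_elim (use bc(3) in \<open>meson mult_mono less_imp_le less_le_trans zero_le\<close>)
qed

lemma lsc_sum: "(\<And>i. i \<in> I \<Longrightarrow> lsc (F i)) \<Longrightarrow> lsc (\<lambda>x. \<Sum>i\<in>I. F i x)"
  by (induction I rule: infinite_finite_induct) (auto intro: lsc_add)

lemma lsc_suminf: "(\<And>i. lsc (F i)) \<Longrightarrow> lsc (\<lambda>x. \<Sum>i. F i x)"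
  unfolding suminf_eq_SUP by (intro lsc_SUP lsc_sum)

section \<open>Approximation by step functions\<close>

text \<open>A dyadic layer-cake sum with mesh \<open>1 / 2 ^ n\<close> and height \<open>n\<close>.
  The strict inequality makes the layers of a lower semicontinuous function open, so the integral of
  the composition is a finite sum of measures of open sets.\<close>

definition step_fun :: "nat \<Rightarrow> ennreal \<Rightarrow> ennreal" where
  "step_fun n t = (\<Sum>k=1..n * 2 ^ n. ennreal (1 / 2 ^ n) * indicator {s. ennreal (real k / 2 ^ n) < s} t)"

text \<open>If \<open>m\<close> is the largest index that occurs, at most \<open>m\<close> layers of
  height \<open>1 / 2 ^ n\<close> are counted. The set \<open>A\<close> need not be an initial
  segment, which allows layers to be shrunk to compact sets that are not nested.\<close>

lemma step_bound:
  assumes "\<And>k. k \<in> {1..N} \<Longrightarrow> k \<in> A \<Longrightarrow> ennreal (real k / 2 ^ n) \<le> t"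
  shows "(\<Sum>k=1..N. ennreal (1 / 2 ^ n) * indicator A k) \<le> t"
proof (cases "{1..N} \<inter> A = {}")
  case True
  then have "(\<Sum>k=1..N. ennreal (1 / 2 ^ n) * indicator A k) = 0"
    by (intro sum.neutral ballI) (metis disjoint_iff indicator_simps(2) mult_zero_right)
  then show ?thesis by simp
next
  case False
  define m where "m = Max ({1..N} \<inter> A)"
  have m: "m \<in> {1..N} \<inter> A" unfolding m_def using False by (intro Max_in) auto
  have "{1..N} \<inter> A \<subseteq> {1..m}" unfolding m_def by auto
  then have c: "card ({1..N} \<inter> A) \<le> m" by (metis card_mono card_atLeastAtMost finite_atLeastAtMost diff_Suc_1)
  have "(\<Sum>k=1..N. ennreal (1 / 2 ^ n) * indicator A k) = (\<Sum>k\<in>{1..N} \<inter> A. ennreal (1 / 2 ^ n))"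
    by (intro sum.mono_neutral_cong_right) (auto simp: indicator_def)
  also have "\<dots> = ennreal (real (card ({1..N} \<inter> A)) / 2 ^ n)"
    by (simp add: ennreal_of_nat_eq_real_of_nat flip: ennreal_mult')
  also have "\<dots> \<le> ennreal (real m / 2 ^ n)" using c by (intro ennreal_leI divide_right_mono) auto
  also have "\<dots> \<le> t" using assms m by auto
  finally show ?thesis .
qed

lemma step_fun_le: "step_fun n t \<le> t"
  unfolding step_fun_def
  using step_bound[of "n * 2 ^ n" "{k. ennreal (real k / 2 ^ n) < t}" n t]
  by (simp add: indicator_def)

text \<open>Together with \<open>step_fun_le\<close> and Fatou's lemma this takes the place of
  monotone convergence.\<close>

lemma step_fun_liminf: "t \<le> liminf (\<lambda>n. step_fun n t)"
proof (rule le_Liminf_iff[THEN iffD2], intro allI impI)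
  fix y assume "y < t"
  then obtain b' where b': "y < b'" "b' < t" using dense by blast
  then obtain b where b: "b' = ennreal b" "b \<ge> 0" by (cases b') auto
  obtain a where a: "y = ennreal a" "a \<ge> 0" using b'(1) by (cases y) auto
  have ab: "a < b" using b' a b by (simp add: ennreal_less_iff)
  \<comment> \<open>\<open>n0\<close> keeps \<open>b\<close> below the truncation height, and
    \<open>n1\<close> makes the mesh finer than \<open>b - a\<close>.\<close>
  obtain n0 where n0: "real n0 > b" using reals_Archimedean2 by blast
  obtain n1 where n1: "(1/2::real) ^ n1 < b - a"
    using real_arch_pow_inv[of "b - a" "1/2"] ab by auto
  show "eventually (\<lambda>n. y < step_fun n t) sequentially"
  proof (rule eventually_sequentiallyI[of "max n0 n1"])
    fix n assume n: "n \<ge> max n0 n1"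
    define m where "m = nat \<lfloor>b * 2 ^ n\<rfloor>"
    have m1: "real m \<le> b * 2 ^ n" using b(2) by (simp add: m_def)
    have m2: "b * 2 ^ n < real m + 1" using b(2) by (simp add: m_def)
    have "real m \<le> real n * 2 ^ n" using m1 n n0
      by (smt (verit) max.bounded_iff mult_right_mono of_nat_le_iff zero_le_power)
    then have "real m \<le> real (n * 2 ^ n)" by simp
    then have mn: "m \<le> n * 2 ^ n" using of_nat_le_iff by blast
    have "(1/2::real) ^ n \<le> (1/2) ^ n1" using n by (intro power_decreasing) auto
    then have "1 / 2 ^ n < b - a" using n1 by (simp add: power_divide)
    then have "a < (b * 2 ^ n - 1) / 2 ^ n" by (simp add: field_simps)
    also have "\<dots> \<le> real m / 2 ^ n" using m2 by (intro divide_right_mono) auto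
    finally have "y < ennreal (real m / 2 ^ n)" using a by (simp add: ennreal_less_iff)
    also have "\<dots> = (\<Sum>k=1..m. ennreal (1 / 2 ^ n))"
      by (simp add: ennreal_of_nat_eq_real_of_nat flip: ennreal_mult')
    also have "\<dots> \<le> (\<Sum>k=1..m. ennreal (1 / 2 ^ n) * indicator {s. ennreal (real k / 2 ^ n) < s} t)"
    proof (rule sum_mono)
      fix k assume "k \<in> {1..m}"
      then have "real k / 2 ^ n \<le> b" using m1 by (auto simp: field_simps)
      then have "ennreal (real k / 2 ^ n) < t" using b'(2) b(1) ennreal_leI le_less_trans by blast
      then show "ennreal (1 / 2 ^ n) \<le> ennreal (1 / 2 ^ n) * indicator {s. ennreal (real k / 2 ^ n) < s} t" by simp
    qed
    also have "\<dots> \<le> step_fun n t" unfolding step_fun_def using mn by (intro sum_mono2) auto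
    finally show "y < step_fun n t" .
  qed
qed

section \<open>Haar measure\<close>

definition sumset :: "'g::plus set \<Rightarrow> 'g set \<Rightarrow> 'g set" where
  "sumset A B = (\<lambda>(a, b). a + b) ` (A \<times> B)"

lemma sumsetI [intro]: "a \<in> A \<Longrightarrow> b \<in> B \<Longrightarrow> a + b \<in> sumset A B"
  unfolding sumset_def by auto

lemma compact_sumset:
  fixes A B :: "'g::{topological_group_add} set"
  assumes "compact A" "compact B" shows "compact (sumset A B)"
  unfolding sumset_def
  by (intro compact_continuous_image compact_Times assms) (auto simp: case_prod_beta intro!: continuous_intros)

lemma plus_image_eq_vimage: "(+) a ` U = (\<lambda>x. - a + x) -` U" for a :: "'g::group_add"
proof (intro set_eqI iffI)
  fix x assume "x \<in> (\<lambda>x. - a + x) -` U"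
  then have "a + (- a + x) \<in> (+) a ` U" by blast
  then show "x \<in> (+) a ` U" by (simp add: add.assoc[symmetric])
qed (auto simp: add.assoc[symmetric])

lemma open_translation_left: "open U \<Longrightarrow> open ((+) a ` U)" for a :: "'g::topological_group_add"
  unfolding plus_image_eq_vimage by (intro open_vimage continuous_intros)

lemma compact_translation_left: "compact U \<Longrightarrow> compact ((+) a ` U)" for a :: "'g::topological_group_add"
  by (intro compact_continuous_image continuous_intros)

lemma borel_translation_left: "A \<in> sets borel \<Longrightarrow> (+) a ` A \<in> sets borel" for a :: "'g::topological_group_add"
  unfolding plus_image_eq_vimage
  by (rule measurable_sets_borel[OF borel_measurable_continuous_onI]) (intro continuous_intros)

text \<open>Not only the point but also the compact set is enlarged to an open set, so that an open
  rectangle results.\<close>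

lemma tube_neighbourhood:
  fixes W :: "('a::topological_space \<times> 'b::topological_space) set"
  assumes K: "compact K" and W: "open W" and KW: "{x0} \<times> K \<subseteq> W"
  obtains X Y where "open X" "open Y" "x0 \<in> X" "K \<subseteq> Y" "X \<times> Y \<subseteq> W"
proof -
  have "\<exists>X0 Y. open X0 \<and> open Y \<and> x0 \<in> X0 \<and> y \<in> Y \<and> X0 \<times> Y \<subseteq> W" if "y \<in> K" for y
    using assms open_prod_def subsetD that by fastforce
  then obtain X0 Y where
    *: "\<forall>y \<in> K. open (X0 y) \<and> open (Y y) \<and> x0 \<in> X0 y \<and> y \<in> Y y \<and> X0 y \<times> Y y \<subseteq> W"
    by metis
  then have "\<And>y. y \<in> K \<Longrightarrow> open (Y y)" "K \<subseteq> (\<Union>y\<in>K. Y y)" by auto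
  from compactE_image[OF K this] obtain D where D: "D \<subseteq> K" "finite D" "K \<subseteq> (\<Union>y\<in>D. Y y)" by metis
  show ?thesis
  proof (rule that[of "\<Inter>y\<in>D. X0 y" "\<Union>y\<in>D. Y y"])
    show "open (\<Inter>y\<in>D. X0 y)" using D * by (intro open_INT) auto
    show "open (\<Union>y\<in>D. Y y)" using D * by (intro open_UN) auto
    show "x0 \<in> (\<Inter>y\<in>D. X0 y)" using D * by auto
    show "(\<Inter>y\<in>D. X0 y) \<times> (\<Union>y\<in>D. Y y) \<subseteq> W" using D(1) * by fast
  qed (use D in auto)
qed

text \<open>The summands are fixed one at a time; the arbitrary constant \<open>c\<close> carries
  those already chosen through the induction.\<close>

lemma ennreal_sum_SUP_less:
  fixes g :: "'b \<Rightarrow> ennreal"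
  assumes "finite A" "a < c + (\<Sum>k\<in>A. e * (SUP K\<in>S k. g K))" "\<And>k. k \<in> A \<Longrightarrow> S k \<noteq> {}"
  shows "\<exists>h. (\<forall>k\<in>A. h k \<in> S k) \<and> a < c + (\<Sum>k\<in>A. e * g (h k))"
  using assms
proof (induction A arbitrary: c rule: finite_induct)
  case (insert k A)
  let ?R = "\<Sum>k\<in>A. e * (SUP K\<in>S k. g K)"
  have "a < (c + ?R) + e * (SUP K\<in>S k. g K)" using insert by (simp add: ac_simps)
  also have "\<dots> = (SUP K\<in>S k. (c + ?R) + e * g K)"
    using insert by (simp add: SUP_mult_left_ennreal ennreal_SUP_add_right)
  finally obtain K where K: "K \<in> S k" "a < (c + ?R) + e * g K" by (auto simp: less_SUP_iff)
  then have "a < (c + e * g K) + ?R" by (simp add: ac_simps)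
  from insert.IH[OF this] insert.prems obtain h where h: "\<forall>k\<in>A. h k \<in> S k" "a < (c + e * g K) + (\<Sum>k\<in>A. e * g (h k))"
    by auto
  have "(\<Sum>j\<in>insert k A. e * g ((h(k := K)) j)) = e * g K + (\<Sum>j\<in>A. e * g (h j))"
    using insert(1,2) by (subst sum.insert) (auto intro!: sum.cong)
  then show ?case using h K by (intro exI[of _ "h(k := K)"]) (auto simp: ac_simps)
qed auto

lemma borel_measurable_step_fun: "step_fun n \<in> borel_measurable borel"
  unfolding step_fun_def
  by (intro borel_measurable_sum borel_measurable_times_ennreal borel_measurable_const borel_measurable_indicator borel_open)
    (simp add: greaterThan_def[symmetric])

locale haar_group =
  fixes \<mu> :: "'g::{topological_group_add,t2_space} measure"
  assumes locally_compact: "locally_compact_space (euclidean :: 'g topology)"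
    and haar: "left_haar_measure \<mu>"
begin

lemma sets_haar [measurable_cong, simp]: "sets \<mu> = sets borel"
  by (rule haar[unfolded left_haar_measure_def, THEN conjunct1, rule_format])

lemma space_haar [simp]: "space \<mu> = UNIV"
  using sets_eq_imp_space_eq[OF sets_haar] by simp

lemma borel_measurable_haar [simp]: "borel_measurable \<mu> = borel_measurable borel"
  by (rule measurable_cong_sets) auto

lemma finite_compact: "compact K \<Longrightarrow> emeasure \<mu> K < top"
  by (rule haar[unfolded left_haar_measure_def, THEN conjunct2, THEN conjunct2, THEN conjunct1, rule_format])

lemma outer_regular: "A \<in> sets borel \<Longrightarrow> emeasure \<mu> A = (INF U\<in>{U. open U \<and> A \<subseteq> U}. emeasure \<mu> U)"
  by (rule haar[unfolded left_haar_measure_def, THEN conjunct2, THEN conjunct2, THEN conjunct2, THEN conjunct1, rule_format])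

lemma inner_regular_open: "open U \<Longrightarrow> emeasure \<mu> U = (SUP K\<in>{K. compact K \<and> K \<subseteq> U}. emeasure \<mu> K)"
  by (rule haar[unfolded left_haar_measure_def, THEN conjunct2, THEN conjunct2, THEN conjunct2, THEN conjunct2, THEN conjunct1, rule_format])

lemma left_invariant: "A \<in> sets borel \<Longrightarrow> emeasure \<mu> ((+) x ` A) = emeasure \<mu> A"
  by (rule haar[unfolded left_haar_measure_def, THEN conjunct2, THEN conjunct2, THEN conjunct2, THEN conjunct2, THEN conjunct2, rule_format])

lemma compact_in_sets [measurable]: "compact K \<Longrightarrow> K \<in> sets borel" for K :: "'g set"
  by (simp add: compact_imp_closed)

lemma obtain_compact_nbhd:
  obtains U K :: "'g set" where "open U" "compact K" "0 \<in> U" "U \<subseteq> K"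
proof -
  have "\<exists>U K :: 'g set. open U \<and> compact K \<and> 0 \<in> U \<and> U \<subseteq> K"
    using locally_compact unfolding locally_compact_space_def by (auto simp: compactin_euclidean_iff)
  then show ?thesis using that by blast
qed

lemma compact_subset_open_finite:
  assumes K: "compact K"
  obtains V C where "open V" "compact C" "K \<subseteq> V" "V \<subseteq> C" "emeasure \<mu> V < top"
proof -
  obtain U C where U: "open U" "compact C" "(0::'g) \<in> U" "U \<subseteq> C" using obtain_compact_nbhd by blast
  have "K \<subseteq> (\<Union>x\<in>K. (+) x ` U)" using U(3) by force
  from compactE_image[OF K open_translation_left[OF U(1)] this]
  obtain D where D: "D \<subseteq> K" "finite D" "K \<subseteq> (\<Union>x\<in>D. (+) x ` U)" by blast
  have C: "compact (\<Union>x\<in>D. (+) x ` C)"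
    by (intro compact_UN ballI D(2) compact_translation_left U(2))
  moreover have V: "open (\<Union>x\<in>D. (+) x ` U)" by (intro open_UN ballI open_translation_left U(1))
  moreover have VC: "(\<Union>x\<in>D. (+) x ` U) \<subseteq> (\<Union>x\<in>D. (+) x ` C)" using U(4) by blast
  moreover have "emeasure \<mu> (\<Union>x\<in>D. (+) x ` U) < top"
    by (rule le_less_trans[OF emeasure_mono[OF VC] finite_compact[OF C]]) (simp only: sets_haar compact_in_sets[OF C])
  ultimately show ?thesis using that D(3) by blast
qed

text \<open>Finitely many translates of a nonempty open null set would cover any compact set, so all
  compact sets would be null, and by inner regularity the whole group.\<close>

lemma positive_open:
  assumes "open U" "U \<noteq> {}" shows "0 < emeasure \<mu> U"
proof (rule ccontr)
  assume "\<not> 0 < emeasure \<mu> U"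
  then have z: "emeasure \<mu> U = 0" by simp
  obtain u where u: "u \<in> U" using assms(2) by blast
  have "emeasure \<mu> K = 0" if K: "compact K" for K
  proof -
    have "K \<subseteq> (\<Union>x\<in>K. (+) (x - u) ` U)"
    proof
      fix x assume "x \<in> K"
      moreover have "x = (x - u) + u" by simp
      ultimately show "x \<in> (\<Union>x\<in>K. (+) (x - u) ` U)" using u by blast
    qed
    from compactE_image[OF K open_translation_left[OF assms(1)] this]
    obtain D where D: "D \<subseteq> K" "finite D" "K \<subseteq> (\<Union>x\<in>D. (+) (x - u) ` U)" by blast
    have "(+) (x - u) ` U \<in> null_sets \<mu>" for x
      using z left_invariant[OF borel_open[OF assms(1)], of "x - u"] borel_translation_left[OF borel_open[OF assms(1)]]
      by (intro null_setsI) simp_all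
    then have "(\<Union>x\<in>D. (+) (x - u) ` U) \<in> null_sets \<mu>"
      by (intro null_sets_UN' countable_finite D(2))
    then have "emeasure \<mu> (\<Union>x\<in>D. (+) (x - u) ` U) = 0" by blast
    moreover have "emeasure \<mu> K \<le> emeasure \<mu> (\<Union>x\<in>D. (+) (x - u) ` U)"
      by (rule emeasure_mono[OF D(3)]) (simp only: sets_haar, intro borel_open open_UN ballI open_translation_left assms(1))
    ultimately show ?thesis by simp
  qed
  then have "(SUP K\<in>{K. compact K \<and> K \<subseteq> UNIV}. emeasure \<mu> K) \<le> 0" by (intro SUP_least) simp
  then have "emeasure \<mu> UNIV = 0" using inner_regular_open[OF open_UNIV] by simp
  then show False using haar[unfolded left_haar_measure_def, THEN conjunct2, THEN conjunct1, rule_format] by contradiction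
qed

lemma measurable_translate: "(+) a \<in> measurable \<mu> \<mu>"
  unfolding measurable_cong_sets[OF sets_haar sets_haar]
  by (intro borel_measurable_continuous_onI continuous_intros)

lemma distr_translate: "distr \<mu> \<mu> ((+) a) = \<mu>"
proof (rule measure_eqI)
  fix A assume "A \<in> sets (distr \<mu> \<mu> ((+) a))"
  then have A: "A \<in> sets borel" by simp
  have "(+) a -` A = (+) (- a) ` A" unfolding plus_image_eq_vimage by simp
  then show "emeasure (distr \<mu> \<mu> ((+) a)) A = emeasure \<mu> A"
    using A by (simp add: emeasure_distr[OF measurable_translate] left_invariant)
qed simp

lemma nn_integral_translate:
  assumes "F \<in> borel_measurable borel"
  shows "(\<integral>\<^sup>+x. F (a + x) \<partial>\<mu>) = (\<integral>\<^sup>+x. F x \<partial>\<mu>)"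
  using nn_integral_distr[OF measurable_translate, of F a] assms by (simp add: distr_translate)

lemma integral_translate:
  fixes F :: "'g \<Rightarrow> 'b::{banach, second_countable_topology}"
  assumes "F \<in> borel_measurable borel"
  shows "(\<integral>x. F (a + x) \<partial>\<mu>) = (\<integral>x. F x \<partial>\<mu>)"
  using integral_distr[OF measurable_translate, of F a] assms by (simp add: distr_translate)

lemma nn_integral_weighted_indicators:
  assumes "\<And>k. k \<in> I \<Longrightarrow> A k \<in> sets borel"
  shows "(\<integral>\<^sup>+x. (\<Sum>k\<in>I. c k * indicator (A k) x) \<partial>\<mu>) = (\<Sum>k\<in>I. c k * emeasure \<mu> (A k))"
proof -
  have "(\<lambda>x. c k * indicator (A k) x) \<in> borel_measurable \<mu>" if "k \<in> I" for k
    by (intro borel_measurable_times_ennreal borel_measurable_const borel_measurable_indicator) (simp add: assms that)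
  then have "(\<integral>\<^sup>+x. (\<Sum>k\<in>I. c k * indicator (A k) x) \<partial>\<mu>) = (\<Sum>k\<in>I. (\<integral>\<^sup>+x. c k * indicator (A k) x \<partial>\<mu>))"
    by (rule nn_integral_sum)
  also have "\<dots> = (\<Sum>k\<in>I. c k * emeasure \<mu> (A k))"
    by (intro sum.cong refl nn_integral_cmult_indicator) (simp add: assms)
  finally show ?thesis .
qed

lemma nn_integral_step_fun:
  assumes "lsc F"
  shows "(\<integral>\<^sup>+x. step_fun n (F x) \<partial>\<mu>) =
    (\<Sum>k=1..n * 2 ^ n. ennreal (1 / 2 ^ n) * emeasure \<mu> {x. ennreal (real k / 2 ^ n) < F x})"
proof -
  have [simp]: "{x. ennreal (real k / 2 ^ n) < F x} \<in> sets borel" for k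
    by (rule borel_open[OF lscD[OF assms]])
  have i: "indicator {s. a < s} (F x) = indicator {x. a < F x} x" for a x by (simp add: indicator_def)
  show ?thesis unfolding step_fun_def i
    by (rule nn_integral_weighted_indicators) auto
qed

lemma lsc_nn_integral_step:
  assumes "lsc F" "a < (\<integral>\<^sup>+x. F x \<partial>\<mu>)"
  shows "\<exists>n. a < (\<integral>\<^sup>+x. step_fun n (F x) \<partial>\<mu>)"
proof -
  have m: "(\<lambda>x. step_fun n (F x)) \<in> borel_measurable \<mu>" for n
    unfolding borel_measurable_haar
    by (rule measurable_compose[OF lsc_measurable[OF assms(1)] borel_measurable_step_fun])
  have "(\<integral>\<^sup>+x. F x \<partial>\<mu>) \<le> (\<integral>\<^sup>+x. liminf (\<lambda>n. step_fun n (F x)) \<partial>\<mu>)"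
    by (intro nn_integral_mono step_fun_liminf)
  also have "\<dots> \<le> liminf (\<lambda>n. \<integral>\<^sup>+x. step_fun n (F x) \<partial>\<mu>)" by (rule nn_integral_liminf[OF m])
  finally have "a < liminf (\<lambda>n. \<integral>\<^sup>+x. step_fun n (F x) \<partial>\<mu>)" using assms(2) by simp
  then have "eventually (\<lambda>n. a < (\<integral>\<^sup>+x. step_fun n (F x) \<partial>\<mu>)) sequentially"
    using less_LiminfD by blast
  then show ?thesis using eventually_happens'[OF sequentially_bot] by blast
qed

text \<open>Inner regularity of the open layers: a strict lower bound of the integral is witnessed
  by finitely many compact sets.\<close>

lemma lsc_nn_integral_approx:
  assumes F: "lsc F" and a: "a < (\<integral>\<^sup>+x. F x \<partial>\<mu>)"
  shows "\<exists>n N K. (\<forall>k\<in>{1..N}. compact (K k) \<and> K k \<subseteq> {x. ennreal (real k / 2 ^ n) < F x}) \<and>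
    a < (\<Sum>k=1..N. ennreal (1 / 2 ^ n) * emeasure \<mu> (K k))"
proof -
  obtain n where n: "a < (\<integral>\<^sup>+x. step_fun n (F x) \<partial>\<mu>)" using lsc_nn_integral_step[OF assms] by blast
  let ?U = "\<lambda>k::nat. {x. ennreal (real k / 2 ^ n) < F x}"
  have "a < 0 + (\<Sum>k=1..n * 2 ^ n. ennreal (1 / 2 ^ n) * (SUP K\<in>{K. compact K \<and> K \<subseteq> ?U k}. emeasure \<mu> K))"
    using n unfolding nn_integral_step_fun[OF F] inner_regular_open[OF lscD[OF F]] by simp
  from ennreal_sum_SUP_less[OF _ this] obtain K where
    "\<forall>k\<in>{1..n * 2 ^ n}. K k \<in> {K. compact K \<and> K \<subseteq> ?U k}" "a < 0 + (\<Sum>k=1..n * 2 ^ n. ennreal (1 / 2 ^ n) * emeasure \<mu> (K k))"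
    by auto
  then show ?thesis by (intro exI[of _ n] exI[of _ "n * 2 ^ n"] exI[of _ K]) auto
qed

text \<open>The union of the witnesses from \<open>lsc_nn_integral_approx\<close> already carries
  enough mass. This confines estimates to sets of finite measure.\<close>

lemma lsc_nn_integral_inner:
  assumes F: "lsc F" and a: "a < (\<integral>\<^sup>+x. F x \<partial>\<mu>)"
  obtains K where "compact K" "a < (\<integral>\<^sup>+x. F x * indicator K x \<partial>\<mu>)"
proof -
  obtain n N K where K: "\<And>k. k \<in> {1..N} \<Longrightarrow> compact (K k) \<and> K k \<subseteq> {x. ennreal (real k / 2 ^ n) < F x}"
    "a < (\<Sum>k=1..N. ennreal (1 / 2 ^ n) * emeasure \<mu> (K k))"
    using lsc_nn_integral_approx[OF assms] by metis
  define C where "C = (\<Union>k\<in>{1..N}. K k)"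
  have C: "compact C" unfolding C_def using K(1) by (intro compact_UN) auto
  have "(\<Sum>k=1..N. ennreal (1 / 2 ^ n) * emeasure \<mu> (K k))
     = (\<integral>\<^sup>+x. (\<Sum>k=1..N. ennreal (1 / 2 ^ n) * indicator (K k) x) \<partial>\<mu>)"
    using K(1) by (subst nn_integral_weighted_indicators) auto
  also have "\<dots> \<le> (\<integral>\<^sup>+x. F x * indicator C x \<partial>\<mu>)"
  proof (rule nn_integral_mono)
    fix x
    have "(\<Sum>k=1..N. ennreal (1 / 2 ^ n) * indicator (K k) x) = (\<Sum>k=1..N. ennreal (1 / 2 ^ n) * indicator {k. x \<in> K k} k)"
      by (simp add: indicator_def)
    also have "\<dots> \<le> F x * indicator C x"
    proof (rule step_bound)
      fix k assume k: "k \<in> {1..N}" "k \<in> {k. x \<in> K k}"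
      then have "x \<in> C" unfolding C_def by blast
      moreover have "ennreal (real k / 2 ^ n) < F x" using K(1)[OF k(1)] k(2) by blast
      ultimately show "ennreal (real k / 2 ^ n) \<le> F x * indicator C x" by simp
    qed
    finally show "(\<Sum>k=1..N. ennreal (1 / 2 ^ n) * indicator (K k) x) \<le> F x * indicator C x" .
  qed
  finally show ?thesis using that C K(2) by (meson less_le_trans)
qed

end

section \<open>Tonelli's theorem for lower semicontinuous functions\<close>

context haar_group
begin

text \<open>A compact part of one section, provided by inner regularity, remains inside the
  neighbouring sections by the tube lemma.\<close>

lemma open_section_lsc:
  assumes W: "open W" shows "lsc (\<lambda>x. emeasure \<mu> {y. (x, y) \<in> W})"
  unfolding lsc_iff_eventually
proof (intro allI impI)
  fix x a assume a: "a < emeasure \<mu> {y. (x, y) \<in> W}"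
  have o: "open {y. (x, y) \<in> W}" for x
    using open_vimage[OF W, of "Pair x"] by (simp add: vimage_def continuous_intros)
  obtain K where K: "compact K" "K \<subseteq> {y. (x, y) \<in> W}" "a < emeasure \<mu> K"
    using a unfolding inner_regular_open[OF o] by (auto simp: less_SUP_iff)
  have "{x} \<times> K \<subseteq> W" using K(2) by blast
  from Elementary_Topology.tube_lemma[OF K(1) W this] obtain X where X: "x \<in> X" "open X" "X \<times> K \<subseteq> W" by blast
  have "a < emeasure \<mu> {y. (x', y) \<in> W}" if "x' \<in> X" for x'
  proof -
    have "K \<subseteq> {y. (x', y) \<in> W}" using X(3) that by blast
    then show ?thesis using K(3) emeasure_mono[of K "{y. (x', y) \<in> W}" \<mu>] o[of x'] by (simp add: less_le_trans)
  qed
  then show "eventually (\<lambda>x. a < emeasure \<mu> {y. (x, y) \<in> W}) (nhds x)"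
    unfolding eventually_nhds using X by blast
qed

text \<open>Tonelli's theorem needs no \<open>\<sigma>\<close>-finiteness here: by inner regularity an open set can be exhausted from
  inside by finite unions of open rectangles of finite measure.\<close>

lemma tonelli_open_le:
  assumes W: "open W"
  shows "(\<integral>\<^sup>+x. emeasure \<mu> {y. (x, y) \<in> W} \<partial>\<mu>) \<le> (\<integral>\<^sup>+y. emeasure \<mu> {x. (x, y) \<in> W} \<partial>\<mu>)"
proof (rule dense_le)
  fix a assume a: "a < (\<integral>\<^sup>+x. emeasure \<mu> {y. (x, y) \<in> W} \<partial>\<mu>)"
  have o: "open {y. (x, y) \<in> W}" "open {y. (y, x) \<in> W}" for x
    using open_vimage[OF W, of "Pair x"] open_vimage[OF W, of "\<lambda>y. (y, x)"]
    by (simp_all add: vimage_def continuous_intros)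
  obtain n N K where K: "\<And>k. k \<in> {1..N} \<Longrightarrow> compact (K k) \<and> K k \<subseteq> {x. ennreal (real k / 2 ^ n) < emeasure \<mu> {y. (x, y) \<in> W}}"
    and aK: "a < (\<Sum>k=1..N. ennreal (1 / 2 ^ n) * emeasure \<mu> (K k))"
    using lsc_nn_integral_approx[OF open_section_lsc[OF W] a] by metis
  \<comment> \<open>Around each point of a compact layer there is an open rectangle in
    \<open>W\<close> with sides of finite measure, whose second side already exceeds the level of
    the layer.\<close>
  have "\<exists>X Y. open X \<and> open Y \<and> x \<in> X \<and> X \<times> Y \<subseteq> W \<and> emeasure \<mu> X < top \<and> emeasure \<mu> Y < top \<and> ennreal (real k / 2 ^ n) < emeasure \<mu> Y"
    if kx: "k \<in> {1..N}" "x \<in> K k" for k x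
  proof -
    have "ennreal (real k / 2 ^ n) < emeasure \<mu> {y. (x, y) \<in> W}" using K kx by blast
    then obtain C where C: "compact C" "C \<subseteq> {y. (x, y) \<in> W}" "ennreal (real k / 2 ^ n) < emeasure \<mu> C"
      unfolding inner_regular_open[OF o(1)] by (auto simp: less_SUP_iff)
    have "{x} \<times> C \<subseteq> W" using C(2) by blast
    from tube_neighbourhood[OF C(1) W this] obtain X Y where XY: "open X" "open Y" "x \<in> X" "C \<subseteq> Y" "X \<times> Y \<subseteq> W" by metis
    obtain V where V: "open V" "C \<subseteq> V" "emeasure \<mu> V < top" using compact_subset_open_finite[OF C(1)] by metis
    obtain V' where V': "open V'" "{x} \<subseteq> V'" "emeasure \<mu> V' < top" using compact_subset_open_finite[OF compact_sing[of x]] by metis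
    have "emeasure \<mu> (X \<inter> V') < top"
      by (rule le_less_trans[OF emeasure_mono V'(3)]) (use V' in auto)
    moreover have "emeasure \<mu> (Y \<inter> V) < top"
      by (rule le_less_trans[OF emeasure_mono V(3)]) (use V in auto)
    moreover have "ennreal (real k / 2 ^ n) < emeasure \<mu> (Y \<inter> V)"
      by (rule less_le_trans[OF C(3) emeasure_mono]) (use V XY in auto)
    ultimately show ?thesis using XY V V' by (intro exI[of _ "X \<inter> V'"] exI[of _ "Y \<inter> V"]) auto
  qed
  then obtain X Y where XY: "\<And>k x. k \<in> {1..N} \<Longrightarrow> x \<in> K k \<Longrightarrow> open (X k x) \<and> open (Y k x) \<and> x \<in> X k x \<and> X k x \<times> Y k x \<subseteq> W
     \<and> emeasure \<mu> (X k x) < top \<and> emeasure \<mu> (Y k x) < top \<and> ennreal (real k / 2 ^ n) < emeasure \<mu> (Y k x)" by metis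
  have "\<exists>D. D \<subseteq> K k \<and> finite D \<and> K k \<subseteq> (\<Union>x\<in>D. X k x)" if k: "k \<in> {1..N}" for k
  proof -
    have "compact (K k)" "\<And>x. x \<in> K k \<Longrightarrow> open (X k x)" "K k \<subseteq> (\<Union>x\<in>K k. X k x)"
      using K[OF k] XY[OF k] by auto
    from compactE_image[OF this] show ?thesis by metis
  qed
  then obtain D where D: "\<And>k. k \<in> {1..N} \<Longrightarrow> D k \<subseteq> K k \<and> finite (D k) \<and> K k \<subseteq> (\<Union>x\<in>D k. X k x)" by metis
  define I where "I = Sigma {1..N} D"
  have fI: "finite I" unfolding I_def using D by auto
  have I: "open (X k x)" "open (Y k x)" "X k x \<times> Y k x \<subseteq> W" "emeasure \<mu> (X k x) < top" "emeasure \<mu> (Y k x) < top"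
    "ennreal (real k / 2 ^ n) < emeasure \<mu> (Y k x)" if "(k, x) \<in> I" for k x
  proof -
    have "k \<in> {1..N}" "x \<in> K k" using that D unfolding I_def by auto
    from XY[OF this] show "open (X k x)" "open (Y k x)" "X k x \<times> Y k x \<subseteq> W" "emeasure \<mu> (X k x) < top" "emeasure \<mu> (Y k x) < top"
      "ennreal (real k / 2 ^ n) < emeasure \<mu> (Y k x)" by auto
  qed
  define R where "R = (\<Union>(k,x)\<in>I. X k x \<times> Y k x)"
  define V where "V = (\<Union>(k,x)\<in>I. X k x) \<union> (\<Union>(k,x)\<in>I. Y k x)"
  have V: "open V" unfolding V_def using I by (intro open_Un open_UN) auto
  have "V = (\<Union>i\<in>I. case i of (k,x) \<Rightarrow> X k x \<union> Y k x)" unfolding V_def by auto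
  then have "emeasure \<mu> V \<le> (\<Sum>i\<in>I. emeasure \<mu> (case i of (k,x) \<Rightarrow> X k x \<union> Y k x))"
    using I fI by (auto intro!: emeasure_subadditive_finite)
  also have "\<dots> < top"
  proof -
    have "emeasure \<mu> (case i of (k,x) \<Rightarrow> X k x \<union> Y k x) < top" if i: "i \<in> I" for i
    proof -
      obtain k x where kx: "i = (k, x)" by (cases i)
      have "emeasure \<mu> (X k x \<union> Y k x) \<le> emeasure \<mu> (X k x) + emeasure \<mu> (Y k x)"
        using I[of k x] i kx by (intro emeasure_subadditive) auto
      also have "\<dots> < top" using I[of k x] i kx by auto
      finally show ?thesis using kx by simp
    qed
    then show ?thesis using fI by (simp add: less_top)
  qed
  finally have Vfin: "emeasure \<mu> V < top" .
  \<comment> \<open>Restricted to the union \<open>V\<close> of all sides, Haar measure is finite.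
    The finite union \<open>R\<close> of rectangles belongs to the product \<sigma>-algebra, which
    an arbitrary open set need not do, so the classical theorem applies to \<open>R\<close>.\<close>
  define \<nu> where "\<nu> = density \<mu> (indicator V)"
  have sets\<nu>: "sets \<nu> = sets borel" unfolding \<nu>_def by simp
  have em\<nu>: "emeasure \<nu> A = emeasure \<mu> (A \<inter> V)" if "A \<in> sets borel" for A
  proof -
    have "emeasure \<nu> A = (\<integral>\<^sup>+x. indicator V x * indicator A x \<partial>\<mu>)"
      unfolding \<nu>_def using that V by (intro emeasure_density) simp_all
    also have "\<dots> = (\<integral>\<^sup>+x. indicator (A \<inter> V) x \<partial>\<mu>)"
      by (intro nn_integral_cong) (simp add: indicator_inter_arith mult.commute)
    also have "\<dots> = emeasure \<mu> (A \<inter> V)"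
      using that V by (intro nn_integral_indicator) simp
    finally show ?thesis .
  qed
  have "finite_measure \<nu>"
    by standard (use em\<nu>[of UNIV] Vfin sets_eq_imp_space_eq[OF sets\<nu>] in auto)
  then interpret \<nu>: finite_measure \<nu> .
  interpret P: pair_sigma_finite \<nu> \<nu> ..
  have Rm: "R \<in> sets (\<nu> \<Otimes>\<^sub>M \<nu>)"
    unfolding R_def using fI I by (intro sets.finite_UN) (auto simp: sets\<nu>)
  have Rx: "Pair x -` R = {y. (x, y) \<in> R}" "(\<lambda>x. (x, y)) -` R = {x. (x, y) \<in> R}" for x y by auto
  have oR: "open R" unfolding R_def using I by (intro open_UN) (auto intro!: open_Times)
  have oRx: "open {y. (x, y) \<in> R}" "open {y. (y, x) \<in> R}" for x
    using open_vimage[OF oR, of "Pair x"] open_vimage[OF oR, of "\<lambda>y. (y, x)"]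
    by (simp_all add: vimage_def continuous_intros)
  have RV: "{y. (x, y) \<in> R} \<inter> V = {y. (x, y) \<in> R}" "{x. (x, y) \<in> R} \<inter> V = {x. (x, y) \<in> R}" for x y
    unfolding R_def V_def by auto
  have eq: "(\<integral>\<^sup>+x. emeasure \<mu> {y. (x, y) \<in> R} \<partial>\<nu>) = (\<integral>\<^sup>+y. emeasure \<mu> {x. (x, y) \<in> R} \<partial>\<nu>)"
    using \<nu>.emeasure_pair_measure_alt[OF Rm] P.emeasure_pair_measure_alt2[OF Rm]
    unfolding Rx by (simp add: em\<nu> oRx RV)
  have RW: "R \<subseteq> W" unfolding R_def using I(3) by blast
  have swapm: "(\<lambda>y. emeasure \<mu> {x. (x, y) \<in> R}) \<in> borel_measurable borel"
  proof -
    have "open ((\<lambda>(x, y). (y, x)) -` R)" by (rule open_vimage[OF oR]) (auto simp: case_prod_beta intro!: continuous_intros)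
    from lsc_measurable[OF open_section_lsc[OF this]] show ?thesis by simp
  qed
  have m2: "(\<lambda>y. emeasure \<mu> {x. (y, x) \<in> R}) \<in> borel_measurable borel"
    using lsc_measurable[OF open_section_lsc[OF oR]] .
  have "(\<Sum>k=1..N. ennreal (1 / 2 ^ n) * emeasure \<mu> (K k))
     = (\<integral>\<^sup>+x. (\<Sum>k=1..N. ennreal (1 / 2 ^ n) * indicator (K k) x) \<partial>\<mu>)"
    using K by (subst nn_integral_weighted_indicators) auto
  also have "\<dots> \<le> (\<integral>\<^sup>+x. indicator V x * emeasure \<mu> {y. (x, y) \<in> R} \<partial>\<mu>)"
  proof (rule nn_integral_mono)
    fix x
    have "(\<Sum>k=1..N. ennreal (1 / 2 ^ n) * indicator (K k) x) = (\<Sum>k=1..N. ennreal (1 / 2 ^ n) * indicator {k. x \<in> K k} k)"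
      by (simp add: indicator_def)
    also have "\<dots> \<le> indicator V x * emeasure \<mu> {y. (x, y) \<in> R}"
    proof (rule step_bound)
      fix k assume k: "k \<in> {1..N}" "k \<in> {k. x \<in> K k}"
      then obtain x' where x': "x' \<in> D k" "x \<in> X k x'" using D[OF k(1)] by blast
      then have kI: "(k, x') \<in> I" unfolding I_def using k by auto
      then have "x \<in> V" unfolding V_def using x' by blast
      moreover have "Y k x' \<subseteq> {y. (x, y) \<in> R}" unfolding R_def using kI x' by blast
      then have "emeasure \<mu> (Y k x') \<le> emeasure \<mu> {y. (x, y) \<in> R}" using oRx by (intro emeasure_mono) auto
      ultimately show "ennreal (real k / 2 ^ n) \<le> indicator V x * emeasure \<mu> {y. (x, y) \<in> R}"
        using I(6)[OF kI] by simp
    qed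
    finally show "(\<Sum>k=1..N. ennreal (1 / 2 ^ n) * indicator (K k) x) \<le> indicator V x * emeasure \<mu> {y. (x, y) \<in> R}" .
  qed
  also have "\<dots> = (\<integral>\<^sup>+x. emeasure \<mu> {y. (x, y) \<in> R} \<partial>\<nu>)"
    unfolding \<nu>_def using V m2 by (subst nn_integral_density) auto
  also have "\<dots> = (\<integral>\<^sup>+y. indicator V y * emeasure \<mu> {x. (x, y) \<in> R} \<partial>\<mu>)"
    unfolding eq unfolding \<nu>_def using V swapm by (subst nn_integral_density) auto
  also have "\<dots> \<le> (\<integral>\<^sup>+y. emeasure \<mu> {x. (x, y) \<in> W} \<partial>\<mu>)"
  proof (rule nn_integral_mono)
    fix y
    have "emeasure \<mu> {x. (x, y) \<in> R} \<le> emeasure \<mu> {x. (x, y) \<in> W}"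
      using RW o by (intro emeasure_mono) auto
    then show "indicator V y * emeasure \<mu> {x. (x, y) \<in> R} \<le> emeasure \<mu> {x. (x, y) \<in> W}"
      by (auto simp: indicator_def)
  qed
  finally show "a \<le> (\<integral>\<^sup>+y. emeasure \<mu> {x. (x, y) \<in> W} \<partial>\<mu>)" using aK by simp
qed

lemma tonelli_open:
  assumes W: "open W"
  shows "(\<integral>\<^sup>+x. emeasure \<mu> {y. (x, y) \<in> W} \<partial>\<mu>) = (\<integral>\<^sup>+y. emeasure \<mu> {x. (x, y) \<in> W} \<partial>\<mu>)"
proof (rule antisym[OF tonelli_open_le[OF W]])
  have "open ((\<lambda>(x, y). (y, x)) -` W)" by (rule open_vimage[OF W]) (auto simp: case_prod_beta intro!: continuous_intros)
  from tonelli_open_le[OF this]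
  show "(\<integral>\<^sup>+y. emeasure \<mu> {x. (x, y) \<in> W} \<partial>\<mu>) \<le> (\<integral>\<^sup>+x. emeasure \<mu> {y. (x, y) \<in> W} \<partial>\<mu>)" by simp
qed

text \<open>On the layers of \<open>step_fun\<close> the two orders agree by
  \<open>tonelli_open\<close>. Fatou's lemma, once in each variable, bounds the left side by the
  limit, and \<open>step_fun_le\<close> bounds the limit by the right side.\<close>

lemma tonelli_lsc_le:
  assumes F: "lsc (\<lambda>(x, y). F x y)"
  shows "(\<integral>\<^sup>+x. (\<integral>\<^sup>+y. F x y \<partial>\<mu>) \<partial>\<mu>) \<le> (\<integral>\<^sup>+y. (\<integral>\<^sup>+x. F x y \<partial>\<mu>) \<partial>\<mu>)"
proof -
  have s: "lsc (F x)" "lsc (\<lambda>x. F x y)" for x y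
    using lsc_compose[OF F, of "Pair x"] lsc_compose[OF F, of "\<lambda>x. (x, y)"] by (simp_all add: continuous_intros)
  have o: "open {(x, y). a < F x y}" for a using lscD[OF F, of a] by (simp add: case_prod_unfold)
  have oswap: "open {(x, y). a < F y x}" for a
    using open_vimage[OF o[of a], of "\<lambda>(x, y). (y, x)"] by (simp add: vimage_def case_prod_unfold continuous_intros)
  have step1: "(\<integral>\<^sup>+y. step_fun n (F x y) \<partial>\<mu>) =
      (\<Sum>k=1..n * 2 ^ n. ennreal (1 / 2 ^ n) * emeasure \<mu> {y. (x, y) \<in> {(x, y). ennreal (real k / 2 ^ n) < F x y}})" for n x
    unfolding nn_integral_step_fun[OF s(1)] by simp
  have step2: "(\<integral>\<^sup>+x. step_fun n (F x y) \<partial>\<mu>) =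
      (\<Sum>k=1..n * 2 ^ n. ennreal (1 / 2 ^ n) * emeasure \<mu> {x. (x, y) \<in> {(x, y). ennreal (real k / 2 ^ n) < F x y}})" for n y
    unfolding nn_integral_step_fun[OF s(2)] by simp
  have m1: "(\<lambda>x. emeasure \<mu> {y. (x, y) \<in> {(x, y). a < F x y}}) \<in> borel_measurable \<mu>" for a
    using lsc_measurable[OF open_section_lsc[OF o]] by simp
  have m2: "(\<lambda>y. emeasure \<mu> {x. (x, y) \<in> {(x, y). a < F x y}}) \<in> borel_measurable \<mu>" for a
    using lsc_measurable[OF open_section_lsc[OF oswap]] by simp
  have eq: "(\<integral>\<^sup>+x. (\<integral>\<^sup>+y. step_fun n (F x y) \<partial>\<mu>) \<partial>\<mu>) = (\<integral>\<^sup>+y. (\<integral>\<^sup>+x. step_fun n (F x y) \<partial>\<mu>) \<partial>\<mu>)" for n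
    unfolding step1 step2
    by (subst (1 2) nn_integral_sum) (simp_all only: nn_integral_cmult[OF m1] nn_integral_cmult[OF m2] tonelli_open[OF o] borel_measurable_times_ennreal borel_measurable_const m1 m2)
  have mm: "(\<lambda>x. (\<integral>\<^sup>+y. step_fun n (F x y) \<partial>\<mu>)) \<in> borel_measurable \<mu>" for n
    unfolding step1 using m1 by simp
  have ms: "(\<lambda>y. step_fun n (F x y)) \<in> borel_measurable \<mu>" for n x
    unfolding borel_measurable_haar
    by (rule measurable_compose[OF lsc_measurable[OF s(1)] borel_measurable_step_fun])
  have "(\<integral>\<^sup>+x. (\<integral>\<^sup>+y. F x y \<partial>\<mu>) \<partial>\<mu>) \<le> (\<integral>\<^sup>+x. (\<integral>\<^sup>+y. liminf (\<lambda>n. step_fun n (F x y)) \<partial>\<mu>) \<partial>\<mu>)"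
    by (intro nn_integral_mono step_fun_liminf)
  also have "\<dots> \<le> (\<integral>\<^sup>+x. liminf (\<lambda>n. \<integral>\<^sup>+y. step_fun n (F x y) \<partial>\<mu>) \<partial>\<mu>)"
    by (intro nn_integral_mono nn_integral_liminf ms)
  also have "\<dots> \<le> liminf (\<lambda>n. \<integral>\<^sup>+x. \<integral>\<^sup>+y. step_fun n (F x y) \<partial>\<mu> \<partial>\<mu>)"
    by (intro nn_integral_liminf mm)
  also have "\<dots> \<le> liminf (\<lambda>n::nat. (\<integral>\<^sup>+y. (\<integral>\<^sup>+x. F x y \<partial>\<mu>) \<partial>\<mu>))"
    unfolding eq by (intro Liminf_mono always_eventually allI nn_integral_mono step_fun_le)
  also have "\<dots> = (\<integral>\<^sup>+y. (\<integral>\<^sup>+x. F x y \<partial>\<mu>) \<partial>\<mu>)" by (simp add: Liminf_const)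
  finally show ?thesis .
qed

lemma tonelli_lsc:
  assumes F: "lsc (\<lambda>(x, y). F x y)"
  shows "(\<integral>\<^sup>+x. (\<integral>\<^sup>+y. F x y \<partial>\<mu>) \<partial>\<mu>) = (\<integral>\<^sup>+y. (\<integral>\<^sup>+x. F x y \<partial>\<mu>) \<partial>\<mu>)"
proof (rule antisym[OF tonelli_lsc_le[OF F]])
  have "lsc (\<lambda>p. (\<lambda>(x, y). F x y) (snd p, fst p))" by (rule lsc_compose[OF F]) (intro continuous_intros)
  then have "lsc (\<lambda>(x, y). F y x)" by (simp add: case_prod_unfold)
  from tonelli_lsc_le[OF this]
  show "(\<integral>\<^sup>+y. (\<integral>\<^sup>+x. F x y \<partial>\<mu>) \<partial>\<mu>) \<le> (\<integral>\<^sup>+x. (\<integral>\<^sup>+y. F x y \<partial>\<mu>) \<partial>\<mu>)" .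
qed

end

section \<open>Right translations and lattices\<close>

context haar_group
begin

lemma step_sum_le_nn_integral:
  assumes "\<And>k. k \<in> {1..N} \<Longrightarrow> K k \<in> sets borel \<and> K k \<subseteq> {x. ennreal (real k / 2 ^ n) < F x}"
  shows "(\<Sum>k=1..N. ennreal (1 / 2 ^ n) * emeasure \<mu> (K k)) \<le> (\<integral>\<^sup>+x. F x \<partial>\<mu>)"
proof -
  have "(\<Sum>k=1..N. ennreal (1 / 2 ^ n) * emeasure \<mu> (K k))
     = (\<integral>\<^sup>+x. (\<Sum>k=1..N. ennreal (1 / 2 ^ n) * indicator (K k) x) \<partial>\<mu>)"
    using assms by (subst nn_integral_weighted_indicators) auto
  also have "\<dots> \<le> (\<integral>\<^sup>+x. F x \<partial>\<mu>)"
  proof (rule nn_integral_mono)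
    fix x
    have "(\<Sum>k=1..N. ennreal (1 / 2 ^ n) * indicator (K k) x) = (\<Sum>k=1..N. ennreal (1 / 2 ^ n) * indicator {k. x \<in> K k} k)"
      by (simp add: indicator_def)
    also have "\<dots> \<le> F x"
    proof (rule step_bound)
      fix k assume k: "k \<in> {1..N}" "k \<in> {k. x \<in> K k}"
      then show "ennreal (real k / 2 ^ n) \<le> F x" using assms[OF k(1)] by (auto intro: less_imp_le)
    qed
    finally show "(\<Sum>k=1..N. ennreal (1 / 2 ^ n) * indicator (K k) x) \<le> F x" .
  qed
  finally show ?thesis .
qed

text \<open>The compact witnesses of a strict lower bound at \<open>x\<close> are carried to
  neighbouring points by the tube lemma. This supplies the measurability of inner integrals.\<close>

lemma lsc_section_integral:
  assumes F: "lsc (\<lambda>(x, y). F x y)" shows "lsc (\<lambda>x. \<integral>\<^sup>+y. F x y \<partial>\<mu>)"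
  unfolding lsc_iff_eventually
proof (intro allI impI)
  fix x a assume a: "a < (\<integral>\<^sup>+y. F x y \<partial>\<mu>)"
  have Fx: "lsc (F x)" for x
    using lsc_compose[OF F, of "Pair x"] by (simp add: continuous_intros)
  obtain n N K where K: "\<And>k. k \<in> {1..N} \<Longrightarrow> compact (K k) \<and> K k \<subseteq> {y. ennreal (real k / 2 ^ n) < F x y}"
    "a < (\<Sum>k=1..N. ennreal (1 / 2 ^ n) * emeasure \<mu> (K k))"
    using lsc_nn_integral_approx[OF Fx a] by metis
  have "\<exists>X. x \<in> X \<and> open X \<and> X \<times> K k \<subseteq> {(x, y). ennreal (real k / 2 ^ n) < F x y}" if k: "k \<in> {1..N}" for k
  proof (rule Elementary_Topology.tube_lemma)
    show "compact (K k)" using K(1)[OF k] by blast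
    show "open {(x, y). ennreal (real k / 2 ^ n) < F x y}" using lscD[OF F] by (simp add: case_prod_unfold)
    show "{x} \<times> K k \<subseteq> {(x, y). ennreal (real k / 2 ^ n) < F x y}" using K(1)[OF k] by blast
  qed
  then obtain X where X: "\<And>k. k \<in> {1..N} \<Longrightarrow> x \<in> X k \<and> open (X k) \<and> X k \<times> K k \<subseteq> {(x, y). ennreal (real k / 2 ^ n) < F x y}"
    by metis
  have "a < (\<integral>\<^sup>+y. F x' y \<partial>\<mu>)" if x': "x' \<in> (\<Inter>k\<in>{1..N}. X k)" for x'
  proof -
    have "(\<Sum>k=1..N. ennreal (1 / 2 ^ n) * emeasure \<mu> (K k)) \<le> (\<integral>\<^sup>+y. F x' y \<partial>\<mu>)"
    proof (rule step_sum_le_nn_integral)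
      fix k assume k: "k \<in> {1..N}"
      have "X k \<times> K k \<subseteq> {(x, y). ennreal (real k / 2 ^ n) < F x y}" "x' \<in> X k" using X[OF k] x' k by auto
      then have "K k \<subseteq> {y. ennreal (real k / 2 ^ n) < F x' y}" by blast
      then show "K k \<in> sets borel \<and> K k \<subseteq> {y. ennreal (real k / 2 ^ n) < F x' y}" using K(1)[OF k] by simp
    qed
    then show ?thesis using K(2) by simp
  qed
  moreover have "open (\<Inter>k\<in>{1..N}. X k)" using X by (intro open_INT) auto
  moreover have "x \<in> (\<Inter>k\<in>{1..N}. X k)" using X by auto
  ultimately show "eventually (\<lambda>x. a < (\<integral>\<^sup>+y. F x y \<partial>\<mu>)) (nhds x)"
    unfolding eventually_nhds by blast
qed

text \<open>Left translation of the inner variable between two exchanges of integration evaluates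
  the average over \<open>V\<close> of the right translates of \<open>U\<close>. Right translations
  are thereby controlled without uniqueness of Haar measure.\<close>

lemma right_section_integral:
  assumes U: "open U" and O: "open V"
  shows "(\<integral>\<^sup>+x. indicator V x * emeasure \<mu> ((\<lambda>y. y + x) -` U) \<partial>\<mu>) = emeasure \<mu> U * emeasure \<mu> (uminus -` V)"
proof -
  have iU: "lsc (indicator U :: 'g \<Rightarrow> ennreal)" and iV: "lsc (indicator V :: 'g \<Rightarrow> ennreal)"
    by (intro lsc_indicator U O)+
  have c: "continuous_on UNIV (\<lambda>p::'g\<times>'g. snd p + fst p)" "continuous_on UNIV (\<lambda>p::'g\<times>'g. fst p)"
     "continuous_on UNIV (\<lambda>p::'g\<times>'g. snd p)" "continuous_on UNIV (\<lambda>p::'g\<times>'g. - snd p + fst p)"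
    by (intro continuous_intros)+
  have V': "open (uminus -` V)" by (intro open_vimage O continuous_intros)
  have Ux: "open ((\<lambda>y. y + x) -` U)" for x by (intro open_vimage U continuous_intros)
  have "(\<integral>\<^sup>+x. indicator V x * emeasure \<mu> ((\<lambda>y. y + x) -` U) \<partial>\<mu>)
      = (\<integral>\<^sup>+x. (\<integral>\<^sup>+y. indicator V x * indicator U (y + x) \<partial>\<mu>) \<partial>\<mu>)"
  proof (rule nn_integral_cong)
    fix x
    have "(\<integral>\<^sup>+y. indicator V x * indicator U (y + x) \<partial>\<mu>) = (\<integral>\<^sup>+y. indicator V x * indicator ((\<lambda>y. y + x) -` U) y \<partial>\<mu>)"
      by (intro nn_integral_cong) (simp add: indicator_def)
    also have "\<dots> = indicator V x * emeasure \<mu> ((\<lambda>y. y + x) -` U)"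
      using Ux by (intro nn_integral_cmult_indicator) simp
    finally show "indicator V x * emeasure \<mu> ((\<lambda>y. y + x) -` U) = (\<integral>\<^sup>+y. indicator V x * indicator U (y + x) \<partial>\<mu>)" ..
  qed
  also have "\<dots> = (\<integral>\<^sup>+y. (\<integral>\<^sup>+x. indicator V x * indicator U (y + x) \<partial>\<mu>) \<partial>\<mu>)"
    by (rule tonelli_lsc) (use lsc_mult[OF lsc_compose[OF iV c(2)] lsc_compose[OF iU c(1)]] in \<open>simp add: case_prod_unfold\<close>)
  also have "\<dots> = (\<integral>\<^sup>+y. (\<integral>\<^sup>+x. indicator V (- y + x) * indicator U x \<partial>\<mu>) \<partial>\<mu>)"
  proof (rule nn_integral_cong)
    fix y
    have m: "(\<lambda>x. indicator V (- y + x) * indicator U x :: ennreal) \<in> borel_measurable borel"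
      by (intro lsc_measurable lsc_mult lsc_compose[OF iV] lsc_indicator U continuous_intros)
    show "(\<integral>\<^sup>+x. indicator V x * indicator U (y + x) \<partial>\<mu>) = (\<integral>\<^sup>+x. indicator V (- y + x) * indicator U x \<partial>\<mu>)"
      using nn_integral_translate[OF m, of y] by (simp add: add.assoc[symmetric])
  qed
  also have "\<dots> = (\<integral>\<^sup>+x. (\<integral>\<^sup>+y. indicator V (- y + x) * indicator U x \<partial>\<mu>) \<partial>\<mu>)"
    by (rule tonelli_lsc[symmetric]) (use lsc_mult[OF lsc_compose[OF iV c(4)] lsc_compose[OF iU c(2)]] in \<open>simp add: case_prod_unfold\<close>)
  also have "\<dots> = (\<integral>\<^sup>+x. emeasure \<mu> (uminus -` V) * indicator U x \<partial>\<mu>)"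
  proof (rule nn_integral_cong)
    fix x
    have m: "(\<lambda>y. indicator V (- y + x) :: ennreal) \<in> borel_measurable borel"
      by (intro lsc_measurable lsc_compose[OF iV] continuous_intros)
    have "(\<integral>\<^sup>+y. indicator V (- y + x) \<partial>\<mu>) = (\<integral>\<^sup>+y. indicator V (- y) \<partial>\<mu>)"
      using nn_integral_translate[OF m, of x] by (simp add: minus_add add.assoc)
    also have "\<dots> = (\<integral>\<^sup>+y. indicator (uminus -` V) y \<partial>\<mu>)"
      by (intro nn_integral_cong) (simp add: indicator_def)
    also have "\<dots> = emeasure \<mu> (uminus -` V)" using V' by (intro nn_integral_indicator) simp
    finally have e: "(\<integral>\<^sup>+y. indicator V (- y + x) \<partial>\<mu>) = emeasure \<mu> (uminus -` V)" .
    show "(\<integral>\<^sup>+y. indicator V (- y + x) * indicator U x \<partial>\<mu>) = emeasure \<mu> (uminus -` V) * indicator U x"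
      unfolding e[symmetric] by (rule nn_integral_multc) (simp add: m)
  qed
  also have "\<dots> = emeasure \<mu> U * emeasure \<mu> (uminus -` V)"
    using nn_integral_cmult_indicator[of U \<mu> "emeasure \<mu> (uminus -` V)"] U by (simp add: mult.commute)
  finally show ?thesis .
qed

text \<open>For a small neighbourhood \<open>V\<close> of \<open>a\<close>,
  \<open>right_section_integral\<close> is applied to \<open>U\<close> and to an open set near the
  fixed compact set \<open>K'\<close> in \<open>U0\<close>. Multiplying the two inequalities
  eliminates the unknown measures of \<open>V\<close> and of its inverse.\<close>

lemma right_translate_bound_open:
  obtains C where "C > 0" "\<And>U. open U \<Longrightarrow> emeasure \<mu> ((\<lambda>x. x + a) -` U) \<le> ennreal C * emeasure \<mu> U"
proof -
  obtain U0 K0 where U0: "open U0" "compact K0" "(0::'g) \<in> U0" "U0 \<subseteq> K0" using obtain_compact_nbhd by blast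
  define H where "H = emeasure \<mu> ((\<lambda>x. x + a) -` U0)"
  have "H \<le> emeasure \<mu> ((\<lambda>x. x - a) ` K0)"
    unfolding H_def
  proof (rule emeasure_mono)
    show "(\<lambda>x. x + a) -` U0 \<subseteq> (\<lambda>x. x - a) ` K0"
    proof
      fix x assume "x \<in> (\<lambda>x. x + a) -` U0"
      then have "x + a \<in> K0" using U0 by auto
      then have "(x + a) - a \<in> (\<lambda>x. x - a) ` K0" by blast
      then show "x \<in> (\<lambda>x. x - a) ` K0" by simp
    qed
    have "compact ((\<lambda>x. x - a) ` K0)" by (intro compact_continuous_image U0 continuous_intros)
    then show "(\<lambda>x. x - a) ` K0 \<in> sets \<mu>" by simp
  qed
  also have "\<dots> < top" by (intro finite_compact compact_continuous_image U0 continuous_intros)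
  finally have H: "H < top" .
  have "0 < emeasure \<mu> U0" using positive_open[OF U0(1)] U0(3) by blast
  then obtain K' where K': "compact K'" "K' \<subseteq> U0" "0 < emeasure \<mu> K'"
    unfolding inner_regular_open[OF U0(1)] by (auto simp: less_SUP_iff)
  have K'f: "emeasure \<mu> K' < top" by (rule finite_compact[OF K'(1)])
  have main: "emeasure \<mu> ((\<lambda>x. x + a) -` U) * emeasure \<mu> K' \<le> H * emeasure \<mu> U" if U: "open U" for U
  proof -
    have oU: "open ((\<lambda>x. x + a) -` U)" by (intro open_vimage U continuous_intros)
    have "emeasure \<mu> ((\<lambda>x. x + a) -` U) * emeasure \<mu> K'
       = (SUP K\<in>{K. compact K \<and> K \<subseteq> (\<lambda>x. x + a) -` U}. emeasure \<mu> K * emeasure \<mu> K')"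
      unfolding inner_regular_open[OF oU] by (rule SUP_mult_right_ennreal)
    also have "\<dots> \<le> H * emeasure \<mu> U"
    proof (rule SUP_least)
      fix K assume "K \<in> {K. compact K \<and> K \<subseteq> (\<lambda>x. x + a) -` U}"
      then have K: "compact K" "K \<subseteq> (\<lambda>x. x + a) -` U" by auto
      have "open ((\<lambda>p. snd p + a + fst p) -` U)" by (intro open_vimage U continuous_intros)
      moreover have "{0} \<times> K \<subseteq> (\<lambda>p. snd p + a + fst p) -` U" using K(2) by auto
      ultimately obtain W1 where W1: "0 \<in> W1" "open W1" "W1 \<times> K \<subseteq> (\<lambda>p. snd p + a + fst p) -` U"
        using Elementary_Topology.tube_lemma[OF K(1), of "(\<lambda>p. snd p + a + fst p) -` U" 0] by blast
      have "open ((\<lambda>p. snd p - fst p) -` U0)" by (intro open_vimage U0 continuous_intros)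
      moreover have "{0} \<times> K' \<subseteq> (\<lambda>p. snd p - fst p) -` U0" using K'(2) by auto
      ultimately obtain W2 U' where W2: "open W2" "open U'" "0 \<in> W2" "K' \<subseteq> U'" "W2 \<times> U' \<subseteq> (\<lambda>p. snd p - fst p) -` U0"
        using tube_neighbourhood[OF K'(1), of "(\<lambda>p. snd p - fst p) -` U0" 0] by blast
      \<comment> \<open>\<open>W1\<close> keeps \<open>K + a + W\<close> inside \<open>U\<close>,
        \<open>W2\<close> keeps \<open>U' - W\<close> inside \<open>U0\<close>, and the symmetric
        part of \<open>U0\<close> gives \<open>V\<close> and its inverse finite measure.\<close>
      define W where "W = W1 \<inter> W2 \<inter> (U0 \<inter> uminus -` U0)"
      have oW: "open W" unfolding W_def using W1 W2 U0 by (intro open_Int open_vimage continuous_intros) auto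
      define V where "V = (+) a ` W"
      have oV: "open V" unfolding V_def by (rule open_translation_left[OF oW])
      have eV: "emeasure \<mu> V = emeasure \<mu> W" unfolding V_def using oW by (intro left_invariant) simp
      have aV: "a \<in> V" unfolding V_def W_def using W1 W2 U0 by (intro image_eqI[of _ _ 0]) auto
      have V0: "0 < emeasure \<mu> V" using positive_open[OF oV] aV by blast
      have omV: "open (uminus -` V)" by (intro open_vimage oV continuous_intros)
      have "- a \<in> uminus -` V" using aV by simp
      then have mV0: "0 < emeasure \<mu> (uminus -` V)" using positive_open[OF omV] by blast
      have Vf: "emeasure \<mu> V < top" unfolding eV
        by (rule le_less_trans[OF emeasure_mono finite_compact[OF U0(2)]]) (use U0 in \<open>auto simp: W_def\<close>)
      have cmV: "compact ((\<lambda>x. x - a) ` K0)" by (intro compact_continuous_image U0 continuous_intros)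
      have "uminus -` V \<subseteq> (\<lambda>x. x - a) ` K0"
      proof
        fix x assume "x \<in> uminus -` V"
        then obtain w where w: "w \<in> W" "- x = a + w" unfolding V_def by auto
        then have "x = - (a + w)" by (metis minus_minus)
        then have "x = - w - a" by (simp add: minus_add)
        moreover have "- w \<in> K0" using w(1) U0(4) unfolding W_def by auto
        ultimately show "x \<in> (\<lambda>x. x - a) ` K0" by blast
      qed
      then have mVf: "emeasure \<mu> (uminus -` V) < top"
        using cmV by (intro le_less_trans[OF emeasure_mono finite_compact[OF cmV]]) auto
      \<comment> \<open>Every preimage of \<open>U\<close> under a right translation by a point of
        \<open>V\<close> still contains \<open>K\<close>.\<close>
      have 1: "emeasure \<mu> K * emeasure \<mu> V \<le> emeasure \<mu> U * emeasure \<mu> (uminus -` V)"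
      proof -
        have "emeasure \<mu> K * emeasure \<mu> V = (\<integral>\<^sup>+x. emeasure \<mu> K * indicator V x \<partial>\<mu>)"
          using oV by (simp add: nn_integral_cmult_indicator)
        also have "\<dots> \<le> (\<integral>\<^sup>+x. indicator V x * emeasure \<mu> ((\<lambda>y. y + x) -` U) \<partial>\<mu>)"
        proof (rule nn_integral_mono)
          fix x
          have "emeasure \<mu> K \<le> emeasure \<mu> ((\<lambda>y. y + x) -` U)" if x: "x \<in> V"
          proof (rule emeasure_mono)
            obtain w where w: "w \<in> W" "x = a + w" using x unfolding V_def by auto
            show "K \<subseteq> (\<lambda>y. y + x) -` U"
            proof
              fix y assume "y \<in> K"
              then have "(w, y) \<in> W1 \<times> K" using w(1) unfolding W_def by auto
              then have "y + a + w \<in> U" using W1(3) by auto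
              then show "y \<in> (\<lambda>y. y + x) -` U" using w(2) by (simp add: add.assoc)
            qed
            have "open ((\<lambda>y. y + x) -` U)" by (intro open_vimage U continuous_intros)
            then show "(\<lambda>y. y + x) -` U \<in> sets \<mu>" by simp
          qed
          then show "emeasure \<mu> K * indicator V x \<le> indicator V x * emeasure \<mu> ((\<lambda>y. y + x) -` U)"
            by (auto simp: indicator_def)
        qed
        also have "\<dots> = emeasure \<mu> U * emeasure \<mu> (uminus -` V)" by (rule right_section_integral[OF U oV])
        finally show ?thesis .
      qed
      \<comment> \<open>The reverse estimate: the preimages of \<open>U'\<close> under the same
        translations stay inside that of \<open>U0\<close> under translation by
        \<open>a\<close>.\<close>
      have 2: "emeasure \<mu> K' * emeasure \<mu> (uminus -` V) \<le> H * emeasure \<mu> V"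
      proof -
        have "emeasure \<mu> K' * emeasure \<mu> (uminus -` V) \<le> emeasure \<mu> U' * emeasure \<mu> (uminus -` V)"
          using W2 by (intro mult_right_mono emeasure_mono) auto
        also have "\<dots> = (\<integral>\<^sup>+x. indicator V x * emeasure \<mu> ((\<lambda>y. y + x) -` U') \<partial>\<mu>)"
          by (rule right_section_integral[OF W2(2) oV, symmetric])
        also have "\<dots> \<le> (\<integral>\<^sup>+x. H * indicator V x \<partial>\<mu>)"
        proof (rule nn_integral_mono)
          fix x
          have "emeasure \<mu> ((\<lambda>y. y + x) -` U') \<le> H" if x: "x \<in> V"
            unfolding H_def
          proof (rule emeasure_mono)
            obtain w where w: "w \<in> W" "x = a + w" using x unfolding V_def by auto
            show "(\<lambda>y. y + x) -` U' \<subseteq> (\<lambda>x. x + a) -` U0"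
            proof
              fix y assume "y \<in> (\<lambda>y. y + x) -` U'"
              then have "(w, y + a + w) \<in> W2 \<times> U'" using w unfolding W_def by (auto simp: add.assoc)
              then have "(w, y + a + w) \<in> (\<lambda>p. snd p - fst p) -` U0" using W2(5) by blast
              then show "y \<in> (\<lambda>x. x + a) -` U0" by simp
            qed
            have "open ((\<lambda>x. x + a) -` U0)" by (intro open_vimage U0 continuous_intros)
            then show "(\<lambda>x. x + a) -` U0 \<in> sets \<mu>" by simp
          qed
          then show "indicator V x * emeasure \<mu> ((\<lambda>y. y + x) -` U') \<le> H * indicator V x"
            by (auto simp: indicator_def)
        qed
        also have "\<dots> = H * emeasure \<mu> V" using oV by (simp add: nn_integral_cmult_indicator)
        finally show ?thesis .
      qed
      let ?m = "emeasure \<mu> (uminus -` V)"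
      have "(emeasure \<mu> K * emeasure \<mu> K') * ?m = emeasure \<mu> K * (emeasure \<mu> K' * ?m)" by (simp add: mult.assoc)
      also have "\<dots> \<le> emeasure \<mu> K * (H * emeasure \<mu> V)" by (intro mult_left_mono 2) simp
      also have "\<dots> = H * (emeasure \<mu> K * emeasure \<mu> V)" by (simp add: mult_ac)
      also have "\<dots> \<le> H * (emeasure \<mu> U * ?m)" by (intro mult_left_mono 1) simp
      also have "\<dots> = (H * emeasure \<mu> U) * ?m" by (simp add: mult.assoc)
      finally show "emeasure \<mu> K * emeasure \<mu> K' \<le> H * emeasure \<mu> U"
        using mV0 mVf by (simp add: ennreal_mult_le_mult_iff mult.commute[of _ ?m])
    qed
    finally show ?thesis .
  qed
  obtain h where h: "H = ennreal h" "h \<ge> 0" using H by (cases H) auto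
  obtain k where k: "emeasure \<mu> K' = ennreal k" "k > 0" using K'f K'(3) by (cases "emeasure \<mu> K'") auto
  show ?thesis
  proof (rule that[of "(h + 1) / k"])
    show "(h + 1) / k > 0" using h k by simp
    fix U :: "'g set" assume U: "open U"
    have "emeasure \<mu> ((\<lambda>x. x + a) -` U) = emeasure \<mu> ((\<lambda>x. x + a) -` U) * emeasure \<mu> K' * ennreal (1 / k)"
      using k by (simp add: mult.assoc flip: ennreal_mult)
    also have "\<dots> \<le> H * emeasure \<mu> U * ennreal (1 / k)" by (intro mult_right_mono main U) simp
    also have "\<dots> = ennreal (h / k) * emeasure \<mu> U" 
    proof -
      have "ennreal h * ennreal (1 / k) = ennreal (h / k)" using h k by (simp flip: ennreal_mult)
      then show ?thesis using h by (metis mult.assoc mult.commute)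
    qed
    also have "\<dots> \<le> ennreal ((h + 1) / k) * emeasure \<mu> U"
      using k by (intro mult_right_mono ennreal_leI divide_right_mono) auto
    finally show "emeasure \<mu> ((\<lambda>x. x + a) -` U) \<le> ennreal ((h + 1) / k) * emeasure \<mu> U" .
  qed
qed

lemma right_translate_bound:
  obtains C where "C > 0"
    "\<And>U. open U \<Longrightarrow> emeasure \<mu> ((\<lambda>x. x + a) -` U) \<le> ennreal C * emeasure \<mu> U"
    "\<And>F. lsc F \<Longrightarrow> (\<integral>\<^sup>+x. F (x + a) \<partial>\<mu>) \<le> ennreal C * (\<integral>\<^sup>+x. F x \<partial>\<mu>)"
proof -
  obtain C where C: "C > 0" "\<And>U. open U \<Longrightarrow> emeasure \<mu> ((\<lambda>x. x + a) -` U) \<le> ennreal C * emeasure \<mu> U"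
    using right_translate_bound_open[of a] by blast
  have "(\<integral>\<^sup>+x. F (x + a) \<partial>\<mu>) \<le> ennreal C * (\<integral>\<^sup>+x. F x \<partial>\<mu>)" if F: "lsc F" for F
  proof (rule dense_le)
    fix b assume b: "b < (\<integral>\<^sup>+x. F (x + a) \<partial>\<mu>)"
    have F': "lsc (\<lambda>x. F (x + a))" by (intro lsc_compose[OF F] continuous_intros)
    obtain n where "b < (\<integral>\<^sup>+x. step_fun n (F (x + a)) \<partial>\<mu>)" using lsc_nn_integral_step[OF F' b] by blast
    also have "\<dots> = (\<Sum>k=1..n * 2 ^ n. ennreal (1 / 2 ^ n) * emeasure \<mu> ((\<lambda>x. x + a) -` {x. ennreal (real k / 2 ^ n) < F x}))"
      unfolding nn_integral_step_fun[OF F'] by (simp add: vimage_def)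
    also have "\<dots> \<le> (\<Sum>k=1..n * 2 ^ n. ennreal (1 / 2 ^ n) * (ennreal C * emeasure \<mu> {x. ennreal (real k / 2 ^ n) < F x}))"
      by (intro sum_mono mult_left_mono C(2) lscD F) simp
    also have "\<dots> = ennreal C * (\<integral>\<^sup>+x. step_fun n (F x) \<partial>\<mu>)"
      unfolding nn_integral_step_fun[OF F] sum_distrib_left by (simp add: mult_ac)
    also have "\<dots> \<le> ennreal C * (\<integral>\<^sup>+x. F x \<partial>\<mu>)"
      by (intro mult_left_mono nn_integral_mono step_fun_le) simp
    finally show "b \<le> ennreal C * (\<integral>\<^sup>+x. F x \<partial>\<mu>)" by simp
  qed
  with C that show ?thesis by blast
qed

text \<open>Zorn's lemma gives a maximal disjoint family of translates, and maximality means that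
  every further translate of \<open>U\<close> meets a member. The family may be uncountable.\<close>

lemma obtain_lattice:
  fixes U :: "'g set"
  assumes "0 \<in> U"
  obtains Y where "disjoint_family_on (\<lambda>y. (+) y ` U) Y" "\<And>x. \<exists>y\<in>Y. (+) x ` U \<inter> (+) y ` U \<noteq> {}"
proof -
  define P where "P = {Y. disjoint_family_on (\<lambda>y::'g. (+) y ` U) Y}"
  have "\<Union>C \<in> P" if C: "subset.chain P C" for C
    unfolding P_def disjoint_family_on_def
  proof (intro CollectI ballI impI)
    fix x y assume xy: "x \<in> \<Union>C" "y \<in> \<Union>C" "x \<noteq> y"
    then obtain A B where AB: "A \<in> C" "B \<in> C" "x \<in> A" "y \<in> B" by blast
    then have "A \<subseteq> B \<or> B \<subseteq> A" using C by (meson subset.chain_total subset_chain_def)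
    then obtain D where "D \<in> C" "x \<in> D" "y \<in> D" using AB by blast
    moreover have "C \<subseteq> P" using C by (simp add: subset_chain_def)
    ultimately show "(+) x ` U \<inter> (+) y ` U = {}"
      using xy(3) unfolding P_def disjoint_family_on_def by blast
  qed
  then obtain Y where Y: "Y \<in> P" "\<And>X. X \<in> P \<Longrightarrow> Y \<subseteq> X \<Longrightarrow> X = Y"
    using subset_Zorn'[of P] by blast
  have "\<exists>y\<in>Y. (+) x ` U \<inter> (+) y ` U \<noteq> {}" for x
  proof (rule ccontr)
    assume n: "\<not> ?thesis"
    then have d: "\<And>y. y \<in> Y \<Longrightarrow> (+) x ` U \<inter> (+) y ` U = {}" by blast
    have "insert x Y \<in> P"
    proof -
      have "(+) u ` U \<inter> (+) v ` U = {}" if "u \<in> insert x Y" "v \<in> insert x Y" "u \<noteq> v" for u v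
        using that Y(1) d[of u] d[of v] unfolding P_def disjoint_family_on_def mem_Collect_eq by (metis Int_commute insertE)
      then show ?thesis unfolding P_def disjoint_family_on_def by simp
    qed
    then have "x \<in> Y" using Y(2)[of "insert x Y"] by blast
    then show False using d[of x] assms by blast
  qed
  then show ?thesis using that Y(1) unfolding P_def by blast
qed

end

section \<open>Orthogonality relations\<close>

locale haar_representation = haar_group \<mu> for \<mu> :: "'g::{topological_group_add,t2_space} measure" +
  fixes \<pi> :: "'g \<Rightarrow> 'h::complex_hilbert_space \<Rightarrow> 'h"
  assumes unitary: "unitary_representation \<pi>" and irreducible: "irreducible_representation \<pi>"
begin

lemma pi_add: "\<pi> z (f + f') = \<pi> z f + \<pi> z f'"
  and pi_scaleC: "\<pi> z (c *\<^sub>C f) = c *\<^sub>C \<pi> z f"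
  and pi_cinner: "cinner (\<pi> z f) (\<pi> z f') = cinner f f'"
  and pi_comp: "\<pi> (x + y) f = \<pi> x (\<pi> y f)"
  and continuous_pi: "continuous_on UNIV (\<lambda>x. \<pi> x f)"
  using unitary unfolding unitary_representation_def by (simp_all add: fun_eq_iff)

lemma norm_pi [simp]: "norm (\<pi> z f) = norm f"
  using pi_cinner[of z f f] by (simp add: cinner_self power2_eq_iff_nonneg flip: of_real_power)

lemma bounded_linear_pi: "bounded_linear (\<pi> z)"
  by (intro bounded_linear_intro[where K=1]) (auto simp: pi_add pi_scaleC simp flip: scaleC_of_real)

lemma pi_zero [simp]: "\<pi> 0 f = f"
proof -
  have "\<pi> 0 (\<pi> 0 f - f) = 0"
    using pi_comp[of 0 0 f] by (simp add: linear_diff[OF bounded_linear.linear[OF bounded_linear_pi]])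
  then have "norm (\<pi> 0 f - f) = 0" using norm_pi[of 0 "\<pi> 0 f - f"] by simp
  then show ?thesis by simp
qed

lemma continuous_voice: "continuous_on UNIV (voice \<pi> g f)"
  unfolding voice_def by (intro continuous_on_cinner_right continuous_pi)

lemma voice_measurable [measurable]: "voice \<pi> g f \<in> borel_measurable borel"
  by (rule borel_measurable_continuous_onI[OF continuous_voice])

lemma lsc_voice: "lsc (abs_fun (voice \<pi> g f))"
  unfolding abs_fun_def by (intro lsc_ennreal_continuous continuous_on_norm continuous_voice)

lemma abs_voice_measurable: "abs_fun (voice \<pi> g f) \<in> borel_measurable borel"
  by (rule lsc_measurable[OF lsc_voice])

lemma voice_pi: "voice \<pi> g (\<pi> x f) y = voice \<pi> g f (- x + y)"
  unfolding voice_def using pi_cinner[of x f "\<pi> (- x + y) g"] by (simp add: add.assoc[symmetric] flip: pi_comp)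

text \<open>Inversion exchanges vector and window. When they are equal, the modulus is invariant
  under inversion, which the synthesis estimate exploits.\<close>

lemma cmod_voice_uminus: "cmod (voice \<pi> g f (- x)) = cmod (voice \<pi> f g x)"
proof -
  have "voice \<pi> g f (- x) = cinner (\<pi> x f) g"
    unfolding voice_def using pi_cinner[of x f "\<pi> (- x) g"] by (simp flip: pi_comp)
  then show ?thesis unfolding voice_def using cinner_commute[of g "\<pi> x f"] by simp
qed

lemma abs_voice_uminus: "abs_fun (voice \<pi> g f) (- x) = abs_fun (voice \<pi> f g) x"
  by (simp add: abs_fun_def cmod_voice_uminus)

lemma cmod_voice_le: "cmod (voice \<pi> g f x) \<le> norm f * norm g"
  unfolding voice_def using cmod_cinner_le[of f "\<pi> x g"] by simp

lemma integrable_bounded_open: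
  assumes U: "open U" "emeasure \<mu> U < top" and f: "continuous_on UNIV f" "\<And>x. cmod (f x) \<le> B"
  shows "integrable \<mu> (\<lambda>y. indicator U y *\<^sub>R f y)"
  by (rule integrableI_bounded_set_indicator[where B=B])
    (use U f in \<open>auto simp: borel_measurable_continuous_onI less_top\<close>)

text \<open>On a set of finite measure the functional \<open>l\<close> is represented by a vector
  \<open>t\<close>. The squared norm of \<open>t\<close> is a double integral with kernel
  \<open>G\<close>, bounded by \<open>I * N\<close> through Schur's test, while \<open>I\<close> is
  the inner product of \<open>f\<close> and \<open>t\<close>. So I^2 is at most
  \<open>(norm f)\<^sup>2 * (I * N)\<close>, and one factor \<open>I\<close> cancels because
  \<open>I\<close> is finite.\<close>

lemma voice_square_integral_open:
  assumes N: "(\<integral>\<^sup>+x. abs_fun (voice \<pi> g g) x \<partial>\<mu>) = ennreal N" "N \<ge> 0"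
    and U: "open U" "emeasure \<mu> U < top"
  shows "(\<integral>\<^sup>+x. (abs_fun (voice \<pi> g f) x)\<^sup>2 * indicator U x \<partial>\<mu>) \<le> ennreal (N * (norm f)\<^sup>2)"
proof -
  define V where "V = voice \<pi> g f"
  define F where "F = abs_fun V"
  define G where "G = abs_fun (voice \<pi> g g)"
  have cV: "continuous_on UNIV V" unfolding V_def by (rule continuous_voice)
  have Vb: "cmod (V y) \<le> norm f * norm g" for y unfolding V_def by (rule cmod_voice_le)
  \<comment> \<open>The inner product of \<open>h\<close> with the adjoint voice transform applied
    to the voice transform of \<open>f\<close> restricted to \<open>U\<close>; the functional avoids
    vector-valued integrals.\<close>
  define l where "l h = (\<integral>y. indicator U y *\<^sub>R (cinner h (\<pi> y g) * cnj (V y)) \<partial>\<mu>)" for h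
  have int: "integrable \<mu> (\<lambda>y. indicator U y *\<^sub>R (cinner h (\<pi> y g) * cnj (V y)))" for h
  proof (rule integrable_bounded_open[OF U, where B="(norm h * norm g) * (norm f * norm g)"])
    show "continuous_on UNIV (\<lambda>y. cinner h (\<pi> y g) * cnj (V y))"
      by (intro continuous_intros continuous_pi cV)
    show "cmod (cinner h (\<pi> y g) * cnj (V y)) \<le> norm h * norm g * (norm f * norm g)" for y
      unfolding norm_mult using cmod_cinner_le[of h "\<pi> y g"] Vb[of y] by (intro mult_mono) auto
  qed
  have nb: "cmod (indicator U y *\<^sub>R (cinner h (\<pi> y g) * cnj (V y))) \<le> norm h * (norm g * (norm f * norm g)) * indicator U y" for h y
    using mult_mono[OF cmod_cinner_le[of h "\<pi> y g"] Vb[of y]] by (simp add: norm_mult indicator_def mult.assoc)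
  have intU: "integrable \<mu> (\<lambda>y. c * indicator U y :: real)" for c
    using U by (intro integrable_mult_right) (simp add: less_top)
  have lb: "cmod (l h) \<le> (norm g * (norm f * norm g) * measure \<mu> U) * norm h" for h
  proof -
    have "cmod (l h) \<le> (\<integral>y. cmod (indicator U y *\<^sub>R (cinner h (\<pi> y g) * cnj (V y))) \<partial>\<mu>)"
      unfolding l_def by (rule integral_norm_bound)
    also have "\<dots> \<le> (\<integral>y. norm h * (norm g * (norm f * norm g)) * indicator U y \<partial>\<mu>)"
      by (rule integral_mono[OF integrable_norm[OF int] intU nb])
    also have "\<dots> = (norm g * (norm f * norm g) * measure \<mu> U) * norm h" using U by simp
    finally show ?thesis .
  qed
  have "\<exists>t. \<forall>h. l h = cinner h t"
  proof (rule riesz_representation[OF _ _ lb])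
    show "l (x + y) = l x + l y" for x y
      unfolding l_def by (subst Bochner_Integration.integral_add[symmetric, OF int int])
        (simp add: cinner_add_left algebra_simps)
    show "l (a *\<^sub>C x) = a * l x" for a x
      unfolding l_def by (subst integral_mult_right_zero[symmetric])
        (simp add: cinner_scaleC_left algebra_simps)
  qed
  then obtain t where t: "\<And>h. l h = cinner h t" by blast
  define I where "I = (\<integral>y. indicator U y * (cmod (V y))\<^sup>2 \<partial>\<mu>)"
  have intI: "integrable \<mu> (\<lambda>y. indicator U y * (cmod (V y))\<^sup>2)"
  proof -
    have "integrable \<mu> (\<lambda>y. cmod (indicator U y *\<^sub>R (cinner f (\<pi> y g) * cnj (V y))))"
      by (rule integrable_norm[OF int])
    moreover have "cinner f (\<pi> y g) = V y" for y unfolding V_def voice_def ..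
    ultimately show ?thesis by (simp add: norm_mult power2_eq_square mult.assoc)
  qed
  have I0: "I \<ge> 0" unfolding I_def by (intro integral_nonneg_AE) simp
  have IF: "(\<integral>\<^sup>+y. (F y)\<^sup>2 * indicator U y \<partial>\<mu>) = ennreal I"
    unfolding I_def F_def abs_fun_def
    by (subst nn_integral_eq_integral[OF intI, symmetric])
      (auto intro!: nn_integral_cong simp: indicator_def ennreal_power)
  have lf: "l f = complex_of_real I"
  proof -
    have "cinner f (\<pi> y g) * cnj (V y) = complex_of_real ((cmod (V y))\<^sup>2)" for y
      unfolding V_def voice_def by (rule complex_norm_square[symmetric])
    then have "l f = (\<integral>y. complex_of_real (indicator U y * (cmod (V y))\<^sup>2) \<partial>\<mu>)"
      unfolding l_def by (simp add: scaleR_conv_of_real)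
    then show ?thesis unfolding I_def by (simp only: integral_complex_of_real)
  qed
  have G_sym: "G (- y + z) = G (- z + y)" for y z
    using abs_voice_uminus[of g g "- z + y"] by (simp add: G_def minus_add)
  have lG: "lsc G" and lF: "lsc F" unfolding G_def F_def V_def by (rule lsc_voice)+
  have lU: "lsc (indicator U :: 'g \<Rightarrow> ennreal)" by (rule lsc_indicator[OF U(1)])
  have mG: "(\<lambda>z. G (- y + z)) \<in> borel_measurable borel" for y
    by (intro lsc_measurable lsc_compose[OF lG] continuous_intros)
  have lpi: "ennreal (cmod (l (\<pi> y g))) \<le> (\<integral>\<^sup>+z. indicator U z * (G (- y + z) * F z) \<partial>\<mu>)" for y
  proof -
    have "ennreal (cmod (l (\<pi> y g))) \<le> (\<integral>\<^sup>+z. ennreal (cmod (indicator U z *\<^sub>R (cinner (\<pi> y g) (\<pi> z g) * cnj (V z)))) \<partial>\<mu>)"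
      unfolding l_def by (rule integral_norm_bound_ennreal[OF int])
    also have "\<dots> = (\<integral>\<^sup>+z. indicator U z * (G (- y + z) * F z) \<partial>\<mu>)"
    proof (rule nn_integral_cong)
      fix z
      have "cinner (\<pi> y g) (\<pi> z g) = voice \<pi> g g (- y + z)"
        using voice_pi[of g y g z] by (simp add: voice_def)
      then show "ennreal (cmod (indicator U z *\<^sub>R (cinner (\<pi> y g) (\<pi> z g) * cnj (V z)))) = indicator U z * (G (- y + z) * F z)"
        by (simp add: G_def F_def abs_fun_def norm_mult ennreal_mult' indicator_def)
    qed
    finally show ?thesis .
  qed
  have tt: "ennreal ((norm t)\<^sup>2) \<le> (\<integral>\<^sup>+y. indicator U y * F y * (\<integral>\<^sup>+z. indicator U z * (G (- y + z) * F z) \<partial>\<mu>) \<partial>\<mu>)"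
  proof -
    have "(norm t)\<^sup>2 = cmod (l t)" unfolding t cinner_self by (simp add: norm_power)
    then have "ennreal ((norm t)\<^sup>2) \<le> (\<integral>\<^sup>+y. ennreal (cmod (indicator U y *\<^sub>R (cinner t (\<pi> y g) * cnj (V y)))) \<partial>\<mu>)"
      unfolding l_def using integral_norm_bound_ennreal[OF int, of t] by simp
    also have "\<dots> \<le> (\<integral>\<^sup>+y. indicator U y * F y * (\<integral>\<^sup>+z. indicator U z * (G (- y + z) * F z) \<partial>\<mu>) \<partial>\<mu>)"
    proof (rule nn_integral_mono)
      fix y
      have "cmod (cinner t (\<pi> y g)) = cmod (l (\<pi> y g))" unfolding t using cinner_commute[of t "\<pi> y g"] by simp
      then have "ennreal (cmod (indicator U y *\<^sub>R (cinner t (\<pi> y g) * cnj (V y)))) = indicator U y * F y * ennreal (cmod (l (\<pi> y g)))"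
        by (simp add: F_def abs_fun_def norm_mult ennreal_mult' indicator_def mult.commute)
      also have "\<dots> \<le> indicator U y * F y * (\<integral>\<^sup>+z. indicator U z * (G (- y + z) * F z) \<partial>\<mu>)"
        by (intro mult_left_mono lpi) simp
      finally show "ennreal (cmod (indicator U y *\<^sub>R (cinner t (\<pi> y g) * cnj (V y)))) \<le> indicator U y * F y * (\<integral>\<^sup>+z. indicator U z * (G (- y + z) * F z) \<partial>\<mu>)" .
    qed
    finally show ?thesis .
  qed
  \<comment> \<open>The inequality 2 a b \<le> a^2 + b^2 splits the double integral into two halves.
    Integrating out the variable without the square costs a factor \<open>N\<close>, in the second
    half after an exchange of integration and by the symmetry of \<open>G\<close>.\<close>
  define A where "A = (\<integral>\<^sup>+y. (\<integral>\<^sup>+z. (F y)\<^sup>2 * indicator U y * (indicator U z * G (- y + z)) \<partial>\<mu>) \<partial>\<mu>)"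
  define B where "B = (\<integral>\<^sup>+y. (\<integral>\<^sup>+z. (F z)\<^sup>2 * indicator U z * (indicator U y * G (- y + z)) \<partial>\<mu>) \<partial>\<mu>)"
  have inner: "(\<integral>\<^sup>+z. (F y)\<^sup>2 * indicator U y * (indicator U z * G (- y + z)) \<partial>\<mu>) \<le> (F y)\<^sup>2 * indicator U y * ennreal N" for y
  proof -
    have "(\<integral>\<^sup>+z. (F y)\<^sup>2 * indicator U y * (indicator U z * G (- y + z)) \<partial>\<mu>)
       \<le> (\<integral>\<^sup>+z. (F y)\<^sup>2 * indicator U y * G (- y + z) \<partial>\<mu>)"
      by (intro nn_integral_mono mult_left_mono) (auto simp: indicator_def)
    also have "\<dots> = (F y)\<^sup>2 * indicator U y * (\<integral>\<^sup>+z. G (- y + z) \<partial>\<mu>)"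
      by (rule nn_integral_cmult) (simp add: mG)
    also have "(\<integral>\<^sup>+z. G (- y + z) \<partial>\<mu>) = ennreal N"
      using nn_integral_translate[OF lsc_measurable[OF lG]] N by (simp add: G_def)
    finally show ?thesis .
  qed
  have mFU: "(\<lambda>y. (F y)\<^sup>2 * indicator U y) \<in> borel_measurable borel"
    unfolding power2_eq_square by (intro lsc_measurable lsc_mult lF lU)
  have half: "(\<integral>\<^sup>+y. (F y)\<^sup>2 * indicator U y * ennreal N \<partial>\<mu>) = ennreal (I * N)"
    using I0 N(2) by (subst nn_integral_multc) (simp_all add: mFU IF ennreal_mult)
  have Ale: "A \<le> ennreal (I * N)" unfolding A_def half[symmetric] by (intro nn_integral_mono inner)
  have c: "continuous_on UNIV (\<lambda>p::'g\<times>'g. - fst p + snd p)" "continuous_on UNIV (\<lambda>p::'g\<times>'g. fst p)"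
     "continuous_on UNIV (\<lambda>p::'g\<times>'g. snd p)"
    by (intro continuous_intros)+
  have "B = (\<integral>\<^sup>+z. (\<integral>\<^sup>+y. (F z)\<^sup>2 * indicator U z * (indicator U y * G (- y + z)) \<partial>\<mu>) \<partial>\<mu>)"
    unfolding B_def power2_eq_square
    by (rule tonelli_lsc) (use lsc_mult[OF lsc_mult[OF lsc_mult[OF lsc_compose[OF lF c(3)] lsc_compose[OF lF c(3)]] lsc_compose[OF lU c(3)]]
       lsc_mult[OF lsc_compose[OF lU c(2)] lsc_compose[OF lG c(1)]]] in \<open>simp add: case_prod_unfold\<close>)
  also have "\<dots> \<le> ennreal (I * N)" unfolding half[symmetric]
    by (intro nn_integral_mono) (use inner G_sym in simp)
  finally have Ble: "B \<le> ennreal (I * N)" .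
  have mA1: "(\<lambda>z. (F y)\<^sup>2 * indicator U y * (indicator U z * G (- y + z))) \<in> borel_measurable \<mu>"
     "(\<lambda>z. (F z)\<^sup>2 * indicator U z * (indicator U y * G (- y + z))) \<in> borel_measurable \<mu>" for y
    unfolding power2_eq_square borel_measurable_haar
    by (intro lsc_measurable lsc_mult lF lU lsc_const lsc_compose[OF lG] continuous_intros)+
  have young: "2 * (a * b) \<le> a\<^sup>2 + b\<^sup>2" if ab: "a < top" "b < top" for a b :: ennreal
  proof -
    obtain r s where rs: "a = ennreal r" "b = ennreal s" "r \<ge> 0" "s \<ge> 0" using ab by (cases a; cases b) auto
    have "0 \<le> (r - s)\<^sup>2" by simp
    then have "2 * (r * s) \<le> r\<^sup>2 + s\<^sup>2" by (simp add: power2_eq_square algebra_simps)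
    then have "ennreal (2 * (r * s)) \<le> ennreal (r\<^sup>2 + s\<^sup>2)" by (rule ennreal_leI)
    then show ?thesis using rs by (simp add: ennreal_mult' ennreal_power flip: ennreal_plus)
  qed
  have mAo: "(\<lambda>y. \<integral>\<^sup>+z. (F y)\<^sup>2 * indicator U y * (indicator U z * G (- y + z)) \<partial>\<mu>) \<in> borel_measurable \<mu>"
     "(\<lambda>y. \<integral>\<^sup>+z. (F z)\<^sup>2 * indicator U z * (indicator U y * G (- y + z)) \<partial>\<mu>) \<in> borel_measurable \<mu>"
  proof -
    have "lsc (\<lambda>(y, z). (F y)\<^sup>2 * indicator U y * (indicator U z * G (- y + z)))"
      unfolding case_prod_unfold power2_eq_square by (intro lsc_mult lsc_compose[OF lF] lsc_compose[OF lU] lsc_compose[OF lG] c)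
    from lsc_section_integral[OF this]
    show "(\<lambda>y. \<integral>\<^sup>+z. (F y)\<^sup>2 * indicator U y * (indicator U z * G (- y + z)) \<partial>\<mu>) \<in> borel_measurable \<mu>"
      by (simp add: lsc_measurable)
    have "lsc (\<lambda>(y, z). (F z)\<^sup>2 * indicator U z * (indicator U y * G (- y + z)))"
      unfolding case_prod_unfold power2_eq_square by (intro lsc_mult lsc_compose[OF lF] lsc_compose[OF lU] lsc_compose[OF lG] c)
    from lsc_section_integral[OF this]
    show "(\<lambda>y. \<integral>\<^sup>+z. (F z)\<^sup>2 * indicator U z * (indicator U y * G (- y + z)) \<partial>\<mu>) \<in> borel_measurable \<mu>"
      by (simp add: lsc_measurable)
  qed
  have "2 * ennreal ((norm t)\<^sup>2) \<le> (\<integral>\<^sup>+y. (\<integral>\<^sup>+z. 2 * (F y * F z) * (indicator U y * indicator U z * G (- y + z)) \<partial>\<mu>) \<partial>\<mu>)"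
  proof -
    have "2 * ennreal ((norm t)\<^sup>2) \<le> 2 * (\<integral>\<^sup>+y. indicator U y * F y * (\<integral>\<^sup>+z. indicator U z * (G (- y + z) * F z) \<partial>\<mu>) \<partial>\<mu>)"
      by (intro mult_left_mono tt) simp
    also have "\<dots> \<le> (\<integral>\<^sup>+y. 2 * (indicator U y * F y * (\<integral>\<^sup>+z. indicator U z * (G (- y + z) * F z) \<partial>\<mu>)) \<partial>\<mu>)"
    proof -
      have "lsc (\<lambda>(y, z). indicator U z * (G (- y + z) * F z))"
        unfolding case_prod_unfold by (intro lsc_mult lsc_compose[OF lF] lsc_compose[OF lU] lsc_compose[OF lG] c)
      from lsc_section_integral[OF this] have "lsc (\<lambda>y. indicator U y * F y * (\<integral>\<^sup>+z. indicator U z * (G (- y + z) * F z) \<partial>\<mu>))"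
        by (intro lsc_mult lU lF)
      then show ?thesis by (subst nn_integral_cmult) (simp_all add: lsc_measurable)
    qed
    also have "\<dots> = (\<integral>\<^sup>+y. (\<integral>\<^sup>+z. 2 * (F y * F z) * (indicator U y * indicator U z * G (- y + z)) \<partial>\<mu>) \<partial>\<mu>)"
    proof (rule nn_integral_cong)
      fix y
      have m: "(\<lambda>z. indicator U z * (G (- y + z) * F z)) \<in> borel_measurable \<mu>"
        unfolding borel_measurable_haar by (intro lsc_measurable lsc_mult lF lU lsc_compose[OF lG] continuous_intros)
      have "2 * (indicator U y * F y * (\<integral>\<^sup>+z. indicator U z * (G (- y + z) * F z) \<partial>\<mu>))
         = (2 * indicator U y * F y) * (\<integral>\<^sup>+z. indicator U z * (G (- y + z) * F z) \<partial>\<mu>)" by (simp add: mult.assoc)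
      also have "\<dots> = (\<integral>\<^sup>+z. (2 * indicator U y * F y) * (indicator U z * (G (- y + z) * F z)) \<partial>\<mu>)"
        by (rule nn_integral_cmult[OF m, symmetric])
      finally show "2 * (indicator U y * F y * (\<integral>\<^sup>+z. indicator U z * (G (- y + z) * F z) \<partial>\<mu>)) =
         (\<integral>\<^sup>+z. 2 * (F y * F z) * (indicator U y * indicator U z * G (- y + z)) \<partial>\<mu>)" by (simp add: mult_ac)
    qed
    finally show ?thesis .
  qed
  also have "\<dots> \<le> (\<integral>\<^sup>+y. (\<integral>\<^sup>+z. ((F y)\<^sup>2 * indicator U y * (indicator U z * G (- y + z)) + (F z)\<^sup>2 * indicator U z * (indicator U y * G (- y + z))) \<partial>\<mu>) \<partial>\<mu>)"
  proof (intro nn_integral_mono)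
    fix y z
    have "2 * (F y * F z) * (indicator U y * indicator U z * G (- y + z)) \<le> ((F y)\<^sup>2 + (F z)\<^sup>2) * (indicator U y * indicator U z * G (- y + z))"
      by (intro mult_right_mono young) (auto simp: F_def abs_fun_def)
    then show "2 * (F y * F z) * (indicator U y * indicator U z * G (- y + z))
       \<le> (F y)\<^sup>2 * indicator U y * (indicator U z * G (- y + z)) + (F z)\<^sup>2 * indicator U z * (indicator U y * G (- y + z))"
      by (simp add: distrib_right distrib_left mult_ac)
  qed
  also have "\<dots> = A + B"
    unfolding A_def B_def nn_integral_add[OF mA1] by (rule nn_integral_add[OF mAo])
  also have "\<dots> \<le> ennreal (I * N) + ennreal (I * N)" by (intro add_mono Ale Ble)
  also have "\<dots> = ennreal (2 * (I * N))" using I0 N(2) by (simp flip: ennreal_plus)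
  also have "2 * ennreal ((norm t)\<^sup>2) = ennreal (2 * (norm t)\<^sup>2)" by (simp add: ennreal_mult')
  finally have "ennreal (2 * (norm t)\<^sup>2) \<le> ennreal (2 * (I * N))" .
  then have tI: "(norm t)\<^sup>2 \<le> I * N" using I0 N(2) by (simp add: ennreal_le_iff)
  have "I = cmod (cinner f t)" using lf I0 unfolding t by simp
  also have "\<dots> \<le> norm f * norm t" by (rule cmod_cinner_le)
  finally have "I\<^sup>2 \<le> (norm f * norm t)\<^sup>2" using I0 by (intro power_mono) auto
  also have "\<dots> \<le> (norm f)\<^sup>2 * (I * N)" unfolding power_mult_distrib by (intro mult_left_mono tI) simp
  finally have "I * I \<le> I * (N * (norm f)\<^sup>2)" by (simp add: power2_eq_square mult_ac)
  then have "I \<le> N * (norm f)\<^sup>2"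
    using I0 N(2) by (cases "I = 0") auto
  then show ?thesis using IF unfolding F_def V_def by (simp add: ennreal_leI)
qed

lemma voice_square_integral:
  assumes N: "(\<integral>\<^sup>+x. abs_fun (voice \<pi> g g) x \<partial>\<mu>) = ennreal N" "N \<ge> 0"
  shows "(\<integral>\<^sup>+x. (abs_fun (voice \<pi> g f) x)\<^sup>2 \<partial>\<mu>) \<le> ennreal (N * (norm f)\<^sup>2)"
proof (rule dense_le)
  fix a assume a: "a < (\<integral>\<^sup>+x. (abs_fun (voice \<pi> g f) x)\<^sup>2 \<partial>\<mu>)"
  have l: "lsc (\<lambda>x. (abs_fun (voice \<pi> g f) x)\<^sup>2)" unfolding power2_eq_square by (intro lsc_mult lsc_voice)
  obtain K where K: "compact K" "a < (\<integral>\<^sup>+x. (abs_fun (voice \<pi> g f) x)\<^sup>2 * indicator K x \<partial>\<mu>)"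
    using lsc_nn_integral_inner[OF l a] by blast
  obtain U where U: "open U" "K \<subseteq> U" "emeasure \<mu> U < top" using compact_subset_open_finite[OF K(1)] by metis
  have "(\<integral>\<^sup>+x. (abs_fun (voice \<pi> g f) x)\<^sup>2 * indicator K x \<partial>\<mu>) \<le> (\<integral>\<^sup>+x. (abs_fun (voice \<pi> g f) x)\<^sup>2 * indicator U x \<partial>\<mu>)"
    using U(2) by (intro nn_integral_mono mult_left_mono) (auto simp: indicator_def)
  also have "\<dots> \<le> ennreal (N * (norm f)\<^sup>2)" by (rule voice_square_integral_open[OF N U(1,3)])
  finally show "a \<le> ennreal (N * (norm f)\<^sup>2)" using K(2) by simp
qed

end

section \<open>Scalar forms of voice transforms and change of window\<close>

context haar_representation
begin

definition integrable_window :: "'h \<Rightarrow> bool" where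
  "integrable_window g \<longleftrightarrow> (\<integral>\<^sup>+x. abs_fun (voice \<pi> g g) x \<partial>\<mu>) < top"

lemma square_integral_shift:
  assumes "integrable_window g"
  obtains c where "c \<ge> 0" "\<And>f. (\<integral>\<^sup>+y. ennreal ((cmod (voice \<pi> g f (y + z)))\<^sup>2) \<partial>\<mu>) \<le> ennreal (c * (norm f)\<^sup>2)"
proof -
  obtain N where N: "(\<integral>\<^sup>+x. abs_fun (voice \<pi> g g) x \<partial>\<mu>) = ennreal N" "N \<ge> 0"
    using assms unfolding integrable_window_def by (cases "\<integral>\<^sup>+x. abs_fun (voice \<pi> g g) x \<partial>\<mu>") auto
  obtain C where C: "C > 0" "\<And>F. lsc F \<Longrightarrow> (\<integral>\<^sup>+x. F (x + z) \<partial>\<mu>) \<le> ennreal C * (\<integral>\<^sup>+x. F x \<partial>\<mu>)"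
    by (rule right_translate_bound[of z]) (rule that)
  have "(\<integral>\<^sup>+y. ennreal ((cmod (voice \<pi> g f (y + z)))\<^sup>2) \<partial>\<mu>) \<le> ennreal (C * N * (norm f)\<^sup>2)" for f
  proof -
    have l: "lsc (\<lambda>x. (abs_fun (voice \<pi> g f) x)\<^sup>2)" unfolding power2_eq_square by (intro lsc_mult lsc_voice)
    have "(\<integral>\<^sup>+y. ennreal ((cmod (voice \<pi> g f (y + z)))\<^sup>2) \<partial>\<mu>) = (\<integral>\<^sup>+y. (abs_fun (voice \<pi> g f) (y + z))\<^sup>2 \<partial>\<mu>)"
      by (simp add: abs_fun_def ennreal_power)
    also have "\<dots> \<le> ennreal C * (\<integral>\<^sup>+y. (abs_fun (voice \<pi> g f) y)\<^sup>2 \<partial>\<mu>)" by (rule C(2)[OF l])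
    also have "\<dots> \<le> ennreal C * ennreal (N * (norm f)\<^sup>2)" by (intro mult_left_mono voice_square_integral N) simp
    also have "\<dots> = ennreal (C * N * (norm f)\<^sup>2)" using C(1) N(2) by (simp add: mult.assoc flip: ennreal_mult)
    finally show ?thesis .
  qed
  then show ?thesis using that[of "C * N"] C(1) N(2) by simp
qed

text \<open>The window \<open>u\<close> is translated by \<open>z\<close> because the two windows \<open>g\<close> and \<open>u\<close> may be orthogonal for the
  form of the orthogonality relations.\<close>

lemma orthogonality_form:
  assumes g: "integrable_window g" and u: "integrable_window u"
  obtains c where "\<And>f1 f2. integrable \<mu> (\<lambda>y. voice \<pi> g f1 y * cnj (voice \<pi> u f2 (y + z)))"
    "\<And>f1 f2. (\<integral>y. voice \<pi> g f1 y * cnj (voice \<pi> u f2 (y + z)) \<partial>\<mu>) = c * cinner f1 f2"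
proof -
  obtain c1 where c1: "c1 \<ge> 0" "\<And>f. (\<integral>\<^sup>+y. ennreal ((cmod (voice \<pi> g f (y + 0)))\<^sup>2) \<partial>\<mu>) \<le> ennreal (c1 * (norm f)\<^sup>2)"
    using square_integral_shift[OF g, of 0] by blast
  obtain c2 where c2: "c2 \<ge> 0" "\<And>f. (\<integral>\<^sup>+y. ennreal ((cmod (voice \<pi> u f (y + z)))\<^sup>2) \<partial>\<mu>) \<le> ennreal (c2 * (norm f)\<^sup>2)"
    using square_integral_shift[OF u, of z] by blast
  define I where "I f1 f2 y = voice \<pi> g f1 y * cnj (voice \<pi> u f2 (y + z))" for f1 f2 y
  have cont: "continuous_on UNIV (I f1 f2)" for f1 f2
    unfolding I_def
    by (intro continuous_intros continuous_voice continuous_on_compose2[OF continuous_voice]) auto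
  have m: "I f1 f2 \<in> borel_measurable borel" for f1 f2 by (rule borel_measurable_continuous_onI[OF cont])
  have mv: "(\<lambda>y. ennreal ((cmod (voice \<pi> g f (y + a)))\<^sup>2)) \<in> borel_measurable \<mu>" for g f a
    unfolding borel_measurable_haar
    by (intro lsc_measurable lsc_ennreal_continuous continuous_intros continuous_on_compose2[OF continuous_voice]) auto
  have bnd: "(\<integral>\<^sup>+y. ennreal (cmod (I f1 f2 y)) \<partial>\<mu>) \<le> ennreal (c1 * (norm f1)\<^sup>2 + c2 * (norm f2)\<^sup>2)" for f1 f2
  proof -
    have "(\<integral>\<^sup>+y. ennreal (cmod (I f1 f2 y)) \<partial>\<mu>)
      \<le> (\<integral>\<^sup>+y. ennreal ((cmod (voice \<pi> g f1 (y + 0)))\<^sup>2) + ennreal ((cmod (voice \<pi> u f2 (y + z)))\<^sup>2) \<partial>\<mu>)"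
    proof (rule nn_integral_mono)
      fix y
      have "a * b \<le> a\<^sup>2 + b\<^sup>2" if "a \<ge> 0" "b \<ge> 0" for a b :: real
      proof -
        have "0 \<le> (a - b)\<^sup>2" "0 \<le> a * b" using that by auto
        then show ?thesis by (simp add: power2_eq_square algebra_simps)
      qed
      then have "cmod (I f1 f2 y) \<le> (cmod (voice \<pi> g f1 (y + 0)))\<^sup>2 + (cmod (voice \<pi> u f2 (y + z)))\<^sup>2"
        unfolding I_def by (simp add: norm_mult)
      then show "ennreal (cmod (I f1 f2 y)) \<le> ennreal ((cmod (voice \<pi> g f1 (y + 0)))\<^sup>2) + ennreal ((cmod (voice \<pi> u f2 (y + z)))\<^sup>2)"
        by (simp add: ennreal_leI flip: ennreal_plus)
    qed
    also have "\<dots> = (\<integral>\<^sup>+y. ennreal ((cmod (voice \<pi> g f1 (y + 0)))\<^sup>2) \<partial>\<mu>) + (\<integral>\<^sup>+y. ennreal ((cmod (voice \<pi> u f2 (y + z)))\<^sup>2) \<partial>\<mu>)"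
      by (rule nn_integral_add[OF mv mv])
    also have "\<dots> \<le> ennreal (c1 * (norm f1)\<^sup>2) + ennreal (c2 * (norm f2)\<^sup>2)" by (intro add_mono c1 c2)
    finally show ?thesis using c1(1) c2(1) by (simp flip: ennreal_plus)
  qed
  have int: "integrable \<mu> (I f1 f2)" for f1 f2
  proof (rule integrableI_bounded)
    show "I f1 f2 \<in> borel_measurable \<mu>" using m by simp
    show "(\<integral>\<^sup>+y. ennreal (norm (I f1 f2 y)) \<partial>\<mu>) < \<infinity>" by (rule le_less_trans[OF bnd]) simp
  qed
  define B where "B f1 f2 = (\<integral>y. I f1 f2 y \<partial>\<mu>)" for f1 f2
  have Bb: "cmod (B f1 f2) \<le> c1 * (norm f1)\<^sup>2 + c2 * (norm f2)\<^sup>2" for f1 f2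
  proof -
    have "ennreal (cmod (B f1 f2)) \<le> ennreal (c1 * (norm f1)\<^sup>2 + c2 * (norm f2)\<^sup>2)"
      unfolding B_def by (rule order_trans[OF integral_norm_bound_ennreal[OF int] bnd])
    then show ?thesis by (subst (asm) ennreal_le_iff) (use c1(1) c2(1) in auto)
  qed
  have s1: "B (a *\<^sub>C f1) f2 = a * B f1 f2" for a f1 f2
    unfolding B_def I_def voice_def cinner_scaleC_left
    by (subst integral_mult_right_zero[symmetric]) (simp add: mult.assoc)
  have s2: "B f1 (a *\<^sub>C f2) = cnj a * B f1 f2" for a f1 f2
    unfolding B_def I_def voice_def cinner_scaleC_left
    by (subst integral_mult_right_zero[symmetric]) (simp add: mult_ac)
  have a1: "B (f1 + f1') f2 = B f1 f2 + B f1' f2" for f1 f1' f2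
  proof -
    have "I (f1 + f1') f2 = (\<lambda>y. I f1 f2 y + I f1' f2 y)"
      by (rule ext) (simp add: I_def voice_def cinner_add_left algebra_simps)
    then show ?thesis unfolding B_def using Bochner_Integration.integral_add[OF int int, of f1 f2 f1' f2] by simp
  qed
  have a2: "B f1 (f2 + f2') = B f1 f2 + B f1 f2'" for f1 f2 f2'
  proof -
    have "I f1 (f2 + f2') = (\<lambda>y. I f1 f2 y + I f1 f2' y)"
      by (rule ext) (simp add: I_def voice_def cinner_add_left algebra_simps)
    then show ?thesis unfolding B_def using Bochner_Integration.integral_add[OF int int, of f1 f2 f1 f2'] by simp
  qed
  have Bb': "cmod (B f1 f2) \<le> (c1 + c2) * norm f1 * norm f2" for f1 f2
  proof (cases "f1 = 0 \<or> f2 = 0")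
    case True
    have "B (0 *\<^sub>C f1) f2 = 0" "B f1 (0 *\<^sub>C f2) = 0" unfolding s1 s2 by simp_all
    moreover have "0 *\<^sub>C f = 0" for f :: 'h using scaleC_of_real[of 0 f] by simp
    ultimately show ?thesis using True by auto
  next
    case False
    \<comment> \<open>Normalizing both vectors turns the bound by a sum of squares into the product
      bound required of a bounded form.\<close>
    define e1 where "e1 = complex_of_real (1 / norm f1) *\<^sub>C f1"
    define e2 where "e2 = complex_of_real (1 / norm f2) *\<^sub>C f2"
    have n: "norm e1 = 1" "norm e2 = 1" using False by (simp_all add: e1_def e2_def norm_scaleC norm_divide)
    have "cmod (B f1 f2) / (norm f1 * norm f2) = cmod (B e1 e2)"
      unfolding e1_def e2_def s1 s2 by (simp add: norm_mult norm_divide)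
    also have "\<dots> \<le> c1 + c2" using Bb[of e1 e2] n by simp
    finally show ?thesis using False by (simp add: field_simps)
  qed
  have "bounded_form B"
    unfolding bounded_form_def using s1 s2 a1 a2 Bb' c1(1) c2(1) by (metis add_nonneg_nonneg)
  moreover have "B (\<pi> x f1) (\<pi> x f2) = B f1 f2" for x f1 f2
  proof -
    have "B (\<pi> x f1) (\<pi> x f2) = (\<integral>y. I f1 f2 (- x + y) \<partial>\<mu>)"
      unfolding B_def I_def voice_pi by (simp add: add.assoc)
    also have "\<dots> = B f1 f2" unfolding B_def by (rule integral_translate[OF m])
    finally show ?thesis .
  qed
  ultimately obtain c where "\<And>f1 f2. B f1 f2 = c * cinner f1 f2"
    using schur_form[OF unitary irreducible] by blast
  then show ?thesis using that[of c] int unfolding B_def I_def by blast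
qed

text \<open>If every shift gave zero, \<open>u\<close> would lie in the closed invariant subspace
  \<open>S\<close> of vectors whose orbit is annihilated by \<open>P\<close>. By irreducibility
  \<open>g\<close> would lie there too, so the squared modulus of its voice transform would have
  integral zero, against continuity and the positive value at the identity.\<close>

lemma nondegenerate_translate:
  assumes g: "integrable_window g" "g \<noteq> 0" and u: "u \<noteq> 0"
  shows "\<exists>z. (\<integral>y. voice \<pi> g g y * cnj (voice \<pi> u g (y + z)) \<partial>\<mu>) \<noteq> 0"
proof (rule ccontr)
  assume "\<not> ?thesis"
  then have z: "(\<integral>y. voice \<pi> g g y * cnj (voice \<pi> u g (y + z)) \<partial>\<mu>) = 0" for z by blast
  obtain N where N: "(\<integral>\<^sup>+x. abs_fun (voice \<pi> g g) x \<partial>\<mu>) = ennreal N" "N \<ge> 0"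
    using g(1) unfolding integrable_window_def by (cases "\<integral>\<^sup>+x. abs_fun (voice \<pi> g g) x \<partial>\<mu>") auto
  define P where "P w = (\<integral>y. voice \<pi> g g y * cinner (\<pi> y w) g \<partial>\<mu>)" for w
  have m: "(\<lambda>y. voice \<pi> g g y * cinner (\<pi> y w) g) \<in> borel_measurable borel" for w
    by (intro borel_measurable_continuous_onI continuous_on_mult continuous_voice continuous_on_cinner_left continuous_pi)
  have b: "(\<integral>\<^sup>+y. ennreal (cmod (voice \<pi> g g y * cinner (\<pi> y w) g)) \<partial>\<mu>) \<le> ennreal (N * norm g * norm w)" for w
  proof -
    have "(\<integral>\<^sup>+y. ennreal (cmod (voice \<pi> g g y * cinner (\<pi> y w) g)) \<partial>\<mu>) \<le> (\<integral>\<^sup>+y. abs_fun (voice \<pi> g g) y * ennreal (norm g * norm w) \<partial>\<mu>)"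
    proof (rule nn_integral_mono)
      fix y
      have "cmod (cinner (\<pi> y w) g) \<le> norm g * norm w" using cmod_cinner_le[of "\<pi> y w" g] by (simp add: mult.commute)
      then show "ennreal (cmod (voice \<pi> g g y * cinner (\<pi> y w) g)) \<le> abs_fun (voice \<pi> g g) y * ennreal (norm g * norm w)"
        unfolding abs_fun_def norm_mult by (subst ennreal_mult[symmetric]) (auto intro!: ennreal_leI mult_left_mono)
    qed
    also have "\<dots> = ennreal (N * norm g * norm w)"
      using N by (subst nn_integral_multc) (auto simp: abs_voice_measurable ennreal_mult mult.assoc)
    finally show ?thesis .
  qed
  have int: "integrable \<mu> (\<lambda>y. voice \<pi> g g y * cinner (\<pi> y w) g)" for w
  proof (rule integrableI_bounded)
    show "(\<lambda>y. voice \<pi> g g y * cinner (\<pi> y w) g) \<in> borel_measurable \<mu>" using m by simp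
    show "(\<integral>\<^sup>+y. ennreal (norm (voice \<pi> g g y * cinner (\<pi> y w) g)) \<partial>\<mu>) < \<infinity>" by (rule le_less_trans[OF b]) simp
  qed
  have Pa: "P (w + w') = P w + P w'" for w w'
    unfolding P_def by (subst Bochner_Integration.integral_add[symmetric, OF int int])
      (simp add: pi_add cinner_add_left algebra_simps)
  have Ps: "P (a *\<^sub>C w) = a * P w" for a w
    unfolding P_def pi_scaleC cinner_scaleC_left
    by (subst integral_mult_right_zero[symmetric]) (simp add: mult_ac)
  have Pb: "cmod (P w) \<le> norm w * (N * norm g)" for w
  proof -
    have "ennreal (cmod (P w)) \<le> ennreal (N * norm g * norm w)"
      unfolding P_def by (rule order_trans[OF integral_norm_bound_ennreal[OF int] b])
    then show ?thesis using N(2) by (simp add: ennreal_le_iff mult_ac)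
  qed
  have Pl: "bounded_linear P"
    by (rule bounded_linear_intro[OF Pa _ Pb]) (metis Ps scaleC_of_real scaleR_conv_of_real)
  define S where "S = {w. \<forall>x. P (\<pi> x w) = 0}"
  have "closed S"
  proof -
    have "S = (\<Inter>x. {w. P (\<pi> x w) = 0})" unfolding S_def by blast
    moreover have "closed {w. P (\<pi> x w) = 0}" for x
      by (intro closed_Collect_eq continuous_intros bounded_linear.continuous_on[OF Pl] bounded_linear.continuous_on[OF bounded_linear_pi])
    ultimately show ?thesis by auto
  qed
  moreover have P0: "P 0 = 0" using linear_0[OF bounded_linear.linear[OF Pl]] .
  moreover have pi0: "\<pi> x 0 = 0" for x using linear_0[OF bounded_linear.linear[OF bounded_linear_pi]] .
  moreover have "0 \<in> S" by (simp add: S_def P0 pi0)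
  moreover have "\<forall>f\<in>S. \<forall>f'\<in>S. f + f' \<in> S" by (simp add: S_def pi_add Pa)
  moreover have "\<forall>c. \<forall>f\<in>S. c *\<^sub>C f \<in> S" by (simp add: S_def pi_scaleC Ps)
  moreover have "\<forall>x. \<forall>f\<in>S. \<pi> x f \<in> S" by (simp add: S_def flip: pi_comp)
  ultimately have "S = {0} \<or> S = UNIV" using irreducible unfolding irreducible_representation_def by blast
  moreover have "u \<in> S"
  proof -
    have "P (\<pi> x u) = (\<integral>y. voice \<pi> g g y * cnj (voice \<pi> u g (y + x)) \<partial>\<mu>)" for x
      unfolding P_def voice_def by (simp add: pi_comp flip: cinner_commute)
    then show ?thesis by (simp add: S_def z)
  qed
  ultimately have "g \<in> S" using u by blast
  then have "P (\<pi> 0 g) = 0" unfolding S_def by blast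
  then have "P g = 0" by simp
  moreover have "P g = (\<integral>y. complex_of_real ((cmod (voice \<pi> g g y))\<^sup>2) \<partial>\<mu>)"
    unfolding P_def
    by (intro Bochner_Integration.integral_cong refl) (simp only: complex_norm_square voice_def flip: cinner_commute)
  ultimately have "(\<integral>y. complex_of_real ((cmod (voice \<pi> g g y))\<^sup>2) \<partial>\<mu>) = 0" by (simp only:)
  then have z0: "(\<integral>y. (cmod (voice \<pi> g g y))\<^sup>2 \<partial>\<mu>) = 0"
    unfolding integral_complex_of_real of_real_eq_0_iff .
  have "integrable \<mu> (\<lambda>y. (cmod (voice \<pi> g g y))\<^sup>2)"
  proof -
    have "integrable \<mu> (\<lambda>y. cmod (voice \<pi> g g y * cinner (\<pi> y g) g))" by (rule integrable_norm[OF int])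
    moreover have "cmod (cinner (\<pi> y g) g) = cmod (voice \<pi> g g y)" for y
      unfolding voice_def using cinner_commute[of g "\<pi> y g"] by simp
    ultimately show ?thesis by (simp add: norm_mult power2_eq_square)
  qed
  then have "AE y in \<mu>. (cmod (voice \<pi> g g y))\<^sup>2 = 0" using z0
    by (subst (asm) integral_nonneg_eq_0_iff_AE) auto
  moreover have op: "open {y. voice \<pi> g g y \<noteq> 0}"
    by (intro open_Collect_neq continuous_voice continuous_on_const)
  ultimately have "emeasure \<mu> {y. voice \<pi> g g y \<noteq> 0} = 0"
    by (subst (asm) AE_iff_measurable[OF _ refl]) auto
  moreover have "0 \<in> {y. voice \<pi> g g y \<noteq> 0}" using g(2) by (simp add: voice_def cinner_self)
  ultimately show False using positive_open[OF op] by (metis empty_iff less_irrefl)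
qed

lemma window_change_bilinear:
  assumes g: "integrable_window g" "g \<noteq> 0" and u: "integrable_window u" "u \<noteq> 0"
  obtains z C where "C > 0" "\<And>f h. ennreal (cmod (cinner f h)) \<le>
     ennreal C * (\<integral>\<^sup>+y. abs_fun (voice \<pi> g f) y * abs_fun (voice \<pi> u h) (y + z) \<partial>\<mu>)"
proof -
  obtain z where z: "(\<integral>y. voice \<pi> g g y * cnj (voice \<pi> u g (y + z)) \<partial>\<mu>) \<noteq> 0"
    using nondegenerate_translate[OF g u(2)] by blast
  obtain c where c: "\<And>f1 f2. integrable \<mu> (\<lambda>y. voice \<pi> g f1 y * cnj (voice \<pi> u f2 (y + z)))"
    "\<And>f1 f2. (\<integral>y. voice \<pi> g f1 y * cnj (voice \<pi> u f2 (y + z)) \<partial>\<mu>) = c * cinner f1 f2"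
    using orthogonality_form[OF g(1) u(1)] by blast
  have c0: "c \<noteq> 0" using z unfolding c(2) by auto
  show ?thesis
  proof (rule that[of "1 / cmod c"])
    show "1 / cmod c > 0" using c0 by simp
    fix f h
    have "ennreal (cmod (c * cinner f h)) \<le> (\<integral>\<^sup>+y. ennreal (cmod (voice \<pi> g f y * cnj (voice \<pi> u h (y + z)))) \<partial>\<mu>)"
      unfolding c(2)[symmetric] by (rule integral_norm_bound_ennreal[OF c(1)])
    also have "\<dots> = (\<integral>\<^sup>+y. abs_fun (voice \<pi> g f) y * abs_fun (voice \<pi> u h) (y + z) \<partial>\<mu>)"
      by (simp add: abs_fun_def norm_mult ennreal_mult')
    finally have "ennreal (1 / cmod c) * ennreal (cmod (c * cinner f h)) \<le> ennreal (1 / cmod c) * (\<integral>\<^sup>+y. abs_fun (voice \<pi> g f) y * abs_fun (voice \<pi> u h) (y + z) \<partial>\<mu>)"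
      by (rule mult_left_mono) simp
    moreover have "ennreal (1 / cmod c) * ennreal (cmod (c * cinner f h)) = ennreal (cmod (cinner f h))"
      using c0 by (simp add: norm_mult flip: ennreal_mult)
    ultimately show "ennreal (cmod (cinner f h)) \<le> ennreal (1 / cmod c) * (\<integral>\<^sup>+y. abs_fun (voice \<pi> g f) y * abs_fun (voice \<pi> u h) (y + z) \<partial>\<mu>)"
      by simp
  qed
qed

text \<open>The choice \<open>h = \<pi> x u\<close> in \<open>window_change_bilinear\<close>. This
  pointwise domination stands in for the reproducing formula and is enough because all later norms
  are solid.\<close>

lemma window_change:
  assumes "integrable_window g" "g \<noteq> 0" "integrable_window u" "u \<noteq> 0"
  obtains z C where "C > 0" "\<And>f x. abs_fun (voice \<pi> u f) x \<le>
     ennreal C * (\<integral>\<^sup>+y. abs_fun (voice \<pi> g f) y * abs_fun (voice \<pi> u u) (- x + y + z) \<partial>\<mu>)"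
proof -
  obtain z C where C: "C > 0" "\<And>f h. ennreal (cmod (cinner f h)) \<le>
     ennreal C * (\<integral>\<^sup>+y. abs_fun (voice \<pi> g f) y * abs_fun (voice \<pi> u h) (y + z) \<partial>\<mu>)"
    by (rule window_change_bilinear[OF assms]) (rule that)
  have "abs_fun (voice \<pi> u f) x \<le>
     ennreal C * (\<integral>\<^sup>+y. abs_fun (voice \<pi> g f) y * abs_fun (voice \<pi> u u) (- x + y + z) \<partial>\<mu>)" for f x
    using C(2)[of f "\<pi> x u"] unfolding abs_fun_def voice_pi by (simp add: voice_def[of \<pi> u f x] add.assoc)
  with C(1) that show ?thesis by blast
qed

text \<open>Of the two voice transforms in \<open>window_change_bilinear\<close>, one is bounded by
  Cauchy-Schwarz and the other is integrated after undoing the right shift. The result embeds the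
  Hilbert space into the anti-dual.\<close>

lemma cinner_le_voice_integral:
  assumes "integrable_window g" "g \<noteq> 0"
  obtains C where "C > 0" "\<And>f h. ennreal (cmod (cinner f h)) \<le>
     ennreal (C * norm f) * (\<integral>\<^sup>+y. abs_fun (voice \<pi> g h) y \<partial>\<mu>)"
proof -
  obtain z C where C: "C > 0" "\<And>f h. ennreal (cmod (cinner f h)) \<le>
     ennreal C * (\<integral>\<^sup>+y. abs_fun (voice \<pi> g f) y * abs_fun (voice \<pi> g h) (y + z) \<partial>\<mu>)"
    by (rule window_change_bilinear[OF assms assms]) (rule that)
  obtain D where D: "D > 0" "\<And>F. lsc F \<Longrightarrow> (\<integral>\<^sup>+x. F (x + z) \<partial>\<mu>) \<le> ennreal D * (\<integral>\<^sup>+x. F x \<partial>\<mu>)"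
    by (rule right_translate_bound[of z]) (rule that)
  have n: "norm g > 0" using assms by simp
  show ?thesis
  proof (rule that[of "C * norm g * D"])
    show "C * norm g * D > 0" using C D n by simp
    fix f h
    have m: "(\<lambda>y. abs_fun (voice \<pi> g h) (y + z)) \<in> borel_measurable borel"
      by (intro lsc_measurable lsc_compose[OF lsc_voice] continuous_intros)
    have "(\<integral>\<^sup>+y. abs_fun (voice \<pi> g f) y * abs_fun (voice \<pi> g h) (y + z) \<partial>\<mu>)
       \<le> (\<integral>\<^sup>+y. ennreal (norm f * norm g) * abs_fun (voice \<pi> g h) (y + z) \<partial>\<mu>)"
      by (intro nn_integral_mono mult_right_mono) (auto simp: abs_fun_def cmod_voice_le intro!: ennreal_leI)
    also have "\<dots> = ennreal (norm f * norm g) * (\<integral>\<^sup>+y. abs_fun (voice \<pi> g h) (y + z) \<partial>\<mu>)"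
      by (rule nn_integral_cmult) (simp add: m)
    also have "\<dots> \<le> ennreal (norm f * norm g) * (ennreal D * (\<integral>\<^sup>+y. abs_fun (voice \<pi> g h) y \<partial>\<mu>))"
      by (intro mult_left_mono D lsc_voice) simp
    finally have "ennreal (cmod (cinner f h)) \<le> ennreal C * (ennreal (norm f * norm g) * (ennreal D * (\<integral>\<^sup>+y. abs_fun (voice \<pi> g h) y \<partial>\<mu>)))"
      using C(2)[of f h] by (meson mult_left_mono order_trans zero_le)
    also have "\<dots> = ennreal (C * norm g * D * norm f) * (\<integral>\<^sup>+y. abs_fun (voice \<pi> g h) y \<partial>\<mu>)"
    proof -
      have "ennreal (C * norm g * D * norm f) = ennreal C * (ennreal (norm f * norm g) * ennreal D)"
        using C(1) D(1) by (simp add: mult_ac flip: ennreal_mult)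
      then show ?thesis by (simp add: mult.assoc)
    qed
    finally show "ennreal (cmod (cinner f h)) \<le> ennreal (C * norm g * D * norm f) * (\<integral>\<^sup>+y. abs_fun (voice \<pi> g h) y \<partial>\<mu>)" .
  qed
qed

end

section \<open>Lebesgue and weak Lebesgue quasi-norms\<close>

lemma ennreal_powr_simps [simp]: "ennreal_powr top r = top" "0 \<le> x \<Longrightarrow> ennreal_powr (ennreal x) r = ennreal (x powr r)"
  "ennreal_powr 0 r = 0" "ennreal_powr 1 r = 1"
  by (simp_all add: ennreal_powr_def)

lemma ennreal_powr_mono: assumes "a \<le> b" "0 \<le> r" shows "ennreal_powr a r \<le> ennreal_powr b r"
  using assms by (cases a; cases b) (auto simp: top_unique intro!: ennreal_leI powr_mono2)

lemma ennreal_powr_powr: "0 < r \<Longrightarrow> 0 < s \<Longrightarrow> ennreal_powr (ennreal_powr a r) s = ennreal_powr a (r * s)"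
  by (cases a) (auto simp: powr_powr)

lemma ennreal_powr_one [simp]: "ennreal_powr a 1 = a"
  by (cases a) auto

lemma ennreal_powr_inverse: "0 < r \<Longrightarrow> ennreal_powr (ennreal_powr a r) (1 / r) = a"
  "0 < r \<Longrightarrow> ennreal_powr (ennreal_powr a (1 / r)) r = a"
  by (simp_all add: ennreal_powr_powr)

lemma ennreal_powr_eq_0_iff [simp]: "ennreal_powr a r = 0 \<longleftrightarrow> a = 0"
  by (cases a) (auto simp: ennreal_eq_0_iff)

lemma ennreal_powr_eq_top_iff [simp]: "ennreal_powr a r = top \<longleftrightarrow> a = top"
  by (cases a) auto

lemma ennreal_powr_less_top_iff [simp]: "ennreal_powr a r < top \<longleftrightarrow> a < top"
  by (cases a) auto

lemma ennreal_powr_mult: "0 < r \<Longrightarrow> ennreal_powr (a * b) r = ennreal_powr a r * ennreal_powr b r"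
  by (cases a; cases b)
    (auto simp: powr_mult ennreal_mult_top ennreal_top_mult ennreal_eq_0_iff simp flip: ennreal_mult)

lemma ennreal_powr_less_iff: assumes "0 < r" shows "a < ennreal_powr b r \<longleftrightarrow> ennreal_powr a (1 / r) < b"
proof -
  have "b \<le> ennreal_powr a (1 / r) \<longleftrightarrow> ennreal_powr b r \<le> a"
    using ennreal_powr_mono[of b "ennreal_powr a (1 / r)" r] ennreal_powr_mono[of "ennreal_powr b r" a "1 / r"] assms
    by (auto simp: ennreal_powr_inverse)
  then show ?thesis by (simp flip: not_le)
qed

lemma ennreal_powr_le_iff: assumes "0 < r" shows "ennreal_powr a r \<le> ennreal_powr b r \<longleftrightarrow> a \<le> b"
  using ennreal_powr_less_iff[OF assms, of "ennreal_powr b r" a] assms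
  by (simp add: ennreal_powr_inverse flip: not_less)

lemma borel_superlevel: "F \<in> borel_measurable borel \<Longrightarrow> {x. a < F x} \<in> sets borel" for F :: "'a::topological_space \<Rightarrow> ennreal"
  using borel_measurable_less[OF borel_measurable_const, of F borel a] by simp

lemma measurable_ennreal_powr [measurable (raw)]:
  assumes "F \<in> borel_measurable M" shows "(\<lambda>x. ennreal_powr (F x) r) \<in> borel_measurable M"
  using assms unfolding ennreal_powr_def by measurable

lemma lsc_ennreal_powr: assumes "lsc F" "0 < r" shows "lsc (\<lambda>x. ennreal_powr (F x) r)"
  using assms unfolding lsc_def by (simp add: ennreal_powr_less_iff)

text \<open>The properties shared by the functionals of L^q and of weak L^p, so that the weight of
  left translations is treated once for both. \<open>N_inner\<close> plays the role of inner
  regularity.\<close>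

locale invariant_norm = haar_group \<mu> for \<mu> :: "'g::{topological_group_add,t2_space} measure" +
  fixes N :: "'g solid"
  assumes N_mono: "\<And>F G. F \<in> borel_measurable borel \<Longrightarrow> G \<in> borel_measurable borel \<Longrightarrow> (\<And>x. F x \<le> G x) \<Longrightarrow> N F \<le> N G"
    and N_nonmeasurable: "\<And>F. F \<notin> borel_measurable borel \<Longrightarrow> N F = top"
    and N_cmult: "\<And>F c. F \<in> borel_measurable borel \<Longrightarrow> 0 < c \<Longrightarrow> N (\<lambda>x. ennreal c * F x) = ennreal c * N F"
    and N_translate: "\<And>F a. F \<in> borel_measurable borel \<Longrightarrow> N (\<lambda>x. F (a + x)) = N F"
    and N_inner: "\<And>F a. lsc F \<Longrightarrow> a < N F \<Longrightarrow> \<exists>K. compact K \<and> a < N (\<lambda>x. F x * indicator K x)"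
    and N_zero: "\<And>F. F \<in> borel_measurable borel \<Longrightarrow> N F = 0 \<Longrightarrow> AE x in \<mu>. F x = 0"
    and N_compact: "\<And>K. compact K \<Longrightarrow> N (indicator K) < top"

context haar_group
begin

text \<open>Strict lower bounds become statements about measures of superlevel sets. Identities
  between essential suprema are then proved by comparing all strict lower bounds.\<close>

lemma less_esssup_iff:
  assumes "F \<in> borel_measurable borel"
  shows "a < esssup \<mu> F \<longleftrightarrow> emeasure \<mu> {x. a < F x} \<noteq> 0"
proof
  assume "a < esssup \<mu> F"
  then show "emeasure \<mu> {x. a < F x} \<noteq> 0" using esssup_pos_measure[where M=\<mu> and f=F and z=a] assms by simp
next
  assume n: "emeasure \<mu> {x. a < F x} \<noteq> 0"
  show "a < esssup \<mu> F"
  proof (rule ccontr)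
    assume "\<not> a < esssup \<mu> F"
    then have "{x. a < F x} \<subseteq> {x. esssup \<mu> F < F x}" by auto
    then have "emeasure \<mu> {x. a < F x} \<le> emeasure \<mu> {x. esssup \<mu> F < F x}"
      using assms by (intro emeasure_mono) (auto intro: borel_superlevel)
    also have "\<dots> = 0" using esssup_zero_measure[where M=\<mu> and f=F] by simp
    finally show False using n by simp
  qed
qed

lemma emeasure_vimage_translate:
  assumes "A \<in> sets borel" shows "emeasure \<mu> ((+) a -` A) = emeasure \<mu> A"
proof -
  have "(+) a -` A = (+) (- a) ` A" unfolding plus_image_eq_vimage by simp
  then show ?thesis using left_invariant[OF assms] by simp
qed

lemma invariant_norm_esssup: "invariant_norm \<mu> (lebesgue_space \<mu> top)"
proof
  have N: "lebesgue_space \<mu> top F = esssup \<mu> F" if "F \<in> borel_measurable borel" for F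
    using that by (simp add: lebesgue_space_def)
  fix F G :: "'g \<Rightarrow> ennreal" and a :: ennreal and c :: real and b :: 'g and K :: "'g set"
  show "F \<notin> borel_measurable borel \<Longrightarrow> lebesgue_space \<mu> top F = top"
    by (simp add: lebesgue_space_def)
  show "F \<in> borel_measurable borel \<Longrightarrow> G \<in> borel_measurable borel \<Longrightarrow> (\<And>x. F x \<le> G x) \<Longrightarrow>
     lebesgue_space \<mu> top F \<le> lebesgue_space \<mu> top G"
    by (simp add: N esssup_mono)
  {
    assume F: "F \<in> borel_measurable borel" and c: "0 < c"
    have cF: "(\<lambda>x. ennreal c * F x) \<in> borel_measurable borel"
      by (intro borel_measurable_times_ennreal borel_measurable_const F)
    have lt: "t < ennreal c * y \<longleftrightarrow> ennreal (1 / c) * t < y" for t y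
    proof
      assume "t < ennreal c * y"
      then have "ennreal (1 / c) * t < ennreal (1 / c) * (ennreal c * y)"
        using c by (intro ennreal_mult_strict_left_mono) auto
      then show "ennreal (1 / c) * t < y" using c by (simp add: mult.assoc[symmetric] flip: ennreal_mult)
    next
      assume "ennreal (1 / c) * t < y"
      then have "ennreal c * (ennreal (1 / c) * t) < ennreal c * y"
        using c by (intro ennreal_mult_strict_left_mono) auto
      then show "t < ennreal c * y" using c by (simp add: mult.assoc[symmetric] flip: ennreal_mult)
    qed
    have "t < esssup \<mu> (\<lambda>x. ennreal c * F x) \<longleftrightarrow> t < ennreal c * esssup \<mu> F" for t
      unfolding less_esssup_iff[OF cF] lt less_esssup_iff[OF F] ..
    then show "lebesgue_space \<mu> top (\<lambda>x. ennreal c * F x) = ennreal c * lebesgue_space \<mu> top F"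
      unfolding N[OF F] N[OF cF] by (metis less_irrefl not_less_iff_gr_or_eq)
  next
    assume F: "F \<in> borel_measurable borel"
    have mt: "(\<lambda>x. b + x) \<in> borel_measurable borel"
      by (intro borel_measurable_continuous_onI continuous_intros)
    have Fb: "(\<lambda>x. F (b + x)) \<in> borel_measurable borel" by (rule measurable_compose[OF mt F])
    have "t < esssup \<mu> (\<lambda>x. F (b + x)) \<longleftrightarrow> t < esssup \<mu> F" for t
    proof -
      have "{x. t < F x} \<in> sets borel" by (rule borel_superlevel[OF F])
      from emeasure_vimage_translate[OF this, of b] show ?thesis
        unfolding less_esssup_iff[OF F] less_esssup_iff[OF Fb] by (simp add: vimage_def)
    qed
    then show "lebesgue_space \<mu> top (\<lambda>x. F (b + x)) = lebesgue_space \<mu> top F"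
      unfolding N[OF F] N[OF Fb] by (metis less_irrefl not_less_iff_gr_or_eq)
  next
    assume F: "lsc F" and a: "a < lebesgue_space \<mu> top F"
    have m: "F \<in> borel_measurable borel" by (rule lsc_measurable[OF F])
    have "0 < emeasure \<mu> {x. a < F x}" using a unfolding N[OF m] less_esssup_iff[OF m] by (simp add: zero_less_iff_neq_zero)
    then obtain K where K: "compact K" "K \<subseteq> {x. a < F x}" "0 < emeasure \<mu> K"
      unfolding inner_regular_open[OF lscD[OF F]] by (auto simp: less_SUP_iff)
    have mK: "(\<lambda>x. F x * indicator K x) \<in> borel_measurable borel" using m K(1) by simp
    have "emeasure \<mu> K \<le> emeasure \<mu> {x. a < F x * indicator K x}"
    proof (rule emeasure_mono)
      show "K \<subseteq> {x. a < F x * indicator K x}" using K(2) by (auto simp: indicator_def)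
      show "{x. a < F x * indicator K x} \<in> sets \<mu>" by (simp add: borel_superlevel[OF mK])
    qed
    then have "a < lebesgue_space \<mu> top (\<lambda>x. F x * indicator K x)"
      unfolding N[OF mK] less_esssup_iff[OF mK] using K(3) by auto
    then show "\<exists>K. compact K \<and> a < lebesgue_space \<mu> top (\<lambda>x. F x * indicator K x)" using K(1) by blast
  next
    assume F: "F \<in> borel_measurable borel" and z: "lebesgue_space \<mu> top F = 0"
    then have "AE x in \<mu>. F x \<le> 0" using esssup_AE[where M=\<mu> and f=F] N[OF F] by simp
    then show "AE x in \<mu>. F x = 0" by simp
  next
    assume "compact K"
    then have m: "(indicator K :: 'g \<Rightarrow> ennreal) \<in> borel_measurable borel" by simp
    have "esssup \<mu> (indicator K) \<le> (1 :: ennreal)" by (intro esssup_I) (auto simp: m indicator_def)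
    then show "lebesgue_space \<mu> top (indicator K) < top" unfolding N[OF m] using le_less_trans by fastforce
  }
qed

lemma lebesgue_space_eq:
  "q \<noteq> top \<Longrightarrow> F \<in> borel_measurable borel \<Longrightarrow>
     lebesgue_space \<mu> q F = ennreal_powr (\<integral>\<^sup>+ x. ennreal_powr (F x) (enn2real q) \<partial>\<mu>) (1 / enn2real q)"
  by (simp add: lebesgue_space_def)

lemma invariant_norm_lebesgue:
  assumes q: "0 < q" "q \<noteq> top" shows "invariant_norm \<mu> (lebesgue_space \<mu> q)"
proof
  define r where "r = enn2real q"
  have r: "r > 0" unfolding r_def using q by (simp add: enn2real_positive_iff less_top)
  note N = lebesgue_space_eq[OF q(2), folded r_def]
  fix F G :: "'g \<Rightarrow> ennreal" and a :: ennreal and c :: real and b :: 'g and K :: "'g set"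
  show "F \<notin> borel_measurable borel \<Longrightarrow> lebesgue_space \<mu> q F = top"
    by (simp add: lebesgue_space_def)
  show "F \<in> borel_measurable borel \<Longrightarrow> G \<in> borel_measurable borel \<Longrightarrow> (\<And>x. F x \<le> G x) \<Longrightarrow>
     lebesgue_space \<mu> q F \<le> lebesgue_space \<mu> q G"
    using r by (simp add: N ennreal_powr_mono nn_integral_mono)
  {
    assume F: "F \<in> borel_measurable borel" and c: "0 < c"
    have cF: "(\<lambda>x. ennreal c * F x) \<in> borel_measurable borel"
      by (intro borel_measurable_times_ennreal borel_measurable_const F)
    have "(\<integral>\<^sup>+ x. ennreal_powr (ennreal c * F x) r \<partial>\<mu>) = ennreal_powr (ennreal c) r * (\<integral>\<^sup>+ x. ennreal_powr (F x) r \<partial>\<mu>)"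
      unfolding ennreal_powr_mult[OF r] by (rule nn_integral_cmult) (use F in \<open>simp add: measurable_ennreal_powr\<close>)
    then show "lebesgue_space \<mu> q (\<lambda>x. ennreal c * F x) = ennreal c * lebesgue_space \<mu> q F"
      using r by (simp only: N[OF F] N[OF cF] ennreal_powr_mult[of "1/r"] zero_less_divide_1_iff ennreal_powr_inverse)
  next
    assume F: "F \<in> borel_measurable borel"
    have mt: "(\<lambda>x. b + x) \<in> borel_measurable borel"
      by (intro borel_measurable_continuous_onI continuous_intros)
    have Fb: "(\<lambda>x. F (b + x)) \<in> borel_measurable borel" by (rule measurable_compose[OF mt F])
    show "lebesgue_space \<mu> q (\<lambda>x. F (b + x)) = lebesgue_space \<mu> q F"
      unfolding N[OF F] N[OF Fb] using nn_integral_translate[of "\<lambda>x. ennreal_powr (F x) r" b] F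
      by (simp add: measurable_ennreal_powr)
  next
    assume F: "lsc F" and a: "a < lebesgue_space \<mu> q F"
    have m: "F \<in> borel_measurable borel" by (rule lsc_measurable[OF F])
    have "ennreal_powr a r < (\<integral>\<^sup>+ x. ennreal_powr (F x) r \<partial>\<mu>)"
      using a r unfolding N[OF m] by (simp add: ennreal_powr_less_iff)
    then obtain K where K: "compact K" "ennreal_powr a r < (\<integral>\<^sup>+ x. ennreal_powr (F x) r * indicator K x \<partial>\<mu>)"
      using lsc_nn_integral_inner[OF lsc_ennreal_powr[OF F r]] by blast
    have mK: "(\<lambda>x. F x * indicator K x) \<in> borel_measurable borel" using m K(1) by simp
    have "ennreal_powr (F x) r * indicator K x = ennreal_powr (F x * indicator K x) r" for x
      by (simp add: indicator_def)
    then have "a < lebesgue_space \<mu> q (\<lambda>x. F x * indicator K x)"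
      using K(2) r unfolding N[OF mK] by (simp add: ennreal_powr_less_iff)
    then show "\<exists>K. compact K \<and> a < lebesgue_space \<mu> q (\<lambda>x. F x * indicator K x)" using K(1) by blast
  next
    assume F: "F \<in> borel_measurable borel" and z: "lebesgue_space \<mu> q F = 0"
    then have "(\<integral>\<^sup>+ x. ennreal_powr (F x) r \<partial>\<mu>) = 0" unfolding N[OF F] by simp
    then have "AE x in \<mu>. ennreal_powr (F x) r = 0"
      using F by (subst (asm) nn_integral_0_iff_AE) (simp_all add: measurable_ennreal_powr)
    then show "AE x in \<mu>. F x = 0" by simp
  next
    assume K: "compact K"
    then have m: "(indicator K :: 'g \<Rightarrow> ennreal) \<in> borel_measurable borel" by simp
    have "(\<integral>\<^sup>+ x. ennreal_powr (indicator K x) r \<partial>\<mu>) = (\<integral>\<^sup>+ x. indicator K x \<partial>\<mu>)"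
      by (intro nn_integral_cong) (simp add: indicator_def)
    also have "\<dots> = emeasure \<mu> K" using K by simp
    finally show "lebesgue_space \<mu> q (indicator K) < top" unfolding N[OF m] using finite_compact[OF K] by simp
  }
qed

text \<open>The rearrangement disappears: the quasi-norm is the supremum of
  \<open>t powr (1 / p) * b\<close> over pairs for which the superlevel set at \<open>b\<close> has
  measure larger than \<open>t\<close>.\<close>

lemma less_weak_lebesgue_iff:
  assumes F: "F \<in> borel_measurable borel" and p: "p > 0"
  shows "a < weak_lebesgue_space \<mu> p F \<longleftrightarrow>
    (\<exists>t>0. \<exists>b. a < ennreal (t powr (1 / p)) * b \<and> ennreal t < emeasure \<mu> {x. b < F x})"
proof
  assume "a < weak_lebesgue_space \<mu> p F"
  then obtain t where t: "t > 0" "a < ennreal (t powr (1 / p)) * rearrangement \<mu> F t"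
    using F unfolding weak_lebesgue_space_def by (auto simp: less_SUP_iff)
  \<comment> \<open>Lowering both factors slightly leaves \<open>b\<close> strictly below the
    infimum that defines the rearrangement, so \<open>b\<close> is outside the set over which it is
    taken.\<close>
  obtain c b where cb: "c < ennreal (t powr (1 / p))" "b < rearrangement \<mu> F t" "a < c * b"
    using ennreal_less_mult_split[OF t(2)] by metis
  have "a < ennreal (t powr (1 / p)) * b"
    using cb(1,3) mult_right_mono[of c "ennreal (t powr (1 / p))" b] by (simp add: less_le_trans)
  moreover have "ennreal t < emeasure \<mu> {x. b < F x}"
  proof (rule ccontr)
    assume "\<not> ?thesis"
    then have "rearrangement \<mu> F t \<le> b"
      unfolding rearrangement_def distribution_fun_def by (intro Inf_lower) simp
    then show False using cb(2) by simp
  qed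
  ultimately show "\<exists>t>0. \<exists>b. a < ennreal (t powr (1 / p)) * b \<and> ennreal t < emeasure \<mu> {x. b < F x}"
    using t(1) by blast
next
  assume "\<exists>t>0. \<exists>b. a < ennreal (t powr (1 / p)) * b \<and> ennreal t < emeasure \<mu> {x. b < F x}"
  then obtain t b where t: "t > 0" "a < ennreal (t powr (1 / p)) * b" "ennreal t < emeasure \<mu> {x. b < F x}" by blast
  have "b \<le> rearrangement \<mu> F t"
    unfolding rearrangement_def
  proof (rule Inf_greatest)
    fix s assume "s \<in> {s. distribution_fun \<mu> F s \<le> ennreal t}"
    then have s: "emeasure \<mu> {x. s < F x} < emeasure \<mu> {x. b < F x}"
      using t(3) unfolding distribution_fun_def by simp
    show "b \<le> s"
    proof (rule ccontr)
      assume "\<not> b \<le> s"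
      then have "{x. b < F x} \<subseteq> {x. s < F x}" by auto
      then have "emeasure \<mu> {x. b < F x} \<le> emeasure \<mu> {x. s < F x}"
        using F by (intro emeasure_mono) (auto intro: borel_superlevel)
      then show False using s by simp
    qed
  qed
  then have "a < ennreal (t powr (1 / p)) * rearrangement \<mu> F t"
    using t(2) mult_left_mono[of b "rearrangement \<mu> F t" "ennreal (t powr (1 / p))"] by (simp add: less_le_trans)
  then show "a < weak_lebesgue_space \<mu> p F"
    using F t(1) unfolding weak_lebesgue_space_def by (auto simp: less_SUP_iff)
qed

lemma ennreal_less_cmult_iff:
  assumes c: "0 < c" shows "t < ennreal c * y \<longleftrightarrow> ennreal (1 / c) * t < y"
proof
  assume "t < ennreal c * y"
  then have "ennreal (1 / c) * t < ennreal (1 / c) * (ennreal c * y)"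
    using c by (intro ennreal_mult_strict_left_mono) auto
  then show "ennreal (1 / c) * t < y" using c by (simp add: mult.assoc[symmetric] flip: ennreal_mult)
next
  assume "ennreal (1 / c) * t < y"
  then have "ennreal c * (ennreal (1 / c) * t) < ennreal c * y"
    using c by (intro ennreal_mult_strict_left_mono) auto
  then show "t < ennreal c * y" using c by (simp add: mult.assoc[symmetric] flip: ennreal_mult)
qed

lemma invariant_norm_weak_lebesgue:
  assumes p: "0 < p" shows "invariant_norm \<mu> (weak_lebesgue_space \<mu> p)"
proof
  note N = less_weak_lebesgue_iff[OF _ p]
  fix F G :: "'g \<Rightarrow> ennreal" and a :: ennreal and c :: real and b :: 'g and K :: "'g set"
  show "F \<notin> borel_measurable borel \<Longrightarrow> weak_lebesgue_space \<mu> p F = top"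
    by (simp add: weak_lebesgue_space_def)
  {
    assume F: "F \<in> borel_measurable borel" and G: "G \<in> borel_measurable borel" and le: "\<And>x. F x \<le> G x"
    show "weak_lebesgue_space \<mu> p F \<le> weak_lebesgue_space \<mu> p G"
    proof (rule dense_le)
      fix a assume "a < weak_lebesgue_space \<mu> p F"
      then obtain t b where t: "t > 0" "a < ennreal (t powr (1 / p)) * b" "ennreal t < emeasure \<mu> {x. b < F x}"
        unfolding N[OF F] by blast
      have "emeasure \<mu> {x. b < F x} \<le> emeasure \<mu> {x. b < G x}"
        using G le by (intro emeasure_mono) (auto intro: less_le_trans borel_superlevel)
      then have "ennreal t < emeasure \<mu> {x. b < G x}" using t(3) by simp
      then have "a < weak_lebesgue_space \<mu> p G" unfolding N[OF G] using t by blast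
      then show "a \<le> weak_lebesgue_space \<mu> p G" by simp
    qed
  next
    assume F: "F \<in> borel_measurable borel" and c: "0 < c"
    have cF: "(\<lambda>x. ennreal c * F x) \<in> borel_measurable borel"
      by (intro borel_measurable_times_ennreal borel_measurable_const F)
    have cc: "ennreal (1 / c) * (ennreal c * y) = y" "ennreal c * (ennreal (1 / c) * y) = y" for y
      using c by (simp_all add: mult.assoc[symmetric] flip: ennreal_mult)
    have "t < weak_lebesgue_space \<mu> p (\<lambda>x. ennreal c * F x) \<longleftrightarrow> t < ennreal c * weak_lebesgue_space \<mu> p F" for t
    proof
      assume "t < weak_lebesgue_space \<mu> p (\<lambda>x. ennreal c * F x)"
      then obtain s b where s: "s > 0" "t < ennreal (s powr (1 / p)) * b" "ennreal s < emeasure \<mu> {x. b < ennreal c * F x}"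
        unfolding N[OF cF] by blast
      have "t < ennreal c * (ennreal (s powr (1 / p)) * (ennreal (1 / c) * b))"
        using s(2) cc(2)[of b] by (metis mult.left_commute)
      then have "ennreal (1 / c) * t < ennreal (s powr (1 / p)) * (ennreal (1 / c) * b)"
        unfolding ennreal_less_cmult_iff[OF c] .
      moreover have "ennreal s < emeasure \<mu> {x. ennreal (1 / c) * b < F x}"
        using s(3) unfolding ennreal_less_cmult_iff[OF c] .
      ultimately show "t < ennreal c * weak_lebesgue_space \<mu> p F"
        unfolding ennreal_less_cmult_iff[OF c] N[OF F] using s(1) by blast
    next
      assume "t < ennreal c * weak_lebesgue_space \<mu> p F"
      then obtain s b where s: "s > 0" "ennreal (1 / c) * t < ennreal (s powr (1 / p)) * b" "ennreal s < emeasure \<mu> {x. b < F x}"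
        unfolding ennreal_less_cmult_iff[OF c] N[OF F] by blast
      have "t < ennreal c * (ennreal (s powr (1 / p)) * b)" using s(2) unfolding ennreal_less_cmult_iff[OF c] .
      then have "t < ennreal (s powr (1 / p)) * (ennreal c * b)" by (simp add: mult.left_commute)
      moreover have "ennreal s < emeasure \<mu> {x. ennreal c * b < ennreal c * F x}"
        using s(3) unfolding ennreal_less_cmult_iff[OF c] cc(1) .
      ultimately show "t < weak_lebesgue_space \<mu> p (\<lambda>x. ennreal c * F x)"
        unfolding N[OF cF] using s(1) by blast
    qed
    then show "weak_lebesgue_space \<mu> p (\<lambda>x. ennreal c * F x) = ennreal c * weak_lebesgue_space \<mu> p F"
      by (metis less_irrefl not_less_iff_gr_or_eq)
  next
    assume F: "F \<in> borel_measurable borel"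
    have mt: "(\<lambda>x. b + x) \<in> borel_measurable borel"
      by (intro borel_measurable_continuous_onI continuous_intros)
    have Fb: "(\<lambda>x. F (b + x)) \<in> borel_measurable borel" by (rule measurable_compose[OF mt F])
    have "emeasure \<mu> {x. s < F (b + x)} = emeasure \<mu> {x. s < F x}" for s
    proof -
      have "{x. s < F x} \<in> sets borel" by (rule borel_superlevel[OF F])
      from emeasure_vimage_translate[OF this, of b] show ?thesis by (simp add: vimage_def)
    qed
    then have "t < weak_lebesgue_space \<mu> p (\<lambda>x. F (b + x)) \<longleftrightarrow> t < weak_lebesgue_space \<mu> p F" for t
      unfolding N[OF F] N[OF Fb] by simp
    then show "weak_lebesgue_space \<mu> p (\<lambda>x. F (b + x)) = weak_lebesgue_space \<mu> p F"
      by (metis less_irrefl not_less_iff_gr_or_eq)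
  next
    assume F: "lsc F" and a: "a < weak_lebesgue_space \<mu> p F"
    have m: "F \<in> borel_measurable borel" by (rule lsc_measurable[OF F])
    obtain t b where t: "t > 0" "a < ennreal (t powr (1 / p)) * b" "ennreal t < emeasure \<mu> {x. b < F x}"
      using a unfolding N[OF m] by blast
    then obtain K where K: "compact K" "K \<subseteq> {x. b < F x}" "ennreal t < emeasure \<mu> K"
      unfolding inner_regular_open[OF lscD[OF F]] by (auto simp: less_SUP_iff)
    have mK: "(\<lambda>x. F x * indicator K x) \<in> borel_measurable borel" using m K(1) by simp
    have "emeasure \<mu> K \<le> emeasure \<mu> {x. b < F x * indicator K x}"
    proof (rule emeasure_mono)
      show "K \<subseteq> {x. b < F x * indicator K x}" using K(2) by (auto simp: indicator_def)
      show "{x. b < F x * indicator K x} \<in> sets \<mu>" by (simp add: borel_superlevel[OF mK])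
    qed
    then have "a < weak_lebesgue_space \<mu> p (\<lambda>x. F x * indicator K x)"
      unfolding N[OF mK] using t(1,2) K(3) by (meson less_le_trans)
    then show "\<exists>K. compact K \<and> a < weak_lebesgue_space \<mu> p (\<lambda>x. F x * indicator K x)" using K(1) by blast
  next
    assume F: "F \<in> borel_measurable borel" and z: "weak_lebesgue_space \<mu> p F = 0"
    have "emeasure \<mu> {x. b < F x} = 0" if b: "b > 0" for b
    proof (rule ccontr)
      assume "emeasure \<mu> {x. b < F x} \<noteq> 0"
      then obtain u where "0 < u" "u < emeasure \<mu> {x. b < F x}" using dense not_gr_zero by metis
      then obtain t where t: "t > 0" "ennreal t < emeasure \<mu> {x. b < F x}" by (cases u) auto
      have "0 < ennreal (t powr (1 / p)) * b" using t b by (simp add: ennreal_zero_less_mult_iff)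
      then have "0 < weak_lebesgue_space \<mu> p F" unfolding N[OF F] using t by blast
      then show False using z by simp
    qed
    then have "AE x in \<mu>. F x \<le> ennreal (1 / real (Suc n))" for n
      using F by (intro AE_I[where N="{x. ennreal (1 / real (Suc n)) < F x}"]) auto
    then have "AE x in \<mu>. \<forall>n. F x \<le> ennreal (1 / real (Suc n))" by (simp add: AE_all_countable)
    then show "AE x in \<mu>. F x = 0"
    proof eventually_elim
      fix x assume le: "\<forall>n. F x \<le> ennreal (1 / real (Suc n))"
      show "F x = 0"
      proof (rule ccontr)
        assume "F x \<noteq> 0"
        moreover have "F x < top" using le[rule_format, of 0] by (auto intro: le_less_trans)
        ultimately obtain y where y: "F x = ennreal y" "y > 0" by (cases "F x") auto
        obtain n where "1 / real (Suc n) < y" using y(2) nat_approx_posE by blast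
        then show False using le[rule_format, of n] y by (simp add: ennreal_le_iff)
      qed
    qed
  next
    assume K: "compact K"
    then have m: "(indicator K :: 'g \<Rightarrow> ennreal) \<in> borel_measurable borel" by simp
    have Kf: "emeasure \<mu> K < top" by (rule finite_compact[OF K])
    obtain k where k: "emeasure \<mu> K = ennreal k" "k \<ge> 0" using Kf by (cases "emeasure \<mu> K") auto
    have "weak_lebesgue_space \<mu> p (indicator K) \<le> ennreal (k powr (1 / p))"
    proof (rule dense_le)
      fix a assume "a < weak_lebesgue_space \<mu> p (indicator K)"
      then obtain t b where t: "t > 0" "a < ennreal (t powr (1 / p)) * b" "ennreal t < emeasure \<mu> {x. b < indicator K x}"
        unfolding N[OF m] by blast
      have b1: "b < 1"
      proof (rule ccontr)
        assume "\<not> b < 1"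
        then have "{x. b < indicator K x} = {}" by (auto simp: indicator_def split: if_splits)
        then show False using t(3) by simp
      qed
      have "{x. b < indicator K x} \<subseteq> K" by (auto simp: indicator_def split: if_splits)
      then have "emeasure \<mu> {x. b < indicator K x} \<le> ennreal k" unfolding k(1)[symmetric] using K by (intro emeasure_mono) auto
      then have "t \<le> k" using t(3) k(2) t(1) by (meson ennreal_less_iff less_imp_le less_le_trans)
      then have "ennreal (t powr (1 / p)) * b \<le> ennreal (k powr (1 / p)) * 1"
        using t(1) p b1 by (intro mult_mono ennreal_leI powr_mono2) auto
      then show "a \<le> ennreal (k powr (1 / p))" using t(2) by simp
    qed
    then show "weak_lebesgue_space \<mu> p (indicator K) < top" using le_less_trans by fastforce
  }
qed

end

section \<open>Amalgam quasi-norms and the weight of left translations\<close>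

context haar_group
begin

text \<open>Inner regularity is given for open sets only. Inside the compact set \<open>C\<close>,
  outer regularity covers \<open>C - A\<close> by an open set of measure less than that of
  \<open>C\<close>, and its removal leaves a compact part of \<open>A\<close> of positive
  measure.\<close>

lemma inner_positive_compact:
  assumes A: "A \<in> sets borel" "A \<subseteq> C" "compact C" "emeasure \<mu> A \<noteq> 0"
  obtains K where "compact K" "K \<subseteq> A" "emeasure \<mu> K \<noteq> 0"
proof -
  have Cf: "emeasure \<mu> C < top" by (rule finite_compact[OF A(3)])
  have Cb: "C \<in> sets borel" using A(3) by simp
  have D: "C - A \<in> sets borel" using Cb A(1) by simp
  have AC: "emeasure \<mu> C = emeasure \<mu> (C - A) + emeasure \<mu> A"
  proof -
    have "(C - A) \<inter> A = {}" "(C - A) \<union> A = C" using A(2) by blast+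
    then show ?thesis using plus_emeasure[of "C - A" \<mu> A] D A(1) by simp
  qed
  have "emeasure \<mu> (C - A) < top"
    by (rule le_less_trans[OF emeasure_mono Cf]) (use Cb in auto)
  then have "emeasure \<mu> (C - A) < emeasure \<mu> C"
    unfolding AC using A(4) by (simp add: ennreal_add_left_cancel_less[of _ 0, simplified] zero_less_iff_neq_zero)
  then obtain O' where O': "open O'" "C - A \<subseteq> O'" "emeasure \<mu> O' < emeasure \<mu> C"
    unfolding outer_regular[OF D] by (auto simp: INF_less_iff)
  have "compact (C - O')" using A(3) O'(1) by (rule compact_diff)
  moreover have "C - O' \<subseteq> A" using O'(2) by blast
  moreover have "emeasure \<mu> (C - O') \<noteq> 0"
  proof
    assume z: "emeasure \<mu> (C - O') = 0"
    have "emeasure \<mu> C \<le> emeasure \<mu> (C - O') + emeasure \<mu> O'"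
    proof -
      have "emeasure \<mu> C \<le> emeasure \<mu> ((C - O') \<union> O')" using Cb O'(1) by (intro emeasure_mono) auto
      also have "\<dots> \<le> emeasure \<mu> (C - O') + emeasure \<mu> O'" using Cb O'(1) by (intro emeasure_subadditive) auto
      finally show ?thesis .
    qed
    then show False using z O'(3) by simp
  qed
  ultimately show ?thesis using that by blast
qed

text \<open>A Steinhaus argument: an open set around \<open>K\<close> with less than twice the
  measure of \<open>K\<close> contains the nearby translates of \<open>K\<close> as well, and two
  essentially disjoint copies do not fit into it.\<close>

lemma translate_overlap:
  assumes K: "compact K" "emeasure \<mu> K \<noteq> 0"
  obtains X where "open X" "(0::'g) \<in> X" "\<And>x. x \<in> X \<Longrightarrow> emeasure \<mu> ((\<lambda>y. x + y) -` K \<inter> K) \<noteq> 0"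
proof -
  have Kf: "emeasure \<mu> K < top" by (rule finite_compact[OF K(1)])
  have Kb: "K \<in> sets borel" using K(1) by simp
  have "emeasure \<mu> K < emeasure \<mu> K + emeasure \<mu> K"
    using Kf K(2) by (simp add: ennreal_add_left_cancel_less[of _ 0, simplified] zero_less_iff_neq_zero)
  then obtain U where U: "open U" "K \<subseteq> U" "emeasure \<mu> U < emeasure \<mu> K + emeasure \<mu> K"
    by (subst (asm) (1) outer_regular[OF Kb]) (auto simp: INF_less_iff)
  have "open ((\<lambda>p. - fst p + snd p) -` U)" by (intro open_vimage U continuous_intros)
  moreover have "{0} \<times> K \<subseteq> (\<lambda>p. - fst p + snd p) -` U" using U(2) by auto
  ultimately obtain X where X: "0 \<in> X" "open X" "X \<times> K \<subseteq> (\<lambda>p. - fst p + snd p) -` U"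
    using Elementary_Topology.tube_lemma[OF K(1), of "(\<lambda>p. - fst p + snd p) -` U" 0] by blast
  have "emeasure \<mu> ((\<lambda>y. x + y) -` K \<inter> K) \<noteq> 0" if x: "x \<in> X" for x
  proof
    assume z: "emeasure \<mu> ((\<lambda>y. x + y) -` K \<inter> K) = 0"
    have e: "emeasure \<mu> ((+) x -` K) = emeasure \<mu> K" by (rule emeasure_vimage_translate[OF Kb])
    have vb: "(+) x -` K \<in> sets borel"
      by (rule measurable_sets_borel[OF borel_measurable_continuous_onI Kb]) (intro continuous_intros)
    have sub: "(+) x -` K \<subseteq> U"
    proof
      fix y assume "y \<in> (+) x -` K"
      then have "(x, x + y) \<in> X \<times> K" using x by simp
      then have "- x + (x + y) \<in> U" using X(3) by auto
      then show "y \<in> U" by (simp add: add.assoc[symmetric])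
    qed
    have "emeasure \<mu> ((+) x -` K) + emeasure \<mu> (K - (+) x -` K) = emeasure \<mu> ((+) x -` K \<union> (K - (+) x -` K))"
      using vb Kb by (intro plus_emeasure) auto
    also have "\<dots> \<le> emeasure \<mu> U" using sub U(1,2) by (intro emeasure_mono) auto
    finally have 1: "emeasure \<mu> K + emeasure \<mu> (K - (+) x -` K) \<le> emeasure \<mu> U" unfolding e .
    have "emeasure \<mu> K \<le> emeasure \<mu> (((+) x -` K \<inter> K) \<union> (K - (+) x -` K))"
      using vb Kb by (intro emeasure_mono) auto
    also have "\<dots> \<le> emeasure \<mu> ((+) x -` K \<inter> K) + emeasure \<mu> (K - (+) x -` K)"
      using vb Kb by (intro emeasure_subadditive) auto
    finally have "emeasure \<mu> K \<le> emeasure \<mu> (K - (+) x -` K)" using z by simp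
    then have "emeasure \<mu> K + emeasure \<mu> K \<le> emeasure \<mu> K + emeasure \<mu> (K - (+) x -` K)" by (rule add_left_mono)
    then have "emeasure \<mu> K + emeasure \<mu> K \<le> emeasure \<mu> U" using 1 by (rule order_trans)
    then show False using U(3) by simp
  qed
  then show ?thesis using that X by blast
qed

lemma borel_indicator_mult:
  "A \<in> sets borel \<Longrightarrow> F \<in> borel_measurable borel \<Longrightarrow> (\<lambda>y. indicator A y * F y :: ennreal) \<in> borel_measurable borel"
  by (intro borel_measurable_times_ennreal borel_measurable_indicator)

lemma less_control_fun_iff:
  assumes Q: "Q \<in> sets borel" and F: "F \<in> borel_measurable borel"
  shows "a < control_fun \<mu> Q F x \<longleftrightarrow> emeasure \<mu> ((+) x ` Q \<inter> {y. a < F y}) \<noteq> 0"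
proof -
  have "{y. a < indicator ((+) x ` Q) y * F y} = (+) x ` Q \<inter> {y. a < F y}"
    by (auto simp: indicator_def split: if_splits)
  then show ?thesis
    unfolding control_fun_def by (subst less_esssup_iff) (auto intro: borel_indicator_mult borel_translation_left Q F)
qed

lemma control_fun_translate:
  assumes Q: "Q \<in> sets borel" and F: "F \<in> borel_measurable borel"
  shows "control_fun \<mu> Q (\<lambda>y. F (a + y)) x = control_fun \<mu> Q F (a + x)"
proof -
  have mt: "(\<lambda>x. a + x) \<in> borel_measurable borel"
    by (intro borel_measurable_continuous_onI continuous_intros)
  have Fa: "(\<lambda>y. F (a + y)) \<in> borel_measurable borel" by (rule measurable_compose[OF mt F])
  have "t < control_fun \<mu> Q (\<lambda>y. F (a + y)) x \<longleftrightarrow> t < control_fun \<mu> Q F (a + x)" for t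
  proof -
    have b: "(+) (a + x) ` Q \<inter> {y. t < F y} \<in> sets borel"
      by (intro sets.Int borel_translation_left Q borel_superlevel F)
    have "(+) a -` ((+) (a + x) ` Q \<inter> {y. t < F y}) = (+) x ` Q \<inter> {y. t < F (a + y)}"
    proof -
      have e: "- (a + x) + (a + y) = - x + y" for y by (simp only: minus_add add.assoc minus_add_cancel)
      show ?thesis unfolding plus_image_eq_vimage
        by (rule set_eqI) (simp only: vimage_eq Int_iff mem_Collect_eq e)
    qed
    then show ?thesis
      unfolding less_control_fun_iff[OF Q F] less_control_fun_iff[OF Q Fa]
      using emeasure_vimage_translate[OF b, of a] by simp
  qed
  then show ?thesis by (metis less_irrefl not_less_iff_gr_or_eq)
qed

text \<open>The set responsible for a large value at \<open>x\<close> contains a compact set of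
  positive measure. Pulled back to \<open>Q\<close>, it overlaps its small translates by
  \<open>translate_overlap\<close>, so nearby values stay large. Even merely measurable functions
  thus have control functions covered by the lower semicontinuous theory.\<close>

lemma lsc_control_fun:
  assumes Q: "rel_compact_nbhd Q" "Q \<in> sets borel" and F: "F \<in> borel_measurable borel"
  shows "lsc (control_fun \<mu> Q F)"
  unfolding lsc_iff_eventually
proof (intro allI impI)
  fix x a assume "a < control_fun \<mu> Q F x"
  then have n: "emeasure \<mu> ((+) x ` Q \<inter> {y. a < F y}) \<noteq> 0" unfolding less_control_fun_iff[OF Q(2) F] .
  have b: "(+) x ` Q \<inter> {y. a < F y} \<in> sets borel" for x
    by (intro sets.Int borel_translation_left Q borel_superlevel F)
  have "(+) x ` Q \<inter> {y. a < F y} \<subseteq> (+) x ` closure Q" using closure_subset by blast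
  moreover have "compact ((+) x ` closure Q)" using Q(1) unfolding rel_compact_nbhd_def by (intro compact_translation_left) blast
  ultimately obtain K where K: "compact K" "K \<subseteq> (+) x ` Q \<inter> {y. a < F y}" "emeasure \<mu> K \<noteq> 0"
    using inner_positive_compact[OF b _ _ n] by metis
  define K' where "K' = (+) (- x) ` K"
  have K': "compact K'" "emeasure \<mu> K' \<noteq> 0" "K' \<subseteq> Q"
    using K left_invariant[of K "- x"] by (auto simp: K'_def compact_translation_left add.assoc[symmetric])
  obtain X where X: "open X" "(0::'g) \<in> X" "\<And>y. y \<in> X \<Longrightarrow> emeasure \<mu> ((\<lambda>z. y + z) -` K' \<inter> K') \<noteq> 0"
    using translate_overlap[OF K'(1,2)] by blast
  have "a < control_fun \<mu> Q F x'" if x': "x' \<in> (\<lambda>x'. - x + x') -` X" for x'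
  proof -
    let ?A = "(\<lambda>z. (- x + x') + z) -` K' \<inter> K'"
    have "emeasure \<mu> ?A \<noteq> 0" using X(3) x' by blast
    moreover have "(+) x' ` ?A \<subseteq> (+) x' ` Q \<inter> {y. a < F y}"
    proof
      fix y assume "y \<in> (+) x' ` ?A"
      then obtain z where z: "y = x' + z" "(- x + x') + z \<in> K'" "z \<in> K'" by auto
      from z(2) have "- x + y \<in> (+) (- x) ` K" using z(1) by (simp add: K'_def add.assoc)
      then have "y \<in> K" by auto
      then show "y \<in> (+) x' ` Q \<inter> {y. a < F y}" using K(2) z K'(3) by auto
    qed
    moreover have Ab: "?A \<in> sets borel"
      using K'(1) by (intro sets.Int measurable_sets_borel[OF borel_measurable_continuous_onI]) (auto intro!: continuous_intros)
    ultimately have "emeasure \<mu> ((+) x' ` Q \<inter> {y. a < F y}) \<noteq> 0"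
      using emeasure_mono[of "(+) x' ` ?A" "(+) x' ` Q \<inter> {y. a < F y}" \<mu>] b[of x'] left_invariant[OF Ab, of x'] by auto
    then show ?thesis unfolding less_control_fun_iff[OF Q(2) F] .
  qed
  moreover have "open ((\<lambda>x'. - x + x') -` X)" by (intro open_vimage X continuous_intros)
  moreover have "x \<in> (\<lambda>x'. - x + x') -` X" using X(2) by simp
  ultimately show "eventually (\<lambda>y. a < control_fun \<mu> Q F y) (nhds x)"
    unfolding eventually_nhds by blast
qed

lemma control_fun_mono:
  assumes "Q \<in> sets borel" "F \<in> borel_measurable borel" "\<And>x. F x \<le> G x"
  shows "control_fun \<mu> Q F x \<le> control_fun \<mu> Q G x"
  unfolding control_fun_def
  by (intro esssup_mono mult_left_mono assms) (auto intro: borel_indicator_mult borel_translation_left assms)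

lemma control_fun_le:
  assumes "Q \<in> sets borel" "F \<in> borel_measurable borel" "\<And>y. y \<in> Q \<Longrightarrow> F (x + y) \<le> c"
  shows "control_fun \<mu> Q F x \<le> c"
proof -
  have "(\<lambda>y. indicator ((+) x ` Q) y * F y) \<in> borel_measurable \<mu>"
    unfolding borel_measurable_haar by (intro borel_indicator_mult borel_translation_left assms)
  then show ?thesis unfolding control_fun_def
    by (rule esssup_I) (use assms(3) in \<open>auto simp: indicator_def\<close>)
qed

text \<open>An essential supremum over an open set sees every value of a lower semicontinuous
  function, because nonempty open sets have positive measure; hence the interior of
  \<open>Q\<close>.\<close>

lemma le_control_fun:
  assumes Q: "Q \<in> sets borel" and F: "lsc F" and y: "y \<in> interior Q"
  shows "F (x + y) \<le> control_fun \<mu> Q F x"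
proof (rule dense_le)
  fix a assume a: "a < F (x + y)"
  have m: "F \<in> borel_measurable borel" by (rule lsc_measurable[OF F])
  have o: "open ((+) x ` interior Q \<inter> {y. a < F y})" by (intro open_Int open_translation_left lscD F open_interior)
  have "x + y \<in> (+) x ` interior Q \<inter> {y. a < F y}" using a y by auto
  then have "0 < emeasure \<mu> ((+) x ` interior Q \<inter> {y. a < F y})" using positive_open[OF o] by blast
  also have "\<dots> \<le> emeasure \<mu> ((+) x ` Q \<inter> {y. a < F y})"
    using interior_subset[of Q]
    by (intro emeasure_mono) (auto intro!: sets.Int borel_translation_left Q borel_superlevel m)
  finally have "a < control_fun \<mu> Q F x" unfolding less_control_fun_iff[OF Q m] by simp
  then show "a \<le> control_fun \<mu> Q F x" by simp
qed

lemma control_fun_cmult: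
  assumes "Q \<in> sets borel" "F \<in> borel_measurable borel" "0 < c"
  shows "control_fun \<mu> Q (\<lambda>x. ennreal c * F x) x = ennreal c * control_fun \<mu> Q F x"
proof -
  have m: "(\<lambda>x. ennreal c * F x) \<in> borel_measurable borel" by (intro borel_measurable_times_ennreal borel_measurable_const assms)
  have "t < control_fun \<mu> Q (\<lambda>x. ennreal c * F x) x \<longleftrightarrow> t < ennreal c * control_fun \<mu> Q F x" for t
    unfolding less_control_fun_iff[OF assms(1) m] ennreal_less_cmult_iff[OF assms(3)] less_control_fun_iff[OF assms(1,2)] ..
  then show ?thesis by (metis less_irrefl not_less_iff_gr_or_eq)
qed

end

section \<open>Amalgams over a weighted invariant norm\<close>

locale amalgam_space = invariant_norm \<mu> N
  for \<mu> :: "'g::{topological_group_add,t2_space} measure" and N :: "'g solid" +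
  fixes Q :: "'g set" and w m :: "'g \<Rightarrow> real"
  assumes Q_nbhd: "rel_compact_nbhd Q" and Q_borel: "Q \<in> sets borel"
    and w_weight: "weight w" and m_weight: "weight m" and moderate: "moderate w m"
begin

abbreviation Y :: "'g solid" where "Y \<equiv> weighted (\<lambda>x. ennreal (m x)) N"
abbreviation W :: "('g \<Rightarrow> ennreal) \<Rightarrow> ennreal" where "W \<equiv> amalgam \<mu> Q Y"

lemma m_pos: "0 < m x" and w_pos: "0 < w x" and m_cont: "continuous_on UNIV m" and w_cont: "continuous_on UNIV w"
  using w_weight m_weight unfolding weight_def by auto

lemma m_moderate: "m (x + y + z) \<le> w x * m y * w z"
  using moderate unfolding moderate_def by blast

lemma lsc_m: "lsc (\<lambda>x. ennreal (m (a + x)))"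
  by (intro lsc_ennreal_continuous continuous_on_compose2[OF m_cont] continuous_intros) auto

lemma lsc_m': "lsc (\<lambda>x. ennreal (m x))"
  by (intro lsc_ennreal_continuous m_cont)

lemma Y_eq: "Y F = N (\<lambda>x. F x * ennreal (m x))"
  by (simp add: weighted_def)

lemma Y_mono: "F \<in> borel_measurable borel \<Longrightarrow> G \<in> borel_measurable borel \<Longrightarrow> (\<And>x. F x \<le> G x) \<Longrightarrow> Y F \<le> Y G"
  unfolding Y_eq by (intro N_mono borel_measurable_times_ennreal mult_right_mono lsc_measurable[OF lsc_m']) auto

lemma Y_cmult: "F \<in> borel_measurable borel \<Longrightarrow> 0 < c \<Longrightarrow> Y (\<lambda>x. ennreal c * F x) = ennreal c * Y F"
  unfolding Y_eq mult.assoc by (intro N_cmult borel_measurable_times_ennreal lsc_measurable[OF lsc_m'])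

lemma lsc_control: "F \<in> borel_measurable borel \<Longrightarrow> lsc (control_fun \<mu> Q F)"
  by (rule lsc_control_fun[OF Q_nbhd Q_borel])

lemma control_measurable: "F \<in> borel_measurable borel \<Longrightarrow> control_fun \<mu> Q F \<in> borel_measurable borel"
  by (rule lsc_measurable[OF lsc_control])

lemma N_finite_AE:
  assumes F: "F \<in> borel_measurable borel" and fin: "N F < top"
  shows "AE x in \<mu>. F x < top"
proof -
  let ?E = "{x. F x = top}"
  have Eb: "?E \<in> sets borel"
    using borel_measurable_eq[OF F borel_measurable_const, of top] by (simp only: space_borel UNIV_I simp_thms)
  have Em: "(indicator ?E :: 'g \<Rightarrow> ennreal) \<in> borel_measurable borel" using Eb by (rule borel_measurable_indicator)
  obtain r where r: "N F = ennreal r" "r \<ge> 0" using fin by (cases "N F") auto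
  \<comment> \<open>Every multiple of the indicator of the set where \<open>F\<close> is infinite
    lies below \<open>F\<close>, so homogeneity leaves it only the norm zero.\<close>
  have le: "ennreal c * N (indicator ?E) \<le> N F" if c: "c > 0" for c
  proof -
    have "ennreal c * N (indicator ?E) = N (\<lambda>x. ennreal c * indicator ?E x)" by (rule N_cmult[OF Em c, symmetric])
    also have "\<dots> \<le> N F"
    proof (rule N_mono)
      show "(\<lambda>x. ennreal c * indicator ?E x) \<in> borel_measurable borel"
        by (rule borel_measurable_times_ennreal[OF borel_measurable_const Em])
      show "F \<in> borel_measurable borel" by (rule F)
      show "ennreal c * indicator ?E x \<le> F x" for x by (simp add: indicator_def)
    qed
    finally show ?thesis .
  qed
  have "N (indicator ?E) = 0"
  proof (rule ccontr)
    assume n: "N (indicator ?E) \<noteq> 0"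
    have "N (indicator ?E) < top" using le[of 1] fin by simp
    then obtain e where e: "N (indicator ?E) = ennreal e" "e > 0" using n by (cases "N (indicator ?E)") auto
    have "ennreal ((r + 1) / e) * ennreal e \<le> ennreal r" using le[of "(r + 1) / e"] e r by simp
    then have "ennreal (r + 1) \<le> ennreal r" using e r by (simp flip: ennreal_mult)
    then show False using r by (simp add: ennreal_le_iff)
  qed
  from N_zero[OF Em this] show ?thesis
    by eventually_elim (auto simp: indicator_def less_top split: if_splits)
qed

lemma W_eq:
  assumes "F \<in> borel_measurable borel" "\<And>K. compact K \<Longrightarrow> esssup \<mu> (\<lambda>y. indicator K y * F y) < top"
  shows "W F = Y (control_fun \<mu> Q F)"
  using assms by (simp add: amalgam_def)

lemma W_finite_D:
  assumes "W F < top"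
  shows "F \<in> borel_measurable borel" "\<And>K. compact K \<Longrightarrow> esssup \<mu> (\<lambda>y. indicator K y * F y) < top"
    "W F = Y (control_fun \<mu> Q F)"
  using assms by (auto simp: amalgam_def split: if_splits)

lemma Y_le_W: "Y (control_fun \<mu> Q F) \<le> W F"
  by (simp add: amalgam_def)

text \<open>A finite norm makes the control function finite almost everywhere, hence at some point
  near any given one. Finitely many such values bound \<open>F\<close> on a compact set.\<close>

lemma lsc_locally_bounded:
  assumes F: "lsc F" and fin: "Y (control_fun \<mu> Q F) < top" and K: "compact K"
  obtains B where "B < top" "\<And>x. x \<in> K \<Longrightarrow> F x \<le> B"
proof -
  have mF: "F \<in> borel_measurable borel" by (rule lsc_measurable[OF F])
  have "AE x in \<mu>. control_fun \<mu> Q F x * ennreal (m x) < top"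
    using fin unfolding Y_eq
    by (intro N_finite_AE borel_measurable_times_ennreal control_measurable mF lsc_measurable[OF lsc_m'])
  then have ae: "AE x in \<mu>. control_fun \<mu> Q F x < top"
    by eventually_elim (metis ennreal_mult_eq_top_iff less_top ennreal_eq_0_iff m_pos not_le)
  have "\<exists>x. y \<in> (+) x ` interior Q \<and> control_fun \<mu> Q F x < top" for y
  proof (rule ccontr)
    assume n: "\<not> ?thesis"
    let ?O = "(\<lambda>x. - x + y) -` interior Q"
    have o: "open ?O" by (intro open_vimage continuous_intros open_interior)
    have "y \<in> ?O" using Q_nbhd unfolding rel_compact_nbhd_def by simp
    then have pos: "0 < emeasure \<mu> ?O" using positive_open[OF o] by blast
    have "\<not> control_fun \<mu> Q F x < top" if "x \<in> ?O" for x
      using n that by (auto simp: plus_image_eq_vimage)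
    then have "AE x in \<mu>. x \<notin> ?O" using ae by (auto elim!: eventually_mono)
    then have "?O \<in> null_sets \<mu>" using AE_iff_null_sets[of ?O \<mu>] borel_open[OF o] by simp
    then have "emeasure \<mu> ?O = 0" by blast
    then show False using pos by simp
  qed
  then obtain g where g: "\<And>y. y \<in> (+) (g y) ` interior Q" "\<And>y. control_fun \<mu> Q F (g y) < top" by metis
  have "K \<subseteq> (\<Union>y\<in>K. (+) (g y) ` interior Q)" using g(1) by blast
  from compactE_image[OF K open_translation_left[OF open_interior] this]
  obtain D where D: "D \<subseteq> K" "finite D" "K \<subseteq> (\<Union>y\<in>D. (+) (g y) ` interior Q)" by blast
  show ?thesis
  proof (rule that[of "\<Sum>y\<in>D. control_fun \<mu> Q F (g y)"])
    show "(\<Sum>y\<in>D. control_fun \<mu> Q F (g y)) < top" using D(2) g(2) by simp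
    fix x assume "x \<in> K"
    then obtain y z where y: "y \<in> D" "z \<in> interior Q" "x = g y + z" using D(3) by blast
    have "F x \<le> control_fun \<mu> Q F (g y)" unfolding y(3) by (rule le_control_fun[OF Q_borel F y(2)])
    also have "\<dots> \<le> (\<Sum>y\<in>D. control_fun \<mu> Q F (g y))" using D(2) y(1) by (intro member_le_sum) auto
    finally show "F x \<le> (\<Sum>y\<in>D. control_fun \<mu> Q F (g y))" .
  qed
qed

text \<open>The definition of \<open>amalgam\<close> also demands local boundedness of
  \<open>F\<close>; a lower semicontinuous majorant of finite control norm supplies it.\<close>

lemma W_le:
  assumes F: "F \<in> borel_measurable borel" and G: "lsc G" and le: "\<And>x. F x \<le> G x"
  shows "W F \<le> Y (control_fun \<mu> Q G)"
proof (cases "Y (control_fun \<mu> Q G) < top")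
  case True
  have mG: "G \<in> borel_measurable borel" by (rule lsc_measurable[OF G])
  have "esssup \<mu> (\<lambda>y. indicator K y * F y) < top" if K: "compact K" for K
  proof -
    obtain B where B: "B < top" "\<And>x. x \<in> K \<Longrightarrow> G x \<le> B" using lsc_locally_bounded[OF G True K] by blast
    have "esssup \<mu> (\<lambda>y. indicator K y * F y) \<le> B"
    proof (intro esssup_I AE_I2)
      show "(\<lambda>y. indicator K y * F y) \<in> borel_measurable \<mu>"
        unfolding borel_measurable_haar using K by (intro borel_indicator_mult F) simp
      fix x show "indicator K x * F x \<le> B"
        using B(2)[of x] order_trans[OF le[of x]] by (cases "x \<in> K") auto
    qed
    then show ?thesis using B(1) by simp
  qed
  then have "W F = Y (control_fun \<mu> Q F)" by (intro W_eq F)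
  also have "\<dots> \<le> Y (control_fun \<mu> Q G)"
    by (intro Y_mono control_measurable F mG control_fun_mono Q_borel le)
  finally show ?thesis .
next
  case False
  then have "Y (control_fun \<mu> Q G) = top" using less_top by blast
  then show ?thesis by simp
qed

lemma W_lsc: "lsc F \<Longrightarrow> W F = Y (control_fun \<mu> Q F)"
  by (intro antisym W_le Y_le_W lsc_measurable) auto

lemma abs_fun_measurable: "F \<in> borel_measurable borel \<Longrightarrow> abs_fun F \<in> borel_measurable borel"
  unfolding abs_fun_def by simp

text \<open>Left invariance of \<open>N\<close> moves the translation from the function to the
  continuous weight \<open>m\<close>.\<close>

lemma qnorm_left_translate:
  assumes "qnorm \<mu> W F < top"
  shows "qnorm \<mu> W (left_translate (- x) F) = N (\<lambda>y. control_fun \<mu> Q (abs_fun F) y * ennreal (m (- x + y)))"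
proof -
  have F: "F \<in> borel_measurable borel" "W (abs_fun F) < top"
    using assms by (auto simp: qnorm_def split: if_splits)
  have mF: "abs_fun F \<in> borel_measurable borel" by (rule abs_fun_measurable[OF F(1)])
  have mt: "(\<lambda>y. x + y) \<in> borel_measurable borel"
    by (intro borel_measurable_continuous_onI continuous_intros)
  have Fx: "(\<lambda>y. F (x + y)) \<in> borel_measurable borel" by (rule measurable_compose[OF mt F(1)])
  have mFx: "(\<lambda>y. abs_fun F (x + y)) \<in> borel_measurable borel" by (rule measurable_compose[OF mt mF])
  have lb: "esssup \<mu> (\<lambda>y. indicator K y * abs_fun F (x + y)) < top" if K: "compact K" for K
  proof -
    have K': "compact ((+) x ` K)" by (rule compact_translation_left[OF K])
    have m1: "(\<lambda>y. indicator ((+) x ` K) y * abs_fun F y) \<in> borel_measurable borel"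
      using K' mF by (intro borel_indicator_mult) auto
    have m2: "(\<lambda>y. indicator K y * abs_fun F (x + y)) \<in> borel_measurable borel"
      using K mFx by (intro borel_indicator_mult) auto
    have "t < esssup \<mu> (\<lambda>y. indicator K y * abs_fun F (x + y)) \<longleftrightarrow> t < esssup \<mu> (\<lambda>y. indicator ((+) x ` K) y * abs_fun F y)" for t
    proof -
      have "(+) x -` {y. t < indicator ((+) x ` K) y * abs_fun F y} = {y. t < indicator K y * abs_fun F (x + y)}"
        by (auto simp: indicator_def split: if_splits)
      then show ?thesis
        unfolding less_esssup_iff[OF m1] less_esssup_iff[OF m2]
        using emeasure_vimage_translate[OF borel_superlevel[OF m1], of x t] by simp
    qed
    then show ?thesis using W_finite_D(2)[OF F(2) K'] by (metis less_irrefl not_less_iff_gr_or_eq)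
  qed
  have "qnorm \<mu> W (left_translate (- x) F) = W (\<lambda>y. abs_fun F (x + y))"
    using Fx by (simp add: qnorm_def left_translate_def abs_fun_def)
  also have "\<dots> = Y (control_fun \<mu> Q (\<lambda>y. abs_fun F (x + y)))" by (rule W_eq[OF mFx lb])
  also have "\<dots> = N (\<lambda>y. control_fun \<mu> Q (abs_fun F) (x + y) * ennreal (m (- x + (x + y))))"
    unfolding Y_eq control_fun_translate[OF Q_borel mF] by (simp add: add.assoc[symmetric])
  also have "\<dots> = N (\<lambda>y. control_fun \<mu> Q (abs_fun F) y * ennreal (m (- x + y)))"
    by (rule N_translate) (intro borel_measurable_times_ennreal control_measurable mF lsc_measurable[OF lsc_m])
  finally show ?thesis .
qed

lemma qnorm_eq: "qnorm \<mu> W F < top \<Longrightarrow> qnorm \<mu> W F = N (\<lambda>y. control_fun \<mu> Q (abs_fun F) y * ennreal (m y))"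
  using qnorm_left_translate[of F 0] by (simp add: left_translate_def)

text \<open>Writes \<open>v_weight\<close> as a supremum of functions that depend on
  \<open>x\<close> only through a translate of \<open>m\<close>; this makes it lower
  semicontinuous.\<close>

lemma v_weight_SUP:
  "v_weight \<mu> Q Y x = (SUP F\<in>{F. qnorm \<mu> W F \<le> 1}. max 1 (N (\<lambda>y. control_fun \<mu> Q (abs_fun F) y * ennreal (m (- x + y)))))"
proof -
  \<comment> \<open>The zero function makes the index set nonempty, so that the maximum with 1 may
    be taken inside the supremum.\<close>
  have ne: "(\<lambda>_. 0) \<in> {F. qnorm \<mu> W F \<le> 1}"
  proof -
    have "lsc (\<lambda>x::'g. 0 :: ennreal)" by simp
    from W_lsc[OF this] have "W (\<lambda>x. 0) = Y (control_fun \<mu> Q (\<lambda>x. 0))" .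
    moreover have "control_fun \<mu> Q (\<lambda>x. 0) x = 0" for x
      using control_fun_le[OF Q_borel, of "\<lambda>_. 0" x 0] by simp
    moreover have "N (\<lambda>x. 0) = 0"
    proof -
      have a: "N (\<lambda>x. ennreal 2 * 0) = ennreal 2 * N (\<lambda>x. 0)" by (rule N_cmult) auto
      have "N (\<lambda>x. 0) \<le> N (indicator {})" by (rule N_mono) auto
      then have "N (\<lambda>x. 0) < top" using N_compact[of "{}"] by simp
      then obtain r where r: "N (\<lambda>x. 0) = ennreal r" "r \<ge> 0" by (cases "N (\<lambda>x. 0)") auto
      have "ennreal r = ennreal (2 * r)" using a r by (simp add: ennreal_mult')
      then show ?thesis using r by simp
    qed
    ultimately have "W (\<lambda>x. 0) = 0" by (simp add: Y_eq)
    then show ?thesis by (simp add: qnorm_def abs_fun_def)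
  qed
  have "operator_norm (qnorm \<mu> W) (left_translate (- x)) =
      (SUP F\<in>{F. qnorm \<mu> W F \<le> 1}. N (\<lambda>y. control_fun \<mu> Q (abs_fun F) y * ennreal (m (- x + y))))"
    unfolding operator_norm_def
    by (intro SUP_cong refl qnorm_left_translate) (auto intro: le_less_trans)
  then show ?thesis
    unfolding v_weight_def
  proof (intro antisym max.boundedI)
    let ?f = "\<lambda>F. N (\<lambda>y. control_fun \<mu> Q (abs_fun F) y * ennreal (m (- x + y)))"
    assume e: "operator_norm (qnorm \<mu> W) (left_translate (- x)) = (SUP F\<in>{F. qnorm \<mu> W F \<le> 1}. ?f F)"
    show "1 \<le> (SUP F\<in>{F. qnorm \<mu> W F \<le> 1}. max 1 (?f F))" by (rule SUP_upper2[OF ne]) simp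
    show "operator_norm (qnorm \<mu> W) (left_translate (- x)) \<le> (SUP F\<in>{F. qnorm \<mu> W F \<le> 1}. max 1 (?f F))"
      unfolding e by (rule SUP_mono') simp
    show "(SUP F\<in>{F. qnorm \<mu> W F \<le> 1}. max 1 (?f F)) \<le> max 1 (operator_norm (qnorm \<mu> W) (left_translate (- x)))"
      unfolding e by (intro SUP_least max.mono order_refl SUP_upper)
  qed
qed

text \<open>By \<open>N_inner\<close> a compact set nearly carries the norm. On it the weights for
  nearby \<open>x'\<close> are at least \<open>c < 1\<close> times the weight for \<open>x\<close>,
  uniformly by the tube lemma.\<close>

lemma lsc_N_translated_weight:
  assumes G: "lsc G" shows "lsc (\<lambda>x. N (\<lambda>y. G y * ennreal (m (- x + y))))"
  unfolding lsc_iff_eventually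
proof (intro allI impI)
  fix x a assume a: "a < N (\<lambda>y. G y * ennreal (m (- x + y)))"
  have lG: "lsc (\<lambda>y. G y * ennreal (m (- x + y)))" for x by (intro lsc_mult G lsc_m)
  obtain K where K: "compact K" "a < N (\<lambda>y. G y * ennreal (m (- x + y)) * indicator K y)" (is "_ < ?n")
    using N_inner[OF lG a] by blast
  have mK: "(\<lambda>y. G y * ennreal (m (- x + y)) * indicator K y) \<in> borel_measurable borel"
    using K(1) by (intro borel_measurable_times_ennreal lsc_measurable[OF lG] borel_measurable_indicator) auto
  have "a < 1 * ?n" using K(2) by simp
  then obtain c' d where c': "c' < 1" "d < ?n" "a < c' * d" using ennreal_less_mult_split by blast
  have "c' \<noteq> 0" using c'(3) by auto
  with c'(1) obtain c where c: "c' = ennreal c" "c > 0" "c < 1"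
    by (cases c') (auto simp: ennreal_less_one_iff)
  have ac: "a < ennreal c * ?n"
    using c'(2,3) c(1) mult_left_mono[of d ?n "ennreal c"] by (auto intro: less_le_trans less_imp_le)
  have "open {p. c * m (- x + snd p) < m (- fst p + snd p)}"
    by (intro open_Collect_less continuous_intros continuous_on_compose2[OF m_cont]) auto
  moreover have "{x} \<times> K \<subseteq> {p. c * m (- x + snd p) < m (- fst p + snd p)}"
    using c m_pos by auto
  ultimately obtain X where X: "x \<in> X" "open X" "X \<times> K \<subseteq> {p. c * m (- x + snd p) < m (- fst p + snd p)}"
    using Elementary_Topology.tube_lemma[OF K(1), of "{p. c * m (- x + snd p) < m (- fst p + snd p)}" x] by blast
  have "a < N (\<lambda>y. G y * ennreal (m (- x' + y)))" if x': "x' \<in> X" for x'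
  proof -
    have "ennreal c * ?n = N (\<lambda>y. ennreal c * (G y * ennreal (m (- x + y)) * indicator K y))"
      by (rule N_cmult[OF mK c(2), symmetric])
    also have "\<dots> \<le> N (\<lambda>y. G y * ennreal (m (- x' + y)))"
    proof (rule N_mono)
      show "(\<lambda>y. ennreal c * (G y * ennreal (m (- x + y)) * indicator K y)) \<in> borel_measurable borel"
        by (intro borel_measurable_times_ennreal borel_measurable_const mK[unfolded mult.assoc] mK)
      show "(\<lambda>y. G y * ennreal (m (- x' + y))) \<in> borel_measurable borel" by (rule lsc_measurable[OF lG])
      fix y
      show "ennreal c * (G y * ennreal (m (- x + y)) * indicator K y) \<le> G y * ennreal (m (- x' + y))"
      proof (cases "y \<in> K")
        case True
        then have "c * m (- x + y) \<le> m (- x' + y)" using X(3) x' by fastforce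
        then have "ennreal c * ennreal (m (- x + y)) \<le> ennreal (m (- x' + y))"
          using c(2) m_pos[of "- x + y"] by (simp add: ennreal_leI flip: ennreal_mult)
        from mult_left_mono[OF this, of "G y"] True show ?thesis by (simp add: mult_ac)
      qed simp
    qed
    finally show ?thesis using ac by simp
  qed
  then show "eventually (\<lambda>x. a < N (\<lambda>y. G y * ennreal (m (- x + y)))) (nhds x)"
    unfolding eventually_nhds using X by blast
qed

lemma lsc_v_weight: "lsc (v_weight \<mu> Q Y)"
proof -
  have "lsc (\<lambda>x. max 1 (N (\<lambda>y. control_fun \<mu> Q (abs_fun F) y * ennreal (m (- x + y)))))"
    if "qnorm \<mu> W F \<le> 1" for F
  proof -
    have "F \<in> borel_measurable borel" using that by (auto simp: qnorm_def top_unique split: if_splits)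
    then have l: "lsc (\<lambda>x. N (\<lambda>y. control_fun \<mu> Q (abs_fun F) y * ennreal (m (- x + y))))"
      by (intro lsc_N_translated_weight lsc_control abs_fun_measurable)
    have "{x. a < max 1 (N (\<lambda>y. control_fun \<mu> Q (abs_fun F) y * ennreal (m (- x + y))))}
       = (if a < 1 then UNIV else {x. a < N (\<lambda>y. control_fun \<mu> Q (abs_fun F) y * ennreal (m (- x + y)))})" for a
      by (auto simp: less_max_iff_disj)
    then show ?thesis using lscD[OF l] unfolding lsc_def by simp
  qed
  then have "lsc (\<lambda>x. SUP F\<in>{F. qnorm \<mu> W F \<le> 1}. max 1 (N (\<lambda>y. control_fun \<mu> Q (abs_fun F) y * ennreal (m (- x + y)))))"
    by (intro lsc_SUP) auto
  then show ?thesis by (simp add: v_weight_SUP[abs_def])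
qed

end

definition translation_weight :: "('g::group_add \<Rightarrow> real) \<Rightarrow> 'g \<Rightarrow> ennreal" where
  "translation_weight m x = max 1 (SUP y. ennreal (m (- x + y) / m y))"

section \<open>Equivalence of \<open>v_weight\<close> and \<open>translation_weight\<close>\<close>

context amalgam_space
begin

abbreviation V where "V \<equiv> translation_weight m"

lemma V_ge_1: "1 \<le> V x"
  unfolding translation_weight_def by simp

lemma V_ge: "ennreal (m (- x + y) / m y) \<le> V x"
  unfolding translation_weight_def by (rule max.coboundedI2) (rule SUP_upper, simp)

lemma V_finite: "V x < top"
proof -
  have "m (- x + y) / m y \<le> w (- x) * w 0" for y
    using m_moderate[of "- x" y 0] m_pos[of y] by (simp add: field_simps)
  then have "(SUP y. ennreal (m (- x + y) / m y)) \<le> ennreal (w (- x) * w 0)"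
    by (intro SUP_least ennreal_leI)
  also have "\<dots> < top" by simp
  finally show ?thesis unfolding translation_weight_def by simp
qed

lemma lsc_V: "lsc V"
proof -
  have l: "lsc (\<lambda>x. SUP y. ennreal (m (- x + y) / m y))"
  proof (intro lsc_SUP lsc_ennreal_continuous)
    fix y
    show "continuous_on UNIV (\<lambda>x. m (- x + y) / m y)"
      using m_pos[of y] by (intro continuous_intros continuous_on_compose2[OF m_cont]) auto
  qed
  have "{x. a < V x} = (if a < 1 then UNIV else {x. a < (SUP y. ennreal (m (- x + y) / m y))})" for a
    unfolding translation_weight_def by (auto simp: less_max_iff_disj)
  then show ?thesis using lscD[OF l] unfolding lsc_def by simp
qed

lemma V_submult: "V (x + y) \<le> V x * V y"
proof -
  have "ennreal (m (- (x + y) + z) / m z) \<le> V x * V y" for z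
  proof -
    have "- (x + y) + z = - y + (- x + z)" by (simp only: minus_add add.assoc)
    then have "m (- (x + y) + z) / m z = (m (- x + z) / m z) * (m (- y + (- x + z)) / m (- x + z))"
      using m_pos[of "- x + z"] by simp
    then have "ennreal (m (- (x + y) + z) / m z) = ennreal ((m (- x + z) / m z) * (m (- y + (- x + z)) / m (- x + z)))"
      by (simp only:)
    also have "\<dots> = ennreal (m (- x + z) / m z) * ennreal (m (- y + (- x + z)) / m (- x + z))"
      by (rule ennreal_mult') (use m_pos in \<open>simp add: less_imp_le\<close>)
    also have "\<dots> \<le> V x * V y" by (intro mult_mono V_ge) auto
    finally show ?thesis .
  qed
  moreover have "1 * 1 \<le> V x * V y" by (intro mult_mono V_ge_1) auto
  ultimately show ?thesis
    unfolding translation_weight_def[of m "x + y"] by (auto intro!: SUP_least)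
qed

lemma v_weight_le_V: "v_weight \<mu> Q Y x \<le> V x"
proof -
  obtain r where r: "V x = ennreal r" "r \<ge> 0" using V_finite[of x] by (cases "V x") auto
  have r1: "r \<ge> 1" using V_ge_1[of x] r by (simp add: ennreal_ge_1)
  have "N (\<lambda>y. control_fun \<mu> Q (abs_fun F) y * ennreal (m (- x + y))) \<le> V x" if F: "qnorm \<mu> W F \<le> 1" for F
  proof -
    have fin: "qnorm \<mu> W F < top" using F le_less_trans by fastforce
    have mF: "abs_fun F \<in> borel_measurable borel"
      using fin by (intro abs_fun_measurable) (auto simp: qnorm_def split: if_splits)
    let ?G = "control_fun \<mu> Q (abs_fun F)"
    have mG: "(\<lambda>y. ?G y * ennreal (m (a + y))) \<in> borel_measurable borel" for a
      by (intro borel_measurable_times_ennreal control_measurable mF lsc_measurable[OF lsc_m])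
    have "N (\<lambda>y. ?G y * ennreal (m (- x + y))) \<le> N (\<lambda>y. ennreal r * (?G y * ennreal (m (0 + y))))"
    proof (rule N_mono)
      show "(\<lambda>y. ?G y * ennreal (m (- x + y))) \<in> borel_measurable borel" by (rule mG)
      show "(\<lambda>y. ennreal r * (?G y * ennreal (m (0 + y)))) \<in> borel_measurable borel"
        by (intro borel_measurable_times_ennreal[OF borel_measurable_const mG])
      fix y
      have "m (- x + y) / m y \<le> r" using V_ge[of x y] r m_pos by (simp add: ennreal_le_iff)
      then have "m (- x + y) \<le> r * m y" using m_pos[of y] by (simp add: field_simps)
      then have "ennreal (m (- x + y)) \<le> ennreal r * ennreal (m y)"
        using r m_pos by (simp add: ennreal_leI flip: ennreal_mult')
      from mult_left_mono[OF this, of "?G y"]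
      show "?G y * ennreal (m (- x + y)) \<le> ennreal r * (?G y * ennreal (m (0 + y)))" by (simp add: mult_ac)
    qed
    also have "\<dots> = ennreal r * N (\<lambda>y. ?G y * ennreal (m (0 + y)))" by (rule N_cmult[OF mG]) (use r1 in simp)
    also have "\<dots> = ennreal r * qnorm \<mu> W F" using qnorm_eq[OF fin] by simp
    also have "\<dots> \<le> ennreal r * 1" by (intro mult_left_mono F) simp
    finally show ?thesis using r by simp
  qed
  then show ?thesis unfolding v_weight_SUP by (intro SUP_least max.boundedI V_ge_1) auto
qed

lemma w_bounded_on_compact:
  assumes "compact D" obtains B where "B > 0" "\<And>x. x \<in> D \<Longrightarrow> w x \<le> B" "\<And>x. x \<in> D \<Longrightarrow> w (- x) \<le> B"
proof -
  have "compact (w ` D)" "compact ((\<lambda>x. w (- x)) ` D)"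
    by (intro compact_continuous_image assms continuous_on_subset[OF w_cont] subset_UNIV
        continuous_on_compose2[OF w_cont] continuous_intros)+
  then obtain B1 B2 where "\<forall>y\<in>w ` D. norm y \<le> B1" "\<forall>y\<in>(\<lambda>x. w (- x)) ` D. norm y \<le> B2"
    using compact_imp_bounded[of "w ` D"] compact_imp_bounded[of "(\<lambda>x. w (- x)) ` D"] unfolding bounded_iff by metis
  then have "\<And>x. x \<in> D \<Longrightarrow> w x \<le> max 1 (max B1 B2)" "\<And>x. x \<in> D \<Longrightarrow> w (- x) \<le> max 1 (max B1 B2)"
    by (auto simp: le_max_iff_disj)
  then show ?thesis using that[of "max 1 (max B1 B2)"] by simp
qed

text \<open>The translation is tested on the indicator of the interior of \<open>Q\<close> moved to
  \<open>y\<close>. Its control function lives on \<open>y + D\<close>, where \<open>m\<close> is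
  comparable to \<open>m y\<close>; after translation it lives where \<open>m\<close> is comparable
  to \<open>m (- x + y)\<close>. The operator norm therefore exceeds a fixed multiple of the
  quotient of the two values.\<close>

lemma V_le_v_weight: obtains C where "C > 0" "\<And>x. V x \<le> ennreal C * v_weight \<mu> Q Y x"
proof -
  define P where "P = interior Q"
  have oP: "open P" and P0: "0 \<in> P" using Q_nbhd unfolding P_def rel_compact_nbhd_def by auto
  have lP: "lsc (indicator P :: 'g \<Rightarrow> ennreal)" by (rule lsc_indicator[OF oP])
  have mP: "(indicator P :: 'g \<Rightarrow> ennreal) \<in> borel_measurable borel" by (rule lsc_measurable[OF lP])
  define h where "h = control_fun \<mu> Q (indicator P)"
  have lh: "lsc h" unfolding h_def by (rule lsc_control[OF mP])
  have mh: "h \<in> borel_measurable borel" by (rule lsc_measurable[OF lh])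
  \<comment> \<open>If \<open>x + Q\<close> meets the interior of \<open>Q\<close>, then
    \<open>x\<close> lies in \<open>D\<close>, so \<open>h\<close> vanishes off this compact
    set.\<close>
  define D where "D = sumset (closure Q) (uminus ` closure Q)"
  have cQ: "compact (closure Q)" using Q_nbhd unfolding rel_compact_nbhd_def by blast
  have D: "compact D" unfolding D_def by (intro compact_sumset cQ compact_continuous_image continuous_intros)
  have h1: "h x \<le> indicator D x" for x
  proof (rule dense_le)
    fix a assume a: "a < h x"
    then have "emeasure \<mu> ((+) x ` Q \<inter> {y. a < indicator P y}) \<noteq> 0"
      unfolding h_def less_control_fun_iff[OF Q_borel mP] .
    then have "(+) x ` Q \<inter> {y. a < indicator P y} \<noteq> {}" by auto
    then obtain z where z: "z \<in> Q" "a < indicator P (x + z)" by auto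
    have zP: "x + z \<in> P" using z(2) by (cases "x + z \<in> P") auto
    have a1: "a < 1" using z(2) zP by simp
    have "x + z \<in> closure Q" "- z \<in> uminus ` closure Q"
      using zP z(1) interior_subset closure_subset unfolding P_def by blast+
    then have "(x + z) + - z \<in> D" unfolding D_def by (rule sumsetI)
    then have "x \<in> D" by (simp add: add.assoc)
    then show "a \<le> indicator D x" using a1 by simp
  qed
  have Nh_fin: "N h < top"
  proof -
    have "N h \<le> N (indicator D)" using D by (intro N_mono mh h1) simp
    then show ?thesis using N_compact[OF D] by simp
  qed
  have Nh_pos: "N h \<noteq> 0"
  proof
    assume "N h = 0"
    then have "AE x in \<mu>. h x = 0" by (rule N_zero[OF mh])
    then have ae: "AE x in \<mu>. x \<notin> {x. 0 < h x}" by eventually_elim simp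
    have o: "open {x. 0 < h x}" by (rule lscD[OF lh])
    have "{x. 0 < h x} \<in> sets \<mu>" using borel_open[OF o] by (simp only: sets_haar)
    then have "{x. 0 < h x} \<in> null_sets \<mu>" by (rule AE_iff_null_sets[THEN iffD2, OF _ ae])
    moreover have "0 \<in> {x. 0 < h x}"
    proof -
      have "1 \<le> h 0" using le_control_fun[OF Q_borel lP, of 0 0] P0 unfolding P_def h_def by simp
      then show ?thesis using less_le_trans[OF zero_less_one] by blast
    qed
    ultimately show False using positive_open[OF o] by (metis empty_iff less_irrefl null_setsD1)
  qed
  obtain \<nu> where \<nu>: "N h = ennreal \<nu>" "\<nu> > 0" using Nh_fin Nh_pos by (cases "N h") auto
  obtain n where n: "N (indicator D) = ennreal n" "n \<ge> 0" using N_compact[OF D] by (cases "N (indicator D)") auto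
  obtain B where B: "B > 0" "\<And>x. x \<in> D \<Longrightarrow> w x \<le> B" "\<And>x. x \<in> D \<Longrightarrow> w (- x) \<le> B"
    using w_bounded_on_compact[OF D] by blast
  define A where "A = w 0 * B"
  have A: "A > 0" unfolding A_def using w_pos B(1) by simp
  have mA1: "m (y + x) \<le> A * m y" if "x \<in> D" for x y
  proof -
    have "m (0 + y + x) \<le> w 0 * m y * w x" by (rule m_moderate)
    also have "\<dots> \<le> w 0 * m y * B" using B(2)[OF that] w_pos m_pos by (intro mult_left_mono) (auto intro: less_imp_le)
    finally show ?thesis by (simp add: A_def mult_ac)
  qed
  have mA2: "m y \<le> A * m (y + x)" if "x \<in> D" for x y
  proof -
    have "m (0 + (y + x) + - x) \<le> w 0 * m (y + x) * w (- x)" by (rule m_moderate)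
    also have "\<dots> \<le> w 0 * m (y + x) * B" using B(3)[OF that] w_pos m_pos by (intro mult_left_mono) (auto intro: less_imp_le)
    finally show ?thesis by (simp add: A_def mult_ac add.assoc)
  qed
  \<comment> \<open>One factor \<open>A\<close> replaces the weight by its value at the centre from
    above before translation, the other from below afterwards; \<open>(n + 1) / \<nu>\<close>
    compares the norms of \<open>indicator D\<close> and \<open>h\<close>.\<close>
  define K where "K = A * A * (n + 1) / \<nu>"
  have K: "K > 0" unfolding K_def using A n \<nu> by simp
  have main: "ennreal (m (- x + y) / m y) \<le> ennreal K * v_weight \<mu> Q Y x" for x y
  proof -
    \<comment> \<open>Puts the test function into the unit ball; \<open>n + 1\<close> avoids a
      division by zero.\<close>
    define t where "t = 1 / (A * m y * (n + 1))"
    have t: "t > 0" unfolding t_def using A m_pos n by simp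
    define F where "F z = complex_of_real (t * indicator P (- y + z))" for z
    have absF: "abs_fun F = (\<lambda>z. ennreal t * indicator P (- y + z))"
      using t by (auto simp: F_def abs_fun_def fun_eq_iff norm_mult indicator_def)
    have mPy: "(\<lambda>z. indicator P (- y + z) :: ennreal) \<in> borel_measurable borel"
      by (intro lsc_measurable lsc_compose[OF lP] continuous_intros)
    have lF: "lsc (abs_fun F)" unfolding absF by (intro lsc_mult lsc_const lsc_compose[OF lP] continuous_intros)
    have cF: "control_fun \<mu> Q (abs_fun F) z = ennreal t * h (- y + z)" for z
      unfolding absF control_fun_cmult[OF Q_borel mPy t] control_fun_translate[OF Q_borel mP] h_def ..
    have mF: "F \<in> borel_measurable borel"
    proof -
      have "(\<lambda>z. - y + z) -` P \<in> sets borel" by (intro borel_open open_vimage oP continuous_intros)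
      then have "(indicator ((\<lambda>z. - y + z) -` P) :: 'g \<Rightarrow> real) \<in> borel_measurable borel" by (rule borel_measurable_indicator)
      moreover have "F = (\<lambda>z. complex_of_real (t * indicator ((\<lambda>z. - y + z) -` P) z))"
        by (simp add: F_def fun_eq_iff indicator_def)
      ultimately show ?thesis by simp
    qed
    have q: "qnorm \<mu> W F = N (\<lambda>z. ennreal t * h (- y + z) * ennreal (m z))"
      using mF W_lsc[OF lF] by (simp add: qnorm_def Y_eq cF)
    have mhm: "(\<lambda>z. h z * ennreal (m (a + z))) \<in> borel_measurable borel" for a
      by (intro borel_measurable_times_ennreal mh lsc_measurable[OF lsc_m])
    have shift: "N (\<lambda>z. ennreal t * h (- y + z) * ennreal (m (a + z))) = ennreal t * N (\<lambda>z. h z * ennreal (m (a + y + z)))" for a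
    proof -
      have "N (\<lambda>z. ennreal t * h (- y + z) * ennreal (m (a + z))) = N (\<lambda>z. (\<lambda>z. ennreal t * (h z * ennreal (m (a + y + z)))) (- y + z))"
        by (simp add: mult.assoc add.assoc)
      also have "\<dots> = N (\<lambda>z. ennreal t * (h z * ennreal (m (a + y + z))))"
        by (rule N_translate) (intro borel_measurable_times_ennreal[OF borel_measurable_const mhm])
      also have "\<dots> = ennreal t * N (\<lambda>z. h z * ennreal (m (a + y + z)))" by (rule N_cmult[OF mhm t])
      finally show ?thesis .
    qed
    have "N (\<lambda>z. h z * ennreal (m (0 + y + z))) \<le> N (\<lambda>z. ennreal (A * m y) * indicator D z)"
    proof (rule N_mono[OF mhm])
      show "(\<lambda>z. ennreal (A * m y) * indicator D z) \<in> borel_measurable borel"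
        using D by (intro borel_measurable_times_ennreal borel_measurable_const borel_measurable_indicator) simp
      fix z
      show "h z * ennreal (m (0 + y + z)) \<le> ennreal (A * m y) * indicator D z"
      proof (cases "z \<in> D")
        case True
        have "h z * ennreal (m (0 + y + z)) \<le> 1 * ennreal (A * m y)"
          using h1[of z] mA1[OF True, of y] True by (intro mult_mono ennreal_leI) auto
        then show ?thesis using True by simp
      next
        case False
        then show ?thesis using h1[of z] by simp
      qed
    qed
    also have "\<dots> = ennreal (A * m y) * N (indicator D)"
      using D A m_pos by (intro N_cmult) simp_all
    also have "\<dots> = ennreal (A * m y * n)" using n A m_pos by (simp add: ennreal_mult' less_imp_le)
    finally have "qnorm \<mu> W F \<le> ennreal t * ennreal (A * m y * n)"
      using shift[of 0] unfolding q by (simp add: mult_left_mono)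
    also have "\<dots> = ennreal (t * (A * m y * n))" using t by (simp add: ennreal_mult')
    also have "t * (A * m y * n) = n / (n + 1)"
      using A m_pos[of y] n unfolding t_def by (simp add: divide_simps)
    also have "ennreal (n / (n + 1)) \<le> 1" using n by (simp add: ennreal_le_1)
    finally have q1: "qnorm \<mu> W F \<le> 1" .
    have "ennreal (m (- x + y) / A) * N h = N (\<lambda>z. ennreal (m (- x + y) / A) * h z)"
      using A m_pos by (intro N_cmult[symmetric] mh) simp
    also have "\<dots> \<le> N (\<lambda>z. h z * ennreal (m (- x + y + z)))"
    proof (rule N_mono[OF borel_measurable_times_ennreal[OF borel_measurable_const mh] mhm])
      fix z
      show "ennreal (m (- x + y) / A) * h z \<le> h z * ennreal (m (- x + y + z))"
      proof (cases "z \<in> D")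
        case True
        have "m (- x + y) / A \<le> m (- x + y + z)" using mA2[OF True, of "- x + y"] A by (simp add: field_simps)
        from mult_left_mono[OF ennreal_leI[OF this], of "h z"] show ?thesis by (simp add: mult.commute)
      next
        case False
        then have "h z = 0" using h1[of z] by simp
        then show ?thesis by simp
      qed
    qed
    finally have "ennreal t * (ennreal (m (- x + y) / A) * N h) \<le> N (\<lambda>z. ennreal t * h (- y + z) * ennreal (m (- x + z)))"
      unfolding shift by (rule mult_left_mono) simp
    also have "\<dots> \<le> v_weight \<mu> Q Y x"
      unfolding v_weight_SUP using q1 by (intro SUP_upper2[of F]) (auto simp: cF)
    finally have le0: "ennreal t * (ennreal (m (- x + y) / A) * N h) \<le> v_weight \<mu> Q Y x" .
    have le: "ennreal (t * (m (- x + y) / A) * \<nu>) \<le> v_weight \<mu> Q Y x"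
    proof -
      have nn: "0 \<le> t" "0 \<le> m (- x + y) / A" "0 \<le> \<nu>" using t A m_pos[of "- x + y"] \<nu> by simp_all
      have "ennreal (t * (m (- x + y) / A) * \<nu>) = ennreal t * (ennreal (m (- x + y) / A) * N h)"
        unfolding \<nu>(1) mult.assoc ennreal_mult[OF nn(1) mult_nonneg_nonneg[OF nn(2,3)]] ennreal_mult[OF nn(2,3)] ..
      then show ?thesis using le0 by simp
    qed
    have K\<nu>: "K * \<nu> = A * A * (n + 1)" unfolding K_def using \<nu>(2) by simp
    have tm: "t * (A * m y * (n + 1)) = 1" unfolding t_def using A m_pos[of y] n by simp
    have "K * (t * (m (- x + y) / A) * \<nu>) * m y = (K * \<nu>) * t * m y * m (- x + y) / A" by simp
    also have "\<dots> = (t * (A * m y * (n + 1))) * m (- x + y)" unfolding K\<nu> using A by simp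
    finally have e: "K * (t * (m (- x + y) / A) * \<nu>) * m y = m (- x + y)" unfolding tm by simp
    have "m y \<noteq> 0" using m_pos[of y] by simp
    then have "m (- x + y) / m y = K * (t * (m (- x + y) / A) * \<nu>)"
      by (rule nonzero_divide_eq_eq[THEN iffD2, OF _ e[symmetric]])
    then have "ennreal (m (- x + y) / m y) = ennreal K * ennreal (t * (m (- x + y) / A) * \<nu>)"
      unfolding ennreal_mult'[OF less_imp_le[OF K], symmetric] by (rule arg_cong[where f=ennreal])
    also have "\<dots> \<le> ennreal K * v_weight \<mu> Q Y x" by (intro mult_left_mono le) simp
    finally show ?thesis .
  qed
  have v1: "1 \<le> v_weight \<mu> Q Y x" for x unfolding v_weight_def by simp
  show ?thesis
  proof (rule that[of "max 1 K"])
    show "max 1 K > 0" by simp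
    fix x
    have "1 * 1 \<le> ennreal (max 1 K) * v_weight \<mu> Q Y x"
      by (intro mult_mono v1) (auto simp: ennreal_ge_1)
    moreover have "(SUP y. ennreal (m (- x + y) / m y)) \<le> ennreal (max 1 K) * v_weight \<mu> Q Y x"
    proof (rule SUP_least)
      fix y
      have "ennreal K * v_weight \<mu> Q Y x \<le> ennreal (max 1 K) * v_weight \<mu> Q Y x"
        by (intro mult_right_mono ennreal_leI) auto
      then show "ennreal (m (- x + y) / m y) \<le> ennreal (max 1 K) * v_weight \<mu> Q Y x"
        using main[of x y] by simp
    qed
    ultimately show "V x \<le> ennreal (max 1 K) * v_weight \<mu> Q Y x"
      unfolding translation_weight_def by simp
  qed
qed

end

section \<open>The spaces of test vectors and their anti-duals\<close>

locale weighted_representation = haar_representation \<mu> \<pi>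
  for \<mu> :: "'g::{topological_group_add,t2_space} measure" and \<pi> :: "'g \<Rightarrow> 'h::complex_hilbert_space \<Rightarrow> 'h" +
  fixes V :: "'g \<Rightarrow> ennreal"
  assumes weight_lsc: "lsc V" and weight_ge_1: "\<And>x. 1 \<le> V x" and weight_finite: "\<And>x. V x < top"
    and weight_submult: "\<And>x y. V (x + y) \<le> V x * V y"
begin

definition equivalent_weight :: "('g \<Rightarrow> ennreal) \<Rightarrow> bool" where
  "equivalent_weight v \<longleftrightarrow> lsc v \<and> (\<exists>C>0. \<forall>x. v x \<le> ennreal C * V x) \<and> (\<exists>C>0. \<forall>x. V x \<le> ennreal C * v x)"

text \<open>With the common weight \<open>V\<close> this is equivalent to \<open>H1_norm\<close> for
  the weights of both function spaces.\<close>

definition T_norm :: "'h \<Rightarrow> 'h \<Rightarrow> ennreal" where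
  "T_norm k f = (\<integral>\<^sup>+x. abs_fun (voice \<pi> k f) x * V x \<partial>\<mu>)"

definition admissible :: "'h \<Rightarrow> bool" where
  "admissible k \<longleftrightarrow> k \<noteq> 0 \<and> T_norm k k < top"

lemma voice_weight_measurable: "lsc v \<Longrightarrow> (\<lambda>x. abs_fun (voice \<pi> k f) x * v x) \<in> borel_measurable borel"
  by (intro lsc_measurable lsc_mult lsc_voice)

lemma H1_norm_eq:
  assumes "lsc v" shows "H1_norm \<mu> \<pi> v k f = (\<integral>\<^sup>+x. abs_fun (voice \<pi> k f) x * v x \<partial>\<mu>)"
  using voice_weight_measurable[OF assms, of k f] voice_measurable[of k f]
  by (simp add: H1_norm_def qnorm_def weighted_def lebesgue_space_def)

lemma integral_le_T_norm: "(\<integral>\<^sup>+x. abs_fun (voice \<pi> k f) x \<partial>\<mu>) \<le> T_norm k f"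
  unfolding T_norm_def
proof (rule nn_integral_mono)
  fix x show "abs_fun (voice \<pi> k f) x \<le> abs_fun (voice \<pi> k f) x * V x"
    using mult_left_mono[OF weight_ge_1[of x], of "abs_fun (voice \<pi> k f) x"] by simp
qed

lemma admissible_integrable_window: "admissible k \<Longrightarrow> integrable_window k"
  unfolding admissible_def integrable_window_def using integral_le_T_norm[of k k] by (auto intro: le_less_trans)

lemma H1_norm_equivalent:
  assumes "equivalent_weight v"
  obtains C where "C > 0" "\<And>k f. H1_norm \<mu> \<pi> v k f \<le> ennreal C * T_norm k f" "\<And>k f. T_norm k f \<le> ennreal C * H1_norm \<mu> \<pi> v k f"
proof -
  obtain C1 C2 where C: "lsc v" "C1 > 0" "\<And>x. v x \<le> ennreal C1 * V x" "C2 > 0" "\<And>x. V x \<le> ennreal C2 * v x"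
    using assms unfolding equivalent_weight_def by blast
  have gen: "(\<integral>\<^sup>+x. abs_fun (voice \<pi> k f) x * a x \<partial>\<mu>) \<le> ennreal c * (\<integral>\<^sup>+x. abs_fun (voice \<pi> k f) x * b x \<partial>\<mu>)"
    if "lsc b" "\<And>x. a x \<le> ennreal c * b x" for a b c k f
  proof -
    have "(\<integral>\<^sup>+x. abs_fun (voice \<pi> k f) x * a x \<partial>\<mu>) \<le> (\<integral>\<^sup>+x. ennreal c * (abs_fun (voice \<pi> k f) x * b x) \<partial>\<mu>)"
    proof (rule nn_integral_mono)
      fix x show "abs_fun (voice \<pi> k f) x * a x \<le> ennreal c * (abs_fun (voice \<pi> k f) x * b x)"
        using mult_left_mono[OF that(2)[of x], of "abs_fun (voice \<pi> k f) x"] by (simp add: mult.left_commute)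
    qed
    also have "\<dots> = ennreal c * (\<integral>\<^sup>+x. abs_fun (voice \<pi> k f) x * b x \<partial>\<mu>)"
      using voice_weight_measurable[OF that(1)] by (intro nn_integral_cmult) simp
    finally show ?thesis .
  qed
  have up: "ennreal C1 * y \<le> ennreal (max C1 C2) * y" "ennreal C2 * y \<le> ennreal (max C1 C2) * y" for y
    by (intro mult_right_mono ennreal_leI; simp)+
  show ?thesis
  proof (rule that[of "max C1 C2"])
    show "max C1 C2 > 0" using C by simp
    show "H1_norm \<mu> \<pi> v k f \<le> ennreal (max C1 C2) * T_norm k f" for k f
      unfolding H1_norm_eq[OF C(1)] T_norm_def by (rule order_trans[OF gen[OF weight_lsc C(3)] up(1)])
    show "T_norm k f \<le> ennreal (max C1 C2) * H1_norm \<mu> \<pi> v k f" for k f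
      unfolding H1_norm_eq[OF C(1)] T_norm_def by (rule order_trans[OF gen[OF C(1) C(5)] up(2)])
  qed
qed

lemma A_set_admissible:
  assumes "equivalent_weight v" "k \<in> A_set \<mu> \<pi> v" "k \<noteq> 0"
  shows "admissible k"
proof -
  obtain C where C: "T_norm k k \<le> ennreal C * H1_norm \<mu> \<pi> v k k"
    using H1_norm_equivalent[OF assms(1)] by metis
  have "H1_norm \<mu> \<pi> v k k < top" using assms(2) unfolding A_set_def fspace_def H1_norm_def by simp
  then have "ennreal C * H1_norm \<mu> \<pi> v k k < top" by (simp add: ennreal_mult_less_top)
  then show ?thesis using C assms(3) unfolding admissible_def by simp
qed

text \<open>\<open>window_change\<close> is integrated against the weight. Translating the outer
  variable by \<open>y + z\<close> turns the second factor into the inversion invariant modulus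
  \<open>G\<close> alone, and submultiplicativity splits the weight into factors for
  \<open>y\<close>, \<open>z\<close> and the new variable.\<close>

lemma T_norm_window:
  assumes k: "admissible k" and u: "admissible u"
  obtains C where "C > 0" "\<And>f. T_norm u f \<le> ennreal C * T_norm k f"
proof -
  obtain z C where C: "C > 0" "\<And>f x. abs_fun (voice \<pi> u f) x \<le>
     ennreal C * (\<integral>\<^sup>+y. abs_fun (voice \<pi> k f) y * abs_fun (voice \<pi> u u) (- x + y + z) \<partial>\<mu>)"
    by (rule window_change[OF admissible_integrable_window[OF k] _ admissible_integrable_window[OF u]])
       (use k u in \<open>auto simp: admissible_def\<close>)
  define G where "G = abs_fun (voice \<pi> u u)"
  have lG: "lsc G" unfolding G_def by (rule lsc_voice)
  have main: "T_norm u f \<le> ennreal C * (V z * T_norm u u * T_norm k f)" for f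
  proof -
    define F where "F = abs_fun (voice \<pi> k f)"
    have lF: "lsc F" unfolding F_def by (rule lsc_voice)
    have c: "continuous_on UNIV (\<lambda>p::'g\<times>'g. - fst p + snd p + z)" "continuous_on UNIV (\<lambda>p::'g\<times>'g. fst p)"
     "continuous_on UNIV (\<lambda>p::'g\<times>'g. snd p)"
      by (intro continuous_intros)+
    have l2: "lsc (\<lambda>(x, y). V x * (F y * G (- x + y + z)))"
      unfolding case_prod_unfold by (intro lsc_mult lsc_compose[OF weight_lsc] lsc_compose[OF lF] lsc_compose[OF lG] c)
    have lyx: "lsc (\<lambda>y. F y * G (- x + y + z))" for x
      by (intro lsc_mult lF lsc_compose[OF lG] continuous_intros)
    have lxy: "lsc (\<lambda>x. V x * G (- x + y + z))" for y
      by (intro lsc_mult weight_lsc lsc_compose[OF lG] continuous_intros)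
    have "T_norm u f \<le> (\<integral>\<^sup>+x. ennreal C * (\<integral>\<^sup>+y. V x * (F y * G (- x + y + z)) \<partial>\<mu>) \<partial>\<mu>)"
      unfolding T_norm_def
    proof (rule nn_integral_mono)
      fix x
      have "abs_fun (voice \<pi> u f) x * V x \<le> ennreal C * (\<integral>\<^sup>+y. F y * G (- x + y + z) \<partial>\<mu>) * V x"
        unfolding F_def G_def by (intro mult_right_mono C(2)) simp
      also have "\<dots> = ennreal C * (V x * (\<integral>\<^sup>+y. F y * G (- x + y + z) \<partial>\<mu>))" by (simp add: mult_ac)
      also have "V x * (\<integral>\<^sup>+y. F y * G (- x + y + z) \<partial>\<mu>) = (\<integral>\<^sup>+y. V x * (F y * G (- x + y + z)) \<partial>\<mu>)"
        using lsc_measurable[OF lyx] by (intro nn_integral_cmult[symmetric]) simp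
      finally show "abs_fun (voice \<pi> u f) x * V x \<le> ennreal C * (\<integral>\<^sup>+y. V x * (F y * G (- x + y + z)) \<partial>\<mu>)" .
    qed
    also have "\<dots> = ennreal C * (\<integral>\<^sup>+x. (\<integral>\<^sup>+y. V x * (F y * G (- x + y + z)) \<partial>\<mu>) \<partial>\<mu>)"
      using lsc_measurable[OF lsc_section_integral[OF l2]] by (intro nn_integral_cmult) simp
    finally have step1: "T_norm u f \<le> ennreal C * (\<integral>\<^sup>+x. (\<integral>\<^sup>+y. V x * (F y * G (- x + y + z)) \<partial>\<mu>) \<partial>\<mu>)" .
    have "(\<integral>\<^sup>+x. (\<integral>\<^sup>+y. V x * (F y * G (- x + y + z)) \<partial>\<mu>) \<partial>\<mu>) = (\<integral>\<^sup>+y. (\<integral>\<^sup>+x. V x * (F y * G (- x + y + z)) \<partial>\<mu>) \<partial>\<mu>)"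
      by (rule tonelli_lsc[OF l2])
    also have "\<dots> \<le> (\<integral>\<^sup>+y. (F y * V y) * (V z * T_norm u u) \<partial>\<mu>)"
    proof (rule nn_integral_mono)
      fix y
      have "(\<integral>\<^sup>+x. V x * (F y * G (- x + y + z)) \<partial>\<mu>) = (\<integral>\<^sup>+x. F y * (V x * G (- x + y + z)) \<partial>\<mu>)" by (simp add: mult_ac)
      also have "\<dots> = F y * (\<integral>\<^sup>+x. V x * G (- x + y + z) \<partial>\<mu>)"
        using lsc_measurable[OF lxy] by (intro nn_integral_cmult) simp
      also have "(\<integral>\<^sup>+x. V x * G (- x + y + z) \<partial>\<mu>) = (\<integral>\<^sup>+x. V (y + z + x) * G (- (y + z + x) + y + z) \<partial>\<mu>)"
        using nn_integral_translate[OF lsc_measurable[OF lxy], of "y + z" y] by simp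
      also have "\<dots> = (\<integral>\<^sup>+x. V (y + z + x) * G x \<partial>\<mu>)"
      proof (rule nn_integral_cong)
        fix x
        have "- (y + z + x) + y + z = - x" by (simp add: minus_add add.assoc)
        then show "V (y + z + x) * G (- (y + z + x) + y + z) = V (y + z + x) * G x"
          unfolding G_def by (simp only: abs_voice_uminus)
      qed
      also have "\<dots> \<le> (\<integral>\<^sup>+x. (V y * V z) * (G x * V x) \<partial>\<mu>)"
      proof (rule nn_integral_mono)
        fix x
        have "V (y + z + x) \<le> V (y + z) * V x" by (rule weight_submult)
        also have "\<dots> \<le> (V y * V z) * V x" by (intro mult_right_mono weight_submult) simp
        finally show "V (y + z + x) * G x \<le> (V y * V z) * (G x * V x)"
          using mult_right_mono[of "V (y + z + x)" "V y * V z * V x" "G x"] by (simp add: mult_ac)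
      qed
      also have "\<dots> = (V y * V z) * T_norm u u"
        unfolding T_norm_def G_def using voice_weight_measurable[OF weight_lsc] by (intro nn_integral_cmult) simp
      finally show "(\<integral>\<^sup>+x. V x * (F y * G (- x + y + z)) \<partial>\<mu>) \<le> (F y * V y) * (V z * T_norm u u)"
        by (simp add: mult_left_mono mult.assoc)
    qed
    also have "\<dots> = T_norm k f * (V z * T_norm u u)"
      unfolding T_norm_def F_def using voice_weight_measurable[OF weight_lsc] by (intro nn_integral_multc) simp
    finally have step2: "(\<integral>\<^sup>+x. (\<integral>\<^sup>+y. V x * (F y * G (- x + y + z)) \<partial>\<mu>) \<partial>\<mu>) \<le> T_norm k f * (V z * T_norm u u)" .
    show ?thesis using order_trans[OF step1 mult_left_mono[OF step2]] by (simp add: mult_ac)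
  qed
  have "V z * T_norm u u < top" using weight_finite u unfolding admissible_def by (simp add: ennreal_mult_less_top)
  then obtain r where r: "V z * T_norm u u = ennreal r" "r \<ge> 0" by (cases "V z * T_norm u u") auto
  show ?thesis
  proof (rule that[of "C * (r + 1)"])
    show "C * (r + 1) > 0" using C r by simp
    fix f
    have "T_norm u f \<le> ennreal (C * r) * T_norm k f"
      using main[of f] C(1) r by (simp add: ennreal_mult mult.assoc)
    also have "\<dots> \<le> ennreal (C * (r + 1)) * T_norm k f"
      using C(1) by (intro mult_right_mono ennreal_leI) auto
    finally show "T_norm u f \<le> ennreal (C * (r + 1)) * T_norm k f" .
  qed
qed

lemma H1_norm_le_T_norm:
  assumes "equivalent_weight v" "admissible k" "admissible u"
  obtains C where "C > 0" "\<And>f. H1_norm \<mu> \<pi> v k f \<le> ennreal C * T_norm u f" "\<And>f. T_norm u f \<le> ennreal C * H1_norm \<mu> \<pi> v k f"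
proof -
  obtain C where C: "C > 0" "\<And>k f. H1_norm \<mu> \<pi> v k f \<le> ennreal C * T_norm k f" "\<And>k f. T_norm k f \<le> ennreal C * H1_norm \<mu> \<pi> v k f"
    by (rule H1_norm_equivalent[OF assms(1)]) (rule that)
  obtain D1 where D1: "D1 > 0" "\<And>f. T_norm u f \<le> ennreal D1 * T_norm k f" using T_norm_window[OF assms(2,3)] by blast
  obtain D2 where D2: "D2 > 0" "\<And>f. T_norm k f \<le> ennreal D2 * T_norm u f" using T_norm_window[OF assms(3,2)] by blast
  have up: "ennreal (C * D) * y \<le> ennreal (C * max D1 D2) * y" if "D = D1 \<or> D = D2" for D y
    using that C(1) by (intro mult_right_mono ennreal_leI mult_left_mono) auto
  show ?thesis
  proof (rule that[of "C * max D1 D2"])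
    show "C * max D1 D2 > 0" using C D1 by simp
    fix f
    have "H1_norm \<mu> \<pi> v k f \<le> ennreal C * (ennreal D2 * T_norm u f)"
      by (rule order_trans[OF C(2) mult_left_mono[OF D2(2)]]) simp
    then show "H1_norm \<mu> \<pi> v k f \<le> ennreal (C * max D1 D2) * T_norm u f"
      using up[of D2 "T_norm u f"] C(1) D2(1) by (simp add: ennreal_mult mult.assoc)
    have "T_norm u f \<le> ennreal D1 * (ennreal C * H1_norm \<mu> \<pi> v k f)"
      by (rule order_trans[OF D1(2) mult_left_mono[OF C(3)]]) simp
    then show "T_norm u f \<le> ennreal (C * max D1 D2) * H1_norm \<mu> \<pi> v k f"
      using up[of D1 "H1_norm \<mu> \<pi> v k f"] C(1) D1(1) by (simp add: ennreal_mult mult_ac)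
  qed
qed

definition test_vectors :: "'h \<Rightarrow> 'h set" where "test_vectors u = {f. T_norm u f < top}"

lemma H1_eq_test_vectors:
  assumes "equivalent_weight v" "admissible k" "admissible u" shows "H1 \<mu> \<pi> v k = test_vectors u"
proof -
  obtain C where C: "C > 0" "\<And>f. H1_norm \<mu> \<pi> v k f \<le> ennreal C * T_norm u f" "\<And>f. T_norm u f \<le> ennreal C * H1_norm \<mu> \<pi> v k f"
    by (rule H1_norm_le_T_norm[OF assms]) (rule that)
  have "H1_norm \<mu> \<pi> v k f < top \<longleftrightarrow> T_norm u f < top" for f
    using C(2,3)[of f] by (auto intro: le_less_trans simp: ennreal_mult_less_top)
  then show ?thesis unfolding H1_def test_vectors_def by blast
qed

definition T_antidual :: "'h \<Rightarrow> ('h \<Rightarrow> complex) set" where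
  "T_antidual u = {\<phi>.
     (\<forall>h\<in>test_vectors u. \<forall>h'\<in>test_vectors u. \<phi> (h + h') = \<phi> h + \<phi> h') \<and>
     (\<forall>h\<in>test_vectors u. \<forall>c. \<phi> (c *\<^sub>C h) = cnj c * \<phi> h) \<and>
     (\<exists>C\<ge>0. \<forall>h\<in>test_vectors u. ennreal (cmod (\<phi> h)) \<le> ennreal C * T_norm u h) \<and>
     (\<forall>h. h \<notin> test_vectors u \<longrightarrow> \<phi> h = 0)}"

text \<open>Equivalent norms have the same test vectors and affect only the constant of the
  boundedness clause. Used for both weights, this puts an element of one coorbit space into the
  anti-dual belonging to the other.\<close>

lemma antidual_eq_T_antidual:
  assumes "equivalent_weight v" "admissible k" "admissible u" shows "antidual \<mu> \<pi> v k = T_antidual u"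
proof -
  obtain C where C: "C > 0" "\<And>f. H1_norm \<mu> \<pi> v k f \<le> ennreal C * T_norm u f" "\<And>f. T_norm u f \<le> ennreal C * H1_norm \<mu> \<pi> v k f"
    by (rule H1_norm_le_T_norm[OF assms]) (rule that)
  have 1: "(\<exists>D\<ge>0. \<forall>h\<in>test_vectors u. ennreal (cmod (\<phi> h)) \<le> ennreal D * H1_norm \<mu> \<pi> v k h)
     \<longleftrightarrow> (\<exists>D\<ge>0. \<forall>h\<in>test_vectors u. ennreal (cmod (\<phi> h)) \<le> ennreal D * T_norm u h)" for \<phi>
  proof
    assume "\<exists>D\<ge>0. \<forall>h\<in>test_vectors u. ennreal (cmod (\<phi> h)) \<le> ennreal D * H1_norm \<mu> \<pi> v k h"
    then obtain D where D: "D \<ge> 0" "\<And>h. h\<in>test_vectors u \<Longrightarrow> ennreal (cmod (\<phi> h)) \<le> ennreal D * H1_norm \<mu> \<pi> v k h" by blast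
    show "\<exists>D\<ge>0. \<forall>h\<in>test_vectors u. ennreal (cmod (\<phi> h)) \<le> ennreal D * T_norm u h"
    proof (intro exI[of _ "D * C"] conjI ballI)
      show "D * C \<ge> 0" using D C by simp
      fix h assume h: "h \<in> test_vectors u"
      have "ennreal (cmod (\<phi> h)) \<le> ennreal D * (ennreal C * T_norm u h)"
        by (rule order_trans[OF D(2)[OF h] mult_left_mono[OF C(2)]]) simp
      then show "ennreal (cmod (\<phi> h)) \<le> ennreal (D * C) * T_norm u h" using D(1) C(1) by (simp add: ennreal_mult mult.assoc)
    qed
  next
    assume "\<exists>D\<ge>0. \<forall>h\<in>test_vectors u. ennreal (cmod (\<phi> h)) \<le> ennreal D * T_norm u h"
    then obtain D where D: "D \<ge> 0" "\<And>h. h\<in>test_vectors u \<Longrightarrow> ennreal (cmod (\<phi> h)) \<le> ennreal D * T_norm u h" by blast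
    show "\<exists>D\<ge>0. \<forall>h\<in>test_vectors u. ennreal (cmod (\<phi> h)) \<le> ennreal D * H1_norm \<mu> \<pi> v k h"
    proof (intro exI[of _ "D * C"] conjI ballI)
      show "D * C \<ge> 0" using D C by simp
      fix h assume h: "h \<in> test_vectors u"
      have "ennreal (cmod (\<phi> h)) \<le> ennreal D * (ennreal C * H1_norm \<mu> \<pi> v k h)"
        by (rule order_trans[OF D(2)[OF h] mult_left_mono[OF C(3)]]) simp
      then show "ennreal (cmod (\<phi> h)) \<le> ennreal (D * C) * H1_norm \<mu> \<pi> v k h" using D(1) C(1) by (simp add: ennreal_mult mult.assoc)
    qed
  qed
  show ?thesis unfolding antidual_def T_antidual_def H1_eq_test_vectors[OF assms] 1 ..
qed

lemma test_vectors_add: "f \<in> test_vectors u \<Longrightarrow> f' \<in> test_vectors u \<Longrightarrow> f + f' \<in> test_vectors u"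
proof -
  assume f: "f \<in> test_vectors u" "f' \<in> test_vectors u"
  have "T_norm u (f + f') \<le> (\<integral>\<^sup>+x. abs_fun (voice \<pi> u f) x * V x + abs_fun (voice \<pi> u f') x * V x \<partial>\<mu>)"
    unfolding T_norm_def
  proof (rule nn_integral_mono)
    fix x
    have "abs_fun (voice \<pi> u (f + f')) x \<le> abs_fun (voice \<pi> u f) x + abs_fun (voice \<pi> u f') x"
      unfolding abs_fun_def voice_def cinner_add_left
      by (metis ennreal_leI ennreal_plus norm_ge_zero norm_triangle_ineq)
    then show "abs_fun (voice \<pi> u (f + f')) x * V x \<le> abs_fun (voice \<pi> u f) x * V x + abs_fun (voice \<pi> u f') x * V x"
      using mult_right_mono[of "abs_fun (voice \<pi> u (f + f')) x" _ "V x"] by (simp flip: distrib_right)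
  qed
  also have "\<dots> = T_norm u f + T_norm u f'"
    unfolding T_norm_def using voice_weight_measurable[OF weight_lsc] by (intro nn_integral_add) simp_all
  finally show ?thesis using f unfolding test_vectors_def by (auto intro: le_less_trans)
qed

lemma test_vectors_scaleC: "f \<in> test_vectors u \<Longrightarrow> c *\<^sub>C f \<in> test_vectors u"
proof -
  assume f: "f \<in> test_vectors u"
  have "T_norm u (c *\<^sub>C f) = (\<integral>\<^sup>+x. ennreal (cmod c) * (abs_fun (voice \<pi> u f) x * V x) \<partial>\<mu>)"
    unfolding T_norm_def by (intro nn_integral_cong)
      (simp add: abs_fun_def voice_def cinner_scaleC_left norm_mult ennreal_mult mult.assoc)
  also have "\<dots> = ennreal (cmod c) * T_norm u f"
    unfolding T_norm_def using voice_weight_measurable[OF weight_lsc] by (intro nn_integral_cmult) simp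
  finally show ?thesis using f unfolding test_vectors_def by (simp add: ennreal_mult_less_top)
qed

lemma test_vectors_pi: assumes "f \<in> test_vectors u" shows "\<pi> x f \<in> test_vectors u"
proof -
  have l: "lsc (\<lambda>y. abs_fun (voice \<pi> u f) (- x + y) * V y)"
    by (intro lsc_mult weight_lsc lsc_compose[OF lsc_voice] continuous_intros)
  have "T_norm u (\<pi> x f) = (\<integral>\<^sup>+y. abs_fun (voice \<pi> u f) (- x + y) * V y \<partial>\<mu>)"
    unfolding T_norm_def abs_fun_def voice_pi ..
  also have "\<dots> = (\<integral>\<^sup>+y. abs_fun (voice \<pi> u f) y * V (x + y) \<partial>\<mu>)"
    using nn_integral_translate[OF lsc_measurable[OF l], of x] by (simp add: add.assoc[symmetric])
  also have "\<dots> \<le> (\<integral>\<^sup>+y. V x * (abs_fun (voice \<pi> u f) y * V y) \<partial>\<mu>)"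
  proof (rule nn_integral_mono)
    fix y show "abs_fun (voice \<pi> u f) y * V (x + y) \<le> V x * (abs_fun (voice \<pi> u f) y * V y)"
      using mult_left_mono[OF weight_submult[of x y], of "abs_fun (voice \<pi> u f) y"] by (simp add: mult_ac)
  qed
  also have "\<dots> = V x * T_norm u f"
    unfolding T_norm_def using voice_weight_measurable[OF weight_lsc] by (intro nn_integral_cmult) simp
  also have "\<dots> < top" using assms weight_finite unfolding test_vectors_def by (simp add: ennreal_mult_less_top)
  finally show ?thesis unfolding test_vectors_def by simp
qed

lemma T_antidual_diff:
  assumes "\<phi> \<in> T_antidual u" "\<psi> \<in> T_antidual u" shows "(\<lambda>h. \<phi> h - c * \<psi> h) \<in> T_antidual u"
proof -
  have "\<exists>C\<ge>0. \<forall>h\<in>test_vectors u. ennreal (cmod (\<phi> h)) \<le> ennreal C * T_norm u h"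
    "\<exists>C\<ge>0. \<forall>h\<in>test_vectors u. ennreal (cmod (\<psi> h)) \<le> ennreal C * T_norm u h"
    using assms unfolding T_antidual_def by simp_all
  then obtain C1 C2 where C: "C1 \<ge> 0" "\<And>h. h \<in> test_vectors u \<Longrightarrow> ennreal (cmod (\<phi> h)) \<le> ennreal C1 * T_norm u h"
    "C2 \<ge> 0" "\<And>h. h \<in> test_vectors u \<Longrightarrow> ennreal (cmod (\<psi> h)) \<le> ennreal C2 * T_norm u h"
    by metis
  have b: "ennreal (cmod (\<phi> h - c * \<psi> h)) \<le> ennreal (C1 + cmod c * C2) * T_norm u h" if h: "h \<in> test_vectors u" for h
  proof -
    have "cmod (\<phi> h - c * \<psi> h) \<le> cmod (\<phi> h) + cmod c * cmod (\<psi> h)"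
      using norm_triangle_ineq4[of "\<phi> h" "c * \<psi> h"] by (simp add: norm_mult)
    then have "ennreal (cmod (\<phi> h - c * \<psi> h)) \<le> ennreal (cmod (\<phi> h)) + ennreal (cmod c) * ennreal (cmod (\<psi> h))"
      by (simp add: ennreal_leI flip: ennreal_mult ennreal_plus)
    also have "\<dots> \<le> ennreal C1 * T_norm u h + ennreal (cmod c) * (ennreal C2 * T_norm u h)"
      by (intro add_mono mult_left_mono C h) simp
    also have "\<dots> = ennreal (C1 + cmod c * C2) * T_norm u h"
      using C(1,3) by (simp add: ennreal_mult distrib_right mult.assoc)
    finally show ?thesis .
  qed
  have "C1 + cmod c * C2 \<ge> 0" using C by simp
  with b have "\<exists>C\<ge>0. \<forall>h\<in>test_vectors u. ennreal (cmod (\<phi> h - c * \<psi> h)) \<le> ennreal C * T_norm u h" by blast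
  then show ?thesis using assms unfolding T_antidual_def by (auto simp: algebra_simps)
qed

lemma T_antidual_diff_sum:
  assumes "\<phi> \<in> T_antidual u" "\<And>i. \<psi> i \<in> T_antidual u" "finite S"
  shows "(\<lambda>h. \<phi> h - (\<Sum>i\<in>S. c i * \<psi> i h)) \<in> T_antidual u"
  using assms(3)
proof (induction S rule: finite_induct)
  case (insert i S)
  have "(\<lambda>h. \<phi> h - (\<Sum>i\<in>insert i S. c i * \<psi> i h)) = (\<lambda>h. (\<phi> h - (\<Sum>i\<in>S. c i * \<psi> i h)) - c i * \<psi> i h)"
    using insert(1,2) by (simp add: fun_eq_iff)
  then show ?case using T_antidual_diff[OF insert.IH assms(2)] by simp
qed (simp add: assms(1))

lemma embed_T_antidual:
  assumes u: "admissible u" shows "(\<lambda>h. if h \<in> test_vectors u then cinner f h else 0) \<in> T_antidual u"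
proof -
  obtain C where C: "C > 0" "\<And>f h. ennreal (cmod (cinner f h)) \<le> ennreal (C * norm f) * (\<integral>\<^sup>+y. abs_fun (voice \<pi> u h) y \<partial>\<mu>)"
    by (rule cinner_le_voice_integral[OF admissible_integrable_window[OF u]]) (use u in \<open>auto simp: admissible_def\<close>)
  have "ennreal (cmod (cinner f h)) \<le> ennreal (C * norm f) * T_norm u h" for h
    by (rule order_trans[OF C(2) mult_left_mono[OF integral_le_T_norm]]) simp
  moreover have "C * norm f \<ge> 0" using C(1) by simp
  ultimately have "\<exists>C\<ge>0. \<forall>h\<in>test_vectors u. ennreal (cmod (if h \<in> test_vectors u then cinner f h else 0)) \<le> ennreal C * T_norm u h"
    by (intro exI[of _ "C * norm f"]) auto
  then show ?thesis unfolding T_antidual_def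
    by (auto simp: test_vectors_add test_vectors_scaleC cinner_add_right cinner_scaleC_right)
qed

end

section \<open>Sums of right translates in amalgams with weighted Lebesgue spaces\<close>

context haar_group
begin

text \<open>Only finiteness is claimed, so bounding a sum by twice the maximum serves all exponents,
  also those below one.\<close>

lemma lebesgue_add_finite:
  assumes q: "0 < q" and F: "F \<in> borel_measurable borel" "G \<in> borel_measurable borel"
    and fin: "lebesgue_space \<mu> q F < top" "lebesgue_space \<mu> q G < top"
  shows "lebesgue_space \<mu> q (\<lambda>x. F x + G x) < top"
proof (cases "q = top")
  case True
  have m: "(\<lambda>x. F x + G x) \<in> borel_measurable \<mu>" using F by simp
  have "esssup \<mu> (\<lambda>x. F x + G x) \<le> esssup \<mu> F + esssup \<mu> G"
  proof (rule esssup_I[OF m])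
    show "AE x in \<mu>. F x + G x \<le> esssup \<mu> F + esssup \<mu> G"
      using esssup_AE[where M=\<mu> and f=F] esssup_AE[where M=\<mu> and f=G] by eventually_elim (rule add_mono)
  qed
  also have "\<dots> < top" using fin F True by (simp add: lebesgue_space_def)
  finally show ?thesis using m True by (simp add: lebesgue_space_def)
next
  case False
  define r where "r = enn2real q"
  have r: "r > 0" unfolding r_def using q False by (simp add: enn2real_positive_iff less_top)
  note N = lebesgue_space_eq[OF False, folded r_def]
  have m: "(\<lambda>x. F x + G x) \<in> borel_measurable borel" using F by simp
  have mp: "(\<lambda>x. ennreal_powr (F x) r) \<in> borel_measurable \<mu>" "(\<lambda>x. ennreal_powr (G x) r) \<in> borel_measurable \<mu>"
    using F by (simp_all add: measurable_ennreal_powr)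
  have fF: "(\<integral>\<^sup>+ x. ennreal_powr (F x) r \<partial>\<mu>) < top" "(\<integral>\<^sup>+ x. ennreal_powr (G x) r \<partial>\<mu>) < top"
    using fin unfolding N[OF F(1)] N[OF F(2)] by simp_all
  have "(\<integral>\<^sup>+ x. ennreal_powr (F x + G x) r \<partial>\<mu>) \<le> (\<integral>\<^sup>+ x. ennreal_powr 2 r * (ennreal_powr (F x) r + ennreal_powr (G x) r) \<partial>\<mu>)"
  proof (rule nn_integral_mono)
    fix x
    have "F x + G x \<le> 2 * max (F x) (G x)" unfolding mult_2 by (intro add_mono) auto
    then have "ennreal_powr (F x + G x) r \<le> ennreal_powr (2 * max (F x) (G x)) r" using r by (intro ennreal_powr_mono) auto
    also have "\<dots> = ennreal_powr 2 r * ennreal_powr (max (F x) (G x)) r" by (rule ennreal_powr_mult[OF r])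
    also have "\<dots> \<le> ennreal_powr 2 r * (ennreal_powr (F x) r + ennreal_powr (G x) r)"
      by (intro mult_left_mono) (auto simp: max_def add_increasing add_increasing2)
    finally show "ennreal_powr (F x + G x) r \<le> ennreal_powr 2 r * (ennreal_powr (F x) r + ennreal_powr (G x) r)" .
  qed
  also have "\<dots> = ennreal_powr 2 r * (\<integral>\<^sup>+ x. ennreal_powr (F x) r + ennreal_powr (G x) r \<partial>\<mu>)"
    by (rule nn_integral_cmult[OF borel_measurable_add[OF mp]])
  also have "\<dots> = ennreal_powr 2 r * ((\<integral>\<^sup>+ x. ennreal_powr (F x) r \<partial>\<mu>) + (\<integral>\<^sup>+ x. ennreal_powr (G x) r \<partial>\<mu>))"
    by (simp only: nn_integral_add[OF mp])
  also have "\<dots> < top" using fF by (simp add: ennreal_mult_less_top)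
  finally show ?thesis unfolding N[OF m] by simp
qed

lemma ennreal_powr_SUP_le:
  assumes "0 < r" shows "ennreal_powr (SUP n. a n) r \<le> (SUP n. ennreal_powr (a n) r)"
proof (rule dense_le)
  fix b assume "b < ennreal_powr (SUP n. a n) r"
  then obtain n where "ennreal_powr b (1 / r) < a n" unfolding ennreal_powr_less_iff[OF assms] by (auto simp: less_SUP_iff)
  then have "b < ennreal_powr (a n) r" unfolding ennreal_powr_less_iff[OF assms] .
  then show "b \<le> (SUP n. ennreal_powr (a n) r)" by (intro SUP_upper2[of n]) auto
qed

lemma lebesgue_SUP_le:
  fixes F :: "nat \<Rightarrow> 'g \<Rightarrow> ennreal"
  assumes q: "0 < q" and F: "\<And>n. F n \<in> borel_measurable borel" and inc: "\<And>n x. F n x \<le> F (Suc n) x"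
  shows "lebesgue_space \<mu> q (\<lambda>x. SUP n. F n x) \<le> (SUP n. lebesgue_space \<mu> q (F n))"
proof -
  have m: "(\<lambda>x. SUP n. F n x) \<in> borel_measurable borel" by (rule borel_measurable_SUP) (auto simp: F)
  show ?thesis
  proof (cases "q = top")
    case True
    have N: "lebesgue_space \<mu> q G = esssup \<mu> G" if "G \<in> borel_measurable borel" for G
      using that True by (simp add: lebesgue_space_def)
    show ?thesis
    proof (rule dense_le)
      fix a assume "a < lebesgue_space \<mu> q (\<lambda>x. SUP n. F n x)"
      then have "emeasure \<mu> {x. a < (SUP n. F n x)} \<noteq> 0" unfolding N[OF m] less_esssup_iff[OF m] .
      moreover have "{x. a < (SUP n. F n x)} = (\<Union>n. {x. a < F n x})" by (auto simp: less_SUP_iff)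
      moreover have "{x. a < F n x} \<in> sets \<mu>" for n by (simp add: borel_superlevel[OF F])
      ultimately have "\<exists>n. emeasure \<mu> {x. a < F n x} \<noteq> 0"
        using emeasure_UN_eq_0[of \<mu> "\<lambda>n. {x. a < F n x}"] by (metis image_subsetI)
      then obtain n where "emeasure \<mu> {x. a < F n x} \<noteq> 0" by blast
      then have "a < lebesgue_space \<mu> q (F n)" unfolding N[OF F] less_esssup_iff[OF F] .
      then show "a \<le> (SUP n. lebesgue_space \<mu> q (F n))" by (intro SUP_upper2[of n]) auto
    qed
  next
    case False
    define r where "r = enn2real q"
    have r: "r > 0" unfolding r_def using q False by (simp add: enn2real_positive_iff less_top)
    note N = lebesgue_space_eq[OF False, folded r_def]
    have "(\<integral>\<^sup>+ x. ennreal_powr (SUP n. F n x) r \<partial>\<mu>) \<le> (\<integral>\<^sup>+ x. (SUP n. ennreal_powr (F n x) r) \<partial>\<mu>)"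
      by (intro nn_integral_mono ennreal_powr_SUP_le r)
    also have "\<dots> = (SUP n. \<integral>\<^sup>+ x. ennreal_powr (F n x) r \<partial>\<mu>)"
    proof (rule nn_integral_monotone_convergence_SUP)
      show "incseq (\<lambda>n x. ennreal_powr (F n x) r)"
        using r by (intro incseq_SucI le_funI ennreal_powr_mono inc) auto
      show "(\<lambda>x. ennreal_powr (F n x) r) \<in> borel_measurable \<mu>" for n using F by (simp add: measurable_ennreal_powr)
    qed
    finally have "lebesgue_space \<mu> q (\<lambda>x. SUP n. F n x) \<le> ennreal_powr (SUP n. \<integral>\<^sup>+ x. ennreal_powr (F n x) r \<partial>\<mu>) (1 / r)"
      unfolding N[OF m] using r by (intro ennreal_powr_mono) auto
    also have "\<dots> \<le> (SUP n. ennreal_powr (\<integral>\<^sup>+ x. ennreal_powr (F n x) r \<partial>\<mu>) (1 / r))"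
      by (rule ennreal_powr_SUP_le) (use r in simp)
    finally show ?thesis unfolding N[OF F] .
  qed
qed

text \<open>For a finite exponent this is the integral bound of
  \<open>right_translate_bound\<close>; for \<open>q = top\<close> only null sets matter and the
  constant is 1.\<close>

lemma lebesgue_right_translate:
  assumes q: "0 < q"
  obtains C where "C > 0" "\<And>F. lsc F \<Longrightarrow> lebesgue_space \<mu> q (\<lambda>x. F (x + a)) \<le> ennreal C * lebesgue_space \<mu> q F"
proof -
  obtain C where C: "C > 0" "\<And>U. open U \<Longrightarrow> emeasure \<mu> ((\<lambda>x. x + a) -` U) \<le> ennreal C * emeasure \<mu> U"
    "\<And>F. lsc F \<Longrightarrow> (\<integral>\<^sup>+x. F (x + a) \<partial>\<mu>) \<le> ennreal C * (\<integral>\<^sup>+x. F x \<partial>\<mu>)"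
    by (rule right_translate_bound[of a]) (rule that)
  have la: "lsc (\<lambda>x. F (x + a))" if "lsc F" for F by (intro lsc_compose[OF that] continuous_intros)
  show ?thesis
  proof (cases "q = top")
    case True
    have N: "lebesgue_space \<mu> q G = esssup \<mu> G" if "lsc G" for G
      using lsc_measurable[OF that] True by (simp add: lebesgue_space_def)
    show ?thesis
    proof (rule that[of 1])
      fix F :: "'g \<Rightarrow> ennreal" assume F: "lsc F"
      have "lebesgue_space \<mu> q (\<lambda>x. F (x + a)) \<le> lebesgue_space \<mu> q F"
      proof (rule dense_le)
        fix b assume "b < lebesgue_space \<mu> q (\<lambda>x. F (x + a))"
        then have "emeasure \<mu> ((\<lambda>x. x + a) -` {x. b < F x}) \<noteq> 0"
          unfolding N[OF la[OF F]] less_esssup_iff[OF lsc_measurable[OF la[OF F]]] by (simp add: vimage_def)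
        then have "emeasure \<mu> {x. b < F x} \<noteq> 0" using C(2)[OF lscD[OF F, of b]] by auto
        then have "b < lebesgue_space \<mu> q F" unfolding N[OF F] less_esssup_iff[OF lsc_measurable[OF F]] .
        then show "b \<le> lebesgue_space \<mu> q F" by simp
      qed
      then show "lebesgue_space \<mu> q (\<lambda>x. F (x + a)) \<le> ennreal 1 * lebesgue_space \<mu> q F" by simp
    qed simp
  next
    case False
    define r where "r = enn2real q"
    have r: "r > 0" unfolding r_def using q False by (simp add: enn2real_positive_iff less_top)
    note N = lebesgue_space_eq[OF False, folded r_def]
    show ?thesis
    proof (rule that[of "C powr (1 / r)"])
      show "C powr (1 / r) > 0" using C(1) by simp
      fix F :: "'g \<Rightarrow> ennreal" assume F: "lsc F"
      have "(\<integral>\<^sup>+ x. ennreal_powr (F (x + a)) r \<partial>\<mu>) \<le> ennreal C * (\<integral>\<^sup>+ x. ennreal_powr (F x) r \<partial>\<mu>)"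
        by (rule C(3)[OF lsc_ennreal_powr[OF F r]])
      then have "lebesgue_space \<mu> q (\<lambda>x. F (x + a)) \<le> ennreal_powr (ennreal C * (\<integral>\<^sup>+ x. ennreal_powr (F x) r \<partial>\<mu>)) (1 / r)"
        unfolding N[OF lsc_measurable[OF la[OF F]]] using r by (intro ennreal_powr_mono) auto
      also have "\<dots> = ennreal (C powr (1 / r)) * lebesgue_space \<mu> q F"
        using r C(1) unfolding N[OF lsc_measurable[OF F]] by (subst ennreal_powr_mult) auto
      finally show "lebesgue_space \<mu> q (\<lambda>x. F (x + a)) \<le> ennreal (C powr (1 / r)) * lebesgue_space \<mu> q F" .
    qed
  qed
qed

lemma control_fun_suminf:
  assumes Q: "Q \<in> sets borel" and F: "\<And>j. F j \<in> borel_measurable borel"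
  shows "control_fun \<mu> Q (\<lambda>x. \<Sum>j. F j x) x \<le> (\<Sum>j. control_fun \<mu> Q (F j) x)"
proof -
  have m: "(\<lambda>y. indicator ((+) x ` Q) y * (\<Sum>j. F j y)) \<in> borel_measurable \<mu>"
    using borel_indicator_mult[OF borel_translation_left[OF Q]] F by simp
  have "AE y in \<mu>. \<forall>j. indicator ((+) x ` Q) y * F j y \<le> control_fun \<mu> Q (F j) x"
    unfolding control_fun_def AE_all_countable by (intro allI esssup_AE)
  then have "AE y in \<mu>. indicator ((+) x ` Q) y * (\<Sum>j. F j y) \<le> (\<Sum>j. control_fun \<mu> Q (F j) x)"
  proof eventually_elim
    case (elim y)
    have "indicator ((+) x ` Q) y * (\<Sum>j. F j y) = (\<Sum>j. indicator ((+) x ` Q) y * F j y)"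
      by (rule ennreal_suminf_cmult[symmetric])
    also have "\<dots> \<le> (\<Sum>j. control_fun \<mu> Q (F j) x)" by (rule suminf_le) (use elim in auto)
    finally show ?case .
  qed
  then show ?thesis unfolding control_fun_def[of \<mu> Q "\<lambda>x. \<Sum>j. F j x"] by (rule esssup_I[OF m])
qed

end

section \<open>The \<open>s\<close>-triangle inequality for countable sums of right
  translates\<close>

locale lebesgue_amalgam = amalgam_space \<mu> "lebesgue_space \<mu> q" Q w m
  for \<mu> :: "'g::{topological_group_add,t2_space} measure" and q :: ennreal and Q :: "'g set" and w m :: "'g \<Rightarrow> real" +
  fixes s :: real
  assumes q_pos: "0 < q" and s_norm: "has_equivalent_s_norm \<mu> (weighted_lebesgue \<mu> q m) s"
begin

lemma s_pos: "0 < s"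
  using s_norm unfolding has_equivalent_s_norm_def by blast

text \<open>The \<open>s\<close>-norm is given on complex functions. Nonnegative functions enter it
  this way, faithfully as long as their values are finite.\<close>

definition complexify :: "('g \<Rightarrow> ennreal) \<Rightarrow> 'g \<Rightarrow> complex" where
  "complexify F x = complex_of_real (enn2real (F x))"

lemma abs_complexify: "(\<And>x. F x < top) \<Longrightarrow> abs_fun (complexify F) = F"
  by (auto simp: fun_eq_iff abs_fun_def complexify_def)

lemma complexify_measurable: "F \<in> borel_measurable borel \<Longrightarrow> complexify F \<in> borel_measurable borel"
  unfolding complexify_def by simp

lemma Y_add_finite:
  assumes "F \<in> borel_measurable borel" "G \<in> borel_measurable borel" "Y F < top" "Y G < top"
  shows "Y (\<lambda>x. F x + G x) < top"
  unfolding Y_eq distrib_right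
  by (rule lebesgue_add_finite[OF q_pos]) (use assms lsc_measurable[OF lsc_m'] in \<open>auto simp: Y_eq\<close>)

lemma Y_zero: "Y (\<lambda>x. 0) = 0"
proof -
  have "Y (\<lambda>x. 0) < top"
  proof -
    have "(indicator {} :: 'g \<Rightarrow> ennreal) = (\<lambda>x. 0)" by (simp add: fun_eq_iff)
    then show ?thesis using N_compact[OF compact_empty] by (simp add: Y_eq)
  qed
  then obtain r where r: "Y (\<lambda>x. 0) = ennreal r" "r \<ge> 0" by (cases "Y (\<lambda>x. 0)") auto
  have "Y (\<lambda>x. 0) = ennreal 2 * Y (\<lambda>x. 0)" using Y_cmult[of "\<lambda>x. 0" 2] by simp
  then have "ennreal r = ennreal (2 * r)" using r by (simp add: ennreal_mult')
  then show ?thesis using r by simp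
qed

text \<open>The \<open>s\<close>-triangle inequality of the equivalent norm \<open>M\<close>,
  transported through \<open>complexify\<close>; the factor \<open>(b / a) powr s\<close> is the
  price of the equivalence. The induction also carries the finiteness of partial sums, since
  \<open>M\<close> is controlled only inside the space.\<close>

lemma Y_finite_sum:
  obtains C where "C > 0" "\<And>J F. finite J \<Longrightarrow> (\<And>j. j \<in> J \<Longrightarrow> F j \<in> borel_measurable borel) \<Longrightarrow> (\<And>j x. j \<in> J \<Longrightarrow> F j x < top)
     \<Longrightarrow> (\<And>j. j \<in> J \<Longrightarrow> Y (F j) < top) \<Longrightarrow>
     ennreal_powr (Y (\<lambda>x. \<Sum>j\<in>J. F j x)) s \<le> ennreal C * (\<Sum>j\<in>(J::nat set). ennreal_powr (Y (F j)) s)"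
proof -
  obtain M :: "('g \<Rightarrow> complex) \<Rightarrow> real" and a b where ab: "a > 0" "b > 0" and
    M0: "\<forall>F\<in>fspace \<mu> Y. 0 \<le> M F \<and> ennreal a * qnorm \<mu> Y F \<le> ennreal (M F) \<and> ennreal (M F) \<le> ennreal b * qnorm \<mu> Y F"
    and Madd0: "\<forall>F\<in>fspace \<mu> Y. \<forall>G\<in>fspace \<mu> Y. M (\<lambda>x. F x + G x) powr s \<le> M F powr s + M G powr s"
    using s_norm[unfolded has_equivalent_s_norm_def weighted_lebesgue_def] by (elim conjE exE) (rule that; assumption)
  note M = M0[rule_format] and Madd = Madd0[rule_format]
  have qn: "qnorm \<mu> Y (complexify F) = Y F" if "F \<in> borel_measurable borel" "\<And>x. F x < top" for F
    using complexify_measurable[OF that(1)] abs_complexify[OF that(2)] by (simp add: qnorm_def)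
  have main: "Y (\<lambda>x. \<Sum>j\<in>J. F j x) < top \<and> M (complexify (\<lambda>x. \<Sum>j\<in>J. F j x)) powr s \<le> (\<Sum>j\<in>J. M (complexify (F j)) powr s)"
    if "finite J" "\<And>j. j \<in> J \<Longrightarrow> F j \<in> borel_measurable borel" "\<And>j x. j \<in> J \<Longrightarrow> F j x < top" "\<And>j. j \<in> J \<Longrightarrow> Y (F j) < top"
    for J :: "nat set" and F
    using that
  proof (induction J rule: finite_induct)
    case empty
    have "qnorm \<mu> Y (complexify (\<lambda>x. 0)) = 0" using qn[of "\<lambda>x. 0"] Y_zero by simp
    then have "M (complexify (\<lambda>x. 0)) = 0" using M[of "complexify (\<lambda>x. 0)"] by (auto simp: fspace_def ennreal_eq_0_iff)
    then show ?case by (simp add: Y_zero)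
  next
    case (insert j J)
    let ?S = "\<lambda>x. \<Sum>j\<in>J. F j x"
    have IH: "Y ?S < top" "M (complexify ?S) powr s \<le> (\<Sum>j\<in>J. M (complexify (F j)) powr s)"
      using insert.IH insert.prems by auto
    have mS: "?S \<in> borel_measurable borel" using insert.prems by (intro borel_measurable_sum) auto
    have fS: "?S x < top" for x using insert.prems insert.hyps(1) by (auto simp: less_top)
    have F: "F j \<in> borel_measurable borel" "\<And>x. F j x < top" "Y (F j) < top" using insert.prems by auto
    have eq: "(\<lambda>x. \<Sum>j\<in>insert j J. F j x) = (\<lambda>x. F j x + ?S x)" using insert.hyps by (simp add: fun_eq_iff)
    have c: "complexify (\<lambda>x. F j x + ?S x) = (\<lambda>x. complexify (F j) x + complexify ?S x)"
      using F(2) fS by (simp add: complexify_def fun_eq_iff enn2real_plus)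
    have "complexify (F j) \<in> fspace \<mu> Y" "complexify ?S \<in> fspace \<mu> Y"
      using qn[OF F(1,2)] qn[OF mS fS] F(3) IH(1) by (simp_all add: fspace_def)
    from Madd[OF this] have "M (complexify (\<lambda>x. F j x + ?S x)) powr s \<le> M (complexify (F j)) powr s + M (complexify ?S) powr s"
      unfolding c .
    also have "\<dots> \<le> (\<Sum>j\<in>insert j J. M (complexify (F j)) powr s)" using insert.hyps IH(2) by simp
    finally show ?case unfolding eq using Y_add_finite[OF F(1) mS F(3) IH(1)] by simp
  qed
  show ?thesis
  proof (rule that[of "(b / a) powr s"])
    show "(b / a) powr s > 0" using ab by simp
    fix J :: "nat set" and F
    assume J: "finite J" "\<And>j. j \<in> J \<Longrightarrow> F j \<in> borel_measurable borel" "\<And>j x. j \<in> J \<Longrightarrow> F j x < top" "\<And>j. j \<in> J \<Longrightarrow> Y (F j) < top"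
    let ?S = "\<lambda>x. \<Sum>j\<in>J. F j x"
    have m: "Y ?S < top \<and> M (complexify ?S) powr s \<le> (\<Sum>j\<in>J. M (complexify (F j)) powr s)"
      by (rule main[of J F]) (use J in blast)+
    have mS: "?S \<in> borel_measurable borel" using J by (intro borel_measurable_sum) auto
    have fS: "?S x < top" for x using J(1,3) by (auto simp: less_top)
    have inS: "complexify ?S \<in> fspace \<mu> Y" using qn[OF mS fS] m by (simp add: fspace_def)
    obtain y where y: "Y ?S = ennreal y" "y \<ge> 0" using m by (cases "Y ?S") auto
    have ay: "a * y \<le> M (complexify ?S)"
    proof -
      have "ennreal (a * y) \<le> ennreal (M (complexify ?S))" "0 \<le> M (complexify ?S)"
        using M[OF inS] y ab qn[OF mS fS] by (simp_all flip: ennreal_mult)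
      then show ?thesis by (simp only: ennreal_le_iff)
    qed
    define z where "z j = enn2real (Y (F j))" for j
    have z: "Y (F j) = ennreal (z j)" "z j \<ge> 0" if "j \<in> J" for j using J(4)[OF that] by (simp_all add: z_def)
    have bz: "M (complexify (F j)) \<le> b * z j" "M (complexify (F j)) \<ge> 0" if j: "j \<in> J" for j
    proof -
      have q1: "qnorm \<mu> Y (complexify (F j)) = ennreal (z j)" using qn[OF J(2)[OF j] J(3)[OF j]] z[OF j] by simp
      then have "complexify (F j) \<in> fspace \<mu> Y" by (simp add: fspace_def)
      from M[OF this] show "M (complexify (F j)) \<le> b * z j" "M (complexify (F j)) \<ge> 0"
        using q1 ab z[OF j] by (simp_all add: ennreal_le_iff flip: ennreal_mult)
    qed
    have "(a * y) powr s \<le> M (complexify ?S) powr s" using ay ab y s_pos by (intro powr_mono2) auto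
    also have "\<dots> \<le> (\<Sum>j\<in>J. M (complexify (F j)) powr s)" using m by blast
    also have "\<dots> \<le> (\<Sum>j\<in>J. (b * z j) powr s)" using bz s_pos by (intro sum_mono powr_mono2) auto
    also have "\<dots> = b powr s * (\<Sum>j\<in>J. z j powr s)"
      unfolding sum_distrib_left using ab z by (intro sum.cong) (auto simp: powr_mult)
    finally have "a powr s * y powr s \<le> b powr s * (\<Sum>j\<in>J. z j powr s)" using ab y by (simp add: powr_mult)
    then have "y powr s \<le> (b / a) powr s * (\<Sum>j\<in>J. z j powr s)"
      using ab by (simp add: powr_divide field_simps)
    then have "ennreal (y powr s) \<le> ennreal ((b / a) powr s * (\<Sum>j\<in>J. z j powr s))" by (rule ennreal_leI)
    also have "\<dots> = ennreal ((b / a) powr s) * (\<Sum>j\<in>J. ennreal (z j powr s))"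
      using ab by (simp add: ennreal_mult' sum_ennreal)
    also have "(\<Sum>j\<in>J. ennreal (z j powr s)) = (\<Sum>j\<in>J. ennreal_powr (Y (F j)) s)"
      using z by (intro sum.cong) auto
    finally show "ennreal_powr (Y ?S) s \<le> ennreal ((b / a) powr s) * (\<Sum>j\<in>J. ennreal_powr (Y (F j)) s)"
      using y by simp
  qed
qed

lemma Y_SUP_le:
  fixes F :: "nat \<Rightarrow> 'g \<Rightarrow> ennreal"
  assumes "\<And>n. F n \<in> borel_measurable borel" "\<And>n x. F n x \<le> F (Suc n) x"
  shows "Y (\<lambda>x. SUP n. F n x) \<le> (SUP n. Y (F n))"
  unfolding Y_eq SUP_mult_right_ennreal
  by (rule lebesgue_SUP_le[OF q_pos])
    (use assms lsc_measurable[OF lsc_m'] in \<open>auto intro!: borel_measurable_times_ennreal mult_right_mono\<close>)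

text \<open>Partial sums increase to the series and the norm passes to the supremum. If one term has
  infinite norm, the right side is infinite as well.\<close>

lemma Y_suminf:
  obtains C where "C > 0" "\<And>F. (\<And>j. F j \<in> borel_measurable borel) \<Longrightarrow> (\<And>j x. F j x < top) \<Longrightarrow>
     ennreal_powr (Y (\<lambda>x. \<Sum>j. F j x)) s \<le> ennreal C * (\<Sum>j. ennreal_powr (Y (F j)) s)"
proof (rule Y_finite_sum)
  fix C assume C: "C > 0" "\<And>J F. finite J \<Longrightarrow> (\<And>j. j \<in> J \<Longrightarrow> F j \<in> borel_measurable borel) \<Longrightarrow> (\<And>j x. j \<in> J \<Longrightarrow> F j x < top)
     \<Longrightarrow> (\<And>j. j \<in> J \<Longrightarrow> Y (F j) < top) \<Longrightarrow>
     ennreal_powr (Y (\<lambda>x. \<Sum>j\<in>J. F j x)) s \<le> ennreal C * (\<Sum>j\<in>(J::nat set). ennreal_powr (Y (F j)) s)"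
  have main: "ennreal_powr (Y (\<lambda>x. \<Sum>j. F j x)) s \<le> ennreal C * (\<Sum>j. ennreal_powr (Y (F j)) s)"
    if F: "\<And>j. F j \<in> borel_measurable borel" "\<And>j x. F j x < top" for F :: "nat \<Rightarrow> 'g \<Rightarrow> ennreal"
  proof (cases "\<exists>j. Y (F j) = top")
    case True
    then obtain j where j: "Y (F j) = top" by blast
    have "ennreal_powr (Y (F j)) s \<le> (\<Sum>j. ennreal_powr (Y (F j)) s)" using sum_le_suminf[of "\<lambda>j. ennreal_powr (Y (F j)) s" "{j}"] by simp
    then have "(\<Sum>j. ennreal_powr (Y (F j)) s) = top" using j by (simp add: top_unique)
    then show ?thesis using C(1) by (simp add: ennreal_mult_top)
  next
    case False
    then have fin: "Y (F j) < top" for j using less_top by blast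
    have "ennreal_powr (Y (\<lambda>x. \<Sum>j. F j x)) s \<le> ennreal_powr (SUP n. Y (\<lambda>x. \<Sum>j<n. F j x)) s"
      unfolding suminf_eq_SUP using s_pos F(1)
      by (intro ennreal_powr_mono Y_SUP_le borel_measurable_sum) auto
    also have "\<dots> \<le> (SUP n. ennreal_powr (Y (\<lambda>x. \<Sum>j<n. F j x)) s)" by (rule ennreal_powr_SUP_le[OF s_pos])
    also have "\<dots> \<le> ennreal C * (\<Sum>j. ennreal_powr (Y (F j)) s)"
    proof (rule SUP_least)
      fix n
      have "ennreal_powr (Y (\<lambda>x. \<Sum>j<n. F j x)) s \<le> ennreal C * (\<Sum>j<n. ennreal_powr (Y (F j)) s)"
        by (rule C(2)) (auto simp: F fin)
      also have "\<dots> \<le> ennreal C * (\<Sum>j. ennreal_powr (Y (F j)) s)"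
        by (intro mult_left_mono sum_le_suminf) auto
      finally show "ennreal_powr (Y (\<lambda>x. \<Sum>j<n. F j x)) s \<le> ennreal C * (\<Sum>j. ennreal_powr (Y (F j)) s)" .
    qed
    finally show ?thesis .
  qed
  show thesis
  proof (rule that[OF C(1)])
    fix F :: "nat \<Rightarrow> 'g \<Rightarrow> ennreal" assume "\<And>j. F j \<in> borel_measurable borel" "\<And>j x. F j x < top"
    then show "ennreal_powr (Y (\<lambda>x. \<Sum>j. F j x)) s \<le> ennreal C * (\<Sum>j. ennreal_powr (Y (F j)) s)" by (rule main)
  qed
qed

text \<open>The local boundedness clause of \<open>amalgam\<close> gives finiteness at every point
  rather than almost everywhere, as \<open>complexify\<close> requires.\<close>

lemma control_finite: assumes "W F < top" shows "control_fun \<mu> Q F x < top"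
proof -
  have K: "compact ((+) x ` closure Q)" using Q_nbhd unfolding rel_compact_nbhd_def by (intro compact_translation_left) blast
  have "control_fun \<mu> Q F x \<le> esssup \<mu> (\<lambda>y. indicator ((+) x ` closure Q) y * F y)"
    unfolding control_fun_def
  proof (rule esssup_mono)
    show "(\<lambda>y. indicator ((+) x ` Q) y * F y) \<in> borel_measurable \<mu>"
      using borel_indicator_mult[OF borel_translation_left[OF Q_borel] W_finite_D(1)[OF assms]] by simp
    fix y
    have "(+) x ` Q \<subseteq> (+) x ` closure Q" using closure_subset by blast
    then show "indicator ((+) x ` Q) y * F y \<le> indicator ((+) x ` closure Q) y * F y"
      by (intro mult_right_mono) (auto simp: indicator_def)
  qed
  also have "\<dots> < top" by (rule W_finite_D(2)[OF assms K])
  finally show ?thesis .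
qed

lemma lsc_finite: assumes "lsc F" "W F < top" shows "F x < top"
proof -
  have "F (x + 0) \<le> control_fun \<mu> Q F x"
    using Q_nbhd unfolding rel_compact_nbhd_def by (intro le_control_fun Q_borel assms) blast
  then show ?thesis using control_finite[OF assms(2), of x] by simp
qed

text \<open>\<open>A\<close> is scaled into the unit ball by means of \<open>B\<close>, which unlike
  \<open>W A\<close> cannot be zero.\<close>

lemma right_norm_bound:
  assumes A: "lsc A" "W A \<le> ennreal B" "0 < B"
  shows "W (\<lambda>x. A (x + t)) \<le> ennreal B * right_norm \<mu> Q Y t"
proof -
  have WA: "W A < top" using A(2) by (auto intro: le_less_trans)
  define c where "c = 1 / B"
  have c: "c > 0" using A(3) by (simp add: c_def)
  have lc: "lsc (\<lambda>x. ennreal c * A x)" by (intro lsc_mult lsc_const A)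
  have mA: "A \<in> borel_measurable borel" by (rule lsc_measurable[OF A(1)])
  have W_c: "W (\<lambda>x. ennreal c * F x) = ennreal c * W F" if F: "lsc F" for F
  proof -
    have "lsc (\<lambda>x. ennreal c * F x)" by (intro lsc_mult lsc_const F)
    moreover have "control_fun \<mu> Q (\<lambda>x. ennreal c * F x) = (\<lambda>x. ennreal c * control_fun \<mu> Q F x)"
      by (rule ext) (rule control_fun_cmult[OF Q_borel lsc_measurable[OF F] c])
    ultimately show ?thesis
      using Y_cmult[OF control_measurable[OF lsc_measurable[OF F]] c] by (simp add: W_lsc F)
  qed
  define F where "F = complexify (\<lambda>x. ennreal c * A x)"
  have fin: "ennreal c * A x < top" for x using lsc_finite[OF A(1) WA] by (simp add: ennreal_mult_less_top)
  have absF: "abs_fun F = (\<lambda>x. ennreal c * A x)" unfolding F_def by (rule abs_complexify[OF fin])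
  have mF: "F \<in> borel_measurable borel" unfolding F_def by (intro complexify_measurable lsc_measurable lc)
  have "qnorm \<mu> W F = ennreal c * W A" using mF absF W_c[OF A(1)] by (simp add: qnorm_def)
  also have "\<dots> \<le> ennreal c * ennreal B" by (intro mult_left_mono A) simp
  also have "\<dots> = 1" using A(3) by (simp add: c_def flip: ennreal_mult)
  finally have q1: "qnorm \<mu> W F \<le> 1" .
  have mt: "(\<lambda>x. x + t) \<in> borel_measurable borel"
    by (intro borel_measurable_continuous_onI continuous_intros)
  have mFt: "right_translate t F \<in> borel_measurable borel"
    unfolding right_translate_def by (rule measurable_compose[OF mt mF])
  have "abs_fun (right_translate t F) = (\<lambda>x. ennreal c * A (x + t))"
    using fun_cong[OF absF] by (simp add: right_translate_def abs_fun_def fun_eq_iff)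
  moreover have lAt: "lsc (\<lambda>x. A (x + t))" by (intro lsc_compose[OF A(1)] continuous_intros)
  ultimately have "qnorm \<mu> W (right_translate t F) = ennreal c * W (\<lambda>x. A (x + t))"
    using mFt W_c[OF lAt] by (simp add: qnorm_def)
  moreover have "qnorm \<mu> W (right_translate t F) \<le> right_norm \<mu> Q Y t"
    unfolding right_norm_def operator_norm_def using q1 by (intro SUP_upper2[of F]) auto
  ultimately have "ennreal B * (ennreal c * W (\<lambda>x. A (x + t))) \<le> ennreal B * right_norm \<mu> Q Y t"
    by (intro mult_left_mono) auto
  then show ?thesis using A(3) by (simp add: c_def mult.assoc[symmetric] flip: ennreal_mult)
qed

text \<open>The Lebesgue functional changes by a constant depending on \<open>a\<close>, and
  moderateness gives the same for the weight \<open>m\<close>.\<close>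

lemma Y_right_translate:
  obtains C where "C > 0" "\<And>H. lsc H \<Longrightarrow> Y (\<lambda>x. H (x + a)) \<le> ennreal C * Y H"
proof -
  obtain C where C: "C > 0" "\<And>F. lsc F \<Longrightarrow> lebesgue_space \<mu> q (\<lambda>x. F (x + a)) \<le> ennreal C * lebesgue_space \<mu> q F"
    using lebesgue_right_translate[OF q_pos, of a] by blast
  define c where "c = w 0 * w (- a)"
  have c: "c > 0" unfolding c_def using w_pos by simp
  show ?thesis
  proof (rule that[of "c * C"])
    show "c * C > 0" using c C by simp
    fix H :: "'g \<Rightarrow> ennreal" assume H: "lsc H"
    have lHm: "lsc (\<lambda>x. H x * ennreal (m x))" by (intro lsc_mult H lsc_m')
    have lHa: "lsc (\<lambda>x. H (x + a))" by (intro lsc_compose[OF H] continuous_intros)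
    have lHma: "lsc (\<lambda>x. H (x + a) * ennreal (m (x + a)))" using lsc_compose[OF lHm, of "\<lambda>x. x + a"] by (simp add: continuous_intros)
    have "Y (\<lambda>x. H (x + a)) \<le> lebesgue_space \<mu> q (\<lambda>x. ennreal c * (H (x + a) * ennreal (m (x + a))))"
      unfolding Y_eq
    proof (rule N_mono)
      show "(\<lambda>x. H (x + a) * ennreal (m x)) \<in> borel_measurable borel" by (intro lsc_measurable lsc_mult lHa lsc_m')
      show "(\<lambda>x. ennreal c * (H (x + a) * ennreal (m (x + a)))) \<in> borel_measurable borel" by (intro lsc_measurable lsc_mult[OF lsc_const lHma])
      fix x
      have "m x \<le> c * m (x + a)" using m_moderate[of 0 "x + a" "- a"] by (simp add: c_def add.assoc mult_ac)
      then have "ennreal (m x) \<le> ennreal c * ennreal (m (x + a))" using c by (simp add: ennreal_leI flip: ennreal_mult')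
      from mult_left_mono[OF this, of "H (x + a)"]
      show "H (x + a) * ennreal (m x) \<le> ennreal c * (H (x + a) * ennreal (m (x + a)))" by (simp add: mult_ac)
    qed
    also have "\<dots> = ennreal c * lebesgue_space \<mu> q (\<lambda>x. H (x + a) * ennreal (m (x + a)))"
      by (rule N_cmult[OF lsc_measurable[OF lHma] c])
    also have "\<dots> \<le> ennreal c * (ennreal C * Y H)"
      unfolding Y_eq by (intro mult_left_mono C(2)[OF lHm]) simp
    finally show "Y (\<lambda>x. H (x + a)) \<le> ennreal (c * C) * Y H" using c C by (simp add: ennreal_mult mult.assoc)
  qed
qed

text \<open>The \<open>s\<close>-triangle inequality is applied to control functions, each right
  translate costing its operator norm. Summability of the \<open>s\<close>-th powers is what
  membership of a window in an amalgam with weighted L^s provides after discretization.\<close>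

lemma W_right_sum:
  fixes \<kappa> :: "nat \<Rightarrow> real" and t :: "nat \<Rightarrow> 'g"
  assumes \<kappa>: "\<And>j. \<kappa> j \<ge> 0" and S: "(\<Sum>j. ennreal_powr (ennreal (\<kappa> j) * right_norm \<mu> Q Y (t j)) s) < top"
  obtains C where "C > 0" "\<And>A B. lsc A \<Longrightarrow> 0 < B \<Longrightarrow> W A \<le> ennreal B \<Longrightarrow> W (\<lambda>x. \<Sum>j. ennreal (\<kappa> j) * A (x + t j)) \<le> ennreal (C * B)"
proof (rule Y_suminf)
  fix D assume D: "D > 0" "\<And>F. (\<And>j. F j \<in> borel_measurable borel) \<Longrightarrow> (\<And>j x. F j x < top) \<Longrightarrow>
     ennreal_powr (Y (\<lambda>x. \<Sum>j. F j x)) s \<le> ennreal D * (\<Sum>j. ennreal_powr (Y (F j)) s)"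
  obtain S' where S': "(\<Sum>j. ennreal_powr (ennreal (\<kappa> j) * right_norm \<mu> Q Y (t j)) s) = ennreal S'" "S' \<ge> 0"
    using S by (cases "\<Sum>j. ennreal_powr (ennreal (\<kappa> j) * right_norm \<mu> Q Y (t j)) s") auto
  have term_fin: "ennreal (\<kappa> j) * right_norm \<mu> Q Y (t j) < top" for j
  proof -
    have "ennreal_powr (ennreal (\<kappa> j) * right_norm \<mu> Q Y (t j)) s \<le> (\<Sum>j. ennreal_powr (ennreal (\<kappa> j) * right_norm \<mu> Q Y (t j)) s)"
      using sum_le_suminf[of "\<lambda>j. ennreal_powr (ennreal (\<kappa> j) * right_norm \<mu> Q Y (t j)) s" "{j}"] by simp
    then have "ennreal_powr (ennreal (\<kappa> j) * right_norm \<mu> Q Y (t j)) s < top" using S by (rule le_less_trans)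
    then show ?thesis unfolding ennreal_powr_less_top_iff .
  qed
  show thesis
  proof (rule that[of "(D * (S' + 1)) powr (1 / s)"])
    show "(D * (S' + 1)) powr (1 / s) > 0" using D S' by simp
    fix A :: "'g \<Rightarrow> ennreal" and B assume A: "lsc A" "0 < B" "W A \<le> ennreal B"
    have lAt: "lsc (\<lambda>x. A (x + a))" for a by (intro lsc_compose[OF A(1)] continuous_intros)
    define F where "F j x = ennreal (\<kappa> j) * control_fun \<mu> Q (\<lambda>x. A (x + t j)) x" for j x
    have mF: "F j \<in> borel_measurable borel" for j
      unfolding F_def by (intro borel_measurable_times_ennreal borel_measurable_const control_measurable lsc_measurable lAt)
    have bound: "W (\<lambda>x. A (x + t j)) \<le> ennreal B * right_norm \<mu> Q Y (t j)" for j
      by (rule right_norm_bound[OF A(1,3,2)])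
    have fin: "F j x < top \<and> Y (F j) \<le> ennreal B * (ennreal (\<kappa> j) * right_norm \<mu> Q Y (t j))" for j x
    \<comment> \<open>At a vanishing coefficient the right translation may be unbounded, so the norm
      estimate has to be bypassed.\<close>
    proof (cases "\<kappa> j = 0")
      case True
      then have "F j = (\<lambda>x. 0)" by (simp add: F_def fun_eq_iff)
      then show ?thesis by (simp add: Y_zero)
    next
      case False
      then have k: "\<kappa> j > 0" using \<kappa>[of j] by simp
      have "right_norm \<mu> Q Y (t j) < top" using term_fin[of j] k by (auto simp: ennreal_mult_less_top)
      then have "ennreal B * right_norm \<mu> Q Y (t j) < top" by (simp add: ennreal_mult_less_top)
      then have Wf: "W (\<lambda>x. A (x + t j)) < top" using bound[of j] by simp
      have "F j x < top" unfolding F_def using control_finite[OF Wf] by (simp add: ennreal_mult_less_top)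
      moreover have "Y (F j) = ennreal (\<kappa> j) * W (\<lambda>x. A (x + t j))"
        unfolding F_def W_lsc[OF lAt] by (rule Y_cmult[OF control_measurable[OF lsc_measurable[OF lAt]] k])
      moreover have "\<dots> \<le> ennreal B * (ennreal (\<kappa> j) * right_norm \<mu> Q Y (t j))"
        using mult_left_mono[OF bound[of j], of "ennreal (\<kappa> j)"] by (simp add: mult_ac)
      ultimately show ?thesis by simp
    qed
    let ?\<Phi> = "\<lambda>x. \<Sum>j. ennreal (\<kappa> j) * A (x + t j)"
    have l\<Phi>: "lsc ?\<Phi>" by (intro lsc_suminf lsc_mult lsc_const lAt)
    have mj: "(\<lambda>x. ennreal (\<kappa> j) * A (x + t j)) \<in> borel_measurable borel" for j
      by (intro lsc_measurable lsc_mult lsc_const lAt)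
    have cj: "control_fun \<mu> Q (\<lambda>x. ennreal (\<kappa> j) * A (x + t j)) x = F j x" for j x
    proof (cases "\<kappa> j = 0")
      case True
      then show ?thesis using control_fun_le[OF Q_borel, of "\<lambda>_. 0" x 0] by (simp add: F_def)
    next
      case False
      then have k: "\<kappa> j > 0" using \<kappa>[of j] by simp
      show ?thesis unfolding F_def by (rule control_fun_cmult[OF Q_borel lsc_measurable[OF lAt] k])
    qed
    have "W ?\<Phi> = Y (control_fun \<mu> Q ?\<Phi>)" by (rule W_lsc[OF l\<Phi>])
    also have "\<dots> \<le> Y (\<lambda>x. \<Sum>j. F j x)"
    proof (rule Y_mono)
      show "control_fun \<mu> Q ?\<Phi> \<in> borel_measurable borel" by (rule control_measurable[OF lsc_measurable[OF l\<Phi>]])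
      show "(\<lambda>x. \<Sum>j. F j x) \<in> borel_measurable borel" using mF by simp
      show "control_fun \<mu> Q ?\<Phi> x \<le> (\<Sum>j. F j x)" for x
        using control_fun_suminf[where Q=Q and F="\<lambda>j x. ennreal (\<kappa> j) * A (x + t j)" and x=x, OF Q_borel mj] unfolding cj .
    qed
    finally have "ennreal_powr (W ?\<Phi>) s \<le> ennreal_powr (Y (\<lambda>x. \<Sum>j. F j x)) s"
      using s_pos by (intro ennreal_powr_mono) auto
    also have "\<dots> \<le> ennreal D * (\<Sum>j. ennreal_powr (Y (F j)) s)" by (rule D(2)[OF mF]) (use fin in blast)
    also have "\<dots> \<le> ennreal D * (\<Sum>j. ennreal_powr (ennreal B) s * ennreal_powr (ennreal (\<kappa> j) * right_norm \<mu> Q Y (t j)) s)"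
      unfolding ennreal_powr_mult[OF s_pos, symmetric] using fin s_pos
      by (intro mult_left_mono suminf_le ennreal_powr_mono) auto
    also have "\<dots> = ennreal (D * (B powr s * S'))"
      using S' A(2) D(1) by (simp add: ennreal_suminf_cmult ennreal_mult')
    also have "\<dots> \<le> ennreal (D * (B powr s * (S' + 1)))" using D by (intro ennreal_leI mult_left_mono) auto
    also have "D * (B powr s * (S' + 1)) = ((D * (S' + 1)) powr (1 / s) * B) powr s"
      using D(1) S'(2) A(2) s_pos by (simp add: powr_mult powr_powr mult_ac)
    finally have "ennreal_powr (W ?\<Phi>) s \<le> ennreal_powr (ennreal ((D * (S' + 1)) powr (1 / s) * B)) s"
      using A(2) by simp
    then show "W ?\<Phi> \<le> ennreal ((D * (S' + 1)) powr (1 / s) * B)" unfolding ennreal_powr_le_iff[OF s_pos] .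
  qed
qed

end

section \<open>Discretization and the synthesis estimate\<close>

lemma ennreal_term_le_suminf: "f n \<le> (\<Sum>n. f n :: ennreal)"
  using sum_le_suminf[of f "{n}"] by simp

context lebesgue_amalgam
begin

lemma compact_closure_Q: "compact (closure Q)" and zero_interior_Q: "0 \<in> interior Q"
  using Q_nbhd unfolding rel_compact_nbhd_def by auto

text \<open>Contains every \<open>x\<close> for which \<open>x + Q\<close> meets \<open>K\<close>,
  hence every point where the control function of a function supported in \<open>K\<close> is
  nonzero.\<close>

definition thicken :: "'g set \<Rightarrow> 'g set" where "thicken K = sumset K (uminus ` closure Q)"

lemma compact_thicken: "compact K \<Longrightarrow> compact (thicken K)"
  unfolding thicken_def by (intro compact_sumset compact_closure_Q compact_continuous_image continuous_intros)

lemma thickenI: "x + a \<in> K \<Longrightarrow> a \<in> Q \<Longrightarrow> x \<in> thicken K"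
proof -
  assume a: "x + a \<in> K" "a \<in> Q"
  have "(x + a) + - a \<in> thicken K" unfolding thicken_def using a closure_subset by (intro sumsetI) auto
  then show ?thesis by (simp add: add.assoc)
qed

lemma Y_compact: assumes K: "compact K" shows "Y (indicator K) < top"
proof -
  obtain B where B: "B > 0" "\<And>x. x \<in> K \<Longrightarrow> w x \<le> B" by (rule w_bounded_on_compact[OF K]) (rule that)
  define c where "c = w 0 * m 0 * B"
  have c: "c > 0" unfolding c_def using w_pos m_pos B by simp
  have mK: "(indicator K :: 'g \<Rightarrow> ennreal) \<in> borel_measurable borel" using K by simp
  have "Y (indicator K) \<le> lebesgue_space \<mu> q (\<lambda>x. ennreal c * indicator K x)"
    unfolding Y_eq
  proof (rule N_mono)
    show "(\<lambda>x. indicator K x * ennreal (m x)) \<in> borel_measurable borel"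
      by (intro borel_measurable_times_ennreal mK lsc_measurable[OF lsc_m'])
    show "(\<lambda>x. ennreal c * indicator K x) \<in> borel_measurable borel"
      by (intro borel_measurable_times_ennreal mK borel_measurable_const)
    fix x
    show "indicator K x * ennreal (m x) \<le> ennreal c * indicator K x"
    proof (cases "x \<in> K")
      case True
      have "m x \<le> w 0 * m 0 * w x" using m_moderate[of 0 0 x] by simp
      also have "\<dots> \<le> c" unfolding c_def using B(2)[OF True] w_pos m_pos by (intro mult_left_mono) (auto intro: less_imp_le)
      finally show ?thesis using True by (simp add: ennreal_leI)
    qed simp
  qed
  also have "\<dots> = ennreal c * lebesgue_space \<mu> q (indicator K)" by (rule N_cmult[OF mK c])
  also have "\<dots> < top" using N_compact[OF K] by (simp add: ennreal_mult_less_top)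
  finally show ?thesis .
qed

text \<open>A right translate of the indicator of the interior of \<open>Q\<close> has positive
  norm. In \<open>discretize\<close> this lets a vanishing integrand be read as a vanishing
  coefficient.\<close>

lemma right_norm_pos: "right_norm \<mu> Q Y t \<noteq> 0"
proof
  assume z: "right_norm \<mu> Q Y t = 0"
  define A :: "'g \<Rightarrow> ennreal" where "A = indicator (interior Q)"
  have lA: "lsc A" unfolding A_def by (rule lsc_indicator) simp
  have "W A \<le> Y (indicator (thicken (closure Q)))"
    unfolding W_lsc[OF lA]
  proof (rule Y_mono)
    show "control_fun \<mu> Q A \<in> borel_measurable borel" by (rule control_measurable[OF lsc_measurable[OF lA]])
    show "(indicator (thicken (closure Q)) :: 'g \<Rightarrow> ennreal) \<in> borel_measurable borel"
      using compact_thicken[OF compact_closure_Q] by simp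
    fix x
    show "control_fun \<mu> Q A x \<le> indicator (thicken (closure Q)) x"
    proof (rule control_fun_le[OF Q_borel lsc_measurable[OF lA]])
      fix y assume y: "y \<in> Q"
      show "A (x + y) \<le> indicator (thicken (closure Q)) x"
        using thickenI[of x y "closure Q"] y interior_subset[of Q] closure_subset[of Q]
        by (cases "x + y \<in> interior Q") (auto simp: A_def)
    qed
  qed
  also have "\<dots> < top" by (rule Y_compact[OF compact_thicken[OF compact_closure_Q]])
  finally obtain B where B: "W A = ennreal B" "B \<ge> 0" by (cases "W A") auto
  have "W (\<lambda>x. A (x + t)) \<le> ennreal (B + 1) * right_norm \<mu> Q Y t"
    using B by (intro right_norm_bound lA) (auto simp: ennreal_leI)
  then have W0: "W (\<lambda>x. A (x + t)) = 0" using z by simp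
  have lAt: "lsc (\<lambda>x. A (x + t))" by (intro lsc_compose[OF lA] continuous_intros)
  define H where "H = control_fun \<mu> Q (\<lambda>x. A (x + t))"
  have lH: "lsc H" unfolding H_def by (rule lsc_control[OF lsc_measurable[OF lAt]])
  have "lebesgue_space \<mu> q (\<lambda>x. H x * ennreal (m x)) = 0" using W0 unfolding W_lsc[OF lAt] Y_eq H_def .
  then have "AE x in \<mu>. H x * ennreal (m x) = 0" by (intro N_zero lsc_measurable lsc_mult lH lsc_m')
  then have ae: "AE x in \<mu>. x \<notin> {x. 0 < H x}"
  proof eventually_elim
    case (elim x)
    then show ?case using m_pos[of x] by (auto simp: ennreal_eq_0_iff)
  qed
  have o: "open {x. 0 < H x}" by (rule lscD[OF lH])
  have "{x. 0 < H x} \<in> sets \<mu>" using borel_open[OF o] by (simp only: sets_haar)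
  then have "{x. 0 < H x} \<in> null_sets \<mu>" by (rule AE_iff_null_sets[THEN iffD2, OF _ ae])
  moreover have "- t \<in> {x. 0 < H x}"
  proof -
    have "1 \<le> H (- t)" using le_control_fun[OF Q_borel lAt zero_interior_Q, of "- t"] zero_interior_Q
      unfolding H_def by (simp add: A_def)
    then show ?thesis using less_le_trans[OF zero_less_one] by blast
  qed
  ultimately show False using positive_open[OF o] by (metis empty_iff less_irrefl null_setsD1)
qed

text \<open>If \<open>x + U\<close> meets \<open>y + U\<close> and \<open>t\<close> lies in
  \<open>y + U\<close>, then \<open>- t + x\<close> has the form \<open>- a + b - c\<close> with
  entries in \<open>U\<close>. So \<open>x\<close> lies in the translate of
  \<open>interior Q\<close> to \<open>t\<close>.\<close>

lemma small_neighbourhood: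
  obtains U where "open U" "(0::'g) \<in> U" "emeasure \<mu> U < top" "\<And>a b c. a \<in> U \<Longrightarrow> b \<in> U \<Longrightarrow> c \<in> U \<Longrightarrow> - a + b - c \<in> interior Q"
proof -
  let ?f = "\<lambda>p::'g \<times> 'g \<times> 'g. - fst p + fst (snd p) - snd (snd p)"
  have "open (?f -` interior Q)" by (intro open_vimage open_interior continuous_intros)
  moreover have "(0, 0, 0) \<in> ?f -` interior Q" using zero_interior_Q by simp
  ultimately obtain A B where AB0: "open A" "open B" "(0, 0, 0) \<in> A \<times> B" "A \<times> B \<subseteq> ?f -` interior Q"
    by (rule open_prod_elim)
  then have AB: "open A" "open B" "0 \<in> A" "(0, 0) \<in> B" "A \<times> B \<subseteq> ?f -` interior Q" by auto
  obtain B1 B2 where B: "open B1" "open B2" "0 \<in> B1" "0 \<in> B2" "B1 \<times> B2 \<subseteq> B"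
    using open_prod_elim[OF AB(2,4)] by (metis mem_Sigma_iff)
  define U where "U = A \<inter> B1 \<inter> B2 \<inter> interior Q"
  have "emeasure \<mu> U \<le> emeasure \<mu> (closure Q)"
    using compact_closure_Q interior_subset[of Q] closure_subset[of Q] unfolding U_def by (intro emeasure_mono) auto
  then have "emeasure \<mu> U < top" using finite_compact[OF compact_closure_Q] by simp
  moreover have "- a + b - c \<in> interior Q" if "a \<in> U" "b \<in> U" "c \<in> U" for a b c
  proof -
    have "(a, b, c) \<in> A \<times> B" using that B(5) unfolding U_def by auto
    then show ?thesis using AB(5) by auto
  qed
  moreover have "open U" "0 \<in> U" unfolding U_def using AB B zero_interior_Q by auto
  ultimately show ?thesis using that by blast
qed

lemma countable_summable_support:
  fixes f :: "'a \<Rightarrow> ennreal"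
  assumes M: "M < top" "\<And>F. finite F \<Longrightarrow> F \<subseteq> Z \<Longrightarrow> (\<Sum>y\<in>F. f y) \<le> M"
  shows "countable {y\<in>Z. f y \<noteq> 0}"
proof -
  obtain r where r: "M = ennreal r" "r \<ge> 0" using M(1) by (cases M) auto
  have fin: "finite {y\<in>Z. ennreal (1 / real (Suc n)) < f y}" (is "finite ?A") for n
  proof (rule ccontr)
    assume inf: "infinite ?A"
    obtain k where k: "real k > r * real (Suc n)" using reals_Archimedean2 by blast
    obtain F where F: "F \<subseteq> ?A" "finite F" "card F = k" using infinite_arbitrarily_large[OF inf] by blast
    have "ennreal (real k / real (Suc n)) = (\<Sum>y\<in>F. ennreal (1 / real (Suc n)))"
      using F(3) by (simp add: ennreal_of_nat_eq_real_of_nat flip: ennreal_mult')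
    also have "\<dots> \<le> (\<Sum>y\<in>F. f y)" using F(1) by (intro sum_mono) (auto intro: less_imp_le)
    also have "\<dots> \<le> ennreal r" using M(2)[OF F(2)] F(1) r by auto
    finally have "real k / real (Suc n) \<le> r" using r by (simp add: ennreal_le_iff)
    then show False using k by (simp add: field_simps)
  qed
  have "{y\<in>Z. f y \<noteq> 0} \<subseteq> (\<Union>n. {y\<in>Z. ennreal (1 / real (Suc n)) < f y})"
  proof
    fix y assume y: "y \<in> {y\<in>Z. f y \<noteq> 0}"
    have "\<exists>n. ennreal (1 / real (Suc n)) < f y"
    proof (cases "f y")
      case (real e)
      then have "e > 0" using y by (cases "e = 0") auto
      then obtain n where "1 / real (Suc n) < e" using nat_approx_posE by blast
      then show ?thesis using real by (auto simp: ennreal_less_iff intro!: exI[of _ n])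
    next
      case top
      then show ?thesis by (intro exI[of _ 0]) simp
    qed
    then show "y \<in> (\<Union>n. {y\<in>Z. ennreal (1 / real (Suc n)) < f y})" using y by blast
  qed
  moreover have "countable (\<Union>n. {y\<in>Z. ennreal (1 / real (Suc n)) < f y})"
    by (intro countable_UN countableI_type countable_finite[OF fin])
  ultimately show ?thesis by (rule countable_subset)
qed

text \<open>The sampling points are moved inside the cells of a lattice to places where the integrand does not
  exceed twice its mean, because the weight \<open>\<rho>\<close> is only known to be measurable.\<close>

lemma discretize:
  assumes G: "lsc G" and Gfin: "\<And>x. control_fun \<mu> Q G x < top" and \<rho>: "\<And>x. \<rho> x \<noteq> 0"
    and m\<rho>: "(\<lambda>x. control_fun \<mu> Q G x * \<rho> x) \<in> borel_measurable borel"
    and int: "(\<integral>\<^sup>+x. ennreal_powr (control_fun \<mu> Q G x * \<rho> x) s \<partial>\<mu>) < top"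
  obtains \<kappa> :: "nat \<Rightarrow> real" and t where "\<And>j. \<kappa> j \<ge> 0"
    "\<And>y. G y \<le> (\<Sum>j. ennreal (\<kappa> j) * indicator (interior Q) (- t j + y))"
    "(\<Sum>j. ennreal_powr (ennreal (\<kappa> j) * \<rho> (t j)) s) < top"
proof -
  define f where "f x = ennreal_powr (control_fun \<mu> Q G x * \<rho> x) s" for x
  have mf: "f \<in> borel_measurable borel" unfolding f_def by (rule measurable_ennreal_powr[OF m\<rho>])
  obtain U where U: "open U" "(0::'g) \<in> U" "emeasure \<mu> U < top" "\<And>a b c. a \<in> U \<Longrightarrow> b \<in> U \<Longrightarrow> c \<in> U \<Longrightarrow> - a + b - c \<in> interior Q"
    by (rule small_neighbourhood) (rule that)
  have U0: "emeasure \<mu> U \<noteq> 0" using positive_open[OF U(1)] U(2) by (metis empty_iff less_irrefl)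
  obtain Z where Z: "disjoint_family_on (\<lambda>y. (+) y ` U) Z" "\<And>x. \<exists>y\<in>Z. (+) x ` U \<inter> (+) y ` U \<noteq> {}"
    by (rule obtain_lattice[OF U(2)]) (rule that)
  have oU: "open ((+) y ` U)" for y by (rule open_translation_left[OF U(1)])
  have bU: "(+) y ` U \<in> sets borel" for y by (rule borel_open[OF oU])
  have eU: "emeasure \<mu> ((+) y ` U) = emeasure \<mu> U" for y by (rule left_invariant[OF borel_open[OF U(1)]])
  define I where "I y = (\<integral>\<^sup>+x. f x * indicator ((+) y ` U) x \<partial>\<mu>)" for y
  have mfi: "(\<lambda>x. f x * indicator ((+) y ` U) x) \<in> borel_measurable \<mu>" for y
    unfolding borel_measurable_haar by (intro borel_measurable_times_ennreal mf borel_measurable_indicator bU)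
  have Itot: "I y \<le> (\<integral>\<^sup>+x. f x \<partial>\<mu>)" for y
    unfolding I_def by (intro nn_integral_mono) (auto simp: indicator_def)
  then have Ifin: "I y < top" for y using int unfolding f_def by (rule le_less_trans)
  \<comment> \<open>Otherwise \<open>f\<close> would exceed twice its mean on the whole cell; this
    forces the integral over the cell to vanish although \<open>f\<close> is positive there.\<close>
  have "\<exists>t\<in>(+) y ` U. f t * emeasure \<mu> U \<le> 2 * I y" for y
  proof (rule ccontr)
    assume "\<not> ?thesis"
    then have gt: "2 * I y < f t * emeasure \<mu> U" if "t \<in> (+) y ` U" for t using that by (meson not_le)
    have "2 * I y * emeasure \<mu> U = (\<integral>\<^sup>+x. 2 * I y * indicator ((+) y ` U) x \<partial>\<mu>)"
      using bU[of y] eU[of y] by (simp add: nn_integral_cmult_indicator)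
    also have "\<dots> \<le> (\<integral>\<^sup>+x. emeasure \<mu> U * (f x * indicator ((+) y ` U) x) \<partial>\<mu>)"
      using gt by (intro nn_integral_mono) (auto simp: indicator_def mult.commute intro: less_imp_le)
    also have "\<dots> = emeasure \<mu> U * I y" unfolding I_def by (rule nn_integral_cmult[OF mfi])
    finally have "2 * I y * emeasure \<mu> U \<le> 1 * I y * emeasure \<mu> U" by (simp add: mult_ac)
    then have "emeasure \<mu> U * (2 * I y) \<le> emeasure \<mu> U * (1 * I y)" by (simp add: mult_ac)
    then have "2 * I y \<le> 1 * I y"
      using ennreal_mult_le_mult_iff[of "emeasure \<mu> U" "2 * I y" "1 * I y"] U0 U(3) by (metis less_irrefl)
    moreover obtain i where i: "I y = ennreal i" "i \<ge> 0" using Ifin[of y] by (cases "I y") auto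
    ultimately have "ennreal (2 * i) \<le> ennreal i" by (simp add: ennreal_mult')
    then have "I y = 0" using i by (simp add: ennreal_le_iff)
    then have "AE x in \<mu>. f x * indicator ((+) y ` U) x = 0"
      unfolding I_def by (subst (asm) nn_integral_0_iff_AE[OF mfi])
    moreover have "f x \<noteq> 0" if "x \<in> (+) y ` U" for x using gt[OF that] by auto
    ultimately have ae: "AE x in \<mu>. x \<notin> (+) y ` U"
      by (auto elim!: eventually_mono simp: indicator_def split: if_splits)
    have "(+) y ` U \<in> sets \<mu>" using bU by (simp only: sets_haar)
    then have "(+) y ` U \<in> null_sets \<mu>" by (rule AE_iff_null_sets[THEN iffD2, OF _ ae])
    then show False using eU[of y] U0 by (simp add: null_setsD1)
  qed
  then obtain t where t: "\<And>y. t y \<in> (+) y ` U" "\<And>y. f (t y) * emeasure \<mu> U \<le> 2 * I y" by metis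
  define k where "k y = enn2real (control_fun \<mu> Q G (t y))" for y
  have k: "ennreal (k y) = control_fun \<mu> Q G (t y)" "k y \<ge> 0" for y using Gfin by (simp_all add: k_def)
  have fk: "f (t y) = ennreal_powr (ennreal (k y) * \<rho> (t y)) s" for y by (simp add: f_def k)
  define M where "M = 2 * (\<integral>\<^sup>+x. f x \<partial>\<mu>) / emeasure \<mu> U"
  have Mfin: "M < top"
  proof -
    obtain i where i: "(\<integral>\<^sup>+x. f x \<partial>\<mu>) = ennreal i" "i \<ge> 0"
      using int unfolding f_def[symmetric] by (cases "\<integral>\<^sup>+x. f x \<partial>\<mu>") auto
    obtain u where u: "emeasure \<mu> U = ennreal u" "u > 0" using U0 U(3) by (cases "emeasure \<mu> U") auto
    have "M = ennreal (2 * i) / ennreal u" unfolding M_def i(1) u(1) using i(2) by (simp add: ennreal_mult')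
    also have "\<dots> = ennreal (2 * i / u)" using i(2) u(2) by (intro divide_ennreal) auto
    finally show ?thesis by simp
  qed
  have sumM: "(\<Sum>y\<in>F. f (t y)) \<le> M" if F: "finite F" "F \<subseteq> Z" for F
  proof -
    have "(\<Sum>y\<in>F. f (t y)) * emeasure \<mu> U \<le> (\<Sum>y\<in>F. 2 * I y)"
      unfolding sum_distrib_right by (intro sum_mono t)
    also have "\<dots> = 2 * (\<Sum>y\<in>F. I y)" by (rule sum_distrib_left[symmetric])
    also have "(\<Sum>y\<in>F. I y) = (\<integral>\<^sup>+x. (\<Sum>y\<in>F. f x * indicator ((+) y ` U) x) \<partial>\<mu>)"
      unfolding I_def by (rule nn_integral_sum[OF mfi, symmetric])
    also have "2 * (\<integral>\<^sup>+x. (\<Sum>y\<in>F. f x * indicator ((+) y ` U) x) \<partial>\<mu>) \<le> 2 * (\<integral>\<^sup>+x. f x \<partial>\<mu>)"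
    proof (intro mult_left_mono nn_integral_mono)
      fix x
      have d: "disjoint_family_on (\<lambda>y. (+) y ` U) F" using Z(1) F(2) by (meson disjoint_family_on_mono)
      have "(\<Sum>y\<in>F. f x * indicator ((+) y ` U) x) = f x * (\<Sum>y\<in>F. indicator ((+) y ` U) x)" by (simp add: sum_distrib_left)
      also have "(\<Sum>y\<in>F. indicator ((+) y ` U) x :: ennreal) = indicator (\<Union>y\<in>F. (+) y ` U) x"
        by (rule indicator_UN_disjoint[OF F(1) d, symmetric])
      also have "f x * \<dots> \<le> f x" by (simp add: indicator_def)
      finally show "(\<Sum>y\<in>F. f x * indicator ((+) y ` U) x) \<le> f x" .
    qed simp
    finally have "(\<Sum>y\<in>F. f (t y)) * emeasure \<mu> U / emeasure \<mu> U \<le> M"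
      unfolding M_def by (rule divide_right_mono_ennreal)
    then show ?thesis using U0 U(3) by (simp add: ennreal_mult_divide_eq)
  qed
  define S where "S = {y\<in>Z. f (t y) \<noteq> 0}"
  have cS: "countable S" unfolding S_def by (rule countable_summable_support[OF Mfin sumM])
  \<comment> \<open>The lattice may be uncountable, but outside the countable set \<open>S\<close>
    the coefficients vanish because \<open>\<rho>\<close> has no zeros.\<close>
  have notS: "k y = 0" if "y \<in> Z" "y \<notin> S" for y
  proof -
    have "ennreal (k y) * \<rho> (t y) = 0" using that unfolding S_def fk by simp
    then show ?thesis using \<rho>[of "t y"] k(2)[of y] by (simp add: ennreal_eq_0_iff)
  qed
  define e where "e = to_nat_on S"
  have e: "inj_on e S" unfolding e_def by (rule inj_on_to_nat_on[OF cS])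
  define g where "g = from_nat_into S"
  have ge: "g (e y) = y" if "y \<in> S" for y unfolding g_def e_def by (rule from_nat_into_to_nat_on[OF cS that])
  define \<kappa> where "\<kappa> n = (if n \<in> e ` S then k (g n) else 0)" for n
  show ?thesis
  proof (rule that[of \<kappa> "\<lambda>n. t (g n)"])
    show "\<kappa> j \<ge> 0" for j unfolding \<kappa>_def using k(2) by simp
    fix x
    obtain y where y: "y \<in> Z" "(+) x ` U \<inter> (+) y ` U \<noteq> {}" using Z(2)[of x] by blast
    then obtain a b where ab: "a \<in> U" "b \<in> U" "x + a = y + b" by blast
    obtain u where u: "u \<in> U" "t y = y + u" using t(1)[of y] by blast
    have "x = y + b - a" using ab(3) by (metis add_diff_cancel)
    then have "- t y + x = - u + b - a" unfolding u(2) by (simp add: minus_add add.assoc diff_conv_add_uminus del: add_uminus_conv_diff)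
    then have inQ: "- t y + x \<in> interior Q" using U(4)[OF u(1) ab(2,1)] by simp
    have "G x \<le> ennreal (k y)"
      using le_control_fun[OF Q_borel G inQ, of "t y"] unfolding k(1) by (simp add: add.assoc[symmetric])
    also have "\<dots> \<le> (\<Sum>j. ennreal (\<kappa> j) * indicator (interior Q) (- t (g j) + x))"
    proof (cases "y \<in> S")
      case True
      have eq: "ennreal (k y) = ennreal (\<kappa> (e y)) * indicator (interior Q) (- t (g (e y)) + x)"
        using True inQ by (simp add: \<kappa>_def ge)
      show ?thesis unfolding eq
        by (rule ennreal_term_le_suminf[of "\<lambda>j. ennreal (\<kappa> j) * indicator (interior Q) (- t (g j) + x)"])
    next
      case False
      then show ?thesis using notS[OF y(1)] by simp
    qed
    finally show "G x \<le> (\<Sum>j. ennreal (\<kappa> j) * indicator (interior Q) (- t (g j) + x))" .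
  next
    have "(\<Sum>j. ennreal_powr (ennreal (\<kappa> j) * \<rho> (t (g j))) s) \<le> M"
      unfolding suminf_eq_SUP
    proof (rule SUP_least)
      fix n
      let ?F = "{y\<in>S. e y < n}"
      have finF: "finite ?F"
        by (rule finite_imageD[of e]) (auto intro: finite_subset[of _ "{..<n}"] inj_on_subset[OF e])
      have "(\<Sum>j<n. ennreal_powr (ennreal (\<kappa> j) * \<rho> (t (g j))) s) = (\<Sum>j\<in>e ` ?F. ennreal_powr (ennreal (\<kappa> j) * \<rho> (t (g j))) s)"
        by (intro sum.mono_neutral_right) (auto simp: \<kappa>_def)
      also have "\<dots> = (\<Sum>y\<in>?F. f (t y))"
        by (subst sum.reindex) (auto intro!: sum.cong inj_on_subset[OF e] simp: \<kappa>_def ge fk)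
      also have "\<dots> \<le> M" by (rule sumM[OF finF]) (auto simp: S_def)
      finally show "(\<Sum>j<n. ennreal_powr (ennreal (\<kappa> j) * \<rho> (t (g j))) s) \<le> M" .
    qed
    then show "(\<Sum>j. ennreal_powr (ennreal (\<kappa> j) * \<rho> (t (g j))) s) < top" using Mfin by (rule le_less_trans)
  qed
qed

end

section \<open>Sums of indicator functions around well-spread points\<close>

context lebesgue_amalgam
begin

text \<open>A bound by \<open>\<tau>\<close> for the weighted \<ell>^q-norm, stated with powers so
  that no root of an infinite sum occurs.\<close>

definition coefficient_bound :: "(nat \<Rightarrow> real) \<Rightarrow> (nat \<Rightarrow> 'g) \<Rightarrow> real \<Rightarrow> bool" where
  "coefficient_bound c y \<tau> \<longleftrightarrow> (\<forall>n. c n \<ge> 0) \<and>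
     (if q = top then \<forall>n. c n * m (y n) \<le> \<tau>
      else (\<Sum>n. ennreal ((c n * m (y n)) powr enn2real q)) \<le> ennreal (\<tau> powr enn2real q))"

text \<open>Indices with coefficient zero are exempt because sequences are padded with zeros at
  uncontrolled points.\<close>

definition bounded_overlap :: "(nat \<Rightarrow> real) \<Rightarrow> (nat \<Rightarrow> 'g) \<Rightarrow> 'g set \<Rightarrow> nat \<Rightarrow> bool" where
  "bounded_overlap c y K b \<longleftrightarrow> (\<forall>x. finite {n. c n \<noteq> 0 \<and> - y n + x \<in> K} \<and> card {n. c n \<noteq> 0 \<and> - y n + x \<in> K} \<le> b)"

text \<open>At each point at most \<open>b\<close> terms are nonzero, so the sum is at most
  \<open>b\<close> times its largest term, and moderateness replaces \<open>m x\<close> by the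
  weight at the centre of that term. Powers of a single term are harmless, so exponents below one
  need no separate treatment.\<close>

lemma Y_overlap_sum:
  assumes K: "compact K"
  obtains C where "C > 0" "\<And>c y \<tau>. bounded_overlap c y K b \<Longrightarrow> coefficient_bound c y \<tau> \<Longrightarrow> \<tau> > 0 \<Longrightarrow>
     Y (\<lambda>x. \<Sum>n. ennreal (c n) * indicator K (- y n + x)) \<le> ennreal (C * \<tau>)"
proof -
  obtain B where B: "B > 0" "\<And>x. x \<in> K \<Longrightarrow> w x \<le> B" by (rule w_bounded_on_compact[OF K]) (rule that)
  \<comment> \<open>The added 1 here and in \<open>\<nu>\<close> only keeps the constants
    positive.\<close>
  define L where "L = w 0 * B * (real b + 1)"
  have L: "L > 0" unfolding L_def using w_pos B by simp
  define \<nu> where "\<nu> = measure \<mu> K + 1"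
  have \<nu>: "\<nu> > 0" "emeasure \<mu> K \<le> ennreal \<nu>"
    using finite_compact[OF K] unfolding \<nu>_def by (simp_all add: emeasure_eq_ennreal_measure less_top measure_nonneg add_nonneg_pos ennreal_leI)
  define C where "C = L * (if q = top then 1 else \<nu> powr (1 / enn2real q))"
  have C: "C > 0" unfolding C_def using L \<nu> by simp
  show ?thesis
  proof (rule that[OF C])
    fix c y \<tau> assume ov: "bounded_overlap c y K b" and cb: "coefficient_bound c y \<tau>" and \<tau>: "\<tau> > 0"
    define a where "a n = c n * m (y n)" for n
    have c0: "c n \<ge> 0" for n using cb unfolding coefficient_bound_def by blast
    have a0: "a n \<ge> 0" for n unfolding a_def using c0 m_pos[of "y n"] by simp
    define J where "J x = {n. c n \<noteq> 0 \<and> - y n + x \<in> K}" for x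
    have J: "finite (J x)" "card (J x) \<le> b" for x using ov unfolding bounded_overlap_def J_def by auto
    have mi: "(\<lambda>x. indicator K (- y n + x) :: ennreal) \<in> borel_measurable borel" for n
    proof -
      have "(\<lambda>x. - y n + x) \<in> borel_measurable borel" by (intro borel_measurable_continuous_onI continuous_intros)
      moreover have "(indicator K :: 'g \<Rightarrow> ennreal) \<in> borel_measurable borel" using K by simp
      ultimately show ?thesis by (rule measurable_compose)
    qed
    let ?A = "\<lambda>x. \<Sum>n. ennreal (c n) * indicator K (- y n + x)"
    have mA: "?A \<in> borel_measurable borel"
      by (intro borel_measurable_suminf_order borel_measurable_times_ennreal borel_measurable_const mi)
    have pt: "\<exists>n. ?A x * ennreal (m x) \<le> ennreal L * (ennreal (a n) * indicator K (- y n + x))" for x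
    proof (cases "J x = {}")
      case True
      then have "c n = 0 \<or> - y n + x \<notin> K" for n unfolding J_def by blast
      then have "ennreal (c n) * indicator K (- y n + x) = 0" for n by (metis ennreal_0 indicator_simps(2) mult_eq_0_iff)
      then have "?A x = (\<Sum>n. 0)" by (intro suminf_cong)
      then have "?A x = 0" by simp
      then have "?A x * ennreal (m x) \<le> ennreal L * (ennreal (a 0) * indicator K (- y 0 + x))"
        by (simp only: mult_zero_left zero_le)
      then show ?thesis by (rule exI)
    next
      case False
      have "Max (a ` J x) \<in> a ` J x" using J(1)[of x] False by (intro Max_in) auto
      then obtain n where n0: "n \<in> J x" "Max (a ` J x) = a n" by auto
      then have n: "n \<in> J x" "\<And>k. k \<in> J x \<Longrightarrow> a k \<le> a n" using Max_ge[of "a ` J x"] J(1)[of x] by auto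
      have mk: "m x \<le> w 0 * m (y k) * B" if "k \<in> J x" for k
      proof -
        have "m (0 + y k + (- y k + x)) \<le> w 0 * m (y k) * w (- y k + x)" by (rule m_moderate)
        also have "\<dots> \<le> w 0 * m (y k) * B"
          using that B(2) w_pos m_pos unfolding J_def by (intro mult_left_mono) (auto intro: less_imp_le)
        finally show ?thesis by (simp add: add.assoc[symmetric])
      qed
      have "?A x = (\<Sum>k\<in>J x. ennreal (c k) * indicator K (- y k + x))"
        by (rule suminf_finite[OF J(1)]) (auto simp: J_def)
      also have "\<dots> = (\<Sum>k\<in>J x. ennreal (c k))" by (intro sum.cong refl) (simp add: J_def)
      finally have A1: "?A x = (\<Sum>k\<in>J x. ennreal (c k))" .
      have "?A x * ennreal (m x) = (\<Sum>k\<in>J x. ennreal (c k * m x))"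
      proof -
        have e: "ennreal (c k * m x) = ennreal (c k) * ennreal (m x)" for k by (rule ennreal_mult'[OF c0])
        show ?thesis by (simp only: A1 sum_distrib_right e)
      qed
      also have "\<dots> \<le> (\<Sum>k\<in>J x. ennreal (w 0 * B * a n))"
      proof (intro sum_mono ennreal_leI)
        fix k assume k: "k \<in> J x"
        have "c k * m x \<le> c k * (w 0 * m (y k) * B)" by (intro mult_left_mono mk k c0)
        also have "\<dots> = w 0 * B * a k" unfolding a_def by simp
        also have "\<dots> \<le> w 0 * B * a n" using n(2)[OF k] w_pos B by (intro mult_left_mono) (auto intro: less_imp_le)
        finally show "c k * m x \<le> w 0 * B * a n" .
      qed
      also have "\<dots> = ennreal (real (card (J x)) * (w 0 * B * a n))"
      proof -
        have "0 \<le> w 0 * B * a n" using w_pos[of 0] B(1) a0[of n] by simp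
        then have "(\<Sum>k\<in>J x. ennreal (w 0 * B * a n)) = ennreal (\<Sum>k\<in>J x. w 0 * B * a n)" by (rule sum_ennreal)
        then show ?thesis by (simp only: sum_constant)
      qed
      also have "\<dots> \<le> ennreal (L * a n)"
      proof (rule ennreal_leI)
        have "real (card (J x)) * (w 0 * B * a n) \<le> (real b + 1) * (w 0 * B * a n)"
          using J(2)[of x] w_pos[of 0] B(1) a0[of n] by (intro mult_right_mono) auto
        then show "real (card (J x)) * (w 0 * B * a n) \<le> L * a n" unfolding L_def by (simp add: mult_ac)
      qed
      also have "\<dots> = ennreal L * (ennreal (a n) * indicator K (- y n + x))"
      proof -
        have "indicator K (- y n + x) = (1::ennreal)" using n(1) unfolding J_def by (simp only: mem_Collect_eq indicator_simps)
        moreover have "ennreal (L * a n) = ennreal L * ennreal (a n)" using L by (intro ennreal_mult') simp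
        ultimately show ?thesis by (simp only: mult_1_right)
      qed
      finally show ?thesis by blast
    qed
    have mAm: "(\<lambda>x. ?A x * ennreal (m x)) \<in> borel_measurable borel"
    proof (rule borel_measurable_times_ennreal)
      show "?A \<in> borel_measurable borel" by (rule mA)
      show "(\<lambda>x. ennreal (m x)) \<in> borel_measurable borel" by (rule lsc_measurable[OF lsc_m'])
    qed
    show "Y ?A \<le> ennreal (C * \<tau>)"
    proof (cases "q = top")
      case True
      have at: "a n \<le> \<tau>" for n using cb True unfolding coefficient_bound_def a_def by simp
      have "?A x * ennreal (m x) \<le> ennreal (L * \<tau>)" for x
      proof -
        obtain n where "?A x * ennreal (m x) \<le> ennreal L * (ennreal (a n) * indicator K (- y n + x))" using pt by blast
        also have "\<dots> \<le> ennreal L * (ennreal \<tau> * 1)"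
        proof (rule mult_left_mono)
          have "ennreal (a n) \<le> ennreal \<tau>" by (rule ennreal_leI[OF at])
          moreover have "indicator K (- y n + x) \<le> (1::ennreal)" by (simp add: indicator_def)
          ultimately show "ennreal (a n) * indicator K (- y n + x) \<le> ennreal \<tau> * 1" by (rule mult_mono) simp_all
        qed simp
        also have "\<dots> = ennreal (L * \<tau>)" using ennreal_mult'[of L \<tau>] L by simp
        finally show ?thesis .
      qed
      then have AE: "AE x in \<mu>. ?A x * ennreal (m x) \<le> ennreal (L * \<tau>)" by (rule AE_I2)
      have mAm': "(\<lambda>x. ?A x * ennreal (m x)) \<in> borel_measurable \<mu>" unfolding borel_measurable_haar by (rule mAm)
      have E: "esssup \<mu> (\<lambda>x. ?A x * ennreal (m x)) \<le> ennreal (L * \<tau>)" by (rule esssup_I[OF mAm' AE])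
      have CL: "C = L" unfolding C_def True by simp
      have "Y ?A = esssup \<mu> (\<lambda>x. ?A x * ennreal (m x))"
      proof -
        have "Y ?A = lebesgue_space \<mu> q (\<lambda>x. ?A x * ennreal (m x))" by (rule Y_eq)
        also have "\<dots> = esssup \<mu> (\<lambda>x. ?A x * ennreal (m x))"
          by (simp only: lebesgue_space_def mAm' True simp_thms if_True if_False)
        finally show ?thesis .
      qed
      then show ?thesis using E unfolding CL by (rule ord_eq_le_trans)
    next
      case False
      define r where "r = enn2real q"
      have r: "r > 0" unfolding r_def using q_pos False by (simp add: enn2real_positive_iff less_top)
      have sumr: "(\<Sum>n. ennreal (a n powr r)) \<le> ennreal (\<tau> powr r)"
        using cb False unfolding coefficient_bound_def a_def r_def by simp
      \<comment> \<open>The index of the dominating term depends on \<open>x\<close>; after taking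
        powers it is replaced by the sum over all indices, which can be integrated termwise.\<close>
      have "(\<integral>\<^sup>+x. ennreal_powr (?A x * ennreal (m x)) r \<partial>\<mu>)
         \<le> (\<integral>\<^sup>+x. (\<Sum>n. ennreal (L powr r) * (ennreal (a n powr r) * indicator K (- y n + x))) \<partial>\<mu>)"
      proof (rule nn_integral_mono)
        fix x
        obtain n where "?A x * ennreal (m x) \<le> ennreal L * (ennreal (a n) * indicator K (- y n + x))" using pt by blast
        then have "ennreal_powr (?A x * ennreal (m x)) r \<le> ennreal_powr (ennreal L * (ennreal (a n) * indicator K (- y n + x))) r"
          using r by (intro ennreal_powr_mono) auto
        also have "\<dots> = ennreal (L powr r) * (ennreal (a n powr r) * indicator K (- y n + x))"
          using L a0[of n] by (simp add: ennreal_powr_mult[OF r] indicator_def)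
        also have "\<dots> \<le> (\<Sum>n. ennreal (L powr r) * (ennreal (a n powr r) * indicator K (- y n + x)))"
          by (rule ennreal_term_le_suminf[of "\<lambda>n. ennreal (L powr r) * (ennreal (a n powr r) * indicator K (- y n + x))"])
        finally show "ennreal_powr (?A x * ennreal (m x)) r \<le> (\<Sum>n. ennreal (L powr r) * (ennreal (a n powr r) * indicator K (- y n + x)))" .
      qed
      also have "\<dots> = (\<Sum>n. \<integral>\<^sup>+x. ennreal (L powr r) * (ennreal (a n powr r) * indicator K (- y n + x)) \<partial>\<mu>)"
        by (rule nn_integral_suminf) (simp only: borel_measurable_haar borel_measurable_times_ennreal borel_measurable_const mi)
      also have "\<dots> = (\<Sum>n. ennreal (L powr r) * emeasure \<mu> K * ennreal (a n powr r))"
      proof (intro suminf_cong)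
        fix n
        have mi': "(\<lambda>x. indicator K (- y n + x) :: ennreal) \<in> borel_measurable \<mu>" using mi by simp
        have "(\<integral>\<^sup>+x. ennreal (L powr r) * (ennreal (a n powr r) * indicator K (- y n + x)) \<partial>\<mu>)
           = (\<integral>\<^sup>+x. (ennreal (L powr r) * ennreal (a n powr r)) * indicator K (- y n + x) \<partial>\<mu>)" by (simp add: mult.assoc)
        also have "\<dots> = (ennreal (L powr r) * ennreal (a n powr r)) * (\<integral>\<^sup>+x. indicator K (- y n + x) \<partial>\<mu>)"
          by (rule nn_integral_cmult[OF mi'])
        also have "(\<integral>\<^sup>+x. indicator K (- y n + x) \<partial>\<mu>) = (\<integral>\<^sup>+x. indicator K x \<partial>\<mu>)"
          by (rule nn_integral_translate) (use K in simp)
        also have "\<dots> = emeasure \<mu> K" using K by simp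
        finally show "(\<integral>\<^sup>+x. ennreal (L powr r) * (ennreal (a n powr r) * indicator K (- y n + x)) \<partial>\<mu>)
           = ennreal (L powr r) * emeasure \<mu> K * ennreal (a n powr r)" by (simp add: mult_ac)
      qed
      also have "\<dots> = ennreal (L powr r) * emeasure \<mu> K * (\<Sum>n. ennreal (a n powr r))" by (rule ennreal_suminf_cmult)
      also have "\<dots> \<le> ennreal (L powr r) * ennreal \<nu> * ennreal (\<tau> powr r)"
        by (intro mult_mono \<nu> sumr) auto
      also have "\<dots> = ennreal_powr (ennreal (C * \<tau>)) r"
      proof -
        have "(C * \<tau>) powr r = L powr r * \<nu> * \<tau> powr r"
          unfolding C_def using False L \<nu> \<tau> r by (simp add: powr_mult powr_powr r_def[symmetric])
        moreover have "ennreal_powr (ennreal (C * \<tau>)) r = ennreal ((C * \<tau>) powr r)"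
          using C \<tau> by simp
        moreover have "ennreal (L powr r * \<nu> * \<tau> powr r) = ennreal (L powr r) * ennreal \<nu> * ennreal (\<tau> powr r)"
          using \<nu>(1) by (simp add: ennreal_mult')
        ultimately show ?thesis by (simp only:)
      qed
      finally have "ennreal_powr (\<integral>\<^sup>+x. ennreal_powr (?A x * ennreal (m x)) r \<partial>\<mu>) (1 / r) \<le> ennreal_powr (ennreal_powr (ennreal (C * \<tau>)) r) (1 / r)"
        using r by (intro ennreal_powr_mono) auto
      then show ?thesis
        unfolding Y_eq lebesgue_space_eq[OF False mAm, folded r_def] ennreal_powr_inverse(1)[OF r] .
    qed
  qed
qed

text \<open>The neighbourhoods are reflected because synthesis evaluates a window at the inverse of
  its argument. Passing to control functions enlarges them to a compact set.\<close>

lemma W_overlap_sum: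
  obtains C where "C > 0" "\<And>c y \<tau>. bounded_overlap c y (thicken (uminus ` closure Q)) b \<Longrightarrow> coefficient_bound c y \<tau> \<Longrightarrow> \<tau> > 0 \<Longrightarrow>
     W (\<lambda>x. \<Sum>n. ennreal (c n) * indicator (uminus -` interior Q) (- y n + x)) \<le> ennreal (C * \<tau>)"
proof -
  define K where "K = thicken (uminus ` closure Q)"
  have K: "compact K" unfolding K_def
    by (intro compact_thicken compact_continuous_image compact_closure_Q continuous_intros)
  obtain C where C: "C > 0" "\<And>c y \<tau>. bounded_overlap c y K b \<Longrightarrow> coefficient_bound c y \<tau> \<Longrightarrow> \<tau> > 0 \<Longrightarrow>
     Y (\<lambda>x. \<Sum>n. ennreal (c n) * indicator K (- y n + x)) \<le> ennreal (C * \<tau>)"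
    by (rule Y_overlap_sum[OF K, of b]) (rule that)
  show ?thesis
  proof (rule that[OF C(1)])
    fix c y \<tau> assume "bounded_overlap c y (thicken (uminus ` closure Q)) b" and a2: "coefficient_bound c y \<tau>" "\<tau> > 0"
    then have a: "bounded_overlap c y K b" "coefficient_bound c y \<tau>" "\<tau> > 0" unfolding K_def by auto
    let ?M = "uminus -` interior Q :: 'g set"
    let ?F = "\<lambda>x. \<Sum>n. ennreal (c n) * indicator ?M (- y n + x)"
    let ?A = "\<lambda>x. \<Sum>n. ennreal (c n) * indicator K (- y n + x)"
    have lM: "lsc (indicator ?M :: 'g \<Rightarrow> ennreal)"
      by (intro lsc_indicator open_vimage open_interior continuous_intros)
    have lF: "lsc ?F" by (intro lsc_suminf lsc_mult lsc_const lsc_compose[OF lM] continuous_intros)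
    have mA: "?A \<in> borel_measurable borel"
    proof (intro borel_measurable_suminf_order borel_measurable_times_ennreal borel_measurable_const)
      fix n
      have "(\<lambda>x. - y n + x) \<in> borel_measurable borel" by (intro borel_measurable_continuous_onI continuous_intros)
      moreover have "(indicator K :: 'g \<Rightarrow> ennreal) \<in> borel_measurable borel" using K by simp
      ultimately show "(\<lambda>x. indicator K (- y n + x) :: ennreal) \<in> borel_measurable borel" by (rule measurable_compose)
    qed
    have "W ?F = Y (control_fun \<mu> Q ?F)" by (rule W_lsc[OF lF])
    also have "\<dots> \<le> Y ?A"
    proof (rule Y_mono[OF control_measurable[OF lsc_measurable[OF lF]] mA])
      fix x show "control_fun \<mu> Q ?F x \<le> ?A x"
      proof (rule control_fun_le[OF Q_borel lsc_measurable[OF lF]])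
        fix z assume z: "z \<in> Q"
        show "?F (x + z) \<le> ?A x"
        proof (intro suminf_le mult_left_mono)
          fix n
          have "- y n + x \<in> K" if "- y n + (x + z) \<in> ?M"
          proof -
            have "- (- y n + (x + z)) \<in> closure Q" using that interior_subset[of Q] closure_subset[of Q] by auto
            then have "- (- (- y n + (x + z))) \<in> uminus ` closure Q" by (rule imageI)
            then show ?thesis unfolding K_def using thickenI[of "- y n + x" z "uminus ` closure Q"] z by (simp add: add.assoc)
          qed
          then show "indicator ?M (- y n + (x + z)) \<le> (indicator K (- y n + x) :: ennreal)" by (auto simp: indicator_def)
        qed auto
      qed
    qed
    also have "\<dots> \<le> ennreal (C * \<tau>)" by (rule C(2)[OF a])
    finally show "W ?F \<le> ennreal (C * \<tau>)" .
  qed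
qed

end

lemma suminf_swap_ennreal: "(\<Sum>n. \<Sum>j. f n j) = (\<Sum>j. \<Sum>n. f n j :: ennreal)"
proof -
  have "(\<Sum>n. \<Sum>j. f n j) = (\<integral>\<^sup>+n. (\<Sum>j. f n j) \<partial>count_space UNIV)" by (simp add: nn_integral_count_space_nat)
  also have "\<dots> = (\<Sum>j. \<integral>\<^sup>+n. f n j \<partial>count_space UNIV)" by (rule nn_integral_suminf) simp
  also have "\<dots> = (\<Sum>j. \<Sum>n. f n j)" by (simp add: nn_integral_count_space_nat)
  finally show ?thesis .
qed

section \<open>Averages of right translates and the convolution bound\<close>

context lebesgue_amalgam
begin

text \<open>Moving the argument within \<open>Q\<close> only shifts the averaging set inside the
  compact set \<open>D\<close>. A finite cover of \<open>D\<close> by translates of \<open>P\<close>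
  bounds the average by finitely many right translates of the control function of
  \<open>\<Phi>\<close>.\<close>

lemma W_average:
  obtains C where "C > 0" "\<And>\<Phi> B. lsc \<Phi> \<Longrightarrow> 0 < B \<Longrightarrow> W \<Phi> \<le> ennreal B \<Longrightarrow>
     W (\<lambda>x. \<integral>\<^sup>+y. \<Phi> (x + y) * indicator (interior Q) (y + z) \<partial>\<mu>) \<le> ennreal (C * B)"
proof (rule Y_finite_sum)
  fix C1 assume C1: "C1 > 0" "\<And>J F. finite J \<Longrightarrow> (\<And>j. j \<in> J \<Longrightarrow> F j \<in> borel_measurable borel) \<Longrightarrow> (\<And>j x. j \<in> J \<Longrightarrow> F j x < top)
     \<Longrightarrow> (\<And>j. j \<in> J \<Longrightarrow> Y (F j) < top) \<Longrightarrow>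
     ennreal_powr (Y (\<lambda>x. \<Sum>j\<in>J. F j x)) s \<le> ennreal C1 * (\<Sum>j\<in>(J::nat set). ennreal_powr (Y (F j)) s)"
  define P where "P = interior Q"
  have oP: "open P" and P0: "0 \<in> P" unfolding P_def using zero_interior_Q by auto
  have lP: "lsc (indicator P :: 'g \<Rightarrow> ennreal)" by (rule lsc_indicator[OF oP])
  define D where "D = sumset (closure Q) ((\<lambda>p. p - z) ` closure Q)"
  have cD: "compact D" unfolding D_def by (intro compact_sumset compact_closure_Q compact_continuous_image continuous_intros)
  have "D \<subseteq> (\<Union>d\<in>D. (+) d ` P)" using P0 by force
  from compactE_image[OF cD open_translation_left[OF oP] this]
  obtain D' where D': "D' \<subseteq> D" "finite D'" "D \<subseteq> (\<Union>d\<in>D'. (+) d ` P)" by blast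
  \<comment> \<open>The finite cover is indexed by natural numbers because
    \<open>Y_finite_sum\<close> is stated for such sums.\<close>
  obtain k :: nat and d where d: "D' = d ` {i. i < k}" using finite_imp_nat_seg_image_inj_on[OF D'(2)] by blast
  have cover: "D \<subseteq> (\<Union>j\<in>{..<k}. (+) (d j) ` P)"
  proof
    fix y assume "y \<in> D"
    then obtain e where e: "e \<in> D'" "y \<in> (+) e ` P" using D'(3) by blast
    then obtain j where "j < k" "e = d j" unfolding d by blast
    then show "y \<in> (\<Union>j\<in>{..<k}. (+) (d j) ` P)" using e(2) by blast
  qed
  have Pf: "emeasure \<mu> P < top"
  proof (rule le_less_trans[OF emeasure_mono finite_compact[OF compact_closure_Q]])
    show "P \<subseteq> closure Q" unfolding P_def using interior_subset closure_subset by blast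
  qed (use compact_closure_Q in simp)
  obtain \<nu> where \<nu>: "emeasure \<mu> P = ennreal \<nu>" "\<nu> > 0"
    using Pf positive_open[OF oP] P0 by (cases "emeasure \<mu> P") auto
  have "\<exists>C>0. \<forall>H. lsc H \<longrightarrow> Y (\<lambda>x. H (x + a)) \<le> ennreal C * Y H" for a
    by (rule Y_right_translate[of a]) blast
  then obtain R where R: "\<And>a. R a > 0" "\<And>a H. lsc H \<Longrightarrow> Y (\<lambda>x. H (x + a)) \<le> ennreal (R a) * Y H" by metis
  define S where "S = C1 * (\<Sum>j<k. (\<nu> * R (d j)) powr s) + 1"
  have S: "S > 0" unfolding S_def using C1(1) by (intro add_nonneg_pos mult_nonneg_nonneg sum_nonneg) auto
  show thesis
  proof (rule that[of "S powr (1 / s)"])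
    show "S powr (1 / s) > 0" using S by simp
    fix \<Phi> :: "'g \<Rightarrow> ennreal" and B assume \<Phi>: "lsc \<Phi>" "0 < B" "W \<Phi> \<le> ennreal B"
    have W\<Phi>: "W \<Phi> < top" using \<Phi>(3) by (auto intro: le_less_trans)
    define A where "A x = (\<integral>\<^sup>+y. \<Phi> (x + y) * indicator P (y + z) \<partial>\<mu>)" for x
    have lA: "lsc A"
    proof -
      have "lsc (\<lambda>(x, y). \<Phi> (x + y) * indicator P (y + z))"
        unfolding case_prod_unfold by (intro lsc_mult lsc_compose[OF \<Phi>(1)] lsc_compose[OF lP] continuous_intros)
      from lsc_section_integral[OF this] show ?thesis unfolding A_def .
    qed
    define H where "H = control_fun \<mu> Q \<Phi>"
    have lH: "lsc H" unfolding H_def by (rule lsc_control[OF lsc_measurable[OF \<Phi>(1)]])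
    have Hfin: "H x < top" for x unfolding H_def by (rule control_finite[OF W\<Phi>])
    define F where "F j x = ennreal \<nu> * H (x + d j)" for j x
    have lHd: "lsc (\<lambda>x. H (x + d j))" for j by (intro lsc_compose[OF lH] continuous_intros)
    have mF: "F j \<in> borel_measurable borel" for j
      unfolding F_def by (intro lsc_measurable lsc_mult lsc_const lHd)
    have Ffin: "F j x < top" for j x unfolding F_def using Hfin by (simp add: ennreal_mult_less_top)
    have YF: "Y (F j) \<le> ennreal (\<nu> * R (d j) * B)" for j
    proof -
      have "Y (F j) = ennreal \<nu> * Y (\<lambda>x. H (x + d j))" unfolding F_def by (rule Y_cmult[OF lsc_measurable[OF lHd] \<nu>(2)])
      also have "\<dots> \<le> ennreal \<nu> * (ennreal (R (d j)) * Y H)" by (intro mult_left_mono R(2) lH) simp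
      also have "Y H = W \<Phi>" unfolding H_def by (rule W_lsc[OF \<Phi>(1), symmetric])
      also have "ennreal \<nu> * (ennreal (R (d j)) * W \<Phi>) \<le> ennreal \<nu> * (ennreal (R (d j)) * ennreal B)"
        by (intro mult_left_mono \<Phi>(3)) auto
      also have "\<dots> = ennreal (\<nu> * R (d j) * B)" using \<nu>(2) R(1)[of "d j"] \<Phi>(2) by (simp add: mult.assoc ennreal_mult less_imp_le)
      finally show ?thesis .
    qed
    have YFt: "Y (F j) < top" for j using YF[of j] by (rule le_less_trans) simp
    have cA: "control_fun \<mu> Q A x \<le> (\<Sum>j<k. F j x)" for x
    proof (rule control_fun_le[OF Q_borel lsc_measurable[OF lA]])
      fix a assume a: "a \<in> Q"
      have l: "lsc (\<lambda>y. \<Phi> (x + y) * indicator P (- a + y + z))"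
        by (intro lsc_mult lsc_compose[OF \<Phi>(1)] lsc_compose[OF lP] continuous_intros)
      have "A (x + a) = (\<integral>\<^sup>+y. \<Phi> (x + y) * indicator P (- a + y + z) \<partial>\<mu>)"
        unfolding A_def using nn_integral_translate[OF lsc_measurable[OF l], of a] by (simp add: add.assoc[symmetric])
      also have "\<dots> \<le> (\<integral>\<^sup>+y. (\<Sum>j<k. H (x + d j) * indicator ((+) (d j) ` P) y) \<partial>\<mu>)"
      proof (rule nn_integral_mono)
        fix y
        show "\<Phi> (x + y) * indicator P (- a + y + z) \<le> (\<Sum>j<k. H (x + d j) * indicator ((+) (d j) ` P) y)"
        proof (cases "- a + y + z \<in> P")
          case True
          have "- a + y + z \<in> closure Q" using True interior_subset[of Q] closure_subset[of Q] unfolding P_def by blast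
          then have "(- a + y + z) - z \<in> (\<lambda>p. p - z) ` closure Q" by (rule imageI)
          moreover have "a \<in> closure Q" using a closure_subset by blast
          ultimately have "a + ((- a + y + z) - z) \<in> D" unfolding D_def by (intro sumsetI)
          then have "y \<in> D" by (simp add: add.assoc[symmetric])
          then obtain j p where j: "j < k" "p \<in> P" "y = d j + p" using cover by blast
          have "\<Phi> (x + y) \<le> H (x + d j)"
            using le_control_fun[OF Q_borel \<Phi>(1), of p "x + d j"] j(2,3) unfolding H_def P_def by (simp add: add.assoc)
          also have "\<dots> = H (x + d j) * indicator ((+) (d j) ` P) y" using j by simp
          also have "\<dots> \<le> (\<Sum>j<k. H (x + d j) * indicator ((+) (d j) ` P) y)" using j(1) by (intro member_le_sum) auto
          finally show ?thesis using True by simp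
        qed simp
      qed
      also have "\<dots> = (\<Sum>j<k. H (x + d j) * emeasure \<mu> ((+) (d j) ` P))"
        by (rule nn_integral_weighted_indicators) (rule borel_open[OF open_translation_left[OF oP]])
      also have "\<dots> = (\<Sum>j<k. F j x)"
        unfolding F_def left_invariant[OF borel_open[OF oP]] \<nu>(1) by (simp add: mult.commute)
      finally show "A (x + a) \<le> (\<Sum>j<k. F j x)" .
    qed
    have mS: "(\<lambda>x. \<Sum>j<k. F j x) \<in> borel_measurable borel" by (intro borel_measurable_sum mF)
    have "W A = Y (control_fun \<mu> Q A)" by (rule W_lsc[OF lA])
    also have "\<dots> \<le> Y (\<lambda>x. \<Sum>j<k. F j x)" by (rule Y_mono[OF control_measurable[OF lsc_measurable[OF lA]] mS cA])
    finally have "ennreal_powr (W A) s \<le> ennreal_powr (Y (\<lambda>x. \<Sum>j<k. F j x)) s" using s_pos by (intro ennreal_powr_mono) auto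
    also have "\<dots> \<le> ennreal C1 * (\<Sum>j<k. ennreal_powr (Y (F j)) s)"
      by (rule C1(2)) (use mF Ffin YFt in auto)
    also have "\<dots> \<le> ennreal C1 * (\<Sum>j<k. ennreal_powr (ennreal (\<nu> * R (d j) * B)) s)"
      using s_pos by (intro mult_left_mono sum_mono ennreal_powr_mono YF) auto
    also have "\<dots> = ennreal (C1 * (\<Sum>j<k. (\<nu> * R (d j)) powr s) * B powr s)"
    proof -
      have "ennreal_powr (ennreal (\<nu> * R (d j) * B)) s = ennreal ((\<nu> * R (d j)) powr s * B powr s)" for j
        using \<nu>(2) R(1)[of "d j"] \<Phi>(2) by (simp add: powr_mult)
      then have "ennreal C1 * (\<Sum>j<k. ennreal_powr (ennreal (\<nu> * R (d j) * B)) s) = ennreal C1 * ennreal (\<Sum>j<k. (\<nu> * R (d j)) powr s * B powr s)"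
        by (simp only: sum_ennreal[OF mult_nonneg_nonneg[OF powr_ge_zero powr_ge_zero]])
      also have "\<dots> = ennreal (C1 * (\<Sum>j<k. (\<nu> * R (d j)) powr s * B powr s))"
        by (rule ennreal_mult'[symmetric]) (use C1(1) in simp)
      finally show ?thesis by (simp only: sum_distrib_right mult.assoc)
    qed
    also have "\<dots> \<le> ennreal (S * B powr s)" unfolding S_def by (intro ennreal_leI mult_right_mono) auto
    also have "S * B powr s = (S powr (1 / s) * B) powr s" using S \<Phi>(2) s_pos by (simp add: powr_mult powr_powr)
    finally have "ennreal_powr (W A) s \<le> ennreal_powr (ennreal (S powr (1 / s) * B)) s" using \<Phi>(2) by simp
    then have "W A \<le> ennreal (S powr (1 / s) * B)" unfolding ennreal_powr_le_iff[OF s_pos] .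
    then show "W (\<lambda>x. \<integral>\<^sup>+y. \<Phi> (x + y) * indicator (interior Q) (y + z) \<partial>\<mu>) \<le> ennreal (S powr (1 / s) * B)"
      unfolding A_def P_def .
  qed
qed

text \<open>Since \<open>G\<close> is invariant under inversion, the left translates of \<open>G\<close> by the points \<open>y n\<close> are dominated by right
  translates of a sum of indicator functions around these points.\<close>

lemma synthesis_bound:
  fixes \<kappa> \<kappa>' :: "nat \<Rightarrow> real" and t t' :: "nat \<Rightarrow> 'g"
  assumes G: "lsc G" "\<And>x. G (- x) = G x" and K: "lsc K"
    and \<kappa>: "\<And>j. \<kappa> j \<ge> 0" "\<And>y. G y \<le> (\<Sum>j. ennreal (\<kappa> j) * indicator (interior Q) (- t j + y))"
      "(\<Sum>j. ennreal_powr (ennreal (\<kappa> j) * right_norm \<mu> Q Y (t j)) s) < top"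
    and \<kappa>': "\<And>j. \<kappa>' j \<ge> 0" "\<And>y. K y \<le> (\<Sum>j. ennreal (\<kappa>' j) * indicator (interior Q) (- t' j + y))"
      "(\<Sum>j. ennreal_powr (ennreal (\<kappa>' j) * right_norm \<mu> Q Y (t' j)) s) < top"
  obtains C where "C > 0" "\<And>c y \<tau> F. bounded_overlap c y (thicken (uminus ` closure Q)) b \<Longrightarrow> coefficient_bound c y \<tau> \<Longrightarrow> \<tau> > 0 \<Longrightarrow>
     F \<in> borel_measurable borel \<Longrightarrow>
     (\<forall>x. F x \<le> (\<Sum>n. ennreal (c n) * (\<integral>\<^sup>+\<xi>. G (- y n + \<xi>) * K (- x + \<xi> + z) \<partial>\<mu>))) \<Longrightarrow> W F \<le> ennreal (C * \<tau>)"
proof -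
  obtain C1 where C1: "C1 > 0" "\<And>c y \<tau>. bounded_overlap c y (thicken (uminus ` closure Q)) b \<Longrightarrow> coefficient_bound c y \<tau> \<Longrightarrow> \<tau> > 0 \<Longrightarrow>
     W (\<lambda>x. \<Sum>n. ennreal (c n) * indicator (uminus -` interior Q) (- y n + x)) \<le> ennreal (C1 * \<tau>)"
    by (rule W_overlap_sum[of b]) (rule that)
  obtain C2 where C2: "C2 > 0" "\<And>A B. lsc A \<Longrightarrow> 0 < B \<Longrightarrow> W A \<le> ennreal B \<Longrightarrow> W (\<lambda>x. \<Sum>j. ennreal (\<kappa> j) * A (x + t j)) \<le> ennreal (C2 * B)"
    by (rule W_right_sum[OF \<kappa>(1,3)]) (rule that)
  obtain C3 where C3: "C3 > 0" "\<And>A B. lsc A \<Longrightarrow> 0 < B \<Longrightarrow> W A \<le> ennreal B \<Longrightarrow> W (\<lambda>x. \<Sum>j. ennreal (\<kappa>' j) * A (x + t' j)) \<le> ennreal (C3 * B)"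
    by (rule W_right_sum[OF \<kappa>'(1,3)]) (rule that)
  obtain C4 where C4: "C4 > 0" "\<And>\<Phi> B. lsc \<Phi> \<Longrightarrow> 0 < B \<Longrightarrow> W \<Phi> \<le> ennreal B \<Longrightarrow>
     W (\<lambda>x. \<integral>\<^sup>+y. \<Phi> (x + y) * indicator (interior Q) (y + z) \<partial>\<mu>) \<le> ennreal (C4 * B)"
    by (rule W_average[of z]) (rule that)
  show ?thesis
  proof (rule that[of "C3 * (C4 * (C2 * C1))"])
    show "C3 * (C4 * (C2 * C1)) > 0" using C1 C2 C3 C4 by simp
    fix c y \<tau> F assume ov: "bounded_overlap c y (thicken (uminus ` closure Q)) b" and cb: "coefficient_bound c y \<tau>" and \<tau>: "\<tau> > 0"
      and mF: "F \<in> borel_measurable borel" and F: "\<forall>x. F x \<le> (\<Sum>n. ennreal (c n) * (\<integral>\<^sup>+\<xi>. G (- y n + \<xi>) * K (- x + \<xi> + z) \<partial>\<mu>))"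
    have lP: "lsc (indicator (interior Q) :: 'g \<Rightarrow> ennreal)" by (rule lsc_indicator) simp
    define A where "A x = (\<Sum>n. ennreal (c n) * indicator (uminus -` interior Q) (- y n + x))" for x
    have lM: "lsc (indicator (uminus -` interior Q :: 'g set) :: 'g \<Rightarrow> ennreal)"
      by (intro lsc_indicator open_vimage open_interior continuous_intros)
    have lA: "lsc A" unfolding A_def by (intro lsc_suminf lsc_mult lsc_const lsc_compose[OF lM] continuous_intros)
    have WA: "W A \<le> ennreal (C1 * \<tau>)" unfolding A_def by (rule C1(2)[OF ov cb \<tau>])
    define \<Phi> where "\<Phi> x = (\<Sum>j. ennreal (\<kappa> j) * A (x + t j))" for x
    have l\<Phi>: "lsc \<Phi>" unfolding \<Phi>_def by (intro lsc_suminf lsc_mult lsc_const lsc_compose[OF lA] continuous_intros)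
    have W\<Phi>: "W \<Phi> \<le> ennreal (C2 * (C1 * \<tau>))" unfolding \<Phi>_def using C1(1) \<tau> by (intro C2(2) lA WA) simp
    \<comment> \<open>Inversion turns the argument of \<open>G\<close> into
      \<open>- \<xi> + y n\<close>, to which the discretization applies. Read through the reflected
      neighbourhood, its \<open>j\<close>-th term is the bump around \<open>y n\<close> evaluated at
      \<open>\<xi> + t j\<close>, a right translate.\<close>
    have \<Psi>: "(\<Sum>n. ennreal (c n) * G (- y n + \<xi>)) \<le> \<Phi> \<xi>" for \<xi>
    proof -
      have "(\<Sum>n. ennreal (c n) * G (- y n + \<xi>)) \<le> (\<Sum>n. \<Sum>j. ennreal (\<kappa> j) * (ennreal (c n) * indicator (uminus -` interior Q) (- y n + (\<xi> + t j))))"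
      proof (rule suminf_le)
        fix n
        have "G (- y n + \<xi>) = G (- \<xi> + y n)" using G(2)[of "- \<xi> + y n"] by (simp add: minus_add)
        also have "\<dots> \<le> (\<Sum>j. ennreal (\<kappa> j) * indicator (interior Q) (- t j + (- \<xi> + y n)))" by (rule \<kappa>(2))
        also have "\<dots> = (\<Sum>j. ennreal (\<kappa> j) * indicator (uminus -` interior Q) (- y n + (\<xi> + t j)))"
        proof (intro suminf_cong arg_cong2[where f="(*)"] refl)
          fix j
          have "- (- y n + (\<xi> + t j)) = - t j + (- \<xi> + y n)" by (simp only: minus_add minus_minus add.assoc)
          then show "indicator (interior Q) (- t j + (- \<xi> + y n)) = indicator (uminus -` interior Q) (- y n + (\<xi> + t j))"
            by (simp only: indicator_def vimage_eq)
        qed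
        finally have "ennreal (c n) * G (- y n + \<xi>) \<le> ennreal (c n) * (\<Sum>j. ennreal (\<kappa> j) * indicator (uminus -` interior Q) (- y n + (\<xi> + t j)))"
          by (rule mult_left_mono) simp
        also have "\<dots> = (\<Sum>j. ennreal (c n) * (ennreal (\<kappa> j) * indicator (uminus -` interior Q) (- y n + (\<xi> + t j))))"
          by (rule ennreal_suminf_cmult[symmetric])
        finally show "ennreal (c n) * G (- y n + \<xi>) \<le> (\<Sum>j. ennreal (\<kappa> j) * (ennreal (c n) * indicator (uminus -` interior Q) (- y n + (\<xi> + t j))))"
          by (simp only: mult.left_commute[of "ennreal (c n)"])
      qed auto
      also have "\<dots> = (\<Sum>j. \<Sum>n. ennreal (\<kappa> j) * (ennreal (c n) * indicator (uminus -` interior Q) (- y n + (\<xi> + t j))))"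
        by (rule suminf_swap_ennreal)
      also have "\<dots> = \<Phi> \<xi>" unfolding \<Phi>_def A_def by (intro suminf_cong ennreal_suminf_cmult)
      finally show ?thesis .
    qed
    \<comment> \<open>The contribution of a single bump at the identity; the other bumps dominating
      \<open>K\<close> give right translates of it.\<close>
    define A' where "A' x = (\<integral>\<^sup>+\<xi>. \<Phi> (x + \<xi>) * indicator (interior Q) (\<xi> + z) \<partial>\<mu>)" for x
    have lA': "lsc A'"
    proof -
      have "lsc (\<lambda>(x, \<xi>). \<Phi> (x + \<xi>) * indicator (interior Q) (\<xi> + z))"
        unfolding case_prod_unfold by (intro lsc_mult lsc_compose[OF l\<Phi>] lsc_compose[OF lP] continuous_intros)
      from lsc_section_integral[OF this] show ?thesis unfolding A'_def .
    qed
    have WA': "W A' \<le> ennreal (C4 * (C2 * (C1 * \<tau>)))"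
      unfolding A'_def using C1(1) C2(1) \<tau> by (intro C4(2) l\<Phi> W\<Phi>) simp
    define X where "X x = (\<Sum>l. ennreal (\<kappa>' l) * A' (x + t' l))" for x
    have lX: "lsc X" unfolding X_def by (intro lsc_suminf lsc_mult lsc_const lsc_compose[OF lA'] continuous_intros)
    have WX: "W X \<le> ennreal (C3 * (C4 * (C2 * (C1 * \<tau>))))"
      unfolding X_def using C1(1) C2(1) C4(1) \<tau> by (intro C3(2) lA' WA') simp
    have "F x \<le> X x" for x
    proof -
      have mGK: "(\<lambda>\<xi>. G (- y n + \<xi>) * K (- x + \<xi> + z)) \<in> borel_measurable \<mu>" for n
        unfolding borel_measurable_haar by (intro lsc_measurable lsc_mult lsc_compose[OF G(1)] lsc_compose[OF K] continuous_intros)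
      have "F x \<le> (\<Sum>n. ennreal (c n) * (\<integral>\<^sup>+\<xi>. G (- y n + \<xi>) * K (- x + \<xi> + z) \<partial>\<mu>))" using F by (rule spec)
      also have "\<dots> = (\<Sum>n. (\<integral>\<^sup>+\<xi>. ennreal (c n) * (G (- y n + \<xi>) * K (- x + \<xi> + z)) \<partial>\<mu>))"
        by (intro suminf_cong nn_integral_cmult[OF mGK, symmetric])
      also have "\<dots> = (\<integral>\<^sup>+\<xi>. (\<Sum>n. ennreal (c n) * (G (- y n + \<xi>) * K (- x + \<xi> + z))) \<partial>\<mu>)"
        by (rule nn_integral_suminf[symmetric]) (rule borel_measurable_times_ennreal[OF borel_measurable_const mGK])
      also have "\<dots> \<le> (\<integral>\<^sup>+\<xi>. \<Phi> \<xi> * K (- x + \<xi> + z) \<partial>\<mu>)"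
      proof (rule nn_integral_mono)
        fix \<xi>
        have "(\<Sum>n. ennreal (c n) * (G (- y n + \<xi>) * K (- x + \<xi> + z))) = (\<Sum>n. K (- x + \<xi> + z) * (ennreal (c n) * G (- y n + \<xi>)))"
          by (simp add: mult_ac)
        also have "\<dots> = K (- x + \<xi> + z) * (\<Sum>n. ennreal (c n) * G (- y n + \<xi>))" by (rule ennreal_suminf_cmult)
        also have "\<dots> \<le> K (- x + \<xi> + z) * \<Phi> \<xi>" by (intro mult_left_mono \<Psi>) simp
        finally show "(\<Sum>n. ennreal (c n) * (G (- y n + \<xi>) * K (- x + \<xi> + z))) \<le> \<Phi> \<xi> * K (- x + \<xi> + z)" by (simp add: mult.commute)
      qed
      \<comment> \<open>Left invariance moves \<open>x\<close> from \<open>K\<close> to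
        \<open>\<Phi>\<close>, so that the bumps dominating \<open>K\<close> no longer depend on
        \<open>x\<close>.\<close>
      also have "\<dots> = (\<integral>\<^sup>+\<xi>. \<Phi> (x + \<xi>) * K (\<xi> + z) \<partial>\<mu>)"
      proof -
        have l: "lsc (\<lambda>\<xi>. \<Phi> \<xi> * K (- x + \<xi> + z))" by (intro lsc_mult l\<Phi> lsc_compose[OF K] continuous_intros)
        show ?thesis using nn_integral_translate[OF lsc_measurable[OF l], of x] by (simp add: add.assoc[symmetric])
      qed
      also have "\<dots> \<le> (\<integral>\<^sup>+\<xi>. (\<Sum>l. ennreal (\<kappa>' l) * (\<Phi> (x + \<xi>) * indicator (interior Q) (- t' l + \<xi> + z))) \<partial>\<mu>)"
      proof (rule nn_integral_mono)
        fix \<xi>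
        have "\<Phi> (x + \<xi>) * K (\<xi> + z) \<le> \<Phi> (x + \<xi>) * (\<Sum>l. ennreal (\<kappa>' l) * indicator (interior Q) (- t' l + (\<xi> + z)))"
          by (intro mult_left_mono \<kappa>'(2)) simp
        also have "\<dots> = (\<Sum>l. \<Phi> (x + \<xi>) * (ennreal (\<kappa>' l) * indicator (interior Q) (- t' l + (\<xi> + z))))"
          by (rule ennreal_suminf_cmult[symmetric])
        finally show "\<Phi> (x + \<xi>) * K (\<xi> + z) \<le> (\<Sum>l. ennreal (\<kappa>' l) * (\<Phi> (x + \<xi>) * indicator (interior Q) (- t' l + \<xi> + z)))"
          by (simp only: mult.left_commute[of "\<Phi> (x + \<xi>)"] add.assoc)
      qed
      also have "\<dots> = (\<Sum>l. \<integral>\<^sup>+\<xi>. ennreal (\<kappa>' l) * (\<Phi> (x + \<xi>) * indicator (interior Q) (- t' l + \<xi> + z)) \<partial>\<mu>)"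
      proof (rule nn_integral_suminf)
        fix l show "(\<lambda>\<xi>. ennreal (\<kappa>' l) * (\<Phi> (x + \<xi>) * indicator (interior Q) (- t' l + \<xi> + z))) \<in> borel_measurable \<mu>"
          unfolding borel_measurable_haar
          by (intro lsc_measurable lsc_mult lsc_const lsc_compose[OF l\<Phi>] lsc_compose[OF lP] continuous_intros)
      qed
      also have "\<dots> = X x"
        unfolding X_def
      proof (rule suminf_cong)
        fix l
        have lI: "lsc (\<lambda>\<xi>. \<Phi> (x + \<xi>) * indicator (interior Q) (- t' l + \<xi> + z))"
          by (intro lsc_mult lsc_compose[OF l\<Phi>] lsc_compose[OF lP] continuous_intros)
        have "(\<integral>\<^sup>+\<xi>. ennreal (\<kappa>' l) * (\<Phi> (x + \<xi>) * indicator (interior Q) (- t' l + \<xi> + z)) \<partial>\<mu>)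
          = ennreal (\<kappa>' l) * (\<integral>\<^sup>+\<xi>. \<Phi> (x + \<xi>) * indicator (interior Q) (- t' l + \<xi> + z) \<partial>\<mu>)"
          by (rule nn_integral_cmult) (simp add: lsc_measurable[OF lI])
        also have "(\<integral>\<^sup>+\<xi>. \<Phi> (x + \<xi>) * indicator (interior Q) (- t' l + \<xi> + z) \<partial>\<mu>) = A' (x + t' l)"
          unfolding A'_def using nn_integral_translate[OF lsc_measurable[OF lI], of "t' l"] by (simp add: add.assoc[symmetric])
        finally show "(\<integral>\<^sup>+\<xi>. ennreal (\<kappa>' l) * (\<Phi> (x + \<xi>) * indicator (interior Q) (- t' l + \<xi> + z)) \<partial>\<mu>) = ennreal (\<kappa>' l) * A' (x + t' l)" .
      qed
      finally show ?thesis .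
    qed
    then have "W F \<le> Y (control_fun \<mu> Q X)" by (rule W_le[OF mF lX])
    also have "\<dots> = W X" by (rule W_lsc[OF lX, symmetric])
    also have "\<dots> \<le> ennreal (C3 * (C4 * (C2 * (C1 * \<tau>))))" by (rule WX)
    finally show "W F \<le> ennreal (C3 * (C4 * (C2 * C1)) * \<tau>)" by (simp add: mult.assoc)
  qed
qed

end

section \<open>Coefficients in the Lorentz sequence space\<close>

text \<open>Any two translates of \<open>K\<close> through the same point meet, so all counted
  indices are neighbours of one of them.\<close>

lemma (in haar_group) well_spread_count:
  fixes x :: "'i \<Rightarrow> 'g"
  assumes "well_spread x" "compact K"
  obtains b where "\<And>\<xi>. finite {i. - x i + \<xi> \<in> K}" "\<And>\<xi>. card {i. - x i + \<xi> \<in> K} \<le> b"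
proof -
  obtain b where b: "\<And>j. finite {i. (+) (x i) ` K \<inter> (+) (x j) ` K \<noteq> {}}"
    "\<And>j. card {i. (+) (x i) ` K \<inter> (+) (x j) ` K \<noteq> {}} \<le> b"
    using assms(1)[unfolded well_spread_def, THEN conjunct1, rule_format, OF assms(2)] by blast
  have "finite {i. - x i + \<xi> \<in> K} \<and> card {i. - x i + \<xi> \<in> K} \<le> b" for \<xi>
  proof (cases "{i. - x i + \<xi> \<in> K} = {}")
    case False
    then obtain j where j: "- x j + \<xi> \<in> K" by blast
    have mem: "\<xi> \<in> (+) (x i) ` K" if "- x i + \<xi> \<in> K" for i
      using that unfolding plus_image_eq_vimage by simp
    have "{i. - x i + \<xi> \<in> K} \<subseteq> {i. (+) (x i) ` K \<inter> (+) (x j) ` K \<noteq> {}}"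
      using mem j by blast
    then show ?thesis using b(1)[of j] b(2)[of j] by (meson card_mono finite_subset le_trans)
  qed simp
  then show ?thesis using that by blast
qed

lemma infsum_ennreal_ge: "f i \<le> (\<Sum>\<^sub>\<infinity>i. f i :: ennreal)"
proof -
  have "sum f {i} \<le> (SUP F\<in>{F. finite F \<and> F \<subseteq> UNIV}. sum f F)" by (rule SUP_upper) simp
  then show ?thesis by (simp add: nonneg_infsum_complete)
qed

locale lorentz_amalgam = amalgam_space \<mu> "weak_lebesgue_space \<mu> p" Q w m
  for \<mu> :: "'g::{topological_group_add,t2_space} measure" and p :: real and Q :: "'g set" and w m :: "'g \<Rightarrow> real" +
  assumes p_pos: "0 < p"
begin

text \<open>Every index with a large weighted coefficient puts a translate of \<open>P\<close>, of
  fixed measure \<open>\<delta>\<close>, into a superlevel set of \<open>H\<close>, and these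
  translates overlap at most \<open>b\<close> times. The weak-type bound on that superlevel set
  limits their number.\<close>

lemma coefficient_count:
  fixes x :: "'i \<Rightarrow> 'g"
  assumes ws: "well_spread x"
  obtains C where "C > 0" "\<And>c A \<sigma>. seq_norm Q Y x c \<le> ennreal A \<Longrightarrow> 0 < A \<Longrightarrow> 0 < \<sigma> \<Longrightarrow>
    finite {i. \<sigma> < cmod (c i) * m (x i)} \<and> real (card {i. \<sigma> < cmod (c i) * m (x i)}) \<le> C * (A / \<sigma>) powr p"
proof -
  define P where "P = interior Q"
  have oP: "open P" and P0: "0 \<in> P" using Q_nbhd unfolding P_def rel_compact_nbhd_def by auto
  have cQ: "compact (closure Q)" using Q_nbhd unfolding rel_compact_nbhd_def by blast
  have PQ: "P \<subseteq> Q" "P \<subseteq> closure Q" unfolding P_def using interior_subset closure_subset by blast+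
  have Pfin: "emeasure \<mu> P < top"
    using emeasure_mono[OF PQ(2), of \<mu>] finite_compact[OF cQ] cQ by (auto intro: le_less_trans)
  define \<delta> where "\<delta> = measure \<mu> P"
  have \<delta>e: "emeasure \<mu> P = ennreal \<delta>" unfolding \<delta>_def using Pfin by (intro emeasure_eq_ennreal_measure) simp
  have "emeasure \<mu> P > 0" using positive_open[OF oP] P0 by blast
  then have \<delta>: "\<delta> > 0" unfolding \<delta>e by simp
  obtain b where b: "\<And>\<xi>. finite {i. - x i + \<xi> \<in> closure Q}" "\<And>\<xi>. card {i. - x i + \<xi> \<in> closure Q} \<le> b"
    by (rule well_spread_count[OF ws cQ]) (rule that)
  obtain B where B: "B > 0" "\<And>z. z \<in> closure Q \<Longrightarrow> w (- z) \<le> B" by (rule w_bounded_on_compact[OF cQ]) (rule that)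
  define C1 where "C1 = w 0 * B"
  have C1: "C1 > 0" unfolding C1_def using w_pos B by simp
  have mC: "m (x i) \<le> C1 * m y" if "- x i + y \<in> P" for i y
  proof -
    have "m (0 + y + - (- x i + y)) \<le> w 0 * m y * w (- (- x i + y))" by (rule m_moderate)
    also have "\<dots> \<le> w 0 * m y * B"
      using that PQ(2) B(2)[of "- x i + y"] w_pos[of 0] m_pos[of y] by (intro mult_left_mono) auto
    also have "0 + y + - (- x i + y) = x i" by (simp only: minus_add minus_minus add_0_left add.assoc[symmetric]) simp
    finally show ?thesis unfolding C1_def by (simp add: mult_ac)
  qed
  define C where "C = (real b + 1) / \<delta> * (2 * C1) powr p"
  have C: "C > 0" unfolding C_def using \<delta> C1 by simp
  show ?thesis
  proof (rule that[OF C])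
    fix c :: "'i \<Rightarrow> complex" and A \<sigma> :: real assume le: "seq_norm Q Y x c \<le> ennreal A" and A: "0 < A" and \<sigma>: "0 < \<sigma>"
    define H where "H y = (\<Sum>\<^sub>\<infinity>i. ennreal (cmod (c i)) * indicator ((+) (x i) ` Q) y) * ennreal (m y)" for y
    have sn: "seq_norm Q Y x c = weak_lebesgue_space \<mu> p H" unfolding seq_norm_def Y_eq H_def ..
    have mH: "H \<in> borel_measurable borel"
    proof (rule ccontr)
      assume "H \<notin> borel_measurable borel"
      then have "weak_lebesgue_space \<mu> p H = top" unfolding weak_lebesgue_space_def by simp
      then show False using le sn by (simp add: top_unique)
    qed
    define U where "U = {y. ennreal (\<sigma> / C1) < H y}"
    have U: "U \<in> sets borel" unfolding U_def using mH by (rule borel_superlevel)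
    \<comment> \<open>The factor 2 makes \<open>t powr (1 / p) * (\<sigma> / C1)\<close> equal to
      \<open>2 * A\<close>, strictly above the assumed bound.\<close>
    define t where "t = (2 * A * C1 / \<sigma>) powr p"
    have t: "t > 0" unfolding t_def using A C1 \<sigma> by simp
    have "emeasure \<mu> U \<le> ennreal t"
    proof (rule ccontr)
      assume "\<not> emeasure \<mu> U \<le> ennreal t"
      then have "ennreal t < emeasure \<mu> {y. ennreal (\<sigma> / C1) < H y}" unfolding U_def by simp
      moreover have "ennreal A < ennreal (t powr (1 / p)) * ennreal (\<sigma> / C1)"
      proof -
        have "t powr (1 / p) = 2 * A * C1 / \<sigma>" unfolding t_def using A C1 \<sigma> p_pos by (simp add: powr_powr)
        then have "t powr (1 / p) * (\<sigma> / C1) = 2 * A" using C1 \<sigma> by simp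
        moreover have "ennreal (t powr (1 / p)) * ennreal (\<sigma> / C1) = ennreal (t powr (1 / p) * (\<sigma> / C1))"
          by (rule ennreal_mult'[symmetric]) simp
        ultimately have "ennreal (t powr (1 / p)) * ennreal (\<sigma> / C1) = ennreal (2 * A)" by (simp only:)
        moreover have "ennreal A < ennreal (2 * A)" using A by (intro ennreal_lessI) simp_all
        ultimately show ?thesis by (simp only:)
      qed
      ultimately have "ennreal A < weak_lebesgue_space \<mu> p H" using t unfolding less_weak_lebesgue_iff[OF mH p_pos] by blast
      then show False using le sn by simp
    qed
    define S where "S = {i. \<sigma> < cmod (c i) * m (x i)}"
    have card: "real (card I) \<le> C * (A / \<sigma>) powr p" if I: "finite I" "I \<subseteq> S" for I
    proof -
      have mem: "y \<in> U" if i: "i \<in> I" "- x i + y \<in> P" for i y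
      proof -
        have "\<sigma> < cmod (c i) * m (x i)" using i I unfolding S_def by blast
        also have "\<dots> \<le> cmod (c i) * (C1 * m y)" by (intro mult_left_mono mC i) simp
        finally have "\<sigma> / C1 < cmod (c i) * m y" using C1 by (simp add: field_simps)
        then have "ennreal (\<sigma> / C1) < ennreal (cmod (c i) * m y)" using C1 \<sigma> by (intro ennreal_lessI) (auto intro: less_trans[OF divide_pos_pos])
        also have "\<dots> = ennreal (cmod (c i)) * indicator ((+) (x i) ` Q) y * ennreal (m y)"
        proof -
          have "y \<in> (+) (x i) ` Q" using i PQ(1) unfolding plus_image_eq_vimage by auto
          then show ?thesis by (simp add: ennreal_mult')
        qed
        also have "\<dots> \<le> H y" unfolding H_def
          by (intro mult_right_mono infsum_ennreal_ge[of "\<lambda>i. ennreal (cmod (c i)) * indicator ((+) (x i) ` Q) y"]) simp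
        finally show ?thesis unfolding U_def by simp
      qed
      have mP: "(+) (x i) ` P \<in> sets \<mu>" for i using oP by (simp add: borel_translation_left borel_open)
      have "ennreal (real (card I) * \<delta>) = (\<Sum>i\<in>I. emeasure \<mu> ((+) (x i) ` P))"
        using \<delta> oP by (simp add: left_invariant borel_open \<delta>e ennreal_mult' ennreal_of_nat_eq_real_of_nat)
      also have "\<dots> = (\<integral>\<^sup>+y. (\<Sum>i\<in>I. indicator ((+) (x i) ` P) y) \<partial>\<mu>)"
        using mP by (subst nn_integral_sum) (auto intro!: sum.cong)
      also have "\<dots> \<le> (\<integral>\<^sup>+y. of_nat b * indicator U y \<partial>\<mu>)"
      proof (rule nn_integral_mono)
        fix y
        let ?J = "{i\<in>I. - x i + y \<in> P}"
        have "(\<Sum>i\<in>I. indicator ((+) (x i) ` P) y :: ennreal) = (\<Sum>i\<in>?J. 1)"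
          using I(1) by (intro sum.mono_neutral_cong_right) (auto simp: plus_image_eq_vimage)
        also have "\<dots> = of_nat (card ?J)" by simp
        also have "\<dots> \<le> of_nat b * indicator U y"
        proof (cases "?J = {}")
          case False
          then have "y \<in> U" using mem by blast
          moreover have "card ?J \<le> b"
          proof -
            have "card ?J \<le> card {i. - x i + y \<in> closure Q}" using PQ(2) by (intro card_mono b) auto
            then show ?thesis using b(2)[of y] by linarith
          qed
          ultimately show ?thesis by simp
        next
          case True
          then have "of_nat (card ?J) = (0::ennreal)" by (simp only: card.empty of_nat_0)
          then show ?thesis by (simp only: zero_le)
        qed
        finally show "(\<Sum>i\<in>I. indicator ((+) (x i) ` P) y :: ennreal) \<le> of_nat b * indicator U y" .
      qed
      also have "\<dots> = of_nat b * emeasure \<mu> U" using U by (simp add: nn_integral_cmult)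
      also have "\<dots> \<le> of_nat b * ennreal t" by (intro mult_left_mono \<open>emeasure \<mu> U \<le> ennreal t\<close>) simp
      also have "\<dots> = ennreal (real b * t)" by (simp add: ennreal_mult' ennreal_of_nat_eq_real_of_nat)
      finally have "real (card I) * \<delta> \<le> real b * t" using t by (simp add: ennreal_le_iff)
      also have "\<dots> \<le> (real b + 1) * t" using t by (simp add: algebra_simps)
      also have "\<dots> = C * (A / \<sigma>) powr p * \<delta>"
      proof -
        have "t = (2 * C1) powr p * (A / \<sigma>) powr p"
          unfolding t_def using A C1 \<sigma> by (simp add: mult_ac flip: powr_mult)
        then show ?thesis unfolding C_def using \<delta> by simp
      qed
      finally show ?thesis using \<delta> by simp
    qed
    \<comment> \<open>A uniform bound for all finite subsets makes \<open>S\<close> itself finite,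
      after which the estimate applies to \<open>S\<close>.\<close>
    have "finite S \<and> card S \<le> nat \<lfloor>C * (A / \<sigma>) powr p\<rfloor>"
      by (rule finite_if_finite_subsets_card_bdd) (use card in \<open>auto intro: le_nat_floor\<close>)
    then show "finite {i. \<sigma> < cmod (c i) * m (x i)} \<and> real (card {i. \<sigma> < cmod (c i) * m (x i)}) \<le> C * (A / \<sigma>) powr p"
      using card[of S] unfolding S_def by blast
  qed
qed

end

text \<open>A dyadic decomposition of the range \<open>(0, \<tau>]\<close> of the sequence.\<close>

lemma suminf_powr_le_of_count:
  fixes a :: "nat \<Rightarrow> real"
  assumes a: "\<And>n. 0 \<le> a n" "\<And>n. a n \<le> \<tau>" and \<tau>: "0 < \<tau>" and pr: "0 < p" "p < r" and B: "0 \<le> B"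
    and count: "\<And>\<sigma>. 0 < \<sigma> \<Longrightarrow> finite {n. \<sigma> < a n} \<and> real (card {n. \<sigma> < a n}) \<le> B * \<sigma> powr (- p)"
  shows "(\<Sum>n. ennreal (a n powr r)) \<le> ennreal (2 powr p / (1 - 2 powr (p - r)) * B * \<tau> powr (r - p))"
proof -
  define \<theta> where "\<theta> = 2 powr (p - r)"
  have \<theta>: "0 < \<theta>" "\<theta> < 1" unfolding \<theta>_def using pr powr_less_mono[of "p - r" 0 "2::real"] by auto
  define u where "u k = \<tau> / 2 ^ k" for k :: nat
  have u: "u k > 0" for k unfolding u_def using \<tau> by simp
  let ?I = "\<lambda>k n. indicator {n. u (Suc k) < a n} n :: ennreal"
  have pt: "ennreal (a n powr r) \<le> (\<Sum>k. ennreal (u k powr r) * ?I k n)" for n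
  proof (cases "a n = 0")
    case False
    then have an: "a n > 0" using a(1)[of n] by simp
    have ex: "\<exists>k. u (Suc k) < a n"
    proof -
      obtain k where "(1/2::real) ^ k < a n / \<tau>" using real_arch_pow_inv[of "a n / \<tau>" "1/2"] an \<tau> by auto
      moreover have "(1/2::real) ^ Suc k \<le> (1/2) ^ k" by simp
      ultimately have "(1/2::real) ^ Suc k < a n / \<tau>" by linarith
      then have "u (Suc k) < a n" unfolding u_def using \<tau> by (simp add: field_simps power_one_over)
      then show ?thesis ..
    qed
    \<comment> \<open>Minimality gives \<open>a n \<le> u k\<close>; for \<open>k = 0\<close> this
      is the bound by \<open>\<tau>\<close>.\<close>
    define k where "k = (LEAST k. u (Suc k) < a n)"
    have k: "u (Suc k) < a n" unfolding k_def using ex by (rule LeastI_ex)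
    have "a n \<le> u k"
    proof (cases k)
      case 0 then show ?thesis using a(2)[of n] by (simp add: u_def)
    next
      case (Suc l)
      then have "\<not> u (Suc l) < a n" using not_less_Least[of l "\<lambda>k. u (Suc k) < a n"] unfolding k_def by simp
      then show ?thesis using Suc by simp
    qed
    then have "a n powr r \<le> u k powr r" using a(1) pr by (intro powr_mono2) auto
    then have "ennreal (a n powr r) \<le> ennreal (u k powr r) * ?I k n" using k by (simp add: ennreal_leI)
    also have "\<dots> \<le> (\<Sum>k. ennreal (u k powr r) * ?I k n)" by (rule ennreal_term_le_suminf[of "\<lambda>k. ennreal (u k powr r) * ?I k n"])
    finally show ?thesis .
  qed (use pr in simp)
  define D where "D = 2 powr p * B * \<tau> powr (r - p)"
  have D: "D \<ge> 0" unfolding D_def using B by simp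
  have "(\<Sum>n. ennreal (a n powr r)) \<le> (\<Sum>n. \<Sum>k. ennreal (u k powr r) * ?I k n)" by (rule suminf_le) (use pt in auto)
  also have "\<dots> = (\<Sum>k. \<Sum>n. ennreal (u k powr r) * ?I k n)" by (rule suminf_swap_ennreal)
  also have "\<dots> \<le> (\<Sum>k. ennreal (D * \<theta> ^ k))"
  proof (rule suminf_le)
    fix k
    have f: "finite {n. u (Suc k) < a n}" using count[OF u] by blast
    have "(\<Sum>n. ennreal (u k powr r) * ?I k n) = (\<Sum>n\<in>{n. u (Suc k) < a n}. ennreal (u k powr r) * ?I k n)"
      by (rule suminf_finite[OF f]) simp
    also have "\<dots> = (\<Sum>n\<in>{n. u (Suc k) < a n}. ennreal (u k powr r))" by (intro sum.cong refl) simp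
    also have "\<dots> = ennreal (\<Sum>n\<in>{n. u (Suc k) < a n}. u k powr r)" by (rule sum_ennreal) simp
    also have "\<dots> \<le> ennreal (B * u (Suc k) powr (- p) * u k powr r)"
      using count[OF u, of "Suc k"] by (intro ennreal_leI) (simp add: mult_right_mono)
    \<comment> \<open>Layer \<open>k\<close> contributes a count of order
      \<open>u (Suc k) powr (- p)\<close> times \<open>u k powr r\<close>; from one layer to the
      next this shrinks by \<open>\<theta>\<close>, which is below 1 because
      \<open>p < r\<close>.\<close>
    also have "B * u (Suc k) powr (- p) * u k powr r = D * \<theta> ^ k"
    proof -
      have e: "u (Suc k) = u k * 2 powr (- 1)" unfolding u_def by (simp add: powr_minus)
      have "u (Suc k) powr (- p) = u k powr (- p) * 2 powr p"
        unfolding e powr_mult powr_powr by simp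
      moreover have "u k powr (- p) * u k powr r = u k powr (r - p)" by (simp flip: powr_add)
      moreover have "u k powr (r - p) = \<tau> powr (r - p) * \<theta> ^ k"
      proof -
        have "u k = \<tau> * 2 powr (- real k)" unfolding u_def by (simp add: powr_minus powr_realpow divide_inverse)
        then have "u k powr (r - p) = \<tau> powr (r - p) * 2 powr (- real k * (r - p))" using \<tau> by (simp add: powr_mult powr_powr)
        also have "- real k * (r - p) = (p - r) * real k" by (simp add: algebra_simps)
        also have "2 powr ((p - r) * real k) = \<theta> ^ k" unfolding \<theta>_def by (simp add: powr_powr[symmetric] powr_realpow)
        finally show ?thesis .
      qed
      ultimately show ?thesis unfolding D_def by (simp add: mult_ac)
    qed
    finally show "(\<Sum>n. ennreal (u k powr r) * ?I k n) \<le> ennreal (D * \<theta> ^ k)" .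
  qed auto
  also have "\<dots> = ennreal (D * (1 / (1 - \<theta>)))"
  proof -
    have "(\<lambda>k. D * \<theta> ^ k) sums (D * (1 / (1 - \<theta>)))" using \<theta> by (intro sums_mult geometric_sums) simp
    moreover have "0 \<le> D * \<theta> ^ k" for k using D \<theta> by simp
    ultimately show ?thesis by (simp add: suminf_ennreal2 sums_iff)
  qed
  also have "D * (1 / (1 - \<theta>)) = 2 powr p / (1 - 2 powr (p - r)) * B * \<tau> powr (r - p)"
    unfolding D_def \<theta>_def by simp
  finally show ?thesis .
qed

section \<open>Weighted sequence norms of the small coefficients\<close>

context lebesgue_amalgam
begin

text \<open>The threshold of order \<open>n powr (- 1 / p)\<close> is inserted into
  \<open>suminf_powr_le_of_count\<close>: the powers of \<open>A\<close> add up to \<open>r\<close>,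
  and the exponent \<open>- (r - p) / p\<close> of \<open>n\<close> equals
  \<open>- \<alpha> * r\<close>. For \<open>q = top\<close> the threshold itself is the bound and
  \<open>\<alpha> = 1 / p\<close>.\<close>

lemma coefficient_bound_of_count:
  assumes p: "0 < p" "ennreal p < q" and \<alpha>: "\<alpha> = 1 / p - enn2real (1 / q)" and C: "0 < C"
  obtains D where "D > 0" "\<And>c y A n. \<forall>j. 0 \<le> c j \<Longrightarrow> 0 < A \<Longrightarrow> 1 \<le> n \<Longrightarrow>
    \<forall>\<sigma>>0. finite {j. \<sigma> < c j * m (y j)} \<and> real (card {j. \<sigma> < c j * m (y j)}) \<le> C * (A / \<sigma>) powr p \<Longrightarrow>
    \<forall>j. c j * m (y j) \<le> C powr (1 / p) * A * real n powr (- 1 / p) \<Longrightarrow>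
    coefficient_bound c y (D * A * real n powr (- \<alpha>))"
proof (cases "q = top")
  case True
  have "C powr (1 / p) > 0" using C by simp
  then show ?thesis
  proof (rule that)
    have "\<alpha> = 1 / p" using \<alpha> True by simp
    then show "coefficient_bound c y (C powr (1 / p) * A * real n powr (- \<alpha>))"
      if "\<forall>j. 0 \<le> c j" "\<forall>j. c j * m (y j) \<le> C powr (1 / p) * A * real n powr (- 1 / p)" for c y A n
      using that True unfolding coefficient_bound_def by simp
  qed
next
  case False
  define r where "r = enn2real q"
  have r: "r > 0" unfolding r_def using q_pos False by (simp add: enn2real_positive_iff less_top)
  have qr: "q = ennreal r" unfolding r_def using False by (simp add: less_top)
  have pr: "p < r" using p(2) r p(1) unfolding qr by (simp add: ennreal_less_iff)
  have "1 / q = ennreal (1 / r)" unfolding qr using divide_ennreal[of 1 r] r by simp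
  then have \<alpha>': "\<alpha> = 1 / p - 1 / r" using \<alpha> r by simp
  define D0 where "D0 = 2 powr p / (1 - 2 powr (p - r)) * C powr (r / p)"
  have "2 powr (p - r) < (1::real)" using pr powr_less_mono[of "p - r" 0 "2::real"] by auto
  then have D0: "D0 > 0" unfolding D0_def using C by simp
  define D where "D = D0 powr (1 / r)"
  have D: "D > 0" unfolding D_def using D0 by simp
  show ?thesis
  proof (rule that[OF D])
    fix c :: "nat \<Rightarrow> real" and y A and n :: nat
    assume c': "\<forall>j. 0 \<le> c j" and A: "0 < A" and n: "1 \<le> n"
      and count': "\<forall>\<sigma>>0. finite {j. \<sigma> < c j * m (y j)} \<and> real (card {j. \<sigma> < c j * m (y j)}) \<le> C * (A / \<sigma>) powr p"
      and le': "\<forall>j. c j * m (y j) \<le> C powr (1 / p) * A * real n powr (- 1 / p)"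
    note c = c'[rule_format] and count = count'[rule_format] and le = le'[rule_format]
    define \<tau> where "\<tau> = C powr (1 / p) * A * real n powr (- 1 / p)"
    have \<tau>: "\<tau> > 0" unfolding \<tau>_def using C A n by simp
    have "(\<Sum>j. ennreal ((c j * m (y j)) powr r)) \<le> ennreal (2 powr p / (1 - 2 powr (p - r)) * (C * A powr p) * \<tau> powr (r - p))"
    proof (rule suminf_powr_le_of_count[OF _ _ \<tau> p(1) pr])
      show "0 \<le> c j * m (y j)" for j using c[of j] m_pos[of "y j"] by simp
      show "c j * m (y j) \<le> \<tau>" for j unfolding \<tau>_def by (rule le)
      show "0 \<le> C * A powr p" using C by simp
      show "finite {n. \<sigma> < c n * m (y n)} \<and> real (card {n. \<sigma> < c n * m (y n)}) \<le> C * A powr p * \<sigma> powr (- p)" if "0 < \<sigma>" for \<sigma>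
      proof -
        have "(A / \<sigma>) powr p = A powr p * \<sigma> powr (- p)" using A that by (simp add: powr_divide powr_minus_divide)
        then show ?thesis using count[OF that] by (simp add: mult.assoc)
      qed
    qed
    also have "2 powr p / (1 - 2 powr (p - r)) * (C * A powr p) * \<tau> powr (r - p) = (D * A * real n powr (- \<alpha>)) powr r"
    proof -
      have "\<tau> powr (r - p) = C powr (1 / p * (r - p)) * A powr (r - p) * real n powr (- 1 / p * (r - p))"
        unfolding \<tau>_def using C A n by (simp add: powr_mult powr_powr)
      moreover have "C powr 1 * C powr (1 / p * (r - p)) = C powr (r / p)"
        unfolding powr_add[symmetric] using p(1) by (simp add: field_simps)
      moreover have "A powr p * A powr (r - p) = A powr r" by (simp flip: powr_add)
      moreover have "- 1 / p * (r - p) = - \<alpha> * r" unfolding \<alpha>' using p(1) r by (simp add: field_simps)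
      moreover have "(D * A * real n powr (- \<alpha>)) powr r = D0 * A powr r * real n powr (- \<alpha> * r)"
        unfolding D_def using D0 A n r by (simp add: powr_mult powr_powr)
      ultimately show ?thesis unfolding D0_def using C by (simp add: mult_ac) (metis mult.assoc mult.commute)
    qed
    finally show "coefficient_bound c y (D * A * real n powr (- \<alpha>))"
      using c False unfolding coefficient_bound_def r_def by simp
  qed
qed

lemma coefficient_bound_scale:
  assumes cb: "coefficient_bound c y \<tau>" and "0 < C" "0 < \<tau>"
  shows "coefficient_bound (\<lambda>n. C * c n) y (C * \<tau>)"
proof (cases "q = top")
  case True
  then show ?thesis using assms unfolding coefficient_bound_def by (simp add: mult.assoc mult_left_mono)
next
  case False
  define r where "r = enn2real q"
  have c: "0 \<le> c n" for n using cb unfolding coefficient_bound_def by blast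
  have e: "ennreal ((C * c n * m (y n)) powr r) = ennreal (C powr r) * ennreal ((c n * m (y n)) powr r)" for n
    using \<open>0 < C\<close> c[of n] m_pos[of "y n"] by (simp add: powr_mult mult.assoc flip: ennreal_mult)
  have "(\<Sum>n. ennreal ((C * c n * m (y n)) powr r)) = ennreal (C powr r) * (\<Sum>n. ennreal ((c n * m (y n)) powr r))"
    unfolding e by (rule ennreal_suminf_cmult)
  also have "\<dots> \<le> ennreal (C powr r) * ennreal (\<tau> powr r)"
    using cb False unfolding coefficient_bound_def r_def by (intro mult_left_mono) auto
  also have "\<dots> = ennreal ((C * \<tau>) powr r)" using assms by (simp add: powr_mult ennreal_mult')
  finally show ?thesis using c False assms(2) unfolding coefficient_bound_def r_def by simp
qed

end

section \<open>Tails of atomic series\<close>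

text \<open>Enumeration of a countable index set turns an unordered sum into a series, padded with
  zeros, so that the estimates for sequences apply.\<close>

lemma has_sum_imp_sums_inj:
  fixes f :: "'i \<Rightarrow> complex" and e :: "'i \<Rightarrow> nat"
  assumes f: "(f has_sum r) S" and e: "inj_on e S"
  shows "(\<lambda>n. if n \<in> e ` S then f (inv_into S e n) else 0) sums r"
proof -
  have "((\<lambda>n. f (inv_into S e n)) \<circ> e has_sum r) S"
    using f by (subst has_sum_cong[where g = f]) (simp_all add: inv_into_f_f[OF e])
  then have "((\<lambda>n. f (inv_into S e n)) has_sum r) (e ` S)" using has_sum_reindex[OF e] by blast
  then have "((\<lambda>n. if n \<in> e ` S then f (inv_into S e n) else 0) has_sum r) UNIV"
    by (subst has_sum_cong_neutral[where T = "e ` S" and g = "\<lambda>n. f (inv_into S e n)"]) auto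
  then show ?thesis by (rule has_sum_imp_sums)
qed

lemma sums_cmod_le:
  assumes "a sums r" shows "ennreal (cmod r) \<le> (\<Sum>n. ennreal (cmod (a n)))"
proof (rule LIMSEQ_le_const2)
  show "(\<lambda>n. ennreal (cmod (\<Sum>k<n. a k))) \<longlonglongrightarrow> ennreal (cmod r)"
    using assms unfolding sums_def by (intro tendsto_ennrealI tendsto_norm)
  have "ennreal (cmod (\<Sum>k<n. a k)) \<le> (\<Sum>n. ennreal (cmod (a n)))" for n
  proof -
    have "ennreal (cmod (\<Sum>k<n. a k)) \<le> ennreal (\<Sum>k<n. cmod (a k))" by (intro ennreal_leI norm_sum)
    also have "\<dots> = (\<Sum>k<n. ennreal (cmod (a k)))" by (rule sum_ennreal[symmetric]) simp
    also have "\<dots> \<le> (\<Sum>n. ennreal (cmod (a n)))" by (rule sum_le_suminf) simp_all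
    finally show ?thesis .
  qed
  then show "\<exists>N. \<forall>n\<ge>N. ennreal (cmod (\<Sum>k<n. a k)) \<le> (\<Sum>n. ennreal (cmod (a n)))" by blast
qed

section \<open>Synthesis and tails for voice transforms\<close>

locale lebesgue_coorbit = lebesgue_amalgam \<mu> q Q w m s + haar_representation \<mu> \<pi>
  for \<mu> :: "'g::{topological_group_add,t2_space} measure" and q :: ennreal and Q :: "'g set" and w m :: "'g \<Rightarrow> real"
    and s :: real and \<pi> :: "'g \<Rightarrow> 'h::complex_hilbert_space \<Rightarrow> 'h"
begin

text \<open>\<open>\<rho>\<close> will be \<open>w_weight\<close> or \<open>w_tilde_weight\<close>;
  as both dominate \<open>right_norm\<close>, the summability passes to the norms of the right
  translations.\<close>

lemma voice_discretize:
  assumes mem: "voice \<pi> u u \<in> fspace \<mu> (amalgam \<mu> Q (weighted \<rho> (lebesgue_space \<mu> (ennreal s))))"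
    and \<rho>: "\<And>x. right_norm \<mu> Q Y x \<le> \<rho> x"
  obtains \<kappa> :: "nat \<Rightarrow> real" and t where "\<And>j. \<kappa> j \<ge> 0"
    "\<And>y. abs_fun (voice \<pi> u u) y \<le> (\<Sum>j. ennreal (\<kappa> j) * indicator (interior Q) (- t j + y))"
    "(\<Sum>j. ennreal_powr (ennreal (\<kappa> j) * right_norm \<mu> Q Y (t j)) s) < top"
proof -
  let ?G = "abs_fun (voice \<pi> u u)"
  let ?F = "\<lambda>x. control_fun \<mu> Q ?G x * \<rho> x"
  have "amalgam \<mu> Q (weighted \<rho> (lebesgue_space \<mu> (ennreal s))) ?G < top"
    using mem voice_measurable[of u u] unfolding fspace_def qnorm_def by simp
  then have "weighted \<rho> (lebesgue_space \<mu> (ennreal s)) (control_fun \<mu> Q ?G) < top"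
    unfolding amalgam_def by (simp split: if_splits)
  then have fin: "lebesgue_space \<mu> (ennreal s) ?F < top" unfolding weighted_def .
  \<comment> \<open>Nothing is known about measurability of \<open>\<rho>\<close> alone; the
    functional is \<open>top\<close> on nonmeasurable functions, so the finite norm forces the
    product to be measurable.\<close>
  have mF: "?F \<in> borel_measurable borel"
  proof (rule ccontr)
    assume "?F \<notin> borel_measurable borel"
    then have "lebesgue_space \<mu> (ennreal s) ?F = top" unfolding lebesgue_space_def borel_measurable_haar by simp
    then show False using fin by simp
  qed
  have int: "(\<integral>\<^sup>+x. ennreal_powr (?F x) s \<partial>\<mu>) < top"
  proof -
    have "ennreal s \<noteq> top" "enn2real (ennreal s) = s" using s_pos by simp_all
    then show ?thesis using fin lebesgue_space_eq[of "ennreal s" ?F] mF by simp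
  qed
  have cf: "control_fun \<mu> Q ?G x < top" for x
  proof -
    have "control_fun \<mu> Q ?G x \<le> ennreal (norm u * norm u)"
      by (rule control_fun_le[OF Q_borel abs_voice_measurable]) (simp add: abs_fun_def cmod_voice_le ennreal_leI)
    then show ?thesis by (rule le_less_trans) simp
  qed
  have \<rho>0: "\<rho> x \<noteq> 0" for x using \<rho>[of x] right_norm_pos[of x] by auto
  obtain \<kappa> :: "nat \<Rightarrow> real" and t where \<kappa>: "\<And>j. \<kappa> j \<ge> 0"
    "\<And>y. ?G y \<le> (\<Sum>j. ennreal (\<kappa> j) * indicator (interior Q) (- t j + y))"
    "(\<Sum>j. ennreal_powr (ennreal (\<kappa> j) * \<rho> (t j)) s) < top"
    by (rule discretize[OF lsc_voice cf \<rho>0 mF int]) (rule that)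
  have "(\<Sum>j. ennreal_powr (ennreal (\<kappa> j) * right_norm \<mu> Q Y (t j)) s) \<le> (\<Sum>j. ennreal_powr (ennreal (\<kappa> j) * \<rho> (t j)) s)"
  proof (rule suminf_le)
    fix j
    have "ennreal (\<kappa> j) * right_norm \<mu> Q Y (t j) \<le> ennreal (\<kappa> j) * \<rho> (t j)" by (rule mult_left_mono[OF \<rho>]) simp
    then show "ennreal_powr (ennreal (\<kappa> j) * right_norm \<mu> Q Y (t j)) s \<le> ennreal_powr (ennreal (\<kappa> j) * \<rho> (t j)) s"
      using s_pos by (intro ennreal_powr_mono) auto
  qed auto
  then have "(\<Sum>j. ennreal_powr (ennreal (\<kappa> j) * right_norm \<mu> Q Y (t j)) s) < top" using \<kappa>(3) by (rule le_less_trans)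
  then show ?thesis by (rule that[OF \<kappa>(1,2)])
qed

text \<open>\<open>window_change\<close> dominates the voice transform of each atom by the integrals
  treated in \<open>synthesis_bound\<close>; its constant \<open>C1\<close> is absorbed into the
  coefficients.\<close>

lemma synthesis_estimate:
  assumes g: "g \<noteq> 0" "integrable_window g" "voice \<pi> g g \<in> fspace \<mu> (amalgam \<mu> Q (weighted \<rho> (lebesgue_space \<mu> (ennreal s))))"
      "\<And>x. right_norm \<mu> Q Y x \<le> \<rho> x"
    and u: "u \<noteq> 0" "integrable_window u" "voice \<pi> u u \<in> fspace \<mu> (amalgam \<mu> Q (weighted \<rho>' (lebesgue_space \<mu> (ennreal s))))"
      "\<And>x. right_norm \<mu> Q Y x \<le> \<rho>' x"
  obtains C where "C > 0" "\<And>c y \<tau> F. bounded_overlap c y (thicken (uminus ` closure Q)) b \<Longrightarrow> coefficient_bound c y \<tau> \<Longrightarrow>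
     \<tau> > 0 \<Longrightarrow> F \<in> borel_measurable borel \<Longrightarrow>
     (\<forall>\<xi>. F \<xi> \<le> (\<Sum>n. ennreal (c n) * abs_fun (voice \<pi> u (\<pi> (y n) g)) \<xi>)) \<Longrightarrow> W F \<le> ennreal (C * \<tau>)"
proof -
  let ?G = "abs_fun (voice \<pi> g g)" and ?K = "abs_fun (voice \<pi> u u)"
  obtain \<kappa> :: "nat \<Rightarrow> real" and t where \<kappa>: "\<And>j. \<kappa> j \<ge> 0" "\<And>y. ?G y \<le> (\<Sum>j. ennreal (\<kappa> j) * indicator (interior Q) (- t j + y))"
    "(\<Sum>j. ennreal_powr (ennreal (\<kappa> j) * right_norm \<mu> Q Y (t j)) s) < top"
    by (rule voice_discretize[OF g(3,4)]) (rule that)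
  obtain \<kappa>' :: "nat \<Rightarrow> real" and t' where \<kappa>': "\<And>j. \<kappa>' j \<ge> 0" "\<And>y. ?K y \<le> (\<Sum>j. ennreal (\<kappa>' j) * indicator (interior Q) (- t' j + y))"
    "(\<Sum>j. ennreal_powr (ennreal (\<kappa>' j) * right_norm \<mu> Q Y (t' j)) s) < top"
    by (rule voice_discretize[OF u(3,4)]) (rule that)
  obtain z C1 where C1: "C1 > 0" "\<And>f x. abs_fun (voice \<pi> u f) x \<le>
     ennreal C1 * (\<integral>\<^sup>+y. abs_fun (voice \<pi> g f) y * ?K (- x + y + z) \<partial>\<mu>)"
    by (rule window_change[OF g(2,1) u(2,1)]) (rule that)
  obtain C2 where C2: "C2 > 0" "\<And>c y \<tau> F. bounded_overlap c y (thicken (uminus ` closure Q)) b \<Longrightarrow> coefficient_bound c y \<tau> \<Longrightarrow> \<tau> > 0 \<Longrightarrow>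
     F \<in> borel_measurable borel \<Longrightarrow>
     (\<forall>x. F x \<le> (\<Sum>n. ennreal (c n) * (\<integral>\<^sup>+\<xi>. ?G (- y n + \<xi>) * ?K (- x + \<xi> + z) \<partial>\<mu>))) \<Longrightarrow> W F \<le> ennreal (C2 * \<tau>)"
    by (rule synthesis_bound[OF lsc_voice abs_voice_uminus lsc_voice \<kappa> \<kappa>', of b z]) (rule that)
  show ?thesis
  proof (rule that[of "C2 * C1"])
    show "C2 * C1 > 0" using C1 C2(1) by simp
    fix c y \<tau> F assume ov: "bounded_overlap c y (thicken (uminus ` closure Q)) b" and cb: "coefficient_bound c y \<tau>" and \<tau>: "\<tau> > 0"
      and mF: "F \<in> borel_measurable borel" and F: "\<forall>\<xi>. F \<xi> \<le> (\<Sum>n. ennreal (c n) * abs_fun (voice \<pi> u (\<pi> (y n) g)) \<xi>)"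
    have "W F \<le> ennreal (C2 * (C1 * \<tau>))"
    proof (rule C2(2)[OF _ coefficient_bound_scale[OF cb C1(1) \<tau>] _ mF])
      show "bounded_overlap (\<lambda>n. C1 * c n) y (thicken (uminus ` closure Q)) b" using ov C1(1) unfolding bounded_overlap_def by simp
      show "C1 * \<tau> > 0" using C1(1) \<tau> by simp
      have "F \<xi> \<le> (\<Sum>n. ennreal (C1 * c n) * (\<integral>\<^sup>+\<eta>. ?G (- y n + \<eta>) * ?K (- \<xi> + \<eta> + z) \<partial>\<mu>))" for \<xi>
      proof -
      have "F \<xi> \<le> (\<Sum>n. ennreal (c n) * abs_fun (voice \<pi> u (\<pi> (y n) g)) \<xi>)" using F by (rule spec)
      also have "\<dots> \<le> (\<Sum>n. ennreal (C1 * c n) * (\<integral>\<^sup>+\<eta>. ?G (- y n + \<eta>) * ?K (- \<xi> + \<eta> + z) \<partial>\<mu>))"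
      proof (rule suminf_le)
        fix n
        have "abs_fun (voice \<pi> g (\<pi> (y n) g)) \<eta> = ?G (- y n + \<eta>)" for \<eta> unfolding abs_fun_def voice_pi ..
        then have "abs_fun (voice \<pi> u (\<pi> (y n) g)) \<xi> \<le> ennreal C1 * (\<integral>\<^sup>+\<eta>. ?G (- y n + \<eta>) * ?K (- \<xi> + \<eta> + z) \<partial>\<mu>)"
          using C1(2)[of "\<pi> (y n) g" \<xi>] by simp
        then have "ennreal (c n) * abs_fun (voice \<pi> u (\<pi> (y n) g)) \<xi>
            \<le> ennreal (c n) * (ennreal C1 * (\<integral>\<^sup>+\<eta>. ?G (- y n + \<eta>) * ?K (- \<xi> + \<eta> + z) \<partial>\<mu>))" by (rule mult_left_mono) simp
        also have "\<dots> = ennreal (C1 * c n) * (\<integral>\<^sup>+\<eta>. ?G (- y n + \<eta>) * ?K (- \<xi> + \<eta> + z) \<partial>\<mu>)"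
        proof -
          have "ennreal (C1 * c n) = ennreal C1 * ennreal (c n)" using C1(1) by (intro ennreal_mult') simp
          then show ?thesis by (simp only: mult.assoc mult.left_commute)
        qed
        finally show "ennreal (c n) * abs_fun (voice \<pi> u (\<pi> (y n) g)) \<xi>
            \<le> ennreal (C1 * c n) * (\<integral>\<^sup>+\<eta>. ?G (- y n + \<eta>) * ?K (- \<xi> + \<eta> + z) \<partial>\<mu>)" .
      qed auto
      finally show ?thesis .
      qed
      then show "\<forall>\<xi>. F \<xi> \<le> (\<Sum>n. ennreal (C1 * c n) * (\<integral>\<^sup>+\<eta>. ?G (- y n + \<eta>) * ?K (- \<xi> + \<eta> + z) \<partial>\<mu>))" by (rule allI)
    qed
    then show "W F \<le> ennreal (C2 * C1 * \<tau>)" by (simp only: mult.assoc)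
  qed
qed

text \<open>Stated for pointwise sums \<open>F\<close> instead of functionals, so that it applies
  directly to the voice transform of a remainder. The set \<open>N\<close> is fixed by
  \<open>c\<close>, \<open>A\<close> and \<open>n\<close> before \<open>F\<close> is considered, and
  the constant by none of these.\<close>

lemma tail_estimate:
  fixes x :: "'i \<Rightarrow> 'g"
  assumes ws: "well_spread x"
    and g: "g \<noteq> 0" "integrable_window g" "voice \<pi> g g \<in> fspace \<mu> (amalgam \<mu> Q (weighted \<rho> (lebesgue_space \<mu> (ennreal s))))"
      "\<And>x. right_norm \<mu> Q Y x \<le> \<rho> x"
    and u: "u \<noteq> 0" "integrable_window u" "voice \<pi> u u \<in> fspace \<mu> (amalgam \<mu> Q (weighted \<rho>' (lebesgue_space \<mu> (ennreal s))))"
      "\<And>x. right_norm \<mu> Q Y x \<le> \<rho>' x"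
    and p: "0 < p" "ennreal p < q" and \<alpha>: "\<alpha> = 1 / p - enn2real (1 / q)" and C0: "0 < C0"
  obtains C where "C > 0" "\<And>(c :: 'i \<Rightarrow> complex) A n. 
     \<forall>\<sigma>>0. finite {i. \<sigma> < cmod (c i) * m (x i)} \<and> real (card {i. \<sigma> < cmod (c i) * m (x i)}) \<le> C0 * (A / \<sigma>) powr p \<Longrightarrow>
     0 < A \<Longrightarrow> 1 \<le> n \<Longrightarrow>
     \<exists>N. finite N \<and> card N \<le> n \<and> (\<forall>F. (\<forall>\<xi>. ((\<lambda>i. c i * voice \<pi> u (\<pi> (x i) g) \<xi>) has_sum F \<xi>) (UNIV - N)) \<longrightarrow>
       F \<in> borel_measurable borel \<and> W (abs_fun F) \<le> ennreal (C * A * real n powr (- \<alpha>)))"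
proof -
  let ?K0 = "thicken (uminus ` closure Q)"
  have K0: "compact ?K0" by (intro compact_thicken compact_continuous_image compact_closure_Q continuous_intros)
  obtain b where b: "\<And>\<xi>. finite {i. - x i + \<xi> \<in> ?K0}" "\<And>\<xi>. card {i. - x i + \<xi> \<in> ?K0} \<le> b"
    by (rule well_spread_count[OF ws K0]) (rule that)
  obtain C1 where C1: "C1 > 0" "\<And>c y \<tau> F. bounded_overlap c y ?K0 b \<Longrightarrow> coefficient_bound c y \<tau> \<Longrightarrow>
     \<tau> > 0 \<Longrightarrow> F \<in> borel_measurable borel \<Longrightarrow>
     (\<forall>\<xi>. F \<xi> \<le> (\<Sum>n. ennreal (c n) * abs_fun (voice \<pi> u (\<pi> (y n) g)) \<xi>)) \<Longrightarrow> W F \<le> ennreal (C1 * \<tau>)"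
    by (rule synthesis_estimate[OF g u, of b]) (rule that)
  obtain D where D: "D > 0" "\<And>c y A n. \<forall>j. 0 \<le> c j \<Longrightarrow> 0 < A \<Longrightarrow> 1 \<le> n \<Longrightarrow>
    \<forall>\<sigma>>0. finite {j. \<sigma> < c j * m (y j)} \<and> real (card {j. \<sigma> < c j * m (y j)}) \<le> C0 * (A / \<sigma>) powr p \<Longrightarrow>
    \<forall>j. c j * m (y j) \<le> C0 powr (1 / p) * A * real n powr (- 1 / p) \<Longrightarrow>
    coefficient_bound c y (D * A * real n powr (- \<alpha>))"
    by (rule coefficient_bound_of_count[OF p \<alpha> C0]) (rule that)
  show ?thesis
  proof (rule that[of "C1 * D"])
    show "C1 * D > 0" using C1(1) D(1) by simp
    fix c :: "'i \<Rightarrow> complex" and A :: real and n :: nat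
    assume count': "\<forall>\<sigma>>0. finite {i. \<sigma> < cmod (c i) * m (x i)} \<and> real (card {i. \<sigma> < cmod (c i) * m (x i)}) \<le> C0 * (A / \<sigma>) powr p"
      and A: "0 < A" and n: "1 \<le> n"
    note count = count'[rule_format]
    define \<tau> where "\<tau> = C0 powr (1 / p) * A * real n powr (- 1 / p)"
    have \<tau>: "\<tau> > 0" unfolding \<tau>_def using C0 A n by simp
    define N where "N = {i. \<tau> < cmod (c i) * m (x i)}"
    \<comment> \<open>The threshold \<open>\<tau>\<close> is chosen so that the counting bound at
      \<open>\<tau>\<close> is exactly \<open>n\<close>.\<close>
    have "(A / \<tau>) powr p * C0 = real n"
    proof -
      have n0: "real n > 0" using n by simp
      have "\<tau> powr p = C0 * A powr p * real n powr (- 1)"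
        unfolding \<tau>_def using C0 A n p(1) by (simp add: powr_mult powr_powr)
      also have "\<dots> = C0 * A powr p / real n" using n0 by (simp add: powr_minus_divide)
      finally have T: "\<tau> powr p * real n = C0 * A powr p" using n0 by simp
      have X: "(A / \<tau>) powr p * \<tau> powr p = A powr p" using A \<tau> by (simp add: powr_divide)
      have "\<tau> powr p * ((A / \<tau>) powr p * C0) = ((A / \<tau>) powr p * \<tau> powr p) * C0" by (simp only: mult_ac)
      also have "\<dots> = \<tau> powr p * real n" unfolding X T by (simp only: mult.commute)
      finally show ?thesis using \<tau> by simp
    qed
    then have N: "finite N" "card N \<le> n" using count[OF \<tau>] unfolding N_def by (simp_all add: mult.commute)
    \<comment> \<open>The index set may be uncountable, but the nonzero coefficients form a
      countable union of finite level sets.\<close>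
    define S where "S = {i. i \<notin> N \<and> c i \<noteq> 0}"
    have "S \<subseteq> (\<Union>k. {i. 1 / real (Suc k) < cmod (c i) * m (x i)})"
    proof
      fix i assume "i \<in> S"
      then have "0 < cmod (c i) * m (x i)" unfolding S_def using m_pos[of "x i"] by simp
      then obtain k where "1 / real (Suc k) < cmod (c i) * m (x i)" by (rule nat_approx_posE)
      then show "i \<in> (\<Union>k. {i. 1 / real (Suc k) < cmod (c i) * m (x i)})" by blast
    qed
    moreover have "finite {i. 1 / real (Suc k) < cmod (c i) * m (x i)}" for k using count[of "1 / real (Suc k)"] by simp
    ultimately have "countable S" by (rule_tac countable_subset) (auto intro: countable_finite)
    then have e: "inj_on (to_nat_on S) S" by (rule inj_on_to_nat_on)
    define e where "e = to_nat_on S"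
    define i where "i n = inv_into S e n" for n
    have ie: "i k \<in> S" "e (i k) = k" if "k \<in> e ` S" for k
      unfolding i_def using that by (simp_all add: inv_into_into f_inv_into_f)
    define d where "d k = (if k \<in> e ` S then c (i k) else 0)" for k
    define y where "y k = x (i k)" for k
    have ov: "bounded_overlap (\<lambda>k. cmod (d k)) y ?K0 b"
      unfolding bounded_overlap_def
    proof
      fix \<xi>
      have sub: "{k. cmod (d k) \<noteq> 0 \<and> - y k + \<xi> \<in> ?K0} \<subseteq> e ` {i. - x i + \<xi> \<in> ?K0}"
      proof
        fix k assume "k \<in> {k. cmod (d k) \<noteq> 0 \<and> - y k + \<xi> \<in> ?K0}"
        then have "k \<in> e ` S" "- x (i k) + \<xi> \<in> ?K0" unfolding d_def y_def by (auto split: if_splits)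
        then show "k \<in> e ` {i. - x i + \<xi> \<in> ?K0}" using ie(2)[of k] by (metis (mono_tags, lifting) image_eqI mem_Collect_eq)
      qed
      have "card {k. cmod (d k) \<noteq> 0 \<and> - y k + \<xi> \<in> ?K0} \<le> card {i. - x i + \<xi> \<in> ?K0}"
        by (rule surj_card_le[OF b(1) sub])
      then show "finite {k. cmod (d k) \<noteq> 0 \<and> - y k + \<xi> \<in> ?K0} \<and> card {k. cmod (d k) \<noteq> 0 \<and> - y k + \<xi> \<in> ?K0} \<le> b"
        using b(2)[of \<xi>] finite_surj[OF b(1) sub] by linarith
    qed
    have cb: "coefficient_bound (\<lambda>k. cmod (d k)) y (D * A * real n powr (- \<alpha>))"
    proof (rule D(2)[OF _ A n]; intro allI impI)
      fix \<sigma> :: real assume \<sigma>: "0 < \<sigma>"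
      have sub: "{k. \<sigma> < cmod (d k) * m (y k)} \<subseteq> e ` {i. \<sigma> < cmod (c i) * m (x i)}"
      proof
        fix k assume k: "k \<in> {k. \<sigma> < cmod (d k) * m (y k)}"
        then have "k \<in> e ` S" using \<sigma> unfolding d_def by (auto split: if_splits)
        moreover from this have "\<sigma> < cmod (c (i k)) * m (x (i k))" using k unfolding d_def y_def by simp
        ultimately show "k \<in> e ` {i. \<sigma> < cmod (c i) * m (x i)}" using ie(2)[of k] by (metis (mono_tags, lifting) image_eqI mem_Collect_eq)
      qed
      have f: "finite {i. \<sigma> < cmod (c i) * m (x i)}" using count[OF \<sigma>] by blast
      have "card {k. \<sigma> < cmod (d k) * m (y k)} \<le> card {i. \<sigma> < cmod (c i) * m (x i)}" by (rule surj_card_le[OF f sub])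
      then show "finite {k. \<sigma> < cmod (d k) * m (y k)} \<and> real (card {k. \<sigma> < cmod (d k) * m (y k)}) \<le> C0 * (A / \<sigma>) powr p"
        using count[OF \<sigma>] finite_surj[OF f sub] by linarith
    next
      fix k
      show "cmod (d k) * m (y k) \<le> C0 powr (1 / p) * A * real n powr (- 1 / p)"
      proof (cases "k \<in> e ` S")
        case True
        then have "i k \<notin> N" using ie(1)[of k] unfolding S_def by blast
        then show ?thesis using True unfolding d_def y_def N_def \<tau>_def by simp
      next
        case False
        then show ?thesis using \<tau> unfolding d_def \<tau>_def by simp
      qed
    qed simp
    have main: "F \<in> borel_measurable borel \<and> W (abs_fun F) \<le> ennreal (C1 * D * A * real n powr (- \<alpha>))"
      if F: "\<And>\<xi>. ((\<lambda>i. c i * voice \<pi> u (\<pi> (x i) g) \<xi>) has_sum F \<xi>) (UNIV - N)" for F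
    proof -
      have sums: "(\<lambda>k. d k * voice \<pi> u (\<pi> (y k) g) \<xi>) sums F \<xi>" for \<xi>
      proof -
        have "((\<lambda>i. c i * voice \<pi> u (\<pi> (x i) g) \<xi>) has_sum F \<xi>) S \<longleftrightarrow> ((\<lambda>i. c i * voice \<pi> u (\<pi> (x i) g) \<xi>) has_sum F \<xi>) (UNIV - N)"
          by (rule has_sum_cong_neutral) (auto simp: S_def)
        then have "((\<lambda>i. c i * voice \<pi> u (\<pi> (x i) g) \<xi>) has_sum F \<xi>) S" using F by blast
        from has_sum_imp_sums_inj[OF this e, folded e_def]
        have "(\<lambda>n. if n \<in> e ` S then c (i n) * voice \<pi> u (\<pi> (x (i n)) g) \<xi> else 0) sums F \<xi>" unfolding i_def .
        moreover have "(if n \<in> e ` S then c (i n) * voice \<pi> u (\<pi> (x (i n)) g) \<xi> else 0) = d n * voice \<pi> u (\<pi> (y n) g) \<xi>" for n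
          unfolding d_def y_def by simp
        ultimately show ?thesis by simp
      qed
      have mF: "F \<in> borel_measurable borel"
      proof (rule borel_measurable_LIMSEQ_metric)
        show "(\<lambda>\<xi>. \<Sum>k<n. d k * voice \<pi> u (\<pi> (y k) g) \<xi>) \<in> borel_measurable borel" for n
          by (intro borel_measurable_sum borel_measurable_times borel_measurable_const voice_measurable)
        show "(\<lambda>n. \<Sum>k<n. d k * voice \<pi> u (\<pi> (y k) g) \<xi>) \<longlonglongrightarrow> F \<xi>" for \<xi> using sums[of \<xi>] unfolding sums_def .
      qed
      have "W (abs_fun F) \<le> ennreal (C1 * (D * A * real n powr (- \<alpha>)))"
      proof (rule C1(2)[OF ov cb])
        show "0 < D * A * real n powr (- \<alpha>)" using D(1) A n by simp
        show "abs_fun F \<in> borel_measurable borel" unfolding abs_fun_def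
          by (rule measurable_compose[OF measurable_compose[OF mF borel_measurable_norm] measurable_ennreal])
        have "abs_fun F \<xi> \<le> (\<Sum>k. ennreal (cmod (d k)) * abs_fun (voice \<pi> u (\<pi> (y k) g)) \<xi>)" for \<xi>
        proof -
        have "abs_fun F \<xi> \<le> (\<Sum>k. ennreal (cmod (d k * voice \<pi> u (\<pi> (y k) g) \<xi>)))" unfolding abs_fun_def by (rule sums_cmod_le[OF sums])
        also have "\<dots> = (\<Sum>k. ennreal (cmod (d k)) * abs_fun (voice \<pi> u (\<pi> (y k) g)) \<xi>)"
        proof (rule suminf_cong)
          fix k
          have "ennreal (cmod (d k) * cmod (voice \<pi> u (\<pi> (y k) g) \<xi>)) = ennreal (cmod (d k)) * ennreal (cmod (voice \<pi> u (\<pi> (y k) g) \<xi>))"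
            by (rule ennreal_mult') simp
          then show "ennreal (cmod (d k * voice \<pi> u (\<pi> (y k) g) \<xi>)) = ennreal (cmod (d k)) * abs_fun (voice \<pi> u (\<pi> (y k) g)) \<xi>"
            unfolding abs_fun_def norm_mult .
        qed
        finally show ?thesis .
        qed
        then show "\<forall>\<xi>. abs_fun F \<xi> \<le> (\<Sum>k. ennreal (cmod (d k)) * abs_fun (voice \<pi> u (\<pi> (y k) g)) \<xi>)" by (rule allI)
      qed
      then show ?thesis using mF by (simp add: mult.assoc)
    qed
    show "\<exists>N. finite N \<and> card N \<le> n \<and> (\<forall>F. (\<forall>\<xi>. ((\<lambda>i. c i * voice \<pi> u (\<pi> (x i) g) \<xi>) has_sum F \<xi>) (UNIV - N)) \<longrightarrow>
       F \<in> borel_measurable borel \<and> W (abs_fun F) \<le> ennreal (C1 * D * A * real n powr (- \<alpha>)))"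
    proof (intro exI[of _ N] conjI N allI impI)
      fix F assume "\<forall>\<xi>. ((\<lambda>i. c i * voice \<pi> u (\<pi> (x i) g) \<xi>) has_sum F \<xi>) (UNIV - N)"
      then have F: "((\<lambda>i. c i * voice \<pi> u (\<pi> (x i) g) \<xi>) has_sum F \<xi>) (UNIV - N)" for \<xi> by (rule spec)
      show "F \<in> borel_measurable borel" by (rule main[OF F, THEN conjunct1])
      show "W (abs_fun F) \<le> ennreal (C1 * D * A * real n powr (- \<alpha>))" by (rule main[OF F, THEN conjunct2])
    qed
  qed
qed

end

text \<open>The weak-* expansion identifies the remainder pointwise, and the norm bound feeds the
  counting estimate; these are the clauses the approximation draws on.\<close>

lemma atomic_decompositionE:
  fixes x :: "'i \<Rightarrow> 'g::{topological_group_add,t2_space}"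
  assumes "atomic_decomposition \<mu> Q \<pi> k u Y x g"
  obtains \<Lambda> :: "'i \<Rightarrow> ('h::complex_hilbert_space \<Rightarrow> complex) \<Rightarrow> complex" and b :: real where "b > 0"
    "\<And>f h. f \<in> coorbit_space \<mu> Q \<pi> k u Y \<Longrightarrow> h \<in> H1 \<mu> \<pi> (v_weight \<mu> Q Y) k \<Longrightarrow>
       ((\<lambda>i. \<Lambda> i f * hilbert_embed \<mu> \<pi> (v_weight \<mu> Q Y) k (\<pi> (x i) g) h) has_sum f h) UNIV"
    "\<And>f. f \<in> coorbit_space \<mu> Q \<pi> k u Y \<Longrightarrow> seq_norm Q Y x (\<lambda>i. \<Lambda> i f) \<le> ennreal b * coorbit_norm \<mu> Q \<pi> k u Y f"
  using assms unfolding atomic_decomposition_def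
proof (elim exE conjE, goal_cases)
  case (1 \<Lambda> a b)
  show ?case
  proof (rule 1(1)[of b \<Lambda>])
    show "b > 0" using 1 by blast
    show "((\<lambda>i. \<Lambda> i f * hilbert_embed \<mu> \<pi> (v_weight \<mu> Q Y) k (\<pi> (x i) g) h) has_sum f h) UNIV"
      if "f \<in> coorbit_space \<mu> Q \<pi> k u Y" "h \<in> H1 \<mu> \<pi> (v_weight \<mu> Q Y) k" for f h using 1 that by blast
    show "seq_norm Q Y x (\<lambda>i. \<Lambda> i f) \<le> ennreal b * coorbit_norm \<mu> Q \<pi> k u Y f"
      if "f \<in> coorbit_space \<mu> Q \<pi> k u Y" for f using 1 that by blast
  qed
qed

text \<open>The approximant keeps those terms of the expansion in the Lorentz coorbit space whose
  index lies in \<open>N\<close>. The error is measured through the voice transform with window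
  \<open>u\<^sub>q\<close>, which is a pointwise sum over the remaining indices; this is meaningful
  because both coorbit spaces lie in the same anti-dual.\<close>

theorem theorem7p1:
  fixes \<mu> :: "'g::{topological_group_add,t2_space} measure"
    and Q :: "'g set"
    and \<pi> :: "'g \<Rightarrow> 'h::complex_hilbert_space \<Rightarrow> 'h"
    and w m :: "'g \<Rightarrow> real"
    and p s\<^sub>p s\<^sub>q \<alpha> :: real
    and q :: ennreal
    and x :: "'i \<Rightarrow> 'g"
    and g k\<^sub>p k\<^sub>q u\<^sub>p u\<^sub>q :: 'h
  assumes "locally_compact_space (euclidean :: 'g topology)"
    and "left_haar_measure \<mu>"
    and "rel_compact_nbhd Q" and "Q \<in> sets borel"
    and "unitary_representation \<pi>" and "irreducible_representation \<pi>"
    and "weight w" and "submultiplicative w" and "weight m" and "moderate w m"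
    and "0 < p" and "ennreal p < q" and "\<alpha> = 1 / p - enn2real (1 / q)"
    and "has_equivalent_s_norm \<mu> (weighted_lorentz \<mu> p m) s\<^sub>p"
    and "has_equivalent_s_norm \<mu> (weighted_lebesgue \<mu> q m) s\<^sub>q"
    and "k\<^sub>p \<in> A_set \<mu> \<pi> (v_weight \<mu> Q (weighted_lorentz \<mu> p m)) - {0}"
    and "k\<^sub>q \<in> A_set \<mu> \<pi> (v_weight \<mu> Q (weighted_lebesgue \<mu> q m)) - {0}"
    and "u\<^sub>p \<in> B_set \<mu> Q \<pi> s\<^sub>p (weighted_lorentz \<mu> p m) - {0}"
    and "u\<^sub>q \<in> B_set \<mu> Q \<pi> s\<^sub>q (weighted_lebesgue \<mu> q m) - {0}"
    and "well_spread x"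
    and "g \<in> D_set \<mu> Q \<pi> s\<^sub>p (weighted_lorentz \<mu> p m)"
    and "D_set \<mu> Q \<pi> s\<^sub>p (weighted_lorentz \<mu> p m) \<subseteq> D_set \<mu> Q \<pi> s\<^sub>q (weighted_lebesgue \<mu> q m)"
    and "atomic_decomposition \<mu> Q \<pi> k\<^sub>p u\<^sub>p (weighted_lorentz \<mu> p m) x g"
    and "atomic_decomposition \<mu> Q \<pi> k\<^sub>q u\<^sub>q (weighted_lebesgue \<mu> q m) x g"
  shows "\<exists>C>0. \<forall>f\<in>coorbit_space \<mu> Q \<pi> k\<^sub>p u\<^sub>p (weighted_lorentz \<mu> p m). \<forall>n\<ge>1.
           best_approx_error \<mu> Q \<pi> k\<^sub>q u\<^sub>q (weighted_lebesgue \<mu> q m) x g n f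
             \<le> ennreal C * coorbit_norm \<mu> Q \<pi> k\<^sub>p u\<^sub>p (weighted_lorentz \<mu> p m) f
                 * ennreal (real n powr (- \<alpha>))"
proof -
  let ?Yp = "weighted_lorentz \<mu> p m" and ?Yq = "weighted_lebesgue \<mu> q m"
  have p: "0 < p" and pq: "ennreal p < q" by fact+
  have q0: "0 < q" using pq by (rule le_less_trans[OF zero_le])
  have hg: "haar_group \<mu>" using assms(1,2) by (intro haar_group.intro)
  have hr: "haar_representation \<mu> \<pi>" using assms(5,6) by (intro haar_representation.intro hg haar_representation_axioms.intro)
  have as: "amalgam_space_axioms Q w m" using assms(3,4,7,9,10) by (intro amalgam_space_axioms.intro)
  have Iq: "invariant_norm \<mu> (lebesgue_space \<mu> q)"
    using haar_group.invariant_norm_esssup[OF hg] haar_group.invariant_norm_lebesgue[OF hg q0] by (cases "q = top") auto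
  interpret P: lorentz_amalgam \<mu> p Q w m
    by (intro lorentz_amalgam.intro amalgam_space.intro haar_group.invariant_norm_weak_lebesgue[OF hg p] as lorentz_amalgam_axioms.intro p)
  interpret L: lebesgue_coorbit \<mu> q Q w m s\<^sub>q \<pi>
    by (intro lebesgue_coorbit.intro lebesgue_amalgam.intro amalgam_space.intro Iq as lebesgue_amalgam_axioms.intro q0 assms(15) hr)
  interpret R: weighted_representation \<mu> \<pi> "translation_weight m"
    by (intro weighted_representation.intro hr weighted_representation_axioms.intro P.lsc_V P.V_ge_1 P.V_finite P.V_submult)
  have Yp: "?Yp = P.Y" and Yq: "?Yq = L.Y" unfolding weighted_lorentz_def weighted_lebesgue_def by (rule refl)+
  let ?vp = "v_weight \<mu> Q ?Yp" and ?vq = "v_weight \<mu> Q ?Yq"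
  have ewp: "R.equivalent_weight ?vp"
  proof -
    obtain C where "C > 0" "\<And>x. translation_weight m x \<le> ennreal C * v_weight \<mu> Q P.Y x" by (rule P.V_le_v_weight) (rule that)
    then show ?thesis unfolding R.equivalent_weight_def Yp using P.lsc_v_weight P.v_weight_le_V
      by (intro conjI exI[of _ "1::real"] exI[of _ C]) simp_all
  qed
  have ewq: "R.equivalent_weight ?vq"
  proof -
    obtain C where "C > 0" "\<And>x. translation_weight m x \<le> ennreal C * v_weight \<mu> Q L.Y x" by (rule L.V_le_v_weight) (rule that)
    then show ?thesis unfolding R.equivalent_weight_def Yq using L.lsc_v_weight L.v_weight_le_V
      by (intro conjI exI[of _ "1::real"] exI[of _ C]) simp_all
  qed
  have kp: "R.admissible k\<^sub>p" using R.A_set_admissible[OF ewp] assms(16) by blast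
  have kq: "R.admissible k\<^sub>q" using R.A_set_admissible[OF ewq] assms(17) by blast
  have uq: "R.admissible u\<^sub>q" using R.A_set_admissible[OF ewq] assms(19) unfolding B_set_def by blast
  have uq0: "u\<^sub>q \<noteq> 0" using uq unfolding R.admissible_def by blast
  have gD: "g \<in> D_set \<mu> Q \<pi> s\<^sub>q ?Yq" using assms(21,22) by blast
  have rw: "right_norm \<mu> Q L.Y y \<le> w_weight \<mu> Q L.Y y" and rwt: "right_norm \<mu> Q L.Y y \<le> w_tilde_weight \<mu> Q L.Y y" for y
    unfolding w_tilde_weight_def w_weight_def by (simp_all add: max.coboundedI1)
  have uB: "voice \<pi> u\<^sub>q u\<^sub>q \<in> fspace \<mu> (amalgam \<mu> Q (weighted (w_weight \<mu> Q L.Y) (lebesgue_space \<mu> (ennreal s\<^sub>q))))"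
    using assms(19) unfolding B_set_def Yq by blast
  text \<open>If \<open>g = 0\<close>, all atoms vanish, and zero coefficients with the window \<open>u\<^sub>q\<close> take their place.\<close>
  define g' where "g' = (if g = 0 then u\<^sub>q else g)"
  have g': "g' \<noteq> 0" unfolding g'_def using uq0 by simp
  have g'w: "L.integrable_window g'"
  proof (cases "g = 0")
    case False
    then have "R.admissible g" using R.A_set_admissible[OF ewq _ False] gD unfolding D_set_def by blast
    then show ?thesis using False R.admissible_integrable_window unfolding g'_def by simp
  qed (simp add: g'_def R.admissible_integrable_window uq)
  \<comment> \<open>The window \<open>u\<^sub>q\<close> is controlled with \<open>w_weight\<close>
    and \<open>g\<close> with \<open>w_tilde_weight\<close>; both dominate
    \<open>right_norm\<close>.\<close>
  define \<rho> where "\<rho> = (if g = 0 then w_weight \<mu> Q L.Y else w_tilde_weight \<mu> Q L.Y)"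
  have g'D: "voice \<pi> g' g' \<in> fspace \<mu> (amalgam \<mu> Q (weighted \<rho> (lebesgue_space \<mu> (ennreal s\<^sub>q))))"
    using uB gD unfolding g'_def \<rho>_def D_set_def Yq by (cases "g = 0") auto
  have \<rho>: "right_norm \<mu> Q L.Y y \<le> \<rho> y" for y unfolding \<rho>_def using rw rwt by simp
  obtain \<Lambda> b where b: "b > 0"
    and hs: "\<And>f h. f \<in> coorbit_space \<mu> Q \<pi> k\<^sub>p u\<^sub>p ?Yp \<Longrightarrow> h \<in> H1 \<mu> \<pi> ?vp k\<^sub>p \<Longrightarrow>
       ((\<lambda>i. \<Lambda> i f * hilbert_embed \<mu> \<pi> ?vp k\<^sub>p (\<pi> (x i) g) h) has_sum f h) UNIV"
    and sn: "\<And>f. f \<in> coorbit_space \<mu> Q \<pi> k\<^sub>p u\<^sub>p ?Yp \<Longrightarrow> seq_norm Q ?Yp x (\<lambda>i. \<Lambda> i f) \<le> ennreal b * coorbit_norm \<mu> Q \<pi> k\<^sub>p u\<^sub>p ?Yp f"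
    by (rule atomic_decompositionE[OF assms(23)]) (rule that)
  obtain C0 where C0: "C0 > 0" "\<And>(c :: 'i \<Rightarrow> complex) A \<sigma>. seq_norm Q P.Y x c \<le> ennreal A \<Longrightarrow> 0 < A \<Longrightarrow> 0 < \<sigma> \<Longrightarrow>
    finite {i. \<sigma> < cmod (c i) * m (x i)} \<and> real (card {i. \<sigma> < cmod (c i) * m (x i)}) \<le> C0 * (A / \<sigma>) powr p"
    by (rule P.coefficient_count[OF assms(20)]) (rule that)
  obtain C where C: "C > 0" "\<And>(c :: 'i \<Rightarrow> complex) A n.
     \<forall>\<sigma>>0. finite {i. \<sigma> < cmod (c i) * m (x i)} \<and> real (card {i. \<sigma> < cmod (c i) * m (x i)}) \<le> C0 * (A / \<sigma>) powr p \<Longrightarrow>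
     0 < A \<Longrightarrow> 1 \<le> n \<Longrightarrow>
     \<exists>N. finite N \<and> card N \<le> n \<and> (\<forall>F. (\<forall>\<xi>. ((\<lambda>i. c i * voice \<pi> u\<^sub>q (\<pi> (x i) g') \<xi>) has_sum F \<xi>) (UNIV - N)) \<longrightarrow>
       F \<in> borel_measurable borel \<and> L.W (abs_fun F) \<le> ennreal (C * A * real n powr (- \<alpha>)))"
    by (rule L.tail_estimate[OF assms(20) g' g'w g'D \<rho> uq0 R.admissible_integrable_window[OF uq] uB rw p pq assms(13) C0(1)]) (rule that)
  \<comment> \<open>With the reference window \<open>u\<^sub>q\<close>, the test vectors and the
    anti-duals of both spaces become literally the same sets.\<close>
  have Hp: "H1 \<mu> \<pi> ?vp k\<^sub>p = R.test_vectors u\<^sub>q" by (rule R.H1_eq_test_vectors[OF ewp kp uq])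
  have Hq: "H1 \<mu> \<pi> ?vq k\<^sub>q = R.test_vectors u\<^sub>q" by (rule R.H1_eq_test_vectors[OF ewq kq uq])
  have Ap: "antidual \<mu> \<pi> ?vp k\<^sub>p = R.T_antidual u\<^sub>q" by (rule R.antidual_eq_T_antidual[OF ewp kp uq])
  have Aq: "antidual \<mu> \<pi> ?vq k\<^sub>q = R.T_antidual u\<^sub>q" by (rule R.antidual_eq_T_antidual[OF ewq kq uq])
  \<comment> \<open>The orbit of \<open>u\<^sub>q\<close> consists of test vectors, so weak-*
    convergence evaluated along it gives pointwise convergence of voice transforms.\<close>
  have tv: "\<pi> \<xi> u\<^sub>q \<in> R.test_vectors u\<^sub>q" for \<xi>
    using uq unfolding R.admissible_def by (intro R.test_vectors_pi) (simp add: R.test_vectors_def)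
  have best: "best_approx_error \<mu> Q \<pi> k\<^sub>q u\<^sub>q ?Yq x g n f \<le> ennreal (C * A * real n powr (- \<alpha>))"
    if f: "f \<in> coorbit_space \<mu> Q \<pi> k\<^sub>p u\<^sub>p ?Yp" and n: "1 \<le> n" and A: "0 < A" "seq_norm Q ?Yp x (\<lambda>i. \<Lambda> i f) \<le> ennreal A" for f n A
  proof -
    define c where "c i = (if g = 0 then 0 else \<Lambda> i f)" for i
    have cg: "c i * voice \<pi> u\<^sub>q (\<pi> (x i) g') \<xi> = \<Lambda> i f * cinner (\<pi> (x i) g) (\<pi> \<xi> u\<^sub>q)" for i \<xi>
    proof (cases "g = 0")
      case True
      have "\<pi> (x i) (0 + 0) = \<pi> (x i) 0 + \<pi> (x i) 0" using assms(5) unfolding unitary_representation_def by blast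
      then have "\<pi> (x i) 0 = 0" by simp
      moreover have "cinner (0::'h) h = 0" for h using cinner_add_left[of "0::'h" 0 h] by simp
      ultimately show ?thesis using True by (simp add: c_def)
    qed (simp add: c_def g'_def voice_def)
    have "finite {i. \<sigma> < cmod (c i) * m (x i)} \<and> real (card {i. \<sigma> < cmod (c i) * m (x i)}) \<le> C0 * (A / \<sigma>) powr p" if \<sigma>: "0 < \<sigma>" for \<sigma>
    proof (cases "g = 0")
      case True
      then have "{i. \<sigma> < cmod (c i) * m (x i)} = {}" using \<sigma> by (simp add: c_def)
      then show ?thesis using C0(1) by simp
    next
      case False
      then show ?thesis using C0(2)[OF A(2)[unfolded Yp] A(1) \<sigma>] by (simp add: c_def)
    qed
    then have cnt: "\<forall>\<sigma>>0. finite {i. \<sigma> < cmod (c i) * m (x i)} \<and> real (card {i. \<sigma> < cmod (c i) * m (x i)}) \<le> C0 * (A / \<sigma>) powr p" by blast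
    from C(2)[OF cnt A(1) n] obtain N where N: "finite N" "card N \<le> n" and tail:
      "\<And>F. (\<And>\<xi>. ((\<lambda>i. c i * voice \<pi> u\<^sub>q (\<pi> (x i) g') \<xi>) has_sum F \<xi>) (UNIV - N)) \<Longrightarrow>
         F \<in> borel_measurable borel \<and> L.W (abs_fun F) \<le> ennreal (C * A * real n powr (- \<alpha>))" by blast
    \<comment> \<open>The remainder is formed with \<open>\<Lambda>\<close> also when
      \<open>g = 0\<close>; by \<open>cg\<close> its voice transform is the tail with coefficients
      \<open>c\<close> and window \<open>g'\<close>.\<close>
    define r where "r h = f h - (\<Sum>i\<in>N. \<Lambda> i f * hilbert_embed \<mu> \<pi> ?vq k\<^sub>q (\<pi> (x i) g) h)" for h
    have fA: "f \<in> R.T_antidual u\<^sub>q" using f Ap unfolding coorbit_space_def coorbit_norm_def by (simp split: if_splits)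
    have em: "hilbert_embed \<mu> \<pi> ?vq k\<^sub>q (\<pi> (x i) g) \<in> R.T_antidual u\<^sub>q" for i
      unfolding hilbert_embed_def Hq by (rule R.embed_T_antidual[OF uq])
    have rA: "r \<in> R.T_antidual u\<^sub>q" unfolding r_def by (rule R.T_antidual_diff_sum[OF fA em N(1)])
    have rs: "((\<lambda>i. c i * voice \<pi> u\<^sub>q (\<pi> (x i) g') \<xi>) has_sum voice_ext \<pi> u\<^sub>q r \<xi>) (UNIV - N)" for \<xi>
    proof -
      let ?t = "\<lambda>i. \<Lambda> i f * cinner (\<pi> (x i) g) (\<pi> \<xi> u\<^sub>q)"
      have "(?t has_sum f (\<pi> \<xi> u\<^sub>q)) UNIV"
        using hs[OF f, of "\<pi> \<xi> u\<^sub>q"] tv[of \<xi>] unfolding hilbert_embed_def Hp by simp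
      from has_sum_Diff[OF this has_sum_finite[OF N(1)]]
      have "(?t has_sum (f (\<pi> \<xi> u\<^sub>q) - sum ?t N)) (UNIV - N)" by simp
      moreover have "f (\<pi> \<xi> u\<^sub>q) - sum ?t N = voice_ext \<pi> u\<^sub>q r \<xi>"
        unfolding voice_ext_def r_def hilbert_embed_def Hq using tv[of \<xi>] by simp
      ultimately show ?thesis unfolding cg by simp
    qed
    have "best_approx_error \<mu> Q \<pi> k\<^sub>q u\<^sub>q ?Yq x g n f \<le> coorbit_norm \<mu> Q \<pi> k\<^sub>q u\<^sub>q ?Yq r"
      unfolding best_approx_error_def r_def by (rule INF_lower2[of "(N, \<lambda>i. \<Lambda> i f)"]) (use N in simp_all)
    also have "\<dots> = L.W (abs_fun (voice_ext \<pi> u\<^sub>q r))"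
      using rA Aq tail[OF rs] unfolding coorbit_norm_def qnorm_def Yq by simp
    also have "\<dots> \<le> ennreal (C * A * real n powr (- \<alpha>))" using tail[OF rs] by blast
    finally show ?thesis .
  qed
  show ?thesis
  proof (intro exI[of _ "C * b"] conjI ballI allI impI)
    show "0 < C * b" using C(1) b by simp
    fix f and n :: nat assume f: "f \<in> coorbit_space \<mu> Q \<pi> k\<^sub>p u\<^sub>p ?Yp" and n: "1 \<le> n"
    obtain M where M: "coorbit_norm \<mu> Q \<pi> k\<^sub>p u\<^sub>p ?Yp f = ennreal M" "0 \<le> M"
      using f unfolding coorbit_space_def by (cases "coorbit_norm \<mu> Q \<pi> k\<^sub>p u\<^sub>p ?Yp f") auto
    define \<nu> where "\<nu> = real n powr (- \<alpha>)"
    have \<nu>: "\<nu> > 0" unfolding \<nu>_def using n by simp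
    have "best_approx_error \<mu> Q \<pi> k\<^sub>q u\<^sub>q ?Yq x g n f \<le> ennreal (C * b * M * \<nu>)"
    proof (rule ennreal_le_epsilon)
      fix e :: real assume e: "0 < e"
      \<comment> \<open>The counting bound needs a positive \<open>A\<close>, while \<open>M\<close>
        may be zero; the excess contributes exactly \<open>e\<close> to the final estimate.\<close>
      define A where "A = b * M + e / (C * \<nu>)"
      have A: "0 < A" unfolding A_def using b M(2) e C(1) \<nu> by (intro add_nonneg_pos) simp_all
      have "seq_norm Q ?Yp x (\<lambda>i. \<Lambda> i f) \<le> ennreal (b * M)" using sn[OF f] b unfolding M(1) by (simp add: ennreal_mult')
      also have "\<dots> \<le> ennreal A" unfolding A_def using e C(1) \<nu> by (intro ennreal_leI) simp
      finally have "best_approx_error \<mu> Q \<pi> k\<^sub>q u\<^sub>q ?Yq x g n f \<le> ennreal (C * A * \<nu>)" unfolding \<nu>_def by (rule best[OF f n A])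
      also have "C * A * \<nu> = C * b * M * \<nu> + e" unfolding A_def using C(1) \<nu> by (simp add: field_simps)
      also have "ennreal (C * b * M * \<nu> + e) = ennreal (C * b * M * \<nu>) + ennreal e"
        using C(1) b M(2) \<nu> e by (intro ennreal_plus) simp_all
      finally show "best_approx_error \<mu> Q \<pi> k\<^sub>q u\<^sub>q ?Yq x g n f \<le> ennreal (C * b * M * \<nu>) + ennreal e" .
    qed
    also have "\<dots> = ennreal (C * b) * coorbit_norm \<mu> Q \<pi> k\<^sub>p u\<^sub>p ?Yp f * ennreal (real n powr (- \<alpha>))"
      unfolding M(1) \<nu>_def using C(1) b M(2) by (simp add: ennreal_mult' mult.assoc)
    finally show "best_approx_error \<mu> Q \<pi> k\<^sub>q u\<^sub>q ?Yq x g n f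
       \<le> ennreal (C * b) * coorbit_norm \<mu> Q \<pi> k\<^sub>p u\<^sub>p ?Yp f * ennreal (real n powr (- \<alpha>))" .
  qed
qed

end
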